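(* Let $\Bbbk$ be a nontrivial commutative ring which is noetherian and hereditary (e.g. $\Bbbk=\mathbb{Z}$). Let $Q$ be a small $\Bbbk$-preadditive category which is Hom-finite, locally bounded, has a Serre functor relative to $\Bbbk$ and has the Strong Retraction Property, and assume that the pseudo-radical $\mathfrak{r}$ is nilpotent, that is, $\mathfrak{r}^N=0$ for some $N\in\mathbb{N}$. For every $\Bbbk$-algebra $A$ and object $X\in{}_{Q,A}\mathrm{Mod}$ the following conditions are equivalent: (i) $X\in\mathscr{E}$. (ii) $\mathbb{H}^i_{[q]}(X)=0$ for every $q\in Q$ and $i>0$. (ii') $\mathbb{H}^1_{[q]}(X)=0$ for every $q\in Q$. (iii) $\mathbb{H}_i^{[q]}(X)=0$ for every $q\in Q$ and $i>0$. (iii') $\mathbb{H}_1^{[q]}(X)=0$ for every $q\in Q$.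
   Context: $\Bbbk$-preadditive category: hom sets $Q(p,q)$ are $\Bbbk$-modules and composition is $\Bbbk$-bilinear. The conditions on $Q$ are: - Hom-finite: each $Q(p,q)$ is a finitely generated projective $\Bbbk$-module. - Locally bounded: for each object $q$ the sets $\{p \mid Q(p,q)\neq 0\}$ and $\{r \mid Q(q,r)\neq 0\}$ are finite. - Serre functor relative to $\Bbbk$: there are a $\Bbbk$-linear autoequivalence $\mathbb{S}\colon Q\to Q$ and an isomorphism $Q(p,q)\cong \operatorname{Hom}_{\Bbbk}(Q(q,\mathbb{S}(p)),\Bbbk)$ natural in $p,q$. - Strong Retraction Property: for each $q$ the map $\Bbbk\to Q(q,q)$, $x\mapsto x\cdot\mathrm{id}_q$, has a $\Bbbk$-module retraction, and there is a collection $\{\mathfrak{r}_q\}_{q\in Q}$ of $\Bbbk$-submodules $\mathfrak{r}_q\subseteq Q(q,q)$ with $Q(q,q)=(\Bbbk\cdot\mathrm{id}_q)\oplus\mathfrak{r}_q$ such that $\mathfrak{r}_q\circ\mathfrak{r}_q\subseteq\mathfrak{r}_q$ for all $q$ and $Q(q,p)\circ Q(p,q)\subseteq\mathfrak{r}_p$ for all $p\neq q$. One such collection is fixed. The pseudo-radical $\mathfrak{r}$ is the ideal of $Q$ with $\mathfrak{r}(q,q)=\mathfrak{r}_q$ and $\mathfrak{r}(p,q)=Q(p,q)$ for $p\neq q$; $\mathfrak{r}^N(p,q)$ is the $\Bbbk$-submodule generated by compositions $p\to\cdots\to q$ of $N$ morphisms in $\mathfrak{r}$. ${}_{Q,A}\mathrm{Mod}$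 is the category of $\Bbbk$-linear functors from $Q$ to left $A$-modules; ${}_{Q}\mathrm{Mod}={}_{Q,\Bbbk}\mathrm{Mod}$; $X^\natural\in{}_{Q}\mathrm{Mod}$ is $X$ with the $A$-structure forgotten. $\mathscr{E}=\{X\mid X^\natural \text{ has finite projective dimension in } {}_Q\mathrm{Mod}\}$ (equivalently, under these hypotheses, finite injective dimension). For $q\in Q$ the stalk functors are the $\Bbbk$-linear functors $S\langle q\rangle=Q(q,-)/\mathfrak{r}(q,-)\colon Q\to\Bbbk\text{-Mod}$ and $S\{q\}=Q(-,q)/\mathfrak{r}(-,q)\colon Q^{\mathrm{op}}\to\Bbbk\text{-Mod}$. For $X\in{}_{Q,A}\mathrm{Mod}$ and $i\geq 0$, $\mathbb{H}^i_{[q]}(X)=\operatorname{Ext}^i_Q(S\langle q\rangle,X)$ and $\mathbb{H}_i^{[q]}(X)=\operatorname{Tor}_i^Q(S\{q\},X)$ (left $A$-modules), where $\operatorname{Hom}_Q(U,X)$ is the $A$-module of natural transformations $U\to X^\natural$, $W\otimes_Q X=\int^{q\in Q}W(q)\otimes_{\Bbbk}X(q)$, and Ext and Tor are computed by projective resolutions of the first argument in the functor categories. *)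

theory Defs
  imports "HOL-Algebra.Module" "HOL-Algebra.Ring_Divisibility"
begin

section \<open>Modules over rings that need not be commutative\<close>

text \<open>The library's locale \<open>module\<close> asks for a commutative ring of scalars. The functors
  below take values in left modules over an arbitrary associative algebra.\<close>

locale left_module = R?: ring R + M?: abelian_group M for R :: "('a, 'z) ring_scheme" (structure)
    and M :: "('a, 'x) module" (structure) +
  assumes lsmult_closed:
      "\<lbrakk>a \<in> carrier R; x \<in> carrier M\<rbrakk> \<Longrightarrow> a \<odot>\<^bsub>M\<^esub> x \<in> carrier M"
    and lsmult_l_distr:
      "\<lbrakk>a \<in> carrier R; b \<in> carrier R; x \<in> carrier M\<rbrakk> \<Longrightarrow>
        (a \<oplus> b) \<odot>\<^bsub>M\<^esub> x = a \<odot>\<^bsub>M\<^esub> x \<oplus>\<^bsub>M\<^esub> b \<odot>\<^bsub>M\<^esub> x"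
    and lsmult_r_distr:
      "\<lbrakk>a \<in> carrier R; x \<in> carrier M; y \<in> carrier M\<rbrakk> \<Longrightarrow>
        a \<odot>\<^bsub>M\<^esub> (x \<oplus>\<^bsub>M\<^esub> y) = a \<odot>\<^bsub>M\<^esub> x \<oplus>\<^bsub>M\<^esub> a \<odot>\<^bsub>M\<^esub> y"
    and lsmult_assoc:
      "\<lbrakk>a \<in> carrier R; b \<in> carrier R; x \<in> carrier M\<rbrakk> \<Longrightarrow>
        (a \<otimes> b) \<odot>\<^bsub>M\<^esub> x = a \<odot>\<^bsub>M\<^esub> (b \<odot>\<^bsub>M\<^esub> x)"
    and lsmult_one: "x \<in> carrier M \<Longrightarrow> \<one> \<odot>\<^bsub>M\<^esub> x = x"

text \<open>Unlike the library's \<open>algebra\<close>, the algebra \<open>A\<close> need not be commutative. The record \<open>A\<close>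
  serves both as a ring and as a module over \<open>k\<close>.\<close>

definition assoc_algebra :: "'k ring \<Rightarrow> ('k, 'a) module \<Rightarrow> bool" where
  "assoc_algebra k A \<longleftrightarrow> module k A \<and> ring A \<and>
    (\<forall>r \<in> carrier k. \<forall>x \<in> carrier A. \<forall>y \<in> carrier A.
      (r \<odot>\<^bsub>A\<^esub> x) \<otimes>\<^bsub>A\<^esub> y = r \<odot>\<^bsub>A\<^esub> (x \<otimes>\<^bsub>A\<^esub> y) \<and>
      x \<otimes>\<^bsub>A\<^esub> (r \<odot>\<^bsub>A\<^esub> y) = r \<odot>\<^bsub>A\<^esub> (x \<otimes>\<^bsub>A\<^esub> y))"

definition self_module :: "('a, 'z) ring_scheme \<Rightarrow> ('a, 'a) module" where
  "self_module R = \<lparr>carrier = carrier R, mult = mult R, one = one R, zero = zero R,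
     add = add R, smult = mult R\<rparr>"

definition lin_maps ::
  "('a, 'z) ring_scheme \<Rightarrow> ('a, 'x) module \<Rightarrow> ('a, 'y) module \<Rightarrow> ('x \<Rightarrow> 'y) set" where
  "lin_maps R M N = {h \<in> carrier M \<rightarrow> carrier N.
     (\<forall>x \<in> carrier M. \<forall>y \<in> carrier M. h (x \<oplus>\<^bsub>M\<^esub> y) = h x \<oplus>\<^bsub>N\<^esub> h y) \<and>
     (\<forall>a \<in> carrier R. \<forall>x \<in> carrier M. h (a \<odot>\<^bsub>M\<^esub> x) = a \<odot>\<^bsub>N\<^esub> h x)}"

definition submod_gen :: "('a, 'z) ring_scheme \<Rightarrow> ('a, 'x) module \<Rightarrow> 'x set \<Rightarrow> 'x set" where
  "submod_gen R M S = \<Inter>{H. submodule H R M \<and> S \<subseteq> H}"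

definition quot_module :: "('a, 'x) module \<Rightarrow> 'x set \<Rightarrow> ('a, 'x set) module" where
  "quot_module M N = \<lparr>carrier = a_rcosets\<^bsub>M\<^esub> N, mult = undefined, one = undefined,
     zero = N, add = set_add M, smult = (\<lambda>a C. \<Union>x\<in>C. N +>\<^bsub>M\<^esub> (a \<odot>\<^bsub>M\<^esub> x))\<rparr>"

definition dsum_module :: "'i set \<Rightarrow> ('i \<Rightarrow> ('a, 'x) module) \<Rightarrow> ('a, 'i \<Rightarrow> 'x) module" where
  "dsum_module I M = \<lparr>carrier = {f \<in> (\<Pi>\<^sub>E i\<in>I. carrier (M i)). finite {i \<in> I. f i \<noteq> \<zero>\<^bsub>M i\<^esub>}},
     mult = undefined, one = undefined, zero = (\<lambda>i\<in>I. \<zero>\<^bsub>M i\<^esub>),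
     add = (\<lambda>f g. \<lambda>i\<in>I. f i \<oplus>\<^bsub>M i\<^esub> g i), smult = (\<lambda>a f. \<lambda>i\<in>I. a \<odot>\<^bsub>M i\<^esub> f i)\<rparr>"

definition dsum_inj :: "'i set \<Rightarrow> ('i \<Rightarrow> ('a, 'x) module) \<Rightarrow> 'i \<Rightarrow> 'x \<Rightarrow> 'i \<Rightarrow> 'x" where
  "dsum_inj I M j x = (\<lambda>i\<in>I. if i = j then x else \<zero>\<^bsub>M i\<^esub>)"

definition zero_module :: "('a, 'x) module \<Rightarrow> bool" where
  "zero_module M \<longleftrightarrow> carrier M = {\<zero>\<^bsub>M\<^esub>}"

definition fin_gen_module :: "'k ring \<Rightarrow> ('k, 'x) module \<Rightarrow> bool" where
  "fin_gen_module k M \<longleftrightarrow> module k M \<and>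
    (\<exists>S. finite S \<and> S \<subseteq> carrier M \<and> submod_gen k M S = carrier M)"

text \<open>Projectivity is the lifting property against epimorphisms, and epimorphisms of modules are the
  surjective linear maps. HOL has no quantification over types, so the test modules live on
  one type, \<open>('x \<times> 'k) list\<close>. It contains an isomorphic copy of \<open>M\<close> and of the free module on
  the set \<open>carrier M\<close> (finite formal sums of terms \<open>(x, r)\<close>). The lifting property
  against the canonical surjection from this free module onto \<open>M\<close> already makes \<open>M\<close> a direct summand
  of a free module, so the choice of the type of test modules is no restriction.\<close>

definition projective_module :: "'k ring \<Rightarrow> ('k, 'x) module \<Rightarrow> bool" where
  "projective_module k M \<longleftrightarrow> module k M \<and>
    (\<forall>(E :: ('k, ('x \<times> 'k) list) module) (B :: ('k, ('x \<times> 'k) list) module).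
      \<forall>g \<in> lin_maps k E B. \<forall>h \<in> lin_maps k M B.
        module k E \<and> module k B \<and> g ` carrier E = carrier B \<longrightarrow>
        (\<exists>l \<in> lin_maps k M E. \<forall>x \<in> carrier M. g (l x) = h x))"

definition hereditary_ring :: "'k ring \<Rightarrow> bool" where
  "hereditary_ring k \<longleftrightarrow>
    (\<forall>I. ideal I k \<longrightarrow> projective_module k ((self_module k)\<lparr>carrier := I\<rparr>))"

definition dual_module :: "'k ring \<Rightarrow> ('k, 'x) module \<Rightarrow> ('k, 'x \<Rightarrow> 'k) module" where
  "dual_module k M = \<lparr>carrier = lin_maps k M (self_module k) \<inter> extensional (carrier M),
     mult = undefined, one = undefined, zero = (\<lambda>x\<in>carrier M. \<zero>\<^bsub>k\<^esub>),
     add = (\<lambda>h h'. \<lambda>x\<in>carrier M. h x \<oplus>\<^bsub>k\<^esub> h' x),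
     smult = (\<lambda>r h. \<lambda>x\<in>carrier M. r \<otimes>\<^bsub>k\<^esub> h x)\<rparr>"


section \<open>Preadditive categories over a commutative ring\<close>

text \<open>\<open>Comp Q p q s g f\<close> is the composite of \<open>f : p \<rightarrow> q\<close> followed by \<open>g : q \<rightarrow> s\<close>.\<close>

record ('k, 'o, 'm) lincat =
  Ob :: "'o set"
  Hom :: "'o \<Rightarrow> 'o \<Rightarrow> ('k, 'm) module"
  Comp :: "'o \<Rightarrow> 'o \<Rightarrow> 'o \<Rightarrow> 'm \<Rightarrow> 'm \<Rightarrow> 'm"
  Ide :: "'o \<Rightarrow> 'm"

locale preadditive =
  fixes k :: "'k ring" and Q :: "('k, 'o, 'm) lincat"
  assumes base_cring: "cring k"
    and hom_module: "\<lbrakk>p \<in> Ob Q; q \<in> Ob Q\<rbrakk> \<Longrightarrow> module k (Hom Q p q)"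
    and ide_closed: "p \<in> Ob Q \<Longrightarrow> Ide Q p \<in> carrier (Hom Q p p)"
    and comp_ide: "\<lbrakk>p \<in> Ob Q; q \<in> Ob Q; f \<in> carrier (Hom Q p q)\<rbrakk> \<Longrightarrow>
        Comp Q p p q f (Ide Q p) = f \<and> Comp Q p q q (Ide Q q) f = f"
    and comp_assoc: "\<lbrakk>p \<in> Ob Q; q \<in> Ob Q; s \<in> Ob Q; t \<in> Ob Q; f \<in> carrier (Hom Q p q);
          g \<in> carrier (Hom Q q s); h \<in> carrier (Hom Q s t)\<rbrakk> \<Longrightarrow>
        Comp Q p s t h (Comp Q p q s g f) = Comp Q p q t (Comp Q q s t h g) f"
    and comp_linear_right: "\<lbrakk>p \<in> Ob Q; q \<in> Ob Q; s \<in> Ob Q; g \<in> carrier (Hom Q q s)\<rbrakk> \<Longrightarrow>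
        (\<lambda>f. Comp Q p q s g f) \<in> lin_maps k (Hom Q p q) (Hom Q p s)"
    and comp_linear_left: "\<lbrakk>p \<in> Ob Q; q \<in> Ob Q; s \<in> Ob Q; f \<in> carrier (Hom Q p q)\<rbrakk> \<Longrightarrow>
        (\<lambda>g. Comp Q p q s g f) \<in> lin_maps k (Hom Q q s) (Hom Q p s)"

definition op_cat :: "('k, 'o, 'm) lincat \<Rightarrow> ('k, 'o, 'm) lincat" where
  "op_cat Q = \<lparr>Ob = Ob Q, Hom = (\<lambda>p q. Hom Q q p), Comp = (\<lambda>p q s g f. Comp Q s q p f g),
     Ide = Ide Q\<rparr>"

definition hom_finite :: "'k ring \<Rightarrow> ('k, 'o, 'm) lincat \<Rightarrow> bool" where
  "hom_finite k Q \<longleftrightarrow> (\<forall>p \<in> Ob Q. \<forall>q \<in> Ob Q.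
     fin_gen_module k (Hom Q p q) \<and> projective_module k (Hom Q p q))"

definition locally_bounded :: "('k, 'o, 'm) lincat \<Rightarrow> bool" where
  "locally_bounded Q \<longleftrightarrow> (\<forall>q \<in> Ob Q.
     finite {p \<in> Ob Q. \<not> zero_module (Hom Q p q)} \<and> finite {s \<in> Ob Q. \<not> zero_module (Hom Q q s)})"

definition linear_endofunctor ::
  "'k ring \<Rightarrow> ('k, 'o, 'm) lincat \<Rightarrow> ('o \<Rightarrow> 'o) \<Rightarrow> ('o \<Rightarrow> 'o \<Rightarrow> 'm \<Rightarrow> 'm) \<Rightarrow> bool" where
  "linear_endofunctor k Q S T \<longleftrightarrow>
     (\<forall>p \<in> Ob Q. S p \<in> Ob Q \<and> T p p (Ide Q p) = Ide Q (S p)) \<and>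
     (\<forall>p \<in> Ob Q. \<forall>q \<in> Ob Q. T p q \<in> lin_maps k (Hom Q p q) (Hom Q (S p) (S q))) \<and>
     (\<forall>p \<in> Ob Q. \<forall>q \<in> Ob Q. \<forall>s \<in> Ob Q. \<forall>f \<in> carrier (Hom Q p q). \<forall>g \<in> carrier (Hom Q q s).
       T p s (Comp Q p q s g f) = Comp Q (S p) (S q) (S s) (T q s g) (T p q f))"

text \<open>The composite of the endofunctors \<open>(S, T)\<close> and then \<open>(S', T')\<close> is naturally isomorphic
  to the identity functor.\<close>

definition comp_iso_identity ::
  "('k, 'o, 'm) lincat \<Rightarrow> ('o \<Rightarrow> 'o) \<Rightarrow> ('o \<Rightarrow> 'o \<Rightarrow> 'm \<Rightarrow> 'm) \<Rightarrow>
    ('o \<Rightarrow> 'o) \<Rightarrow> ('o \<Rightarrow> 'o \<Rightarrow> 'm \<Rightarrow> 'm) \<Rightarrow> bool" where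
  "comp_iso_identity Q S T S' T' \<longleftrightarrow> (\<exists>\<alpha> \<beta>.
     (\<forall>p \<in> Ob Q. \<alpha> p \<in> carrier (Hom Q p (S' (S p))) \<and> \<beta> p \<in> carrier (Hom Q (S' (S p)) p) \<and>
        Comp Q p (S' (S p)) p (\<beta> p) (\<alpha> p) = Ide Q p \<and>
        Comp Q (S' (S p)) p (S' (S p)) (\<alpha> p) (\<beta> p) = Ide Q (S' (S p))) \<and>
     (\<forall>p \<in> Ob Q. \<forall>q \<in> Ob Q. \<forall>f \<in> carrier (Hom Q p q).
        Comp Q p q (S' (S q)) (\<alpha> q) f =
        Comp Q p (S' (S p)) (S' (S q)) (T' (S p) (S q) (T p q f)) (\<alpha> p)))"

definition linear_autoequivalence ::
  "'k ring \<Rightarrow> ('k, 'o, 'm) lincat \<Rightarrow> ('o \<Rightarrow> 'o) \<Rightarrow> ('o \<Rightarrow> 'o \<Rightarrow> 'm \<Rightarrow> 'm) \<Rightarrow> bool" where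
  "linear_autoequivalence k Q S T \<longleftrightarrow> linear_endofunctor k Q S T \<and>
     (\<exists>S' T'. linear_endofunctor k Q S' T' \<and>
        comp_iso_identity Q S T S' T' \<and> comp_iso_identity Q S' T' S T)"

text \<open>The family \<open>\<phi>\<close> is the isomorphism \<open>Q(p, q) \<cong> Hom(Q(q, S p), k)\<close>; the last two clauses are
  naturality in \<open>q\<close> and in \<open>p\<close>.\<close>

definition has_serre_functor :: "'k ring \<Rightarrow> ('k, 'o, 'm) lincat \<Rightarrow> bool" where
  "has_serre_functor k Q \<longleftrightarrow> (\<exists>S T \<phi>. linear_autoequivalence k Q S T \<and>
     (\<forall>p \<in> Ob Q. \<forall>q \<in> Ob Q.
        \<phi> p q \<in> lin_maps k (Hom Q p q) (dual_module k (Hom Q q (S p))) \<and>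
        bij_betw (\<phi> p q) (carrier (Hom Q p q)) (carrier (dual_module k (Hom Q q (S p))))) \<and>
     (\<forall>p \<in> Ob Q. \<forall>q \<in> Ob Q. \<forall>q' \<in> Ob Q. \<forall>f \<in> carrier (Hom Q p q). \<forall>h \<in> carrier (Hom Q q q').
        \<forall>g \<in> carrier (Hom Q q' (S p)).
          \<phi> p q' (Comp Q p q q' h f) g = \<phi> p q f (Comp Q q q' (S p) g h)) \<and>
     (\<forall>p \<in> Ob Q. \<forall>p' \<in> Ob Q. \<forall>q \<in> Ob Q. \<forall>f \<in> carrier (Hom Q p q). \<forall>e \<in> carrier (Hom Q p' p).
        \<forall>g \<in> carrier (Hom Q q (S p')).
          \<phi> p' q (Comp Q p' p q f e) g = \<phi> p q f (Comp Q q (S p') (S p) (T p' p e) g)))"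

definition scalars :: "'k ring \<Rightarrow> ('k, 'o, 'm) lincat \<Rightarrow> 'o \<Rightarrow> 'm set" where
  "scalars k Q q = (\<lambda>x. x \<odot>\<^bsub>Hom Q q q\<^esub> Ide Q q) ` carrier k"

definition strong_retraction ::
  "'k ring \<Rightarrow> ('k, 'o, 'm) lincat \<Rightarrow> ('o \<Rightarrow> 'm set) \<Rightarrow> bool" where
  "strong_retraction k Q r \<longleftrightarrow>
     (\<forall>q \<in> Ob Q.
       (\<exists>\<rho> \<in> lin_maps k (Hom Q q q) (self_module k). \<forall>x \<in> carrier k. \<rho> (x \<odot>\<^bsub>Hom Q q q\<^esub> Ide Q q) = x) \<and>
       submodule (r q) k (Hom Q q q) \<and>
       scalars k Q q <+>\<^bsub>Hom Q q q\<^esub> r q = carrier (Hom Q q q) \<and>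
       scalars k Q q \<inter> r q = {\<zero>\<^bsub>Hom Q q q\<^esub>} \<and>
       (\<forall>f \<in> r q. \<forall>g \<in> r q. Comp Q q q q g f \<in> r q)) \<and>
     (\<forall>p \<in> Ob Q. \<forall>q \<in> Ob Q. p \<noteq> q \<longrightarrow>
       (\<forall>f \<in> carrier (Hom Q p q). \<forall>g \<in> carrier (Hom Q q p). Comp Q p q p g f \<in> r p))"

definition pseudo_radical :: "('k, 'o, 'm) lincat \<Rightarrow> ('o \<Rightarrow> 'm set) \<Rightarrow> 'o \<Rightarrow> 'o \<Rightarrow> 'm set" where
  "pseudo_radical Q r p q = (if p = q then r q else carrier (Hom Q p q))"

primrec chains ::
  "('k, 'o, 'm) lincat \<Rightarrow> ('o \<Rightarrow> 'o \<Rightarrow> 'm set) \<Rightarrow> nat \<Rightarrow> 'o \<Rightarrow> 'o \<Rightarrow> 'm set" where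
  "chains Q I 0 p q = (if p = q then {Ide Q p} else {})"
| "chains Q I (Suc n) p q =
     {Comp Q p s q g f | s f g. s \<in> Ob Q \<and> f \<in> chains Q I n p s \<and> g \<in> I s q}"

definition ideal_power ::
  "'k ring \<Rightarrow> ('k, 'o, 'm) lincat \<Rightarrow> ('o \<Rightarrow> 'o \<Rightarrow> 'm set) \<Rightarrow> nat \<Rightarrow> 'o \<Rightarrow> 'o \<Rightarrow> 'm set" where
  "ideal_power k Q I n p q = submod_gen k (Hom Q p q) (chains Q I n p q)"

definition nilpotent_ideal ::
  "'k ring \<Rightarrow> ('k, 'o, 'm) lincat \<Rightarrow> ('o \<Rightarrow> 'o \<Rightarrow> 'm set) \<Rightarrow> bool" where
  "nilpotent_ideal k Q I \<longleftrightarrow>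
     (\<exists>N. \<forall>p \<in> Ob Q. \<forall>q \<in> Ob Q. ideal_power k Q I N p q = {\<zero>\<^bsub>Hom Q p q\<^esub>})"


section \<open>The functor categories\<close>

record ('o, 'm, 'a, 'x) modfun =
  fobj :: "'o \<Rightarrow> ('a, 'x) module"
  fmor :: "'o \<Rightarrow> 'o \<Rightarrow> 'm \<Rightarrow> 'x \<Rightarrow> 'x"

text \<open>The \<open>k\<close>-linear functors from \<open>Q\<close> to left \<open>A\<close>-modules. A scalar \<open>r\<close> from \<open>k\<close> acts on an
  \<open>A\<close>-module through the element \<open>r \<odot> \<one>\<close> of \<open>A\<close>.\<close>

definition QAMod ::
  "'k ring \<Rightarrow> ('k, 'o, 'm) lincat \<Rightarrow> ('k, 'a) module \<Rightarrow> ('o, 'm, 'a, 'x) modfun set" where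
  "QAMod k Q A = {X.
     (\<forall>p \<in> Ob Q. left_module A (fobj X p) \<and>
        (\<forall>x \<in> carrier (fobj X p). fmor X p p (Ide Q p) x = x)) \<and>
     (\<forall>p \<in> Ob Q. \<forall>q \<in> Ob Q. \<forall>f \<in> carrier (Hom Q p q).
        fmor X p q f \<in> lin_maps A (fobj X p) (fobj X q)) \<and>
     (\<forall>p \<in> Ob Q. \<forall>q \<in> Ob Q. \<forall>s \<in> Ob Q. \<forall>f \<in> carrier (Hom Q p q). \<forall>g \<in> carrier (Hom Q q s).
        \<forall>x \<in> carrier (fobj X p). fmor X p s (Comp Q p q s g f) x = fmor X q s g (fmor X p q f x)) \<and>
     (\<forall>p \<in> Ob Q. \<forall>q \<in> Ob Q. \<forall>f \<in> carrier (Hom Q p q). \<forall>g \<in> carrier (Hom Q p q).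
        \<forall>x \<in> carrier (fobj X p).
          fmor X p q (f \<oplus>\<^bsub>Hom Q p q\<^esub> g) x = fmor X p q f x \<oplus>\<^bsub>fobj X q\<^esub> fmor X p q g x) \<and>
     (\<forall>p \<in> Ob Q. \<forall>q \<in> Ob Q. \<forall>f \<in> carrier (Hom Q p q). \<forall>r \<in> carrier k.
        \<forall>x \<in> carrier (fobj X p).
          fmor X p q (r \<odot>\<^bsub>Hom Q p q\<^esub> f) x = (r \<odot>\<^bsub>A\<^esub> \<one>\<^bsub>A\<^esub>) \<odot>\<^bsub>fobj X q\<^esub> fmor X p q f x)}"

abbreviation QMod ::
  "'k ring \<Rightarrow> ('k, 'o, 'm) lincat \<Rightarrow> ('o, 'm, 'k, 'x) modfun set" where
  "QMod k Q \<equiv> QAMod k Q (self_module k)"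

definition forget ::
  "('k, 'a) module \<Rightarrow> ('o, 'm, 'a, 'x) modfun \<Rightarrow> ('o, 'm, 'k, 'x) modfun" where
  "forget A X = \<lparr>fobj = (\<lambda>p. \<lparr>carrier = carrier (fobj X p), mult = mult (fobj X p),
       one = one (fobj X p), zero = zero (fobj X p), add = add (fobj X p),
       smult = (\<lambda>r x. (r \<odot>\<^bsub>A\<^esub> \<one>\<^bsub>A\<^esub>) \<odot>\<^bsub>fobj X p\<^esub> x)\<rparr>),
     fmor = fmor X\<rparr>"

definition nat_trans ::
  "'k ring \<Rightarrow> ('k, 'o, 'm) lincat \<Rightarrow> ('o, 'm, 'k, 'u) modfun \<Rightarrow> ('o, 'm, 'k, 'v) modfun \<Rightarrow>
    ('o \<Rightarrow> 'u \<Rightarrow> 'v) set" where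
  "nat_trans k Q U V = {\<eta>.
     (\<forall>p \<in> Ob Q. \<eta> p \<in> lin_maps k (fobj U p) (fobj V p)) \<and>
     (\<forall>p \<in> Ob Q. \<forall>q \<in> Ob Q. \<forall>f \<in> carrier (Hom Q p q). \<forall>u \<in> carrier (fobj U p).
        \<eta> q (fmor U p q f u) = fmor V p q f (\<eta> p u))}"

text \<open>The abelian structure of the functor category is pointwise; in particular epimorphisms are the
  pointwise surjections. As for modules, projectivity needs test objects on one fixed type. The
  type \<open>('o \<times> 'm \<times> 'x) list\<close> contains, for every functor \<open>U\<close> with values on \<open>'x\<close>, an isomorphic copy
  of \<open>U\<close> and of its standard projective cover, the direct sum of the representables
  \<open>Q(q, -)\<close> over all \<open>q\<close> and all elements of \<open>U q\<close> (finite formal sums of terms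
  \<open>(q, f, x)\<close>). So testing on this type gives the usual notion of projectivity.

  Iterating the construction does not increase the cardinality of the infinite type
  \<open>('o \<times> 'm \<times> 'x) list\<close>: if a type is infinite and at least as large as \<open>'o\<close> and \<open>'m\<close>, then
  functors on it have covers on it. Hence every functor with values on \<open>'x\<close> has a projective
  resolution by functors with values on \<open>('o \<times> 'm \<times> 'x) list\<close>, and it has one of length \<open>n\<close>
  as soon as its projective dimension is at most \<open>n\<close>.\<close>

type_synonym ('o, 'm, 'x) words = "('o \<times> 'm \<times> 'x) list"

definition projective_functor ::
  "'k ring \<Rightarrow> ('k, 'o, 'm) lincat \<Rightarrow> ('o, 'm, 'k, 'x) modfun \<Rightarrow> bool" where
  "projective_functor k Q P \<longleftrightarrow> P \<in> QMod k Q \<and>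
    (\<forall>(E :: ('o, 'm, 'k, ('o, 'm, 'x) words) modfun) \<in> QMod k Q.
     \<forall>(B :: ('o, 'm, 'k, ('o, 'm, 'x) words) modfun) \<in> QMod k Q.
     \<forall>g \<in> nat_trans k Q E B. \<forall>h \<in> nat_trans k Q P B.
       (\<forall>p \<in> Ob Q. g p ` carrier (fobj E p) = carrier (fobj B p)) \<longrightarrow>
       (\<exists>l \<in> nat_trans k Q P E. \<forall>p \<in> Ob Q. \<forall>x \<in> carrier (fobj P p). g p (l p x) = h p x))"

text \<open>An exact sequence \<open>\<dots> \<rightarrow> P 1 \<rightarrow> P 0 \<rightarrow> U \<rightarrow> 0\<close> with maps \<open>d n : P (n + 1) \<rightarrow> P n\<close> and
  augmentation \<open>e\<close>.\<close>

type_synonym ('o, 'm, 'k, 'u, 'x) resolution =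
  "(nat \<Rightarrow> ('o, 'm, 'k, 'u) modfun) \<times> (nat \<Rightarrow> 'o \<Rightarrow> 'u \<Rightarrow> 'u) \<times> ('o \<Rightarrow> 'u \<Rightarrow> 'x)"

definition projective_resolution ::
  "'k ring \<Rightarrow> ('k, 'o, 'm) lincat \<Rightarrow> ('o, 'm, 'k, 'x) modfun \<Rightarrow>
    ('o, 'm, 'k, ('o, 'm, 'x) words, 'x) resolution \<Rightarrow> bool" where
  "projective_resolution k Q U = (\<lambda>(P, d, e).
     (\<forall>n. projective_functor k Q (P n) \<and> d n \<in> nat_trans k Q (P (Suc n)) (P n)) \<and>
     e \<in> nat_trans k Q (P 0) U \<and>
     (\<forall>p \<in> Ob Q.
       e p ` carrier (fobj (P 0) p) = carrier (fobj U p) \<and>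
       d 0 p ` carrier (fobj (P 1) p) = {x \<in> carrier (fobj (P 0) p). e p x = \<zero>\<^bsub>fobj U p\<^esub>} \<and>
       (\<forall>n. d (Suc n) p ` carrier (fobj (P (Suc (Suc n))) p) =
          {x \<in> carrier (fobj (P (Suc n)) p). d n p x = \<zero>\<^bsub>fobj (P n) p\<^esub>})))"

definition finite_proj_dim ::
  "'k ring \<Rightarrow> ('k, 'o, 'm) lincat \<Rightarrow> ('o, 'm, 'k, 'x) modfun \<Rightarrow> bool" where
  "finite_proj_dim k Q U \<longleftrightarrow> (\<exists>P d e N. projective_resolution k Q U (P, d, e) \<and>
     (\<forall>n > N. \<forall>p \<in> Ob Q. zero_module (fobj (P n) p)))"

definition exact_class ::
  "'k ring \<Rightarrow> ('k, 'o, 'm) lincat \<Rightarrow> ('k, 'a) module \<Rightarrow> ('o, 'm, 'a, 'x) modfun set" where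
  "exact_class k Q A = {X \<in> QAMod k Q A. finite_proj_dim k Q (forget A X)}"


section \<open>Ext\<close>

text \<open>The \<open>A\<close>-module of natural transformations \<open>U \<rightarrow> X\<^sup>\<natural>\<close>; they are represented by functions
  which are \<open>undefined\<close> outside the carriers.\<close>

definition nat_module ::
  "'k ring \<Rightarrow> ('k, 'o, 'm) lincat \<Rightarrow> ('k, 'a) module \<Rightarrow> ('o, 'm, 'k, 'u) modfun \<Rightarrow>
    ('o, 'm, 'a, 'x) modfun \<Rightarrow> ('a, 'o \<Rightarrow> 'u \<Rightarrow> 'x) module" where
  "nat_module k Q A U X = \<lparr>
     carrier = nat_trans k Q U (forget A X) \<inter> (\<Pi>\<^sub>E p\<in>Ob Q. extensional (carrier (fobj U p))),
     mult = undefined, one = undefined,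
     zero = (\<lambda>p\<in>Ob Q. \<lambda>u\<in>carrier (fobj U p). \<zero>\<^bsub>fobj X p\<^esub>),
     add = (\<lambda>\<eta> \<theta>. \<lambda>p\<in>Ob Q. \<lambda>u\<in>carrier (fobj U p). \<eta> p u \<oplus>\<^bsub>fobj X p\<^esub> \<theta> p u),
     smult = (\<lambda>a \<eta>. \<lambda>p\<in>Ob Q. \<lambda>u\<in>carrier (fobj U p). a \<odot>\<^bsub>fobj X p\<^esub> \<eta> p u)\<rparr>"

definition precomp ::
  "('k, 'o, 'm) lincat \<Rightarrow> ('o, 'm, 'k, 'u) modfun \<Rightarrow> ('o \<Rightarrow> 'u \<Rightarrow> 'v) \<Rightarrow> ('o \<Rightarrow> 'v \<Rightarrow> 'x) \<Rightarrow>
    'o \<Rightarrow> 'u \<Rightarrow> 'x" where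
  "precomp Q U d \<eta> = (\<lambda>p\<in>Ob Q. \<lambda>u\<in>carrier (fobj U p). \<eta> p (d p u))"

text \<open>Cohomology of \<open>M 0 \<rightarrow> M 1 \<rightarrow> \<dots>\<close> with \<open>\<delta> n : M n \<rightarrow> M (n + 1)\<close>, and homology of
  \<open>\<dots> \<rightarrow> M 1 \<rightarrow> M 0\<close> with \<open>d n : M (n + 1) \<rightarrow> M n\<close>.\<close>

definition cohomology ::
  "(nat \<Rightarrow> ('a, 'x) module) \<Rightarrow> (nat \<Rightarrow> 'x \<Rightarrow> 'x) \<Rightarrow> nat \<Rightarrow> ('a, 'x set) module" where
  "cohomology M \<delta> i =
     quot_module ((M i)\<lparr>carrier := {x \<in> carrier (M i). \<delta> i x = \<zero>\<^bsub>M (Suc i)\<^esub>}\<rparr>)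
       (case i of 0 \<Rightarrow> {\<zero>\<^bsub>M 0\<^esub>} | Suc j \<Rightarrow> \<delta> j ` carrier (M j))"

definition homology ::
  "(nat \<Rightarrow> ('a, 'x) module) \<Rightarrow> (nat \<Rightarrow> 'x \<Rightarrow> 'x) \<Rightarrow> nat \<Rightarrow> ('a, 'x set) module" where
  "homology M d i =
     quot_module ((M i)\<lparr>carrier := (case i of 0 \<Rightarrow> carrier (M 0)
         | Suc j \<Rightarrow> {x \<in> carrier (M (Suc j)). d j x = \<zero>\<^bsub>M j\<^esub>})\<rparr>)
       (d i ` carrier (M (Suc i)))"

definition some_resolution ::
  "'k ring \<Rightarrow> ('k, 'o, 'm) lincat \<Rightarrow> ('o, 'm, 'k, 'x) modfun \<Rightarrow>
    ('o, 'm, 'k, ('o, 'm, 'x) words, 'x) resolution" where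
  "some_resolution k Q U = (SOME R. projective_resolution k Q U R)"

definition Ext_module ::
  "'k ring \<Rightarrow> ('k, 'o, 'm) lincat \<Rightarrow> ('k, 'a) module \<Rightarrow> nat \<Rightarrow> ('o, 'm, 'k, 'u) modfun \<Rightarrow>
    ('o, 'm, 'a, 'x) modfun \<Rightarrow> ('a, ('o \<Rightarrow> ('o, 'm, 'u) words \<Rightarrow> 'x) set) module" where
  "Ext_module k Q A i U X = (case some_resolution k Q U of (P, d, e) \<Rightarrow>
     cohomology (\<lambda>n. nat_module k Q A (P n) X) (\<lambda>n. precomp Q (P (Suc n)) (d n)) i)"


section \<open>Tensor products and Tor\<close>

text \<open>The left \<open>A\<close>-module \<open>W \<otimes> Y\<close> over \<open>k\<close>, for a \<open>k\<close>-module \<open>W\<close> and a left \<open>A\<close>-module \<open>Y\<close>, is the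
  free \<open>A\<close>-module on symbols \<open>[w, y]\<close> modulo bilinearity over \<open>k\<close> and the relations
  \<open>[w, a y] = a [w, y]\<close>, which say that \<open>A\<close> acts through \<open>Y\<close>.\<close>

definition tensor_free ::
  "('k, 'a) module \<Rightarrow> ('k, 'w) module \<Rightarrow> ('a, 'y) module \<Rightarrow> ('a, 'w \<times> 'y \<Rightarrow> 'a) module" where
  "tensor_free A W Y = dsum_module (carrier W \<times> carrier Y) (\<lambda>_. self_module A)"

definition tensor_symbol ::
  "('k, 'a) module \<Rightarrow> ('k, 'w) module \<Rightarrow> ('a, 'y) module \<Rightarrow> 'w \<Rightarrow> 'y \<Rightarrow> 'w \<times> 'y \<Rightarrow> 'a" where
  "tensor_symbol A W Y w y =
     dsum_inj (carrier W \<times> carrier Y) (\<lambda>_. self_module A) (w, y) \<one>\<^bsub>A\<^esub>"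

definition tensor_relations ::
  "'k ring \<Rightarrow> ('k, 'a) module \<Rightarrow> ('k, 'w) module \<Rightarrow> ('a, 'y) module \<Rightarrow> ('w \<times> 'y \<Rightarrow> 'a) set" where
  "tensor_relations k A W Y = (let F = tensor_free A W Y; t = tensor_symbol A W Y in
     {t (w \<oplus>\<^bsub>W\<^esub> w') y \<ominus>\<^bsub>F\<^esub> (t w y \<oplus>\<^bsub>F\<^esub> t w' y) | w w' y.
        w \<in> carrier W \<and> w' \<in> carrier W \<and> y \<in> carrier Y} \<union>
     {t w (y \<oplus>\<^bsub>Y\<^esub> y') \<ominus>\<^bsub>F\<^esub> (t w y \<oplus>\<^bsub>F\<^esub> t w y') | w y y'.
        w \<in> carrier W \<and> y \<in> carrier Y \<and> y' \<in> carrier Y} \<union>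
     {t (r \<odot>\<^bsub>W\<^esub> w) y \<ominus>\<^bsub>F\<^esub> t w ((r \<odot>\<^bsub>A\<^esub> \<one>\<^bsub>A\<^esub>) \<odot>\<^bsub>Y\<^esub> y) | r w y.
        r \<in> carrier k \<and> w \<in> carrier W \<and> y \<in> carrier Y} \<union>
     {t w (a \<odot>\<^bsub>Y\<^esub> y) \<ominus>\<^bsub>F\<^esub> (a \<odot>\<^bsub>F\<^esub> t w y) | a w y.
        a \<in> carrier A \<and> w \<in> carrier W \<and> y \<in> carrier Y})"

definition tensor_module ::
  "'k ring \<Rightarrow> ('k, 'a) module \<Rightarrow> ('k, 'w) module \<Rightarrow> ('a, 'y) module \<Rightarrow>
    ('a, ('w \<times> 'y \<Rightarrow> 'a) set) module" where
  "tensor_module k A W Y = quot_module (tensor_free A W Y)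
     (submod_gen A (tensor_free A W Y) (tensor_relations k A W Y))"

definition pure_tensor ::
  "'k ring \<Rightarrow> ('k, 'a) module \<Rightarrow> ('k, 'w) module \<Rightarrow> ('a, 'y) module \<Rightarrow> 'w \<Rightarrow> 'y \<Rightarrow>
    ('w \<times> 'y \<Rightarrow> 'a) set" where
  "pure_tensor k A W Y w y =
     submod_gen A (tensor_free A W Y) (tensor_relations k A W Y) +>\<^bsub>tensor_free A W Y\<^esub>
     tensor_symbol A W Y w y"

text \<open>The coend of \<open>W(q) \<otimes> X(q)\<close>, for \<open>W\<close> in \<open>QMod k (op_cat Q)\<close> and \<open>X\<close> in \<open>QAMod k Q A\<close>, is the
  cokernel of the difference of the two maps from the sum over all \<open>f : p \<rightarrow> q\<close> of
  \<open>W(q) \<otimes> X(p)\<close> to the sum over all \<open>q\<close> of \<open>W(q) \<otimes> X(q)\<close>.\<close>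

definition coend_sum ::
  "'k ring \<Rightarrow> ('k, 'o, 'm) lincat \<Rightarrow> ('k, 'a) module \<Rightarrow> ('o, 'm, 'k, 'w) modfun \<Rightarrow>
    ('o, 'm, 'a, 'x) modfun \<Rightarrow> ('a, 'o \<Rightarrow> ('w \<times> 'x \<Rightarrow> 'a) set) module" where
  "coend_sum k Q A W X = dsum_module (Ob Q) (\<lambda>q. tensor_module k A (fobj W q) (fobj X q))"

definition coend_symbol ::
  "'k ring \<Rightarrow> ('k, 'o, 'm) lincat \<Rightarrow> ('k, 'a) module \<Rightarrow> ('o, 'm, 'k, 'w) modfun \<Rightarrow>
    ('o, 'm, 'a, 'x) modfun \<Rightarrow> 'o \<Rightarrow> 'w \<Rightarrow> 'x \<Rightarrow> 'o \<Rightarrow> ('w \<times> 'x \<Rightarrow> 'a) set" where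
  "coend_symbol k Q A W X q w x =
     dsum_inj (Ob Q) (\<lambda>q. tensor_module k A (fobj W q) (fobj X q)) q
       (pure_tensor k A (fobj W q) (fobj X q) w x)"

definition coend_relations ::
  "'k ring \<Rightarrow> ('k, 'o, 'm) lincat \<Rightarrow> ('k, 'a) module \<Rightarrow> ('o, 'm, 'k, 'w) modfun \<Rightarrow>
    ('o, 'm, 'a, 'x) modfun \<Rightarrow> ('o \<Rightarrow> ('w \<times> 'x \<Rightarrow> 'a) set) set" where
  "coend_relations k Q A W X =
     {coend_symbol k Q A W X p (fmor W q p f w) x \<ominus>\<^bsub>coend_sum k Q A W X\<^esub>
      coend_symbol k Q A W X q w (fmor X p q f x) | p q f w x.
        p \<in> Ob Q \<and> q \<in> Ob Q \<and> f \<in> carrier (Hom Q p q) \<and>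
        w \<in> carrier (fobj W q) \<and> x \<in> carrier (fobj X p)}"

definition tensor_functor ::
  "'k ring \<Rightarrow> ('k, 'o, 'm) lincat \<Rightarrow> ('k, 'a) module \<Rightarrow> ('o, 'm, 'k, 'w) modfun \<Rightarrow>
    ('o, 'm, 'a, 'x) modfun \<Rightarrow> ('a, ('o \<Rightarrow> ('w \<times> 'x \<Rightarrow> 'a) set) set) module" where
  "tensor_functor k Q A W X = quot_module (coend_sum k Q A W X)
     (submod_gen A (coend_sum k Q A W X) (coend_relations k Q A W X))"

definition tensor_element ::
  "'k ring \<Rightarrow> ('k, 'o, 'm) lincat \<Rightarrow> ('k, 'a) module \<Rightarrow> ('o, 'm, 'k, 'w) modfun \<Rightarrow>
    ('o, 'm, 'a, 'x) modfun \<Rightarrow> 'o \<Rightarrow> 'w \<Rightarrow> 'x \<Rightarrow> ('o \<Rightarrow> ('w \<times> 'x \<Rightarrow> 'a) set) set" where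
  "tensor_element k Q A W X q w x =
     submod_gen A (coend_sum k Q A W X) (coend_relations k Q A W X) +>\<^bsub>coend_sum k Q A W X\<^esub>
     coend_symbol k Q A W X q w x"

text \<open>The \<open>A\<close>-linear map induced by \<open>\<tau> : W \<rightarrow> W'\<close>. The elements \<open>tensor_element\<close> generate, so the
  map is determined by its values on them.\<close>

definition tensor_map ::
  "'k ring \<Rightarrow> ('k, 'o, 'm) lincat \<Rightarrow> ('k, 'a) module \<Rightarrow> ('o, 'm, 'k, 'w) modfun \<Rightarrow>
    ('o, 'm, 'k, 'v) modfun \<Rightarrow> ('o, 'm, 'a, 'x) modfun \<Rightarrow> ('o \<Rightarrow> 'w \<Rightarrow> 'v) \<Rightarrow>
    ('o \<Rightarrow> ('w \<times> 'x \<Rightarrow> 'a) set) set \<Rightarrow> ('o \<Rightarrow> ('v \<times> 'x \<Rightarrow> 'a) set) set" where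
  "tensor_map k Q A W W' X \<tau> = (THE h.
     h \<in> lin_maps A (tensor_functor k Q A W X) (tensor_functor k Q A W' X) \<and>
     h \<in> extensional (carrier (tensor_functor k Q A W X)) \<and>
     (\<forall>q \<in> Ob Q. \<forall>w \<in> carrier (fobj W q). \<forall>x \<in> carrier (fobj X q).
        h (tensor_element k Q A W X q w x) = tensor_element k Q A W' X q (\<tau> q w) x))"

definition Tor_module ::
  "'k ring \<Rightarrow> ('k, 'o, 'm) lincat \<Rightarrow> ('k, 'a) module \<Rightarrow> nat \<Rightarrow> ('o, 'm, 'k, 'w) modfun \<Rightarrow>
    ('o, 'm, 'a, 'x) modfun \<Rightarrow>
    ('a, ('o \<Rightarrow> (('o, 'm, 'w) words \<times> 'x \<Rightarrow> 'a) set) set set) module" where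
  "Tor_module k Q A i W X = (case some_resolution k (op_cat Q) W of (P, d, e) \<Rightarrow>
     homology (\<lambda>n. tensor_functor k Q A (P n) X)
       (\<lambda>n. tensor_map k Q A (P (Suc n)) (P n) X (d n)) i)"


section \<open>Stalk functors and their (co)homology\<close>

text \<open>\<open>Q(q, -) / \<rr>(q, -)\<close>, with morphisms acting by composition on representatives of cosets.\<close>

definition stalk ::
  "('k, 'o, 'm) lincat \<Rightarrow> ('o \<Rightarrow> 'm set) \<Rightarrow> 'o \<Rightarrow> ('o, 'm, 'k, 'm set) modfun" where
  "stalk Q r q = \<lparr>fobj = (\<lambda>p. quot_module (Hom Q q p) (pseudo_radical Q r q p)),
     fmor = (\<lambda>p p' f C. \<Union>g\<in>C. pseudo_radical Q r q p' +>\<^bsub>Hom Q q p'\<^esub> Comp Q q p p' f g)\<rparr>"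

text \<open>\<open>Q(-, q) / \<rr>(-, q)\<close>: the pseudo-radical of the opposite category, formed from the same
  submodules \<open>r\<close>, is the opposite of the pseudo-radical of \<open>Q\<close>.\<close>

definition costalk ::
  "('k, 'o, 'm) lincat \<Rightarrow> ('o \<Rightarrow> 'm set) \<Rightarrow> 'o \<Rightarrow> ('o, 'm, 'k, 'm set) modfun" where
  "costalk Q r q = stalk (op_cat Q) r q"

definition stalk_cohomology ::
  "'k ring \<Rightarrow> ('k, 'o, 'm) lincat \<Rightarrow> ('o \<Rightarrow> 'm set) \<Rightarrow> ('k, 'a) module \<Rightarrow> nat \<Rightarrow> 'o \<Rightarrow>
    ('o, 'm, 'a, 'x) modfun \<Rightarrow> ('a, ('o \<Rightarrow> ('o, 'm, 'm set) words \<Rightarrow> 'x) set) module" where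
  "stalk_cohomology k Q r A i q X = Ext_module k Q A i (stalk Q r q) X"

definition stalk_homology ::
  "'k ring \<Rightarrow> ('k, 'o, 'm) lincat \<Rightarrow> ('o \<Rightarrow> 'm set) \<Rightarrow> ('k, 'a) module \<Rightarrow> nat \<Rightarrow> 'o \<Rightarrow>
    ('o, 'm, 'a, 'x) modfun \<Rightarrow>
    ('a, ('o \<Rightarrow> (('o, 'm, 'm set) words \<times> 'x \<Rightarrow> 'a) set) set set) module" where
  "stalk_homology k Q r A i q X = Tor_module k Q A i (costalk Q r q) X"

end

theory Submission
  imports Defs "HOL-Library.Nat_Bijection"
begin

text \<open>Call \<open>X\<close> radical injective if every natural family on \<open>r(p, -)\<close> is multiplication by an element of
  \<open>X p\<close>. Since \<open>r\<close> is nilpotent and \<open>k\<close> hereditary, maps into such \<open>X\<close> then extend along all subfunctors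
  with pointwise projective quotient. The Serre functor makes free functors radical injective, and makes
  radical injective functors that are pointwise projective retracts of free ones, so radical injective functors
  have finite projective dimension. Conversely, finite projective dimension of \<open>X\<close> makes its dual
  \<open>Hom(X(-), \<rat>/\<int>)\<close> radical injective on the opposite category; applying both implications to the dual
  leads back to \<open>X\<close>. Vanishing of \<open>Ext\<^sup>1\<close> on the stalks means that \<open>X\<close> is radical injective,
  vanishing of \<open>Tor\<^sub>1\<close> that its dual is.\<close>

section \<open>Additive maps and direct sums\<close>

text \<open>The passage through Q/Z answers a one-sided closure property. Radical injectivity passes
  to kernels of surjections: the error in the quotient is killed by \<open>r\<close>, so it is a
  multiple of a socle element, which can be lifted and subtracted. A projective resolution, however,
  ends in \<open>X\<close> as a cokernel. Dualising turns cokernels into kernels; since Q/Z is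
  injective and separates points, this is exact and one can come back from the double dual. The same
  duality turns Tor into Ext. The second obstacle is that \<open>k\<close> is not a field: a map
  given on a subfunctor \<open>U\<close> of \<open>V\<close> need not extend to \<open>V\<close>
  even at a single object. Each extension step therefore carries a dual basis of
  \<open>V / U\<close>. Hom-finiteness and local boundedness keep the successive quotients inside
  direct sums of copies of \<open>k\<close> (not products), and there heredity makes them
  projective. For the same reason the kernel of a cover of a radical injective functor is pointwise
  projective, hence projective, so finite projective dimension turns out to be at most one.\<close>

abbreviation El :: "('o, 'm, 'a, 'x) modfun \<Rightarrow> 'o \<Rightarrow> 'x set" where "El X p \<equiv> carrier (fobj X p)"

abbreviation Mor :: "('k, 'o, 'm) lincat \<Rightarrow> 'o \<Rightarrow> 'o \<Rightarrow> 'm set" where "Mor Q p q \<equiv> carrier (Hom Q p q)"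

abbreviation free_module :: "'k ring \<Rightarrow> 'i set \<Rightarrow> ('k, 'i \<Rightarrow> 'k) module" where
  "free_module k I \<equiv> dsum_module I (\<lambda>_. self_module k)"

abbreviation forms :: "'k ring \<Rightarrow> ('k, 'x) module \<Rightarrow> ('x \<Rightarrow> 'k) set" where "forms k M \<equiv> lin_maps k M (self_module k)"

abbreviation dsupp :: "'i set \<Rightarrow> ('i \<Rightarrow> ('x, 'z) ring_scheme) \<Rightarrow> ('i \<Rightarrow> 'x) \<Rightarrow> 'i set" where
  "dsupp I M c \<equiv> {i \<in> I. c i \<noteq> \<zero>\<^bsub>M i\<^esub>}"

abbreviation scal :: "('k, 'a) module \<Rightarrow> 'k \<Rightarrow> 'a" where "scal A a \<equiv> a \<odot>\<^bsub>A\<^esub> \<one>\<^bsub>A\<^esub>"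

lemma ag_zero_closed: "abelian_group M \<Longrightarrow> \<zero>\<^bsub>M\<^esub> \<in> carrier M"
  and ag_add_closed: "abelian_group M \<Longrightarrow> x \<in> carrier M \<Longrightarrow> y \<in> carrier M \<Longrightarrow> x \<oplus>\<^bsub>M\<^esub> y \<in> carrier M"
  by (auto simp: abelian_group_def abelian_monoid.zero_closed abelian_monoid.a_closed)

lemma left_module_of_module: "module k M \<Longrightarrow> left_module k M"
  unfolding module_def left_module_def module_axioms_def left_module_axioms_def
  by (auto intro: cring.axioms)

lemma module_of_left_module: "cring k \<Longrightarrow> left_module k M \<Longrightarrow> module k M"
  unfolding module_def left_module_def module_axioms_def left_module_axioms_def
  by auto

lemma left_moduleD:
  assumes "left_module R M"
  shows "ring R" "abelian_group M"
  using assms by (auto simp: left_module_def)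

lemmas lm_ag = left_moduleD(2)

lemma left_moduleI:
  assumes "ring R" "abelian_group M"
    and "\<And>a x. \<lbrakk>a \<in> carrier R; x \<in> carrier M\<rbrakk> \<Longrightarrow> a \<odot>\<^bsub>M\<^esub> x \<in> carrier M"
    and "\<And>a b x. \<lbrakk>a \<in> carrier R; b \<in> carrier R; x \<in> carrier M\<rbrakk> \<Longrightarrow>
        (a \<oplus>\<^bsub>R\<^esub> b) \<odot>\<^bsub>M\<^esub> x = a \<odot>\<^bsub>M\<^esub> x \<oplus>\<^bsub>M\<^esub> b \<odot>\<^bsub>M\<^esub> x"
    and "\<And>a x y. \<lbrakk>a \<in> carrier R; x \<in> carrier M; y \<in> carrier M\<rbrakk> \<Longrightarrow>
        a \<odot>\<^bsub>M\<^esub> (x \<oplus>\<^bsub>M\<^esub> y) = a \<odot>\<^bsub>M\<^esub> x \<oplus>\<^bsub>M\<^esub> a \<odot>\<^bsub>M\<^esub> y"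
    and "\<And>a b x. \<lbrakk>a \<in> carrier R; b \<in> carrier R; x \<in> carrier M\<rbrakk> \<Longrightarrow>
        (a \<otimes>\<^bsub>R\<^esub> b) \<odot>\<^bsub>M\<^esub> x = a \<odot>\<^bsub>M\<^esub> (b \<odot>\<^bsub>M\<^esub> x)"
    and "\<And>x. x \<in> carrier M \<Longrightarrow> \<one>\<^bsub>R\<^esub> \<odot>\<^bsub>M\<^esub> x = x"
  shows "left_module R M"
  using assms by (auto simp: left_module_def left_module_axioms_def)

text \<open>Characters with values in Q/Z are only additive, and for natural families linearity
  comes for free (\<open>natural_lin_maps\<close>). So additivity is the level at which maps are
  built and compared.\<close>

definition add_maps :: "('x, 'b) ring_scheme \<Rightarrow> ('y, 'c) ring_scheme \<Rightarrow> ('x \<Rightarrow> 'y) set" where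
  "add_maps M N = {h \<in> carrier M \<rightarrow> carrier N.
     \<forall>x \<in> carrier M. \<forall>y \<in> carrier M. h (x \<oplus>\<^bsub>M\<^esub> y) = h x \<oplus>\<^bsub>N\<^esub> h y}"

lemma add_mapsI:
  assumes "\<And>x. x \<in> carrier M \<Longrightarrow> h x \<in> carrier N"
    and "\<And>x y. \<lbrakk>x \<in> carrier M; y \<in> carrier M\<rbrakk> \<Longrightarrow> h (x \<oplus>\<^bsub>M\<^esub> y) = h x \<oplus>\<^bsub>N\<^esub> h y"
  shows "h \<in> add_maps M N"
  using assms by (auto simp: add_maps_def)

lemma add_maps_closed: "h \<in> add_maps M N \<Longrightarrow> x \<in> carrier M \<Longrightarrow> h x \<in> carrier N"
  by (auto simp: add_maps_def)

lemma add_maps_add: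
  "h \<in> add_maps M N \<Longrightarrow> x \<in> carrier M \<Longrightarrow> y \<in> carrier M \<Longrightarrow> h (x \<oplus>\<^bsub>M\<^esub> y) = h x \<oplus>\<^bsub>N\<^esub> h y"
  by (auto simp: add_maps_def)

lemma add_maps_zero:
  assumes "abelian_group M" "abelian_group N" "h \<in> add_maps M N"
  shows "h \<zero>\<^bsub>M\<^esub> = \<zero>\<^bsub>N\<^esub>"
proof -
  interpret M: abelian_group M by fact
  interpret N: abelian_group N by fact
  have "h \<zero>\<^bsub>M\<^esub> \<oplus>\<^bsub>N\<^esub> h \<zero>\<^bsub>M\<^esub> = h \<zero>\<^bsub>M\<^esub>"
    using add_maps_add[OF assms(3), of "\<zero>\<^bsub>M\<^esub>" "\<zero>\<^bsub>M\<^esub>"] by simp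
  thus ?thesis
    using add_maps_closed[OF assms(3), of "\<zero>\<^bsub>M\<^esub>"] by simp
qed

lemma add_maps_minus:
  assumes "abelian_group M" "abelian_group N" "h \<in> add_maps M N" "x \<in> carrier M" "y \<in> carrier M"
  shows "h (x \<ominus>\<^bsub>M\<^esub> y) = h x \<ominus>\<^bsub>N\<^esub> h y"
proof -
  interpret M: abelian_group M by fact
  interpret N: abelian_group N by fact
  have "h (x \<ominus>\<^bsub>M\<^esub> y) \<oplus>\<^bsub>N\<^esub> h y = h x"
    using add_maps_add[OF assms(3), of "x \<ominus>\<^bsub>M\<^esub> y" y] assms(4,5)
    by (simp add: M.minus_eq M.a_assoc M.l_neg)
  thus ?thesis
    using add_maps_closed[OF assms(3)] assms(4,5)
    by (metis M.minus_closed N.add.inv_solve_right a_minus_def)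
qed

lemma add_maps_comp: "g \<in> add_maps N L \<Longrightarrow> h \<in> add_maps M N \<Longrightarrow> (\<lambda>x. g (h x)) \<in> add_maps M L"
  by (auto simp: add_maps_def Pi_iff)

lemma add_maps_plus:
  assumes "abelian_group N" "g \<in> add_maps M N" "h \<in> add_maps M N"
  shows "(\<lambda>x. g x \<oplus>\<^bsub>N\<^esub> h x) \<in> add_maps M N"
proof -
  interpret N: abelian_group N by fact
  show ?thesis using assms by (auto simp: add_maps_def Pi_iff N.a_ac)
qed

lemma add_maps_cong:
  "abelian_group M \<Longrightarrow> h \<in> add_maps M N \<Longrightarrow> (\<And>x. x \<in> carrier M \<Longrightarrow> g x = h x) \<Longrightarrow> g \<in> add_maps M N"
  by (auto simp: add_maps_def Pi_iff abelian_monoid.a_closed abelian_group.axioms(1))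

lemma add_maps_const_zero:
  assumes "abelian_group N" shows "(\<lambda>_. \<zero>\<^bsub>N\<^esub>) \<in> add_maps M N"
proof -
  interpret N: abelian_group N by fact
  show ?thesis by (auto simp: add_maps_def)
qed

section \<open>Linear maps and submodules\<close>

lemma lin_maps_iff: "h \<in> lin_maps R M N \<longleftrightarrow>
    h \<in> add_maps M N \<and> (\<forall>a \<in> carrier R. \<forall>x \<in> carrier M. h (a \<odot>\<^bsub>M\<^esub> x) = a \<odot>\<^bsub>N\<^esub> h x)"
  by (auto simp: lin_maps_def add_maps_def)

lemma lin_maps_add_maps: "h \<in> lin_maps R M N \<Longrightarrow> h \<in> add_maps M N"
  by (simp add: lin_maps_iff)

lemma lin_maps_closed: "h \<in> lin_maps R M N \<Longrightarrow> x \<in> carrier M \<Longrightarrow> h x \<in> carrier N"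
  and lin_maps_add: "h \<in> lin_maps R M N \<Longrightarrow> x \<in> carrier M \<Longrightarrow> y \<in> carrier M \<Longrightarrow> h (x \<oplus>\<^bsub>M\<^esub> y) = h x \<oplus>\<^bsub>N\<^esub> h y"
  by (auto simp: lin_maps_def)

lemma lin_maps_zero: "abelian_group M \<Longrightarrow> abelian_group N \<Longrightarrow> h \<in> lin_maps R M N \<Longrightarrow> h \<zero>\<^bsub>M\<^esub> = \<zero>\<^bsub>N\<^esub>"
  and lin_maps_minus: "abelian_group M \<Longrightarrow> abelian_group N \<Longrightarrow> h \<in> lin_maps R M N \<Longrightarrow> x \<in> carrier M \<Longrightarrow> y \<in> carrier M \<Longrightarrow>
    h (x \<ominus>\<^bsub>M\<^esub> y) = h x \<ominus>\<^bsub>N\<^esub> h y"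
  by (blast intro: add_maps_zero add_maps_minus lin_maps_add_maps)+

lemma lin_maps_smult:
  "h \<in> lin_maps R M N \<Longrightarrow> a \<in> carrier R \<Longrightarrow> x \<in> carrier M \<Longrightarrow> h (a \<odot>\<^bsub>M\<^esub> x) = a \<odot>\<^bsub>N\<^esub> h x"
  by (simp add: lin_maps_iff)

lemma lin_maps_comp: "g \<in> lin_maps R N L \<Longrightarrow> h \<in> lin_maps R M N \<Longrightarrow> (\<lambda>x. g (h x)) \<in> lin_maps R M L"
  by (auto simp: lin_maps_iff add_maps_comp add_maps_closed)

lemma lin_maps_id: "(\<lambda>x. x) \<in> lin_maps R M M"
  by (auto simp: lin_maps_def)

lemma lin_maps_restrict: "h \<in> lin_maps R M N \<Longrightarrow> U \<subseteq> carrier M \<Longrightarrow> h \<in> lin_maps R (M\<lparr>carrier := U\<rparr>) N"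
  by (auto simp: lin_maps_def Pi_iff subset_iff)

lemma left_module_zero_smult:
  assumes "left_module R M" "x \<in> carrier M" shows "\<zero>\<^bsub>R\<^esub> \<odot>\<^bsub>M\<^esub> x = \<zero>\<^bsub>M\<^esub>"
proof -
  interpret M: left_module R M by fact
  have "\<zero>\<^bsub>R\<^esub> \<odot>\<^bsub>M\<^esub> x \<oplus>\<^bsub>M\<^esub> \<zero>\<^bsub>R\<^esub> \<odot>\<^bsub>M\<^esub> x = \<zero>\<^bsub>R\<^esub> \<odot>\<^bsub>M\<^esub> x"
    using assms(2) by (simp flip: M.lsmult_l_distr)
  thus ?thesis using assms(2) M.lsmult_closed by simp
qed

lemma left_module_smult_add_maps:
  assumes "left_module R M" "a \<in> carrier R" shows "(\<lambda>x. a \<odot>\<^bsub>M\<^esub> x) \<in> add_maps M M"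
  using assms by (auto intro!: add_mapsI simp: left_module.lsmult_closed left_module.lsmult_r_distr)

lemma left_module_smult_zero:
  assumes "left_module R M" "a \<in> carrier R" shows "a \<odot>\<^bsub>M\<^esub> \<zero>\<^bsub>M\<^esub> = \<zero>\<^bsub>M\<^esub>"
  using add_maps_zero[OF _ _ left_module_smult_add_maps[OF assms]] lm_ag[OF assms(1)]
  by simp

lemma left_module_smult_point:
  assumes "left_module R M" "x \<in> carrier M"
  shows "(\<lambda>a. a \<odot>\<^bsub>M\<^esub> x) \<in> lin_maps R (self_module R) M"
  using assms
  by (auto simp: lin_maps_def self_module_def left_module.lsmult_closed left_module.lsmult_l_distr
      left_module.lsmult_assoc)

lemma left_module_self:
  assumes "ring R" shows "left_module R (self_module R)"
proof -
  interpret ring R by fact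
  have "abelian_group (self_module R)"
  proof (rule abelian_groupI)
    show "\<exists>y\<in>carrier (self_module R). y \<oplus>\<^bsub>self_module R\<^esub> x = \<zero>\<^bsub>self_module R\<^esub>"
      if "x \<in> carrier (self_module R)" for x
      using that l_neg[of x] a_inv_closed[of x] by (auto simp: self_module_def)
  qed (auto simp: self_module_def a_ac)
  thus ?thesis
    by (intro left_moduleI assms) (auto simp: self_module_def l_distr r_distr m_assoc)
qed

lemma self_module_simps [simp]:
  "carrier (self_module R) = carrier R" "add (self_module R) = add R" "zero (self_module R) = zero R"
  "smult (self_module R) = mult R" "mult (self_module R) = mult R" "one (self_module R) = one R"
  by (auto simp: self_module_def)

lemma a_inv_self_module: "\<ominus>\<^bsub>self_module R\<^esub> x = \<ominus>\<^bsub>R\<^esub> x"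
  by (simp add: a_inv_def m_inv_def)

lemma lin_maps_diff:
  assumes N: "left_module R N" and f: "f \<in> lin_maps R M N" and g: "g \<in> lin_maps R M N"
  shows "(\<lambda>x. f x \<ominus>\<^bsub>N\<^esub> g x) \<in> lin_maps R M N"
proof -
  interpret N: left_module R N by fact
  note f' = lin_maps_add_maps[OF f] and g' = lin_maps_add_maps[OF g]
  note c = add_maps_closed[OF f'] add_maps_closed[OF g']
  show ?thesis
    using c add_maps_minus[OF N.abelian_group_axioms N.abelian_group_axioms left_module_smult_add_maps[OF N]]
    by (auto simp: lin_maps_iff add_maps_def add_maps_add[OF f'] add_maps_add[OF g'] lin_maps_smult[OF f]
        lin_maps_smult[OF g] N.minus_eq N.minus_add N.a_ac)
qed

lemma lin_maps_plus:
  assumes N: "left_module R N" and f: "f \<in> lin_maps R M N" and g: "g \<in> lin_maps R M N"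
  shows "(\<lambda>x. f x \<oplus>\<^bsub>N\<^esub> g x) \<in> lin_maps R M N"
  using add_maps_plus[OF lm_ag[OF N] lin_maps_add_maps[OF f] lin_maps_add_maps[OF g]]
    lin_maps_closed[OF f] lin_maps_closed[OF g]
  by (auto simp: lin_maps_iff lin_maps_smult[OF f] lin_maps_smult[OF g] left_module.lsmult_r_distr[OF N])

lemma submoduleD:
  assumes "left_module R M" "submodule U R M"
  shows "U \<subseteq> carrier M" "\<zero>\<^bsub>M\<^esub> \<in> U" "\<And>x y. x \<in> U \<Longrightarrow> y \<in> U \<Longrightarrow> x \<oplus>\<^bsub>M\<^esub> y \<in> U"
    "\<And>a x. a \<in> carrier R \<Longrightarrow> x \<in> U \<Longrightarrow> a \<odot>\<^bsub>M\<^esub> x \<in> U" "\<And>x. x \<in> U \<Longrightarrow> \<ominus>\<^bsub>M\<^esub> x \<in> U"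
    "\<And>x y. x \<in> U \<Longrightarrow> y \<in> U \<Longrightarrow> x \<ominus>\<^bsub>M\<^esub> y \<in> U"
proof -
  interpret M: left_module R M by fact
  interpret U: subgroup U "add_monoid M" using assms(2) by (simp add: submodule_def)
  show "U \<subseteq> carrier M" "\<zero>\<^bsub>M\<^esub> \<in> U" "\<And>x y. x \<in> U \<Longrightarrow> y \<in> U \<Longrightarrow> x \<oplus>\<^bsub>M\<^esub> y \<in> U"
    using U.subset U.one_closed U.m_closed by auto
  show 1: "\<And>x. x \<in> U \<Longrightarrow> \<ominus>\<^bsub>M\<^esub> x \<in> U" using U.m_inv_closed by (simp add: a_inv_def)
  show "\<And>a x. a \<in> carrier R \<Longrightarrow> x \<in> U \<Longrightarrow> a \<odot>\<^bsub>M\<^esub> x \<in> U"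
    using assms(2) by (simp add: submodule_def submodule_axioms_def)
  show "\<And>x y. x \<in> U \<Longrightarrow> y \<in> U \<Longrightarrow> x \<ominus>\<^bsub>M\<^esub> y \<in> U"
    using 1 U.m_closed by (simp add: a_minus_def)
qed

lemma left_module_minus_one:
  assumes "left_module R M" "x \<in> carrier M" shows "\<ominus>\<^bsub>M\<^esub> x = (\<ominus>\<^bsub>R\<^esub> \<one>\<^bsub>R\<^esub>) \<odot>\<^bsub>M\<^esub> x"
proof -
  interpret M: left_module R M by fact
  have "(\<ominus>\<^bsub>R\<^esub> \<one>\<^bsub>R\<^esub>) \<odot>\<^bsub>M\<^esub> x \<oplus>\<^bsub>M\<^esub> x = (\<ominus>\<^bsub>R\<^esub> \<one>\<^bsub>R\<^esub> \<oplus>\<^bsub>R\<^esub> \<one>\<^bsub>R\<^esub>) \<odot>\<^bsub>M\<^esub> x"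
    using assms(2) by (subst M.lsmult_l_distr) (auto simp: M.lsmult_one)
  also have "\<dots> = \<zero>\<^bsub>M\<^esub>" using left_module_zero_smult[OF assms] by (simp add: M.R.l_neg)
  finally show ?thesis
    using assms(2) M.lsmult_closed by (metis M.add.inv_equality M.R.a_inv_closed M.R.one_closed)
qed

lemma left_submoduleI:
  assumes M: "left_module R M" and U: "U \<subseteq> carrier M" "\<zero>\<^bsub>M\<^esub> \<in> U"
    "\<And>x y. x \<in> U \<Longrightarrow> y \<in> U \<Longrightarrow> x \<oplus>\<^bsub>M\<^esub> y \<in> U" "\<And>a x. a \<in> carrier R \<Longrightarrow> x \<in> U \<Longrightarrow> a \<odot>\<^bsub>M\<^esub> x \<in> U"
  shows "submodule U R M"
proof -
  interpret M: left_module R M by fact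
  have "\<ominus>\<^bsub>M\<^esub> x \<in> U" if "x \<in> U" for x
    using U(4)[OF _ that, of "\<ominus>\<^bsub>R\<^esub> \<one>\<^bsub>R\<^esub>"] left_module_minus_one[OF M, of x] that U(1) by auto
  thus ?thesis
    using U by (auto simp: submodule_def submodule_axioms_def a_inv_def intro!: subgroup.intro)
qed

lemma left_module_submodule:
  assumes "left_module R M" "submodule U R M" shows "left_module R (M\<lparr>carrier := U\<rparr>)"
proof -
  interpret M: left_module R M by fact
  note U = submoduleD[OF assms]
  have c: "x \<in> carrier M" if "x \<in> U" for x using that U(1) by auto
  have "abelian_group (M\<lparr>carrier := U\<rparr>)"
  proof (rule abelian_groupI)
    show "\<exists>y\<in>carrier (M\<lparr>carrier := U\<rparr>). y \<oplus>\<^bsub>M\<lparr>carrier := U\<rparr>\<^esub> x = \<zero>\<^bsub>M\<lparr>carrier := U\<rparr>\<^esub>"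
      if "x \<in> carrier (M\<lparr>carrier := U\<rparr>)" for x
      using that U(5) M.l_neg[OF c] by auto
  qed (auto simp: c U M.a_ac)
  thus ?thesis
    by (intro left_moduleI M.R.ring_axioms)
      (auto simp: c U M.lsmult_l_distr M.lsmult_r_distr M.lsmult_assoc M.lsmult_one)
qed

lemma lin_maps_kernel:
  assumes M: "left_module R M" and N: "left_module R N" and h: "h \<in> lin_maps R M N"
  shows "submodule {x \<in> carrier M. h x = \<zero>\<^bsub>N\<^esub>} R M"
proof -
  interpret M: left_module R M by fact
  interpret N: left_module R N by fact
  note h' = lin_maps_add_maps[OF h]
  show ?thesis
    by (rule left_submoduleI[OF M])
      (auto simp: add_maps_zero[OF M.abelian_group_axioms N.abelian_group_axioms h']
        add_maps_add[OF h'] lin_maps_smult[OF h] M.lsmult_closed left_module_smult_zero[OF N])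
qed

lemma lin_maps_image:
  assumes M: "left_module R M" and N: "left_module R N" and h: "h \<in> lin_maps R M N"
  shows "submodule (h ` carrier M) R N"
proof -
  interpret M: left_module R M by fact
  interpret N: left_module R N by fact
  note h' = lin_maps_add_maps[OF h]
  show ?thesis
  proof (rule left_submoduleI[OF N])
    show "\<zero>\<^bsub>N\<^esub> \<in> h ` carrier M"
      using add_maps_zero[OF M.abelian_group_axioms N.abelian_group_axioms h'] by (metis M.zero_closed imageI)
    show "x \<oplus>\<^bsub>N\<^esub> y \<in> h ` carrier M" if xy: "x \<in> h ` carrier M" "y \<in> h ` carrier M" for x y
    proof -
      obtain a b where "a \<in> carrier M" "b \<in> carrier M" "x = h a" "y = h b" using xy by blast
      thus ?thesis using add_maps_add[OF h', of a b] by (auto intro!: image_eqI[of _ _ "a \<oplus>\<^bsub>M\<^esub> b"])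
    qed
    show "a \<odot>\<^bsub>N\<^esub> x \<in> h ` carrier M" if ax: "a \<in> carrier R" "x \<in> h ` carrier M" for a x
    proof -
      obtain b where "b \<in> carrier M" "x = h b" using ax by blast
      thus ?thesis using lin_maps_smult[OF h ax(1), of b] ax(1)
        by (auto intro!: image_eqI[of _ _ "a \<odot>\<^bsub>M\<^esub> b"] simp: M.lsmult_closed)
    qed
  qed (use add_maps_closed[OF h'] in auto)
qed

lemma submod_gen_submodule:
  assumes M: "left_module R M" and S: "S \<subseteq> carrier M"
  shows "submodule (submod_gen R M S) R M" "S \<subseteq> submod_gen R M S"
    "\<And>H. submodule H R M \<Longrightarrow> S \<subseteq> H \<Longrightarrow> submod_gen R M S \<subseteq> H"
proof -
  interpret M: left_module R M by fact
  have c: "submodule (carrier M) R M"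
    by (rule left_submoduleI[OF M]) (auto simp: M.lsmult_closed)
  show "S \<subseteq> submod_gen R M S" by (auto simp: submod_gen_def)
  show m: "\<And>H. submodule H R M \<Longrightarrow> S \<subseteq> H \<Longrightarrow> submod_gen R M S \<subseteq> H"
    by (auto simp: submod_gen_def)
  note D = submoduleD[OF M]
  show "submodule (submod_gen R M S) R M"
    by (rule left_submoduleI[OF M]) (use m[OF c S] D in \<open>auto simp: submod_gen_def\<close>)
qed

section \<open>Direct sums and their universal property\<close>

lemma dsum_simps:
  "carrier (dsum_module I M) = {f \<in> (\<Pi>\<^sub>E i\<in>I. carrier (M i)). finite (dsupp I M f)}"
  "\<zero>\<^bsub>dsum_module I M\<^esub> = (\<lambda>i\<in>I. \<zero>\<^bsub>M i\<^esub>)"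
  "f \<oplus>\<^bsub>dsum_module I M\<^esub> g = (\<lambda>i\<in>I. f i \<oplus>\<^bsub>M i\<^esub> g i)"
  "a \<odot>\<^bsub>dsum_module I M\<^esub> f = (\<lambda>i\<in>I. a \<odot>\<^bsub>M i\<^esub> f i)"
  by (auto simp: dsum_module_def)

lemma dsumD:
  assumes "c \<in> carrier (dsum_module I M)"
  shows "i \<in> I \<Longrightarrow> c i \<in> carrier (M i)" "finite (dsupp I M c)" "c \<in> extensional I"
  using assms by (auto simp: dsum_simps PiE_def)

lemma a_inv_zero_ag: "abelian_group M \<Longrightarrow> \<ominus>\<^bsub>M\<^esub> \<zero>\<^bsub>M\<^esub> = \<zero>\<^bsub>M\<^esub>"
  by (metis abelian_group.axioms(1) abelian_group.l_neg abelian_group.a_inv_closed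
      abelian_monoid.r_zero abelian_monoid.zero_closed)

lemma dsum_abelian_group:
  assumes "\<forall>i\<in>I. abelian_group (M i)" shows "abelian_group (dsum_module I M)"
proof (rule abelian_groupI)
  note ag = bspec[OF assms]
  note am = abelian_group.axioms(1)[OF ag]
  note cl [simp] = abelian_monoid.zero_closed[OF am] abelian_monoid.a_closed[OF am]
    abelian_monoid.l_zero[OF am] abelian_monoid.r_zero[OF am] abelian_group.a_inv_closed[OF ag]
  let ?D = "dsum_module I M"
  show "\<zero>\<^bsub>?D\<^esub> \<in> carrier ?D" by (auto simp: dsum_simps)
  show "x \<oplus>\<^bsub>?D\<^esub> y \<in> carrier ?D" if x: "x \<in> carrier ?D" and y: "y \<in> carrier ?D" for x y
  proof -
    have "finite {i \<in> I. x i \<oplus>\<^bsub>M i\<^esub> y i \<noteq> \<zero>\<^bsub>M i\<^esub>}"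
      by (rule finite_subset[OF _ finite_UnI[OF dsumD(2)[OF x] dsumD(2)[OF y]]]) auto
    thus ?thesis using dsumD[OF x] dsumD[OF y]
      by (auto simp: dsum_simps cong: conj_cong)
  qed
  show "x \<oplus>\<^bsub>?D\<^esub> y \<oplus>\<^bsub>?D\<^esub> z = x \<oplus>\<^bsub>?D\<^esub> (y \<oplus>\<^bsub>?D\<^esub> z)"
    if "x \<in> carrier ?D" "y \<in> carrier ?D" "z \<in> carrier ?D" for x y z
    using dsumD(1)[OF that(1)] dsumD(1)[OF that(2)] dsumD(1)[OF that(3)]
    by (auto simp: dsum_simps abelian_monoid.a_assoc[OF am] cong: restrict_cong)
  show "x \<oplus>\<^bsub>?D\<^esub> y = y \<oplus>\<^bsub>?D\<^esub> x" if "x \<in> carrier ?D" "y \<in> carrier ?D" for x y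
    using dsumD(1)[OF that(1)] dsumD(1)[OF that(2)]
    by (auto simp: dsum_simps abelian_monoid.a_comm[OF am] cong: restrict_cong)
  show "\<zero>\<^bsub>?D\<^esub> \<oplus>\<^bsub>?D\<^esub> x = x" if "x \<in> carrier ?D" for x
    using dsumD[OF that] by (auto simp: dsum_simps fun_eq_iff extensional_def)
  show "\<exists>y\<in>carrier ?D. y \<oplus>\<^bsub>?D\<^esub> x = \<zero>\<^bsub>?D\<^esub>" if x: "x \<in> carrier ?D" for x
  proof -
    have "{i \<in> I. \<ominus>\<^bsub>M i\<^esub> x i \<noteq> \<zero>\<^bsub>M i\<^esub>} \<subseteq> dsupp I M x"
      using a_inv_zero_ag[OF ag] by auto
    from finite_subset[OF this dsumD(2)[OF x]]
    have "(\<lambda>i\<in>I. \<ominus>\<^bsub>M i\<^esub> x i) \<in> carrier ?D" using dsumD[OF x]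
      by (auto simp: dsum_simps cong: conj_cong)
    moreover have "(\<lambda>i\<in>I. \<ominus>\<^bsub>M i\<^esub> x i) \<oplus>\<^bsub>?D\<^esub> x = \<zero>\<^bsub>?D\<^esub>"
      using dsumD(1)[OF x] by (auto simp: dsum_simps abelian_group.l_neg[OF ag] cong: restrict_cong)
    ultimately show ?thesis by blast
  qed
qed

lemma family_abelian_group: "\<forall>i\<in>I. left_module R (M i) \<Longrightarrow> \<forall>i\<in>I. abelian_group (M i)"
  by (auto simp: left_module_def)

lemma family_add_maps: "\<forall>i\<in>I. h i \<in> lin_maps R (M i) N \<Longrightarrow> \<forall>i\<in>I. h i \<in> add_maps (M i) N"
  by (auto simp: lin_maps_iff)

lemma dsum_left_module:
  assumes R: "ring R" and MA: "\<forall>i\<in>I. left_module R (M i)" shows "left_module R (dsum_module I M)"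
proof (rule left_moduleI[OF assms(1)])
  note lm = bspec[OF MA]
  let ?D = "dsum_module I M"
  show "abelian_group ?D" by (rule dsum_abelian_group) (blast intro: left_moduleD(2) lm)
  show "a \<odot>\<^bsub>?D\<^esub> x \<in> carrier ?D" if a: "a \<in> carrier R" and x: "x \<in> carrier ?D" for a x
  proof -
    have "{i \<in> I. a \<odot>\<^bsub>M i\<^esub> x i \<noteq> \<zero>\<^bsub>M i\<^esub>} \<subseteq> dsupp I M x"
      using left_module_smult_zero[OF lm a] by auto
    from finite_subset[OF this dsumD(2)[OF x]] show ?thesis using dsumD[OF x] a
      by (auto simp: dsum_simps left_module.lsmult_closed[OF lm] cong: conj_cong)
  qed
qed (auto simp: dsum_simps fun_eq_iff PiE_def extensional_def Pi_iff
     left_module.lsmult_l_distr[OF bspec[OF MA]] left_module.lsmult_r_distr[OF bspec[OF MA]]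
     left_module.lsmult_assoc[OF bspec[OF MA]] left_module.lsmult_one[OF bspec[OF MA]])

lemma dsum_inj_apply [simp]:
  "dsum_inj I M j x i = (if i \<in> I then if i = j then x else \<zero>\<^bsub>M i\<^esub> else undefined)"
  by (simp add: dsum_inj_def)

lemma dsum_inj_closed:
  assumes "\<forall>i\<in>I. abelian_group (M i)" "x \<in> carrier (M j)"
  shows "dsum_inj I M j x \<in> carrier (dsum_module I M)"
proof -
  have "{i \<in> I. (if i = j then x else \<zero>\<^bsub>M i\<^esub>) \<noteq> \<zero>\<^bsub>M i\<^esub>} \<subseteq> {j}" by auto
  from finite_subset[OF this] show ?thesis
    using assms ag_zero_closed[OF bspec[OF assms(1)]]
    by (auto simp: dsum_simps dsum_inj_def cong: conj_cong)
qed

lemma dsum_inj_add_maps: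
  assumes "\<forall>i\<in>I. abelian_group (M i)" "j \<in> I"
  shows "dsum_inj I M j \<in> add_maps (M j) (dsum_module I M)"
  using ag_zero_closed[OF bspec[OF assms(1)]]
    abelian_monoid.l_zero[OF abelian_group.axioms(1)[OF bspec[OF assms(1)]]]
  by (auto intro!: add_mapsI dsum_inj_closed assms(1) simp: dsum_simps fun_eq_iff)

lemma dsum_inj_lin_maps:
  assumes "\<forall>i\<in>I. left_module R (M i)" "j \<in> I"
  shows "dsum_inj I M j \<in> lin_maps R (M j) (dsum_module I M)"
  using dsum_inj_add_maps[OF family_abelian_group[OF assms(1)] assms(2)]
    left_module_smult_zero[OF bspec[OF assms(1)]]
  by (auto simp: lin_maps_iff dsum_simps fun_eq_iff)

definition dsum_lift ::
  "('y, 'b) ring_scheme \<Rightarrow> 'i set \<Rightarrow> ('i \<Rightarrow> ('a, 'x) module) \<Rightarrow> ('i \<Rightarrow> 'x \<Rightarrow> 'y) \<Rightarrow> ('i \<Rightarrow> 'x) \<Rightarrow> 'y" where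
  "dsum_lift N I M h c = (\<Oplus>\<^bsub>N\<^esub>i \<in> dsupp I M c. h i (c i))"

text \<open>The support varies with the argument, so two values of \<open>dsum_lift\<close> can be
  added or compared only after passing to a common finite index set; the extra terms are
  zero.\<close>

lemma dsum_lift_superset:
  assumes MA: "\<forall>i\<in>I. abelian_group (M i)" and N: "abelian_group N"
    and hA: "\<forall>i\<in>I. h i \<in> add_maps (M i) N"
    and S: "finite S" "S \<subseteq> I" "dsupp I M c \<subseteq> S" and c: "c \<in> carrier (dsum_module I M)"
  shows "dsum_lift N I M h c = (\<Oplus>\<^bsub>N\<^esub>i \<in> S. h i (c i))"
  unfolding dsum_lift_def
proof -
  note M = bspec[OF MA] and h = bspec[OF hA]
  interpret N: abelian_group N by fact
  show "(\<Oplus>\<^bsub>N\<^esub>i \<in> dsupp I M c. h i (c i)) = (\<Oplus>\<^bsub>N\<^esub>i \<in> S. h i (c i))"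
  proof (rule N.add.finprod_mono_neutral_cong_left[OF S(1,3)])
    show "h i (c i) = \<zero>\<^bsub>N\<^esub>" if "i \<in> S - dsupp I M c" for i
      using add_maps_zero[OF M N h, of i] that S(2) by auto
    show "(\<lambda>i. h i (c i)) \<in> S \<rightarrow> carrier N"
      by (rule Pi_I, rule add_maps_closed[OF h dsumD(1)[OF c]]) (use S(2) in auto)
  qed auto
qed

lemma dsum_lift_add_maps:
  assumes MA: "\<forall>i\<in>I. abelian_group (M i)" and N: "abelian_group N"
    and hA: "\<forall>i\<in>I. h i \<in> add_maps (M i) N"
  shows "dsum_lift N I M h \<in> add_maps (dsum_module I M) N"
proof (rule add_mapsI)
  note M = bspec[OF MA] and h = bspec[OF hA]
  interpret N: abelian_group N by fact
  let ?D = "dsum_module I M"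
  interpret D: abelian_group ?D by (rule dsum_abelian_group[OF MA])
  have hc: "h i (c i) \<in> carrier N" if "i \<in> I" "c \<in> carrier ?D" for i c
    by (rule add_maps_closed[OF h[OF that(1)] dsumD(1)[OF that(2,1)]])
  show "dsum_lift N I M h c \<in> carrier N" if "c \<in> carrier ?D" for c
    unfolding dsum_lift_def using hc[OF _ that] by (auto intro!: N.finsum_closed)
  show "dsum_lift N I M h (c \<oplus>\<^bsub>?D\<^esub> d) = dsum_lift N I M h c \<oplus>\<^bsub>N\<^esub> dsum_lift N I M h d"
    if c: "c \<in> carrier ?D" and d: "d \<in> carrier ?D" for c d
  proof -
    define S where "S = dsupp I M c \<union> dsupp I M d"
    have S: "finite S" "S \<subseteq> I" "dsupp I M c \<subseteq> S" "dsupp I M d \<subseteq> S"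
      using dsumD(2)[OF c] dsumD(2)[OF d] by (auto simp: S_def)
    have S': "{i \<in> I. (c \<oplus>\<^bsub>?D\<^esub> d) i \<noteq> \<zero>\<^bsub>M i\<^esub>} \<subseteq> S"
      using abelian_monoid.l_zero[OF abelian_group.axioms(1)[OF M] ag_zero_closed[OF M]]
      by (auto simp: S_def dsum_simps)
    have "dsum_lift N I M h (c \<oplus>\<^bsub>?D\<^esub> d) = (\<Oplus>\<^bsub>N\<^esub>i \<in> S. h i ((c \<oplus>\<^bsub>?D\<^esub> d) i))"
      by (rule dsum_lift_superset[OF MA N hA S(1,2) S']) (use c d in auto)
    also have "\<dots> = (\<Oplus>\<^bsub>N\<^esub>i \<in> S. h i (c i) \<oplus>\<^bsub>N\<^esub> h i (d i))"
    proof (rule N.finsum_cong'[OF refl])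
      show "(\<lambda>i. h i (c i) \<oplus>\<^bsub>N\<^esub> h i (d i)) \<in> S \<rightarrow> carrier N" using S(2) hc c d by auto
      show "h i ((c \<oplus>\<^bsub>?D\<^esub> d) i) = h i (c i) \<oplus>\<^bsub>N\<^esub> h i (d i)" if "i \<in> S" for i
        using that S(2) add_maps_add[OF h] dsumD(1)[OF c] dsumD(1)[OF d] by (auto simp: dsum_simps)
    qed
    also have "\<dots> = (\<Oplus>\<^bsub>N\<^esub>i \<in> S. h i (c i)) \<oplus>\<^bsub>N\<^esub> (\<Oplus>\<^bsub>N\<^esub>i \<in> S. h i (d i))"
      using S(2) hc c d by (intro N.finsum_addf) auto
    also have "\<dots> = dsum_lift N I M h c \<oplus>\<^bsub>N\<^esub> dsum_lift N I M h d"
      using dsum_lift_superset[OF MA N hA S(1,2)] S(3,4) c d by simp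
    finally show ?thesis .
  qed
qed

lemma dsum_lift_inj:
  assumes MA: "\<forall>i\<in>I. abelian_group (M i)" and N: "abelian_group N"
    and hA: "\<forall>i\<in>I. h i \<in> add_maps (M i) N" and j: "j \<in> I" "x \<in> carrier (M j)"
  shows "dsum_lift N I M h (dsum_inj I M j x) = h j x"
proof -
  note M = bspec[OF MA] and h = bspec[OF hA]
  interpret N: abelian_group N by fact
  have "dsum_lift N I M h (dsum_inj I M j x) = (\<Oplus>\<^bsub>N\<^esub>i \<in> {j}. h i (dsum_inj I M j x i))"
    by (rule dsum_lift_superset[OF MA N hA]) (use j dsum_inj_closed[OF MA] in \<open>auto split: if_splits\<close>)
  also have "\<dots> = h j x" using j add_maps_closed[OF h] by (subst N.finsum_insert) auto
  finally show ?thesis .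
qed

text \<open>Splitting off one nonzero coordinate shrinks the support by one, so the induction runs
  on its cardinality.\<close>

lemma dsum_induct [consumes 2, case_names zero add]:
  assumes MA: "\<forall>i\<in>I. abelian_group (M i)" and "c \<in> carrier (dsum_module I M)"
    and "P \<zero>\<^bsub>dsum_module I M\<^esub>"
    and step: "\<And>c i x. \<lbrakk>c \<in> carrier (dsum_module I M); i \<in> I; x \<in> carrier (M i); P c\<rbrakk> \<Longrightarrow>
      P (dsum_inj I M i x \<oplus>\<^bsub>dsum_module I M\<^esub> c)"
  shows "P c"
  using assms(2)
proof (induction "card (dsupp I M c)" arbitrary: c)
  case 0
  hence "c = \<zero>\<^bsub>dsum_module I M\<^esub>"
    using dsumD[OF 0(2)] by (auto simp: dsum_simps fun_eq_iff extensional_def)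
  thus ?case using assms(3) by simp
next
  case (Suc n)
  note M = bspec[OF MA] and c = dsumD[OF Suc(3)]
  note am = abelian_group.axioms(1)[OF M]
  have "dsupp I M c \<noteq> {}" using Suc(2) by (metis card.empty nat.distinct(1))
  then obtain j where j: "j \<in> I" "c j \<noteq> \<zero>\<^bsub>M j\<^esub>" by blast
  define d where "d = c(j := \<zero>\<^bsub>M j\<^esub>)"
  have supp: "dsupp I M d = dsupp I M c - {j}" by (auto simp: d_def)
  have d: "d \<in> carrier (dsum_module I M)"
    using Suc(3) j supp abelian_monoid.zero_closed[OF am] by (auto simp: dsum_simps PiE_def extensional_def d_def)
  have "card (dsupp I M d) = n" using Suc(2) c(2) j supp by simp
  hence "P d" using Suc(1) d by simp
  moreover have "c = dsum_inj I M j (c j) \<oplus>\<^bsub>dsum_module I M\<^esub> d"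
    using c abelian_monoid.l_zero[OF am] abelian_monoid.r_zero[OF am] j
    by (auto simp: dsum_simps fun_eq_iff d_def extensional_def)
  ultimately show ?case using step[OF d j(1) c(1)[OF j(1)]] by simp
qed

lemma dsum_ext:
  assumes MA: "\<forall>i\<in>I. abelian_group (M i)" and N: "abelian_group N"
    and g: "g \<in> add_maps (dsum_module I M) N" and h: "h \<in> add_maps (dsum_module I M) N"
    and eq: "\<And>i x. i \<in> I \<Longrightarrow> x \<in> carrier (M i) \<Longrightarrow> g (dsum_inj I M i x) = h (dsum_inj I M i x)"
    and c: "c \<in> carrier (dsum_module I M)"
  shows "g c = h c"
  using MA c
proof (induction rule: dsum_induct)
  case zero
  show ?case using add_maps_zero[OF dsum_abelian_group[OF MA] N g]
      add_maps_zero[OF dsum_abelian_group[OF MA] N h] by simp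
next
  case (add c i x)
  thus ?case using add_maps_add[OF g] add_maps_add[OF h] dsum_inj_closed[OF MA] eq by simp
qed

lemma dsum_lift_lin_maps:
  assumes R: "ring R" and MA: "\<forall>i\<in>I. left_module R (M i)" and N: "left_module R N"
    and hA: "\<forall>i\<in>I. h i \<in> lin_maps R (M i) N"
  shows "dsum_lift N I M h \<in> lin_maps R (dsum_module I M) N"
proof -
  note M = bspec[OF MA] and h = bspec[OF hA]
  note M' = family_abelian_group[OF MA] and N' = lm_ag[OF N] and h' = family_add_maps[OF hA]
  note D = dsum_left_module[OF R MA]
  note L = dsum_lift_add_maps[OF M' N' h']
  have "dsum_lift N I M h (a \<odot>\<^bsub>dsum_module I M\<^esub> c) = a \<odot>\<^bsub>N\<^esub> dsum_lift N I M h c"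
    if a: "a \<in> carrier R" and c: "c \<in> carrier (dsum_module I M)" for a c
  proof (rule dsum_ext[OF M' N' _ _ _ c])
    show "(\<lambda>c. dsum_lift N I M h (a \<odot>\<^bsub>dsum_module I M\<^esub> c)) \<in> add_maps (dsum_module I M) N"
      by (rule add_maps_comp[OF L left_module_smult_add_maps[OF D a]])
    show "(\<lambda>c. a \<odot>\<^bsub>N\<^esub> dsum_lift N I M h c) \<in> add_maps (dsum_module I M) N"
      by (rule add_maps_comp[OF left_module_smult_add_maps[OF N a] L])
    show "dsum_lift N I M h (a \<odot>\<^bsub>dsum_module I M\<^esub> dsum_inj I M i x) = a \<odot>\<^bsub>N\<^esub> dsum_lift N I M h (dsum_inj I M i x)"
      if "i \<in> I" "x \<in> carrier (M i)" for i x
      using lin_maps_smult[OF dsum_inj_lin_maps[OF MA that(1)] a that(2), symmetric] that lin_maps_smult[OF h[OF that(1)] a that(2)]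
        dsum_lift_inj[OF M' N' h'] left_module.lsmult_closed[OF M[OF that(1)] a that(2)]
      by simp
  qed
  thus ?thesis using L by (simp add: lin_maps_iff)
qed

lemma dsum_proj_lin_maps:
  assumes "j \<in> I"
  shows "(\<lambda>c. c j) \<in> lin_maps R (dsum_module I M) (M j)"
  using assms by (auto simp: lin_maps_def dsum_simps)

section \<open>Quotients and transport of structure\<close>

lemma ag_minus_eq_zero:
  assumes "abelian_group G" "x \<in> carrier G" "y \<in> carrier G"
  shows "x \<ominus>\<^bsub>G\<^esub> y = \<zero>\<^bsub>G\<^esub> \<longleftrightarrow> x = y"
proof -
  interpret G: abelian_group G by fact
  show ?thesis using assms(2,3) by (metis G.a_inv_closed G.minus_minus G.minus_equality G.r_neg a_minus_def)
qed

text \<open>The homomorphism theorem, with the image kept as a subset of the target. It serves to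
  define maps on images before they are extended: into a radical injective functor in
  \<open>radical_injective_extend_along\<close>, and into Q/Z when sequences are dualised.\<close>

lemma add_maps_factor:
  assumes M: "abelian_group M" and N: "abelian_group N" and L: "abelian_group L" and d: "d \<in> add_maps M N" and h: "h \<in> add_maps M L"
    and ker: "\<And>x. x \<in> carrier M \<Longrightarrow> d x = \<zero>\<^bsub>N\<^esub> \<Longrightarrow> h x = \<zero>\<^bsub>L\<^esub>"
  shows "\<exists>\<psi> \<in> add_maps (N\<lparr>carrier := d ` carrier M\<rparr>) L. \<forall>x \<in> carrier M. \<psi> (d x) = h x"
proof -
  define \<psi> where "\<psi> y = h (inv_into (carrier M) d y)" for y
  have \<psi>: "\<psi> (d x) = h x" if x: "x \<in> carrier M" for x
  proof -
    define y where "y = inv_into (carrier M) d (d x)"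
    have y: "y \<in> carrier M" "d y = d x" unfolding y_def by (rule inv_into_into f_inv_into_f; use x in blast)+
    have "d (x \<ominus>\<^bsub>M\<^esub> y) = \<zero>\<^bsub>N\<^esub>"
      using add_maps_minus[OF M N d x y(1)] ag_minus_eq_zero[OF N add_maps_closed[OF d x] add_maps_closed[OF d y(1)]] y(2) by simp
    hence "h x \<ominus>\<^bsub>L\<^esub> h y = \<zero>\<^bsub>L\<^esub>"
      using ker[OF abelian_group.minus_closed[OF M x y(1)]] add_maps_minus[OF M L h x y(1)] by simp
    thus ?thesis using ag_minus_eq_zero[OF L add_maps_closed[OF h x] add_maps_closed[OF h y(1)]] by (simp add: \<psi>_def y_def)
  qed
  have "\<psi> \<in> add_maps (N\<lparr>carrier := d ` carrier M\<rparr>) L"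
  proof (rule add_mapsI)
    show "\<psi> y \<in> carrier L" if "y \<in> carrier (N\<lparr>carrier := d ` carrier M\<rparr>)" for y using that \<psi> add_maps_closed[OF h] by auto
    fix x y assume "x \<in> carrier (N\<lparr>carrier := d ` carrier M\<rparr>)" "y \<in> carrier (N\<lparr>carrier := d ` carrier M\<rparr>)"
    then obtain u v where uv: "u \<in> carrier M" "x = d u" "v \<in> carrier M" "y = d v" by auto
    show "\<psi> (x \<oplus>\<^bsub>N\<lparr>carrier := d ` carrier M\<rparr>\<^esub> y) = \<psi> x \<oplus>\<^bsub>L\<^esub> \<psi> y"
      using add_maps_add[OF d uv(1,3)] add_maps_add[OF h uv(1,3)] \<psi>[OF uv(1)] \<psi>[OF uv(3)] \<psi>[OF ag_add_closed[OF M uv(1,3)]] uv(2,4) by simp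
  qed
  thus ?thesis using \<psi> by blast
qed

section \<open>Quotient modules\<close>

lemma submodule_abelian_subgroup:
  assumes "left_module R M" "submodule U R M" shows "abelian_subgroup U M"
proof -
  interpret M: left_module R M by fact
  have "subgroup U (add_monoid M)" using assms(2) by (simp add: submodule_def)
  thus ?thesis
    by (intro abelian_subgroupI3 M.abelian_group_axioms) (simp add: additive_subgroup_def)
qed

lemma quot_module_eq:
  assumes M: "left_module R M" and U: "submodule U R M" and x: "x \<in> carrier M" and y: "y \<in> carrier M"
  shows "U +>\<^bsub>M\<^esub> x = U +>\<^bsub>M\<^esub> y \<longleftrightarrow> x \<ominus>\<^bsub>M\<^esub> y \<in> U"
proof -
  interpret M: left_module R M by fact
  interpret U: abelian_subgroup U M by (rule submodule_abelian_subgroup[OF M U])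
  have "x \<in> U +>\<^bsub>M\<^esub> y \<longleftrightarrow> x \<ominus>\<^bsub>M\<^esub> y \<in> U"
    using U.a_rcos_module[OF y x] by (simp add: a_minus_def)
  moreover have "x \<in> U +>\<^bsub>M\<^esub> y \<longleftrightarrow> U +>\<^bsub>M\<^esub> x = U +>\<^bsub>M\<^esub> y"
    using U.a_repr_independence'[of x y] U.a_rcos_self[OF x] x y by metis
  ultimately show ?thesis by simp
qed

lemma quot_module_simps:
  "carrier (quot_module M U) = (\<lambda>x. U +>\<^bsub>M\<^esub> x) ` carrier M"
  "\<zero>\<^bsub>quot_module M U\<^esub> = U"
  by (auto simp: quot_module_def A_RCOSETS_def')

lemma quot_module_smult:
  assumes M: "left_module R M" and U: "submodule U R M" and a: "a \<in> carrier R" and x: "x \<in> carrier M"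
  shows "a \<odot>\<^bsub>quot_module M U\<^esub> (U +>\<^bsub>M\<^esub> x) = U +>\<^bsub>M\<^esub> (a \<odot>\<^bsub>M\<^esub> x)"
proof -
  interpret M: left_module R M by fact
  interpret U: abelian_subgroup U M by (rule submodule_abelian_subgroup[OF M U])
  note sm = left_module_smult_add_maps[OF M a]
  have "U +>\<^bsub>M\<^esub> (a \<odot>\<^bsub>M\<^esub> y) = U +>\<^bsub>M\<^esub> (a \<odot>\<^bsub>M\<^esub> x)" if y: "y \<in> U +>\<^bsub>M\<^esub> x" for y
  proof -
    have yM: "y \<in> carrier M" using U.a_elemrcos_carrier[OF x y] .
    have "y \<ominus>\<^bsub>M\<^esub> x \<in> U" using U.a_rcos_module[OF x yM] y by (simp add: a_minus_def)
    hence "a \<odot>\<^bsub>M\<^esub> (y \<ominus>\<^bsub>M\<^esub> x) \<in> U" using submoduleD(4)[OF M U a] by simp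
    thus ?thesis
      using add_maps_minus[OF M.abelian_group_axioms M.abelian_group_axioms sm yM x]
        quot_module_eq[OF M U] M.lsmult_closed[OF a] x yM by simp
  qed
  moreover have "x \<in> U +>\<^bsub>M\<^esub> x" using U.a_rcos_self[OF x] .
  ultimately have "(\<Union>y\<in>U +>\<^bsub>M\<^esub> x. U +>\<^bsub>M\<^esub> (a \<odot>\<^bsub>M\<^esub> y)) = U +>\<^bsub>M\<^esub> (a \<odot>\<^bsub>M\<^esub> x)"
    by (intro UN_constant_eq ballI)
  thus ?thesis by (simp add: quot_module_def)
qed

lemma quot_module_add:
  assumes M: "left_module R M" and U: "submodule U R M" and x: "x \<in> carrier M" and y: "y \<in> carrier M"
  shows "(U +>\<^bsub>M\<^esub> x) \<oplus>\<^bsub>quot_module M U\<^esub> (U +>\<^bsub>M\<^esub> y) = U +>\<^bsub>M\<^esub> (x \<oplus>\<^bsub>M\<^esub> y)"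
  using abelian_subgroup.a_rcos_sum[OF submodule_abelian_subgroup[OF M U] x y]
  by (simp add: quot_module_def)

lemma quot_left_module:
  assumes M: "left_module R M" and U: "submodule U R M" shows "left_module R (quot_module M U)"
proof -
  interpret M: left_module R M by fact
  interpret U: abelian_subgroup U M by (rule submodule_abelian_subgroup[OF M U])
  note s = quot_module_smult[OF M U] quot_module_add[OF M U]
  have z: "U = U +>\<^bsub>M\<^esub> \<zero>\<^bsub>M\<^esub>" using U.a_subset M.a_coset_add_zero by simp
  have ag: "abelian_group (quot_module M U)"
  proof (rule abelian_groupI)
    show "\<zero>\<^bsub>quot_module M U\<^esub> \<in> carrier (quot_module M U)"
      using z by (auto simp: quot_module_simps)
    show "\<zero>\<^bsub>quot_module M U\<^esub> \<oplus>\<^bsub>quot_module M U\<^esub> x = x" if "x \<in> carrier (quot_module M U)" for x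
      using that s(2)[OF M.zero_closed] z by (auto simp: quot_module_simps)
    show "\<exists>y\<in>carrier (quot_module M U). y \<oplus>\<^bsub>quot_module M U\<^esub> x = \<zero>\<^bsub>quot_module M U\<^esub>"
      if "x \<in> carrier (quot_module M U)" for x
    proof -
      obtain y where y: "y \<in> carrier M" "x = U +>\<^bsub>M\<^esub> y" using \<open>x \<in> _\<close> by (auto simp: quot_module_simps)
      hence "(U +>\<^bsub>M\<^esub> (\<ominus>\<^bsub>M\<^esub> y)) \<oplus>\<^bsub>quot_module M U\<^esub> x = \<zero>\<^bsub>quot_module M U\<^esub>"
        using s(2)[of "\<ominus>\<^bsub>M\<^esub> y" y] z by (simp add: M.l_neg quot_module_simps)
      thus ?thesis using y by (auto simp: quot_module_simps)
    qed
  qed (auto simp: quot_module_simps(1) s M.a_ac)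
  show ?thesis
    by (rule left_moduleI[OF M.R.ring_axioms ag])
      (auto simp: quot_module_simps(1) s M.lsmult_closed M.lsmult_l_distr M.lsmult_r_distr
        M.lsmult_assoc M.lsmult_one)
qed

lemma quot_proj_lin_maps:
  assumes M: "left_module R M" and U: "submodule U R M"
  shows "(\<lambda>x. U +>\<^bsub>M\<^esub> x) \<in> lin_maps R M (quot_module M U)"
  using quot_module_smult[OF M U] quot_module_add[OF M U]
  by (auto simp: lin_maps_def quot_module_simps(1))

lemma quot_module_lift:
  assumes M: "left_module R M" and U: "submodule U R M" and G: "abelian_group G"
    and h: "h \<in> add_maps M G" "\<And>u. u \<in> U \<Longrightarrow> h u = \<zero>\<^bsub>G\<^esub>"
  shows "\<exists>h' \<in> add_maps (quot_module M U) G. \<forall>x \<in> carrier M. h' (U +>\<^bsub>M\<^esub> x) = h x"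
proof -
  interpret U: abelian_subgroup U M by (rule submodule_abelian_subgroup[OF M U])
  have "h x = \<zero>\<^bsub>G\<^esub>" if "x \<in> carrier M" "U +>\<^bsub>M\<^esub> x = \<zero>\<^bsub>quot_module M U\<^esub>" for x
    using that U.a_rcos_self[OF that(1)] h(2) by (simp add: quot_module_simps(2))
  from add_maps_factor[OF lm_ag[OF M] lm_ag[OF quot_left_module[OF M U]] G lin_maps_add_maps[OF quot_proj_lin_maps[OF M U]] h(1) this]
  show ?thesis by (simp add: add_maps_def quot_module_simps(1))
qed

section \<open>Copies of modules on other types\<close>

definition transport :: "('x \<Rightarrow> 'y) \<Rightarrow> ('a, 'x) module \<Rightarrow> ('a, 'y) module" where
  "transport \<iota> M = \<lparr>carrier = \<iota> ` carrier M, mult = undefined, one = undefined, zero = \<iota> \<zero>\<^bsub>M\<^esub>,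
     add = (\<lambda>x y. \<iota> (inv_into (carrier M) \<iota> x \<oplus>\<^bsub>M\<^esub> inv_into (carrier M) \<iota> y)),
     smult = (\<lambda>a x. \<iota> (a \<odot>\<^bsub>M\<^esub> inv_into (carrier M) \<iota> x))\<rparr>"

lemma transport_simps:
  "carrier (transport \<iota> M) = \<iota> ` carrier M" "\<zero>\<^bsub>transport \<iota> M\<^esub> = \<iota> \<zero>\<^bsub>M\<^esub>"
  by (auto simp: transport_def)

lemma transport_left_module:
  assumes M: "left_module R M" and \<iota>: "inj_on \<iota> (carrier M)" shows "left_module R (transport \<iota> M)"
proof -
  interpret M: left_module R M by fact
  have ag: "abelian_group (transport \<iota> M)"
  proof (rule abelian_groupI)
    show "\<exists>y\<in>carrier (transport \<iota> M). y \<oplus>\<^bsub>transport \<iota> M\<^esub> x = \<zero>\<^bsub>transport \<iota> M\<^esub>"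
      if "x \<in> carrier (transport \<iota> M)" for x
    proof -
      obtain y where "y \<in> carrier M" "x = \<iota> y" using \<open>x \<in> _\<close> by (auto simp: transport_def)
      thus ?thesis using \<iota>
        by (auto simp: transport_def M.l_neg intro!: bexI[of _ "\<ominus>\<^bsub>M\<^esub> y"])
    qed
  qed (use \<iota> in \<open>auto simp: transport_def M.a_ac\<close>)
  show ?thesis
    by (rule left_moduleI[OF M.R.ring_axioms ag])
      (use \<iota> in \<open>auto simp: transport_def M.lsmult_closed M.lsmult_l_distr M.lsmult_r_distr
        M.lsmult_assoc M.lsmult_one\<close>)
qed

lemma transport_lin_maps:
  assumes M: "left_module R M" and \<iota>: "inj_on \<iota> (carrier M)"
  shows "\<iota> \<in> lin_maps R M (transport \<iota> M)" "inv_into (carrier M) \<iota> \<in> lin_maps R (transport \<iota> M) M"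
proof -
  interpret M: left_module R M by fact
  show "\<iota> \<in> lin_maps R M (transport \<iota> M)" "inv_into (carrier M) \<iota> \<in> lin_maps R (transport \<iota> M) M"
    using \<iota> by (auto simp: lin_maps_def transport_def M.lsmult_closed)
qed

text \<open>The test objects for projectivity have lists as elements, so free objects must be coded
  by lists. The nonzero values are listed in an arbitrary order; \<open>w\<close> tags each with its
  index, so the set of entries determines the finitely supported function.\<close>

definition support_list :: "('i \<Rightarrow> 'x \<Rightarrow> 'w) \<Rightarrow> 'i set \<Rightarrow> ('i \<Rightarrow> 'x) \<Rightarrow> ('i \<Rightarrow> 'x) \<Rightarrow> 'w list" where
  "support_list w I z c = (SOME l. set l = (\<lambda>i. w i (c i)) ` {i \<in> I. c i \<noteq> z i})"

lemma support_list_inj: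
  assumes w: "\<And>i j x y. w i x = w j y \<Longrightarrow> i = j \<and> x = y"
  shows "inj_on (support_list w I (\<lambda>i. \<zero>\<^bsub>M i\<^esub>)) (carrier (dsum_module I M))"
proof (rule inj_onI)
  fix c d assume c: "c \<in> carrier (dsum_module I M)" and d: "d \<in> carrier (dsum_module I M)"
    and eq: "support_list w I (\<lambda>i. \<zero>\<^bsub>M i\<^esub>) c = support_list w I (\<lambda>i. \<zero>\<^bsub>M i\<^esub>) d"
  have s: "set (support_list w I (\<lambda>i. \<zero>\<^bsub>M i\<^esub>) c) = (\<lambda>i. w i (c i)) ` (dsupp I M c)"
    if "c \<in> carrier (dsum_module I M)" for c
    unfolding support_list_def
    by (rule someI_ex, rule finite_list, rule finite_imageI, rule dsumD(2)[OF that])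
  have "c i = d i" if c: "c \<in> carrier (dsum_module I M)" and d: "d \<in> carrier (dsum_module I M)"
    and eq: "(\<lambda>i. w i (c i)) ` (dsupp I M c) = (\<lambda>i. w i (d i)) ` (dsupp I M d)"
    and ne: "i \<in> I" "c i \<noteq> \<zero>\<^bsub>M i\<^esub>" for c d i
  proof -
    have "w i (c i) \<in> (\<lambda>i. w i (d i)) ` (dsupp I M d)" using ne eq by blast
    then obtain j where "w i (c i) = w j (d j)" by blast
    thus ?thesis using w by metis
  qed
  note * = this
  have e: "(\<lambda>i. w i (c i)) ` (dsupp I M c) = (\<lambda>i. w i (d i)) ` (dsupp I M d)"
    using s[OF c] s[OF d] eq by simp
  have "c i = d i" if "i \<in> I" for i
    using *[OF c d e that] *[OF d c e[symmetric] that] by metis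
  thus "c = d" using extensionalityI[OF dsumD(3)[OF c] dsumD(3)[OF d]] by blast
qed


section \<open>Relatively projective quotients over a hereditary ring\<close>

text \<open>The free module on all elements of \<open>M\<close>; \<open>lincomb\<close> is its
  canonical surjection onto \<open>M\<close>. A linear section of \<open>lincomb\<close> is a dual
  basis for which no generators have to be chosen.\<close>

definition coords :: "'k ring \<Rightarrow> ('k, 'x) module \<Rightarrow> ('k, 'x \<Rightarrow> 'k) module" where
  "coords k M = free_module k (carrier M)"

definition lincomb :: "'k ring \<Rightarrow> ('k, 'x) module \<Rightarrow> ('x \<Rightarrow> 'k) \<Rightarrow> 'x" where
  "lincomb k M = dsum_lift M (carrier M) (\<lambda>_. self_module k) (\<lambda>x a. a \<odot>\<^bsub>M\<^esub> x)"

text \<open>A dual basis of \<open>V / U\<close>, written on \<open>V\<close>: for a submodule \<open>U\<close> it says that \<open>V / U\<close> is projective.\<close>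

definition rel_proj :: "'k ring \<Rightarrow> ('k, 'x) module \<Rightarrow> 'x set \<Rightarrow> bool" where
  "rel_proj k V U \<longleftrightarrow> (\<exists>\<xi> \<in> lin_maps k V (coords k V).
     (\<forall>u \<in> U. \<xi> u = \<zero>\<^bsub>coords k V\<^esub>) \<and> (\<forall>v \<in> carrier V. v \<ominus>\<^bsub>V\<^esub> lincomb k V (\<xi> v) \<in> U))"

lemma family_self: "ring k \<Longrightarrow> \<forall>i\<in>I. left_module k (self_module k)"
  by (simp add: left_module_self)

lemma free_left_module: "ring k \<Longrightarrow> left_module k (free_module k I)"
  by (rule dsum_left_module) (auto simp: left_module_self)

lemma coords_left_module: "ring k \<Longrightarrow> left_module k (coords k M)"
  by (simp add: coords_def free_left_module)

lemma free_lift_lin_maps: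
  assumes k: "ring k" and M: "left_module k M" and y: "\<And>i. i \<in> I \<Longrightarrow> y i \<in> carrier M"
  shows "dsum_lift M I (\<lambda>_. self_module k) (\<lambda>i a. a \<odot>\<^bsub>M\<^esub> y i)
    \<in> lin_maps k (free_module k I) M"
  by (rule dsum_lift_lin_maps[OF k family_self[OF k] M]) (auto intro: left_module_smult_point[OF M y])

lemma free_lift_inj:
  assumes k: "ring k" and M: "left_module k M" and y: "\<And>i. i \<in> I \<Longrightarrow> y i \<in> carrier M"
    and j: "j \<in> I" "a \<in> carrier k"
  shows "dsum_lift M I (\<lambda>_. self_module k) (\<lambda>i a. a \<odot>\<^bsub>M\<^esub> y i)
    (dsum_inj I (\<lambda>_. self_module k) j a) = a \<odot>\<^bsub>M\<^esub> y j"
proof -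
  have "dsum_lift M I (\<lambda>_. self_module k) (\<lambda>i a. a \<odot>\<^bsub>M\<^esub> y i)
    (dsum_inj I (\<lambda>_. self_module k) j a) = (\<lambda>i a. a \<odot>\<^bsub>M\<^esub> y i) j a"
    by (rule dsum_lift_inj[OF family_abelian_group[OF family_self[OF k]] lm_ag[OF M]])
      (use j lin_maps_add_maps[OF left_module_smult_point[OF M y]] in auto)
  thus ?thesis by simp
qed

lemma lincomb_lin_maps: "ring k \<Longrightarrow> left_module k M \<Longrightarrow> lincomb k M \<in> lin_maps k (coords k M) M"
  unfolding lincomb_def coords_def by (rule free_lift_lin_maps)

lemma lincomb_inj:
  "ring k \<Longrightarrow> left_module k M \<Longrightarrow> x \<in> carrier M \<Longrightarrow> a \<in> carrier k \<Longrightarrow>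
    lincomb k M (dsum_inj (carrier M) (\<lambda>_. self_module k) x a) = a \<odot>\<^bsub>M\<^esub> x"
  unfolding lincomb_def by (rule free_lift_inj)

lemma rel_proj_zero_coords:
  assumes k: "ring k" and M: "left_module k M" and rp: "rel_proj k M {\<zero>\<^bsub>M\<^esub>}"
  obtains \<xi> where "\<xi> \<in> lin_maps k M (coords k M)" "\<And>v. v \<in> carrier M \<Longrightarrow> lincomb k M (\<xi> v) = v"
proof -
  obtain \<xi> where \<xi>: "\<xi> \<in> lin_maps k M (coords k M)" "\<And>v. v \<in> carrier M \<Longrightarrow> v \<ominus>\<^bsub>M\<^esub> lincomb k M (\<xi> v) = \<zero>\<^bsub>M\<^esub>"
    using rp by (auto simp: rel_proj_def)
  have "lincomb k M (\<xi> v) = v" if "v \<in> carrier M" for v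
    using \<xi>(2)[OF that] ag_minus_eq_zero[OF lm_ag[OF M] that]
      lin_maps_closed[OF lin_maps_comp[OF lincomb_lin_maps[OF k M] \<xi>(1)] that] by simp
  thus ?thesis using that \<xi>(1) by blast
qed

lemma free_ext:
  assumes k: "ring k" and N: "abelian_group N"
    and g: "g \<in> add_maps (free_module k I) N" and h: "h \<in> add_maps (free_module k I) N"
    and eq: "\<And>i a. i \<in> I \<Longrightarrow> a \<in> carrier k \<Longrightarrow>
      g (dsum_inj I (\<lambda>_. self_module k) i a) = h (dsum_inj I (\<lambda>_. self_module k) i a)"
    and c: "c \<in> carrier (free_module k I)"
  shows "g c = h c"
  by (rule dsum_ext[OF family_abelian_group[OF family_self[OF k]] N g h eq c]) auto

text \<open>Both \<open>M\<close> and the free module on it are copied to the list type on which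
  \<open>projective_module\<close> tests (\<open>M\<close> as one-letter words with a dummy scalar).
  Lifting the copy of the identity along the canonical surjection yields the dual basis.\<close>

lemma projective_module_rel_proj:
  fixes k :: "'k ring" and M :: "('k, 'x) module"
  assumes "projective_module k M"
  shows "rel_proj k M {\<zero>\<^bsub>M\<^esub>}"
proof -
  have M: "module k M" using assms by (simp add: projective_module_def)
  interpret M: module k M by fact
  have k: "ring k" and M': "left_module k M"
    using M by (auto intro: left_module_of_module M.R.ring_axioms)
  let ?F = "coords k M"
  let ?s = "support_list Pair (carrier M) (\<lambda>_. \<zero>\<^bsub>k\<^esub>) :: ('x \<Rightarrow> 'k) \<Rightarrow> ('x \<times> 'k) list"
  let ?t = "\<lambda>x::'x. [(x, undefined::'k)]"
  have F: "left_module k ?F" by (rule coords_left_module[OF k])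
  have s: "inj_on ?s (carrier ?F)"
    using support_list_inj[of Pair "carrier M" "\<lambda>_. self_module k"] by (simp add: coords_def)
  have t: "inj_on ?t (carrier M)" by (auto intro: inj_onI)
  let ?E = "transport ?s ?F" and ?B = "transport ?t M"
  note sE = transport_lin_maps[OF F s] and tB = transport_lin_maps[OF M' t]
  define g where "g y = ?t (lincomb k M (inv_into (carrier ?F) ?s y))" for y
  have g: "g \<in> lin_maps k ?E ?B"
    unfolding g_def by (intro lin_maps_comp[OF tB(1)] lin_maps_comp[OF lincomb_lin_maps[OF k M']] sE(2))
  have "g ` carrier ?E = carrier ?B"
  proof
    show "g ` carrier ?E \<subseteq> carrier ?B" using lin_maps_closed[OF g] by blast
    show "carrier ?B \<subseteq> g ` carrier ?E"
    proof
      fix y assume "y \<in> carrier ?B"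
      then obtain x where x: "x \<in> carrier M" "y = ?t x" by (auto simp: transport_simps)
      let ?c = "dsum_inj (carrier M) (\<lambda>_. self_module k) x \<one>\<^bsub>k\<^esub>"
      have c: "?c \<in> carrier ?F" unfolding coords_def
        by (rule dsum_inj_closed[OF family_abelian_group[OF family_self[OF k]]]) simp
      have "g (?s ?c) = y"
        using c x s lincomb_inj[OF k M' x(1) M.R.one_closed] M.smult_one by (simp add: g_def)
      thus "y \<in> g ` carrier ?E" using c by (auto simp: transport_simps intro!: image_eqI[of y g "?s ?c"])
    qed
  qed
  moreover have "module k ?E" "module k ?B"
    using transport_left_module[OF F s] transport_left_module[OF M' t] M.R.is_cring
    by (auto intro: module_of_left_module)
  ultimately have "\<exists>l \<in> lin_maps k M ?E. \<forall>x \<in> carrier M. g (l x) = ?t x"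
    using bspec[OF bspec[OF spec[OF spec[OF conjunct2[OF assms[unfolded projective_module_def]]]] g] tB(1)]
    by blast
  then obtain l where l: "l \<in> lin_maps k M ?E" "\<And>x. x \<in> carrier M \<Longrightarrow> g (l x) = ?t x" by blast
  define \<xi> where "\<xi> x = inv_into (carrier ?F) ?s (l x)" for x
  have \<xi>: "\<xi> \<in> lin_maps k M ?F" unfolding \<xi>_def by (rule lin_maps_comp[OF sE(2) l(1)])
  have "lincomb k M (\<xi> x) = x" if "x \<in> carrier M" for x
    using l(2)[OF that] by (simp add: g_def \<xi>_def)
  moreover have "\<xi> \<zero>\<^bsub>M\<^esub> = \<zero>\<^bsub>?F\<^esub>"
    by (rule lin_maps_zero[OF M.abelian_group_axioms lm_ag[OF F] \<xi>])
  ultimately show ?thesis using \<xi> by (auto simp: rel_proj_def M.r_neg M.minus_eq intro!: bexI[of _ \<xi>])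
qed

section \<open>Submodules of free modules over a hereditary ring\<close>

lemma chain_common:
  assumes "\<forall>a\<in>C. \<forall>b\<in>C. P a b \<or> P b a" "a \<in> C" "b \<in> C" "\<And>x. x \<in> C \<Longrightarrow> P x x"
  obtains c where "c \<in> C" "P a c" "P b c"
  using assms by blast

text \<open>Every submodule of a free module over a hereditary ring is projective. The proof extends \<open>\<xi>\<close> by Zorn's
  lemma, one coordinate at a time; the obstruction in coordinate \<open>j\<close> is an ideal, which is projective.\<close>

lemma hereditary_coords:
  fixes k :: "'k ring" and V :: "('k, 'v) module" and \<theta> :: "'v \<Rightarrow> 'i \<Rightarrow> 'k"
  assumes her: "hereditary_ring k" and V: "module k V"
    and \<theta>: "\<theta> \<in> lin_maps k V (free_module k I)"
  shows "\<exists>\<xi> \<in> lin_maps k V (coords k V). \<forall>v \<in> carrier V.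
    (\<theta> v = (\<lambda>i\<in>I. \<zero>\<^bsub>k\<^esub>) \<longrightarrow> \<xi> v = \<zero>\<^bsub>coords k V\<^esub>) \<and> \<theta> (lincomb k V (\<xi> v)) = \<theta> v"
proof -
  interpret V: module k V by fact
  have k: "ring k" and V': "left_module k V"
    using V by (auto intro: left_module_of_module V.R.ring_axioms)
  let ?S = "\<lambda>_. self_module k"
  let ?D = "dsum_module I ?S"
  let ?C = "coords k V"
  have D: "left_module k ?D" by (rule free_left_module[OF k])
  have C: "left_module k ?C" by (rule coords_left_module[OF k])
  interpret C: left_module k ?C by (rule C)
  note \<theta>' = lin_maps_add_maps[OF \<theta>]
  have \<theta>c: "\<theta> v \<in> carrier ?D" if "v \<in> carrier V" for v using add_maps_closed[OF \<theta>' that] .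
  have comp: "(\<lambda>v. \<theta> v i) \<in> forms k V" if "i \<in> I" for i
    using lin_maps_comp[OF dsum_proj_lin_maps[OF that] \<theta>] .
  \<comment> \<open>Elements of \<open>V\<close> whose image under \<open>\<theta>\<close> is
    supported in \<open>J\<close>. \<open>W {}\<close> is the kernel of \<open>\<theta>\<close> and
    \<open>W I\<close> is all of \<open>V\<close>, so the partial solutions in \<open>good\<close>
    grow from the kernel to \<open>V\<close>.\<close>
  define W where "W J = {v \<in> carrier V. \<forall>i\<in>I - J. \<theta> v i = \<zero>\<^bsub>k\<^esub>}" for J
  have Wsub: "submodule (W J) k V" for J
  proof (rule left_submoduleI[OF V'])
    show "\<zero>\<^bsub>V\<^esub> \<in> W J"
      using add_maps_zero[OF V.abelian_group_axioms lm_ag[OF D] \<theta>'] by (auto simp: W_def dsum_simps)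
  qed (auto simp: W_def add_maps_add[OF \<theta>'] lin_maps_smult[OF \<theta>] dsum_simps)
  have Wc: "W J \<subseteq> carrier V" for J by (auto simp: W_def)
  define VJ where "VJ J = V\<lparr>carrier := W J\<rparr>" for J
  have VJ: "left_module k (VJ J)" for J unfolding VJ_def by (rule left_module_submodule[OF V' Wsub])
  have VJs [simp]: "carrier (VJ J) = W J" "add (VJ J) = add V" "zero (VJ J) = zero V" "smult (VJ J) = smult V" for J
    by (auto simp: VJ_def)
  have ker: "v \<in> W J" if "v \<in> carrier V" "\<theta> v = (\<lambda>i\<in>I. \<zero>\<^bsub>k\<^esub>)" for v J using that by (auto simp: W_def)
  have lc: "lincomb k V \<in> lin_maps k ?C V" by (rule lincomb_lin_maps[OF k V'])
  \<comment> \<open>\<open>lincomb\<close> after \<open>\<xi>\<close> is the identity only modulo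
    the kernel of \<open>\<theta>\<close>: what is constructed is a dual basis of the image of
    \<open>\<theta>\<close>, written with elements of \<open>V\<close>. Extensionality makes
    \<open>le\<close> antisymmetric.\<close>
  define good where "good = (\<lambda>(J, \<xi>). J \<subseteq> I \<and> \<xi> \<in> lin_maps k (VJ J) ?C \<and> \<xi> \<in> extensional (W J) \<and>
    (\<forall>v \<in> W J. (\<theta> v = (\<lambda>i\<in>I. \<zero>\<^bsub>k\<^esub>) \<longrightarrow> \<xi> v = \<zero>\<^bsub>?C\<^esub>) \<and> \<theta> (lincomb k V (\<xi> v)) = \<theta> v))"
  define le where "le = (\<lambda>(J, \<xi>) (J', \<xi>'). J \<subseteq> J' \<and> (\<forall>v \<in> W J. \<xi>' v = (\<xi> v :: 'v \<Rightarrow> 'k)))"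
  have Wmono: "W J \<subseteq> W J'" if "J \<subseteq> J'" for J J' using that by (auto simp: W_def)
  have "\<exists>m \<in> Collect good. \<forall>a \<in> Collect good. le m a \<longrightarrow> a = m"
  proof (rule predicate_Zorn)
    show "partial_order_on (Collect good) (relation_of le (Collect good))"
    proof (rule partial_order_on_relation_ofI)
      show "le a a" for a by (auto simp: le_def)
      show "le a c" if "le a b" "le b c" for a b c
        using that Wmono[of "fst a" "fst b"] by (cases a; cases b; cases c) (auto simp: le_def subset_iff)
      show "a = b" if ab: "a \<in> Collect good" "b \<in> Collect good" "le a b" "le b a" for a b
      proof -
        obtain J x J' y where e: "a = (J, x)" "b = (J', y)" by (cases a, cases b) auto
        have J: "J = J'" using ab e by (auto simp: le_def)
        have "x = y"
          by (rule extensionalityI[of _ "W J"]) (use ab e J in \<open>auto simp: le_def good_def\<close>)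
        thus ?thesis using e J by simp
      qed
    qed
    fix Ch assume Ch: "Ch \<in> Chains (relation_of le (Collect good))"
    hence sub: "\<And>a. a \<in> Ch \<Longrightarrow> good a" and tot: "\<forall>a\<in>Ch. \<forall>b\<in>Ch. le a b \<or> le b a"
      by (auto simp: Chains_def relation_of_def)
    show "\<exists>u \<in> Collect good. \<forall>a \<in> Ch. le a u"
    proof (cases "Ch = {}")
      case True
      have "W {} \<subseteq> {v \<in> carrier V. \<theta> v = (\<lambda>i\<in>I. \<zero>\<^bsub>k\<^esub>)}"
        using dsumD(3)[OF \<theta>c] by (auto simp: W_def fun_eq_iff extensional_def)
      moreover have "lincomb k V \<zero>\<^bsub>?C\<^esub> = \<zero>\<^bsub>V\<^esub>"
        by (rule lin_maps_zero[OF C.abelian_group_axioms V.abelian_group_axioms lc])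
      moreover have "\<theta> \<zero>\<^bsub>V\<^esub> = (\<lambda>i\<in>I. \<zero>\<^bsub>k\<^esub>)"
        using add_maps_zero[OF V.abelian_group_axioms lm_ag[OF D] \<theta>'] by (simp add: dsum_simps)
      ultimately have "good ({}, \<lambda>v\<in>W {}. \<zero>\<^bsub>?C\<^esub>)"
        using submoduleD(3,4)[OF V' Wsub[of "{}"]] left_module_smult_zero[OF C] by (auto simp: good_def lin_maps_def)
      thus ?thesis using True by blast
    next
      case False
      define J where "J = \<Union>(fst ` Ch)"
      \<comment> \<open>\<open>\<theta> v\<close> has finite support, and a finite subset of the
        union of a chain lies in one member of the chain.\<close>
      have cover: "\<exists>a \<in> Ch. v \<in> W (fst a)" if v: "v \<in> W J" for v
      proof -
        have vc: "v \<in> carrier V" using v Wc by auto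
        have fin: "finite (dsupp I (\<lambda>_. k) (\<theta> v))" using dsumD(2)[OF \<theta>c[OF vc]] by simp
        have sb: "dsupp I (\<lambda>_. k) (\<theta> v) \<subseteq> \<Union>(fst ` Ch)" using v by (auto simp: W_def J_def)
        have "fst a \<subseteq> fst b \<or> fst b \<subseteq> fst a" if "a \<in> Ch" "b \<in> Ch" for a b
          using bspec[OF bspec[OF tot that(1)] that(2)] by (auto simp: le_def split: prod.splits)
        hence "subset.chain UNIV (fst ` Ch)" by (auto simp: subset_chain_def)
        then obtain K where "K \<in> fst ` Ch" "dsupp I (\<lambda>_. k) (\<theta> v) \<subseteq> K"
          using finite_subset_Union_chain[OF fin sb] False by blast
        thus ?thesis using vc by (auto simp: W_def)
      qed
      define \<xi> where "\<xi> = (\<lambda>v\<in>W J. snd (SOME a. a \<in> Ch \<and> v \<in> W (fst a)) v)"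
      have agree: "\<xi> v = snd a v" if a: "a \<in> Ch" and v: "v \<in> W (fst a)" for a v
      proof -
        define b where "b = (SOME a. a \<in> Ch \<and> v \<in> W (fst a))"
        have b: "b \<in> Ch" "v \<in> W (fst b)"
          using someI[of "\<lambda>a. a \<in> Ch \<and> v \<in> W (fst a)" a] a v by (auto simp: b_def)
        have "v \<in> W J" using v a Wmono[of "fst a" J] by (auto simp: J_def)
        moreover have "le a b \<or> le b a" using tot a b by blast
        hence "snd b v = snd a v" using v b by (auto simp: le_def split: prod.splits)
        ultimately show ?thesis by (simp add: \<xi>_def b_def)
      qed
      have memb: "fst a \<subseteq> I \<and> snd a \<in> lin_maps k (VJ (fst a)) ?C \<and> (\<forall>v \<in> W (fst a).
          (\<theta> v = (\<lambda>i\<in>I. \<zero>\<^bsub>k\<^esub>) \<longrightarrow> snd a v = \<zero>\<^bsub>?C\<^esub>) \<and> \<theta> (lincomb k V (snd a v)) = \<theta> v)" if "a \<in> Ch" for a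
        using sub[OF that] by (auto simp: good_def split: prod.splits)
      have "\<xi> \<in> lin_maps k (VJ J) ?C"
      proof -
        have 1: "\<xi> v \<in> carrier ?C" and 2: "a \<in> carrier k \<Longrightarrow> \<xi> (a \<odot>\<^bsub>V\<^esub> v) = a \<odot>\<^bsub>?C\<^esub> \<xi> v" if v: "v \<in> W J" for v a
        proof -
          obtain b where b: "b \<in> Ch" "v \<in> W (fst b)" using cover[OF v] by blast
          show "\<xi> v \<in> carrier ?C"
            using agree[OF b] lin_maps_closed[of "snd b" k "VJ (fst b)" ?C v] memb[OF b(1)] b(2) by simp
          show "\<xi> (a \<odot>\<^bsub>V\<^esub> v) = a \<odot>\<^bsub>?C\<^esub> \<xi> v" if a: "a \<in> carrier k"
            using agree[OF b] agree[OF b(1) submoduleD(4)[OF V' Wsub a b(2)]] memb[OF b(1)]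
              lin_maps_smult[of "snd b" k "VJ (fst b)" ?C a v] a b(2) by simp
        qed
        have 3: "\<xi> (v \<oplus>\<^bsub>V\<^esub> w) = \<xi> v \<oplus>\<^bsub>?C\<^esub> \<xi> w" if v: "v \<in> W J" and w: "w \<in> W J" for v w
        proof -
          obtain a b where ab: "a \<in> Ch" "v \<in> W (fst a)" "b \<in> Ch" "w \<in> W (fst b)" using cover v w by meson
          obtain c where c: "c \<in> Ch" "le a c" "le b c"
            by (rule chain_common[OF tot ab(1,3)]) (auto simp: le_def)
          have vw: "v \<in> W (fst c)" "w \<in> W (fst c)"
            using ab c Wmono[of "fst a" "fst c"] Wmono[of "fst b" "fst c"] by (auto simp: le_def split: prod.splits)
          show ?thesis
            using agree[OF c(1) vw(1)] agree[OF c(1) vw(2)] agree[OF c(1) submoduleD(3)[OF V' Wsub vw]] vw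
              lin_maps_add[of "snd c" k "VJ (fst c)" ?C v w] memb[OF c(1)] by simp
        qed
        show ?thesis using 1 2 3 by (auto simp: lin_maps_def)
      qed
      moreover have "(\<theta> v = (\<lambda>i\<in>I. \<zero>\<^bsub>k\<^esub>) \<longrightarrow> \<xi> v = \<zero>\<^bsub>?C\<^esub>) \<and> \<theta> (lincomb k V (\<xi> v)) = \<theta> v" if v: "v \<in> W J" for v
        using cover[OF v] agree memb by auto
      moreover have "J \<subseteq> I" unfolding J_def using memb by blast
      moreover have "\<xi> \<in> extensional (W J)" by (simp add: \<xi>_def)
      ultimately have "good (J, \<xi>)" by (simp add: good_def)
      moreover have "le a (J, \<xi>)" if "a \<in> Ch" for a
        using agree[OF that] that by (auto simp: le_def J_def split: prod.splits)
      ultimately show ?thesis by blast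
    qed
  qed
  then obtain J \<xi> where J: "good (J, \<xi>)" and max: "\<And>a. good a \<Longrightarrow> le (J, \<xi>) a \<Longrightarrow> a = (J, \<xi>)"
    by (metis mem_Collect_eq surj_pair)
  note JI = J[unfolded good_def, simplified]
  have \<xi>: "\<xi> \<in> lin_maps k (VJ J) ?C" using JI by blast
  have "J = I"
  proof (rule ccontr)
    assume "J \<noteq> I"
    then obtain j where j: "j \<in> I" "j \<notin> J" using JI by blast
    define J' where "J' = insert j J"
    \<comment> \<open>The ideal of all values of the new coordinate \<open>j\<close> on
      \<open>W J'\<close>; by heredity it has a dual basis \<open>\<zeta>\<close>.\<close>
    define \<aa> where "\<aa> = (\<lambda>v. \<theta> v j) ` W J'"
    have \<aa>s: "submodule \<aa> k (self_module k)"
      using lin_maps_image[OF VJ left_module_self[OF k], of "\<lambda>v. \<theta> v j" J'] lin_maps_restrict[OF comp[OF j(1)] Wc]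
      by (simp add: \<aa>_def VJ_def)
    note \<aa> = submoduleD[OF left_module_self[OF k] \<aa>s, simplified]
    have "ideal \<aa> k"
    proof (rule idealI[OF k])
      show "subgroup \<aa> (add_monoid k)" using \<aa>s by (simp add: submodule_def subgroup_def self_module_def a_inv_def m_inv_def)
      show "a \<in> \<aa> \<Longrightarrow> x \<in> carrier k \<Longrightarrow> x \<otimes>\<^bsub>k\<^esub> a \<in> \<aa>" for a x using \<aa>(4) by blast
      show "a \<in> \<aa> \<Longrightarrow> x \<in> carrier k \<Longrightarrow> a \<otimes>\<^bsub>k\<^esub> x \<in> \<aa>" for a x using \<aa>(1) \<aa>(4)[of x a] V.R.m_comm by auto
    qed
    hence "projective_module k ((self_module k)\<lparr>carrier := \<aa>\<rparr>)" using her by (auto simp: hereditary_ring_def)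
    let ?A = "(self_module k)\<lparr>carrier := \<aa>\<rparr>"
    have Am: "left_module k ?A" by (rule left_module_submodule[OF left_module_self[OF k] \<aa>s])
    obtain \<zeta> where \<zeta>: "\<zeta> \<in> lin_maps k ?A (coords k ?A)" and "\<And>a. a \<in> carrier ?A \<Longrightarrow> lincomb k ?A (\<zeta> a) = a"
      by (rule rel_proj_zero_coords[OF k Am projective_module_rel_proj[OF \<open>projective_module k ?A\<close>]]) blast
    hence \<zeta>e: "lincomb k ?A (\<zeta> a) = a" if "a \<in> \<aa>" for a using that by simp
    let ?B = "dsum_module \<aa> ?S"
    have CA: "coords k ?A = ?B" by (simp add: coords_def)
    have "\<forall>a \<in> \<aa>. \<exists>v \<in> W J'. \<theta> v j = a" by (auto simp: \<aa>_def)
    \<comment> \<open>\<open>w a\<close> is a chosen preimage of \<open>a\<close>. Since the choice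
      need not be linear, it is extended linearly from formal combinations of elements of the ideal:
      \<open>\<beta>\<close> is the extension to \<open>V\<close>, and \<open>\<gamma>\<close> the
      same combination kept formal, so that \<open>lincomb\<close> after \<open>\<gamma>\<close> is
      \<open>\<beta>\<close>.\<close>
    then obtain w where w: "\<And>a. a \<in> \<aa> \<Longrightarrow> w a \<in> W J'" "\<And>a. a \<in> \<aa> \<Longrightarrow> \<theta> (w a) j = a" by metis
    have wc: "w a \<in> carrier V" if "a \<in> \<aa>" for a using w(1)[OF that] Wc by blast
    let ?d = "\<lambda>a. dsum_inj (carrier V) ?S (w a) \<one>\<^bsub>k\<^esub>"
    have dc: "?d a \<in> carrier ?C" if "a \<in> \<aa>" for a
      unfolding coords_def by (rule dsum_inj_closed[OF family_abelian_group[OF family_self[OF k]]]) simp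
    define \<beta> where "\<beta> = dsum_lift V \<aa> ?S (\<lambda>a c. c \<odot>\<^bsub>V\<^esub> w a)"
    define \<gamma> where "\<gamma> = dsum_lift ?C \<aa> ?S (\<lambda>a c. c \<odot>\<^bsub>?C\<^esub> ?d a)"
    have \<beta>: "\<beta> \<in> lin_maps k ?B V" unfolding \<beta>_def by (rule free_lift_lin_maps[OF k V' wc])
    have \<gamma>: "\<gamma> \<in> lin_maps k ?B ?C" unfolding \<gamma>_def by (rule free_lift_lin_maps[OF k C dc])
    note \<beta>' = lin_maps_add_maps[OF \<beta>] and \<gamma>' = lin_maps_add_maps[OF \<gamma>]
    have \<beta>i: "\<beta> (dsum_inj \<aa> ?S a c) = c \<odot>\<^bsub>V\<^esub> w a" if "a \<in> \<aa>" "c \<in> carrier k" for a c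
      unfolding \<beta>_def by (rule free_lift_inj[OF k V' wc that])
    have \<gamma>i: "\<gamma> (dsum_inj \<aa> ?S a c) = c \<odot>\<^bsub>?C\<^esub> ?d a" if "a \<in> \<aa>" "c \<in> carrier k" for a c
      unfolding \<gamma>_def by (rule free_lift_inj[OF k C dc that])
    have lc\<gamma>: "lincomb k V (\<gamma> x) = \<beta> x" if x: "x \<in> carrier ?B" for x
    proof (rule free_ext[OF k V.abelian_group_axioms _ \<beta>' _ x])
      show "(\<lambda>x. lincomb k V (\<gamma> x)) \<in> add_maps ?B V" by (rule add_maps_comp[OF lin_maps_add_maps[OF lc] \<gamma>'])
      show "lincomb k V (\<gamma> (dsum_inj \<aa> ?S a c)) = \<beta> (dsum_inj \<aa> ?S a c)" if "a \<in> \<aa>" "c \<in> carrier k" for a c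
        using that \<beta>i \<gamma>i lin_maps_smult[OF lc that(2) dc[OF that(1)]] lincomb_inj[OF k V' wc[OF that(1)] V.R.one_closed] wc[OF that(1)]
        by simp
    qed
    have \<theta>\<beta>: "\<theta> (\<beta> x) j = lincomb k ?A x" if x: "x \<in> carrier ?B" for x
    proof (rule free_ext[OF k V.R.abelian_group_axioms _ _ _ x])
      show "(\<lambda>x. \<theta> (\<beta> x) j) \<in> add_maps ?B k"
        using add_maps_comp[OF lin_maps_add_maps[OF comp[OF j(1)]] \<beta>'] by (simp add: add_maps_def)
      show "lincomb k ?A \<in> add_maps ?B k"
        using lin_maps_add_maps[OF lincomb_lin_maps[OF k Am]] \<aa>(1) by (auto simp: CA add_maps_def Pi_iff)
      show "\<theta> (\<beta> (dsum_inj \<aa> ?S a c)) j = lincomb k ?A (dsum_inj \<aa> ?S a c)" if "a \<in> \<aa>" "c \<in> carrier k" for a c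
        using that \<beta>i lin_maps_smult[OF comp[OF j(1)] that(2) wc[OF that(1)]] w(2) lincomb_inj[OF k Am, of a c] by simp
    qed
    have \<beta>W: "\<beta> x \<in> W J'" if x: "x \<in> carrier ?B" for x
    proof -
      have "\<theta> (\<beta> x) i = \<zero>\<^bsub>k\<^esub>" if i: "i \<in> I - J'" for i
      proof (rule free_ext[OF k V.R.abelian_group_axioms _ _ _ x])
        show "(\<lambda>x. \<theta> (\<beta> x) i) \<in> add_maps ?B k"
          using add_maps_comp[OF lin_maps_add_maps[OF comp] \<beta>', of i] i by (simp add: add_maps_def)
        show "(\<lambda>x. \<zero>\<^bsub>k\<^esub>) \<in> add_maps ?B k" by (rule add_maps_const_zero[OF V.R.abelian_group_axioms])
        show "\<theta> (\<beta> (dsum_inj \<aa> ?S a c)) i = \<zero>\<^bsub>k\<^esub>" if "a \<in> \<aa>" "c \<in> carrier k" for a c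
          using that \<beta>i lin_maps_smult[OF comp that(2) wc[OF that(1)], of i] w(1)[OF that(1)] i by (simp add: W_def)
      qed
      thus ?thesis using add_maps_closed[OF \<beta>' x] by (auto simp: W_def)
    qed
    \<comment> \<open>\<open>e v\<close> expands the \<open>j\<close>-th coordinate of
      \<open>v\<close> in the dual basis of the ideal. Hence \<open>v\<close> and
      \<open>\<beta> (e v)\<close> have the same \<open>j\<close>-th coordinate, and their
      difference \<open>pr v\<close> lies in \<open>W J\<close>, where \<open>\<xi>\<close> is
      already available.\<close>
    define e where "e v = \<zeta> (\<theta> v j)" for v
    have \<theta>A: "(\<lambda>v. \<theta> v j) \<in> lin_maps k (VJ J') ?A"
      using lin_maps_restrict[OF comp[OF j(1)] Wc, of J'] by (auto simp: lin_maps_def \<aa>_def VJ_def)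
    have e: "e \<in> lin_maps k (VJ J') ?B" unfolding e_def using lin_maps_comp[OF \<zeta> \<theta>A] by (simp add: CA)
    note e' = lin_maps_add_maps[OF e]
    have ec: "e v \<in> carrier ?B" if "v \<in> W J'" for v using add_maps_closed[OF e'] that by simp
    define pr where "pr v = v \<ominus>\<^bsub>V\<^esub> \<beta> (e v)" for v
    have \<beta>ec: "\<beta> (e v) \<in> carrier V" if "v \<in> W J'" for v using add_maps_closed[OF \<beta>' ec[OF that]] .
    have pr: "pr v \<in> W J" if v: "v \<in> W J'" for v
    proof -
      have vc: "v \<in> carrier V" using v Wc by auto
      have "pr v \<in> W J'" unfolding pr_def using submoduleD(6)[OF V' Wsub v \<beta>W[OF ec[OF v]]] .
      moreover have "\<theta> (pr v) j = \<zero>\<^bsub>k\<^esub>"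
      proof -
        have "\<theta> (pr v) j = \<theta> v j \<ominus>\<^bsub>k\<^esub> \<theta> (\<beta> (e v)) j"
          using lin_maps_minus[OF V.abelian_group_axioms lm_ag[OF left_module_self[OF k]] comp[OF j(1)] vc \<beta>ec[OF v]]
          by (simp add: pr_def a_minus_def a_inv_self_module)
        also have "\<theta> (\<beta> (e v)) j = \<theta> v j" using \<theta>\<beta>[OF ec[OF v]] \<zeta>e[of "\<theta> v j"] v by (simp add: e_def \<aa>_def)
        finally show ?thesis using lin_maps_closed[OF comp[OF j(1)] vc] by (simp add: V.R.r_right_minus_eq V.R.r_neg V.R.minus_eq)
      qed
      ultimately show ?thesis by (auto simp: W_def J'_def)
    qed
    have "(\<lambda>v. v) \<in> lin_maps k (VJ J') V" using Wc by (auto simp: lin_maps_def)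
    hence "pr \<in> lin_maps k (VJ J') V" unfolding pr_def by (rule lin_maps_diff[OF V' _ lin_maps_comp[OF \<beta> e]])
    hence prl: "pr \<in> lin_maps k (VJ J') (VJ J)" using pr by (simp add: lin_maps_def Pi_iff)
    define \<xi>' where "\<xi>' = (\<lambda>v\<in>W J'. \<xi> (pr v) \<oplus>\<^bsub>?C\<^esub> \<gamma> (e v))"
    have \<xi>c: "\<xi> v \<in> carrier ?C" if "v \<in> W J" for v using lin_maps_closed[OF \<xi>] that by simp
    have \<gamma>c: "\<gamma> (e v) \<in> carrier ?C" if "v \<in> W J'" for v using add_maps_closed[OF \<gamma>' ec[OF that]] .
    have "\<xi>' \<in> lin_maps k (VJ J') ?C"
      using lin_maps_plus[OF C lin_maps_comp[OF \<xi> prl] lin_maps_comp[OF \<gamma> e]] submoduleD(3,4)[OF V' Wsub]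
      by (simp add: \<xi>'_def lin_maps_def Pi_iff)
    \<comment> \<open>If the new coordinate of \<open>v\<close> is zero, nothing is subtracted.
      Hence \<open>\<xi>'\<close> vanishes on the kernel of \<open>\<theta>\<close> and restricts to
      \<open>\<xi>\<close> on \<open>W J\<close>.\<close>
    moreover have zz: "pr v = v \<and> e v = \<zero>\<^bsub>?B\<^esub>" if v: "v \<in> W J'" and z: "\<theta> v j = \<zero>\<^bsub>k\<^esub>" for v
    proof -
      have "e v = \<zero>\<^bsub>?B\<^esub>" using lin_maps_zero[OF lm_ag[OF Am] lm_ag[OF coords_left_module[OF k]] \<zeta>] z
        by (simp add: e_def CA)
      moreover have "\<beta> \<zero>\<^bsub>?B\<^esub> = \<zero>\<^bsub>V\<^esub>" by (rule add_maps_zero[OF lm_ag[OF free_left_module[OF k]] V.abelian_group_axioms \<beta>'])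
      ultimately show ?thesis using v Wc[of J'] by (auto simp: pr_def V.minus_eq)
    qed
    have \<gamma>0: "\<gamma> \<zero>\<^bsub>?B\<^esub> = \<zero>\<^bsub>?C\<^esub>" by (rule add_maps_zero[OF lm_ag[OF free_left_module[OF k]] C.abelian_group_axioms \<gamma>'])
    have "\<xi>' v = \<zero>\<^bsub>?C\<^esub>" if v: "v \<in> W J'" and z: "\<theta> v = (\<lambda>i\<in>I. \<zero>\<^bsub>k\<^esub>)" for v
    proof -
      have "v \<in> W J" using ker[OF _ z] v Wc by auto
      hence "\<xi> v = \<zero>\<^bsub>?C\<^esub>" using JI z by blast
      thus ?thesis using zz[OF v] z j v \<gamma>0 by (simp add: \<xi>'_def)
    qed
    moreover have "\<theta> (lincomb k V (\<xi>' v)) = \<theta> v" if v: "v \<in> W J'" for v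
    proof -
      have vc: "v \<in> carrier V" "pr v \<in> carrier V" using v Wc pr[OF v] by auto
      have lx: "lincomb k V (\<xi> (pr v)) \<in> carrier V" using lin_maps_closed[OF lc \<xi>c[OF pr[OF v]]] .
      have "\<theta> (lincomb k V (\<xi>' v)) = \<theta> (lincomb k V (\<xi> (pr v)) \<oplus>\<^bsub>V\<^esub> \<beta> (e v))"
        using v lin_maps_add[OF lc \<xi>c[OF pr[OF v]] \<gamma>c[OF v]] lc\<gamma>[OF ec[OF v]] by (simp add: \<xi>'_def)
      also have "\<dots> = \<theta> (pr v) \<oplus>\<^bsub>?D\<^esub> \<theta> (\<beta> (e v))"
        using add_maps_add[OF \<theta>' lx \<beta>ec[OF v]] JI pr[OF v] by simp
      also have "\<dots> = \<theta> (pr v \<oplus>\<^bsub>V\<^esub> \<beta> (e v))" using add_maps_add[OF \<theta>' vc(2) \<beta>ec[OF v]] by simp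
      also have "pr v \<oplus>\<^bsub>V\<^esub> \<beta> (e v) = v" using vc \<beta>ec[OF v] by (simp add: pr_def V.minus_eq V.a_assoc V.l_neg)
      finally show ?thesis .
    qed
    moreover have "J' \<subseteq> I" using JI j by (auto simp: J'_def)
    ultimately have "good (J', \<xi>')" by (auto simp: good_def \<xi>'_def)
    moreover have "le (J, \<xi>) (J', \<xi>')"
    proof -
      have "\<xi>' v = \<xi> v" if v: "v \<in> W J" for v
      proof -
        have v': "v \<in> W J'" using v Wmono[of J J'] by (auto simp: J'_def)
        have "\<theta> v j = \<zero>\<^bsub>k\<^esub>" using v j by (auto simp: W_def)
        thus ?thesis using zz[OF v'] v' \<gamma>0 \<xi>c[OF v] by (simp add: \<xi>'_def)
      qed
      thus ?thesis by (auto simp: le_def J'_def)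
    qed
    ultimately have "J' = J" using max by blast
    thus False using j by (auto simp: J'_def)
  qed
  hence "W J = carrier V" by (auto simp: W_def)
  thus ?thesis using JI \<xi> by (intro bexI[of _ \<xi>]) (auto simp: VJ_def lin_maps_def)
qed

text \<open>The quotient of \<open>V\<close> by the kernel of \<open>\<theta>\<close> embeds into a
  free module, so it is projective by heredity. Most quotients below are shown to be projective by
  exhibiting their denominator as such a kernel.\<close>

lemma rel_proj_kernel:
  assumes her: "hereditary_ring k" and V: "module k V"
    and \<theta>: "\<theta> \<in> lin_maps k V (free_module k I)"
  shows "rel_proj k V {v \<in> carrier V. \<theta> v = (\<lambda>i\<in>I. \<zero>\<^bsub>k\<^esub>)}"
proof -
  interpret V: module k V by fact
  have k: "ring k" and V': "left_module k V"
    using V by (auto intro: left_module_of_module V.R.ring_axioms)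
  have D: "abelian_group (free_module k I)"
    by (rule lm_ag[OF free_left_module[OF k]])
  obtain \<xi> where \<xi>: "\<xi> \<in> lin_maps k V (coords k V)" and x: "\<And>v. v \<in> carrier V \<Longrightarrow>
    (\<theta> v = (\<lambda>i\<in>I. \<zero>\<^bsub>k\<^esub>) \<longrightarrow> \<xi> v = \<zero>\<^bsub>coords k V\<^esub>) \<and> \<theta> (lincomb k V (\<xi> v)) = \<theta> v"
    using hereditary_coords[OF assms] by blast
  have "\<theta> (v \<ominus>\<^bsub>V\<^esub> lincomb k V (\<xi> v)) = (\<lambda>i\<in>I. \<zero>\<^bsub>k\<^esub>)" and "v \<ominus>\<^bsub>V\<^esub> lincomb k V (\<xi> v) \<in> carrier V"
    if v: "v \<in> carrier V" for v
  proof -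
    have l: "lincomb k V (\<xi> v) \<in> carrier V"
      using lin_maps_closed[OF lin_maps_comp[OF lincomb_lin_maps[OF k V'] \<xi>] v] .
    thus "v \<ominus>\<^bsub>V\<^esub> lincomb k V (\<xi> v) \<in> carrier V" using v by simp
    show "\<theta> (v \<ominus>\<^bsub>V\<^esub> lincomb k V (\<xi> v)) = (\<lambda>i\<in>I. \<zero>\<^bsub>k\<^esub>)"
      using lin_maps_minus[OF V.abelian_group_axioms D \<theta> v l] x[OF v]
        ag_minus_eq_zero[OF D] lin_maps_closed[OF \<theta> v] by (simp add: dsum_simps(2))
  qed
  thus ?thesis using \<xi> x unfolding rel_proj_def by (intro bexI[of _ \<xi>]) auto
qed

section \<open>Characters of abelian groups\<close>

text \<open>Q/Z by representatives in [0, 1). As a type of class \<open>ab_group_add\<close> it has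
  finite sums and cancellation at once; \<open>qz_group\<close> is its view as a record.\<close>

typedef qz = "{x :: rat. 0 \<le> x \<and> x < 1}" by (rule exI[of _ 0]) simp

definition to_qz :: "rat \<Rightarrow> qz" where "to_qz x = Abs_qz (frac x)"

lemma Rep_to_qz: "Rep_qz (to_qz x) = frac x"
  by (simp add: to_qz_def Abs_qz_inverse frac_lt_1)

lemma to_qz_Rep: "to_qz (Rep_qz y) = y"
  using Rep_qz[of y] by (simp add: to_qz_def frac_eq Rep_qz_inverse)

lemma to_qz_frac: "to_qz (frac x + y) = to_qz (x + y)" "to_qz (y + frac x) = to_qz (y + x)"
    "to_qz (frac x) = to_qz x"
  by (simp_all add: to_qz_def)

lemma to_qz_eq_iff: "to_qz x = to_qz y \<longleftrightarrow> x - y \<in> \<int>"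
proof -
  have "to_qz x = to_qz y \<longleftrightarrow> frac x = frac y"
    by (metis Rep_to_qz Rep_qz_inject)
  also have "\<dots> \<longleftrightarrow> x - y \<in> \<int>"
  proof
    assume "frac x = frac y"
    hence "x - y = of_int (\<lfloor>x\<rfloor> - \<lfloor>y\<rfloor>)" by (simp add: frac_def)
    thus "x - y \<in> \<int>" by (metis Ints_of_int)
  next
    assume "x - y \<in> \<int>"
    then obtain n where "x = y + of_int n" by (metis Ints_cases add_diff_cancel_left' diff_add_cancel add.commute)
    thus "frac x = frac y" by (simp add: frac_def)
  qed
  finally show ?thesis .
qed

instantiation qz :: ab_group_add
begin
definition "0 = to_qz 0"
definition "x + y = to_qz (Rep_qz x + Rep_qz y)"
definition "- x = to_qz (- Rep_qz x)"
definition "x - y = to_qz (Rep_qz x - Rep_qz y)"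
instance
proof
  fix a b c :: qz
  show "a + b + c = a + (b + c)" by (simp add: plus_qz_def Rep_to_qz to_qz_frac add.assoc)
  show "a + b = b + a" by (simp add: plus_qz_def add.commute)
  show "0 + a = a" by (simp add: plus_qz_def zero_qz_def Rep_to_qz to_qz_frac to_qz_Rep)
  show "- a + a = 0" by (simp add: plus_qz_def uminus_qz_def zero_qz_def Rep_to_qz to_qz_frac)
  show "a - b = a + - b" by (simp add: plus_qz_def minus_qz_def uminus_qz_def Rep_to_qz to_qz_frac)
qed
end

definition qz_scale :: "int \<Rightarrow> qz \<Rightarrow> qz" where "qz_scale m y = to_qz (of_int m * Rep_qz y)"

lemma to_qz_add: "to_qz (x + y) = to_qz x + to_qz y"
  by (simp add: plus_qz_def Rep_to_qz to_qz_frac)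

lemma qz_scale_to_qz: "qz_scale m (to_qz x) = to_qz (of_int m * x)"
proof -
  have "of_int m * frac x - of_int m * x = of_int (- m * \<lfloor>x\<rfloor>)" by (simp add: frac_def algebra_simps)
  thus ?thesis unfolding qz_scale_def Rep_to_qz to_qz_eq_iff by (metis Ints_of_int)
qed

lemma qz_scale_add: "qz_scale (m + n) y = qz_scale m y + qz_scale n y"
  by (simp add: qz_scale_def to_qz_add distrib_right)

lemma qz_scale_one: "qz_scale 1 y = y"
  by (simp add: qz_scale_def to_qz_Rep)

lemma qz_scale_zero: "qz_scale 0 y = 0"
  by (simp add: qz_scale_def zero_qz_def)

lemma qz_scale_minus: "qz_scale (- n) y = - qz_scale n y"
  by (metis add.right_inverse add_eq_0_iff qz_scale_add qz_scale_zero)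

lemma qz_scale_scale: "qz_scale m (qz_scale n y) = qz_scale (m * n) y"
  by (simp add: qz_scale_def[of n] qz_scale_def[of "m * n"] qz_scale_to_qz mult.assoc)

lemma qz_divisible: "n > 0 \<Longrightarrow> \<exists>z. qz_scale n z = y"
  by (rule exI[of _ "to_qz (Rep_qz y / of_int n)"]) (simp add: qz_scale_to_qz to_qz_Rep)

definition qz_group :: "qz ring" where
  "qz_group = \<lparr>carrier = UNIV, mult = undefined, one = undefined, zero = 0, add = (+)\<rparr>"

lemma qz_group_simps [simp]:
  "carrier qz_group = UNIV" "zero qz_group = 0" "add qz_group = (+)"
  by (auto simp: qz_group_def)

lemma qz_group_abelian: "abelian_group qz_group"
  by (rule abelian_groupI) (auto simp: add_ac intro: exI[of _ "- x" for x] add.left_inverse)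

abbreviation chars :: "('x, 'b) ring_scheme \<Rightarrow> ('x \<Rightarrow> qz) set" where
  "chars M \<equiv> add_maps M qz_group"

lemma char_zero: "abelian_group M \<Longrightarrow> \<chi> \<in> chars M \<Longrightarrow> \<chi> \<zero>\<^bsub>M\<^esub> = 0"
  using add_maps_zero[OF _ qz_group_abelian] by fastforce

definition add_closed :: "('x, 'b) ring_scheme \<Rightarrow> 'x set \<Rightarrow> bool" where
  "add_closed M H \<longleftrightarrow> H \<subseteq> carrier M \<and> \<zero>\<^bsub>M\<^esub> \<in> H \<and>
    (\<forall>x\<in>H. \<forall>y\<in>H. x \<oplus>\<^bsub>M\<^esub> y \<in> H) \<and> (\<forall>x\<in>H. \<ominus>\<^bsub>M\<^esub> x \<in> H)"

lemma add_maps_image_closed: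
  assumes M: "abelian_group M" and N: "abelian_group N" and h: "h \<in> add_maps M N"
  shows "add_closed N (h ` carrier M)"
proof -
  interpret M: abelian_group M by fact
  interpret N: abelian_group N by fact
  have "\<ominus>\<^bsub>N\<^esub> h x \<in> h ` carrier M" if x: "x \<in> carrier M" for x
  proof -
    have "h (\<zero>\<^bsub>M\<^esub> \<ominus>\<^bsub>M\<^esub> x) = \<zero>\<^bsub>N\<^esub> \<ominus>\<^bsub>N\<^esub> h x"
      using add_maps_minus[OF M N h M.zero_closed x] add_maps_zero[OF M N h] by simp
    hence "\<ominus>\<^bsub>N\<^esub> h x = h (\<ominus>\<^bsub>M\<^esub> x)" using x add_maps_closed[OF h x] by (simp add: M.minus_eq N.minus_eq)
    thus ?thesis using x by blast
  qed
  moreover have "h x \<oplus>\<^bsub>N\<^esub> h y \<in> h ` carrier M" if "x \<in> carrier M" "y \<in> carrier M" for x y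
    using add_maps_add[OF h that] that by (metis M.a_closed imageI)
  moreover have "\<zero>\<^bsub>N\<^esub> \<in> h ` carrier M" using add_maps_zero[OF M N h] by (metis M.zero_closed imageI)
  ultimately show ?thesis using add_maps_closed[OF h] by (auto simp: add_closed_def)
qed

lemma submodule_add_closed: "left_module R M \<Longrightarrow> submodule U R M \<Longrightarrow> add_closed M U"
  using submoduleD by (fastforce simp: add_closed_def)

section \<open>Extension of characters and separation of points\<close>

lemma int_subgroup_cyclic:
  fixes T :: "int set"
  assumes "0 \<in> T" "\<And>m n. m \<in> T \<Longrightarrow> n \<in> T \<Longrightarrow> m - n \<in> T"
  obtains n where "n \<ge> 0" "T = range (\<lambda>q. n * q)"
proof (cases "\<exists>m \<in> T. m \<noteq> 0")
  case False
  thus ?thesis using that[of 0] assms(1) by auto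
next
  case True
  have neg: "- m \<in> T" if "m \<in> T" for m using assms(2)[OF assms(1) that] by simp
  have add: "m + n \<in> T" if "m \<in> T" "n \<in> T" for m n using assms(2)[OF that(1) neg[OF that(2)]] by simp
  obtain m0 where "m0 \<in> T" "m0 \<noteq> 0" using True by blast
  hence "\<exists>a::nat. a > 0 \<and> int a \<in> T" using neg[of m0]
    by (cases "m0 > 0") (auto intro: exI[of _ "nat m0"] exI[of _ "nat (- m0)"])
  define a where "a = (LEAST a::nat. a > 0 \<and> int a \<in> T)"
  have a: "a > 0" "int a \<in> T"
    using LeastI_ex[OF \<open>\<exists>a::nat. a > 0 \<and> int a \<in> T\<close>] by (auto simp: a_def)
  have mult: "int a * int q \<in> T" for q
    by (induction q) (auto simp: assms(1) distrib_left intro: add a(2))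
  have mult': "int a * q \<in> T" for q
    using mult[of "nat q"] neg[OF mult[of "nat (- q)"]] by (cases "q \<ge> 0") auto
  have mod0: "m mod int a = 0" if m: "m \<in> T" for m
  proof (rule ccontr)
    assume nz: "m mod int a \<noteq> 0"
    have "m mod int a = m - int a * (m div int a)" by (simp add: minus_mult_div_eq_mod)
    hence "m mod int a \<in> T" using assms(2)[OF m mult'] by simp
    moreover have "m mod int a > 0" using nz a(1) pos_mod_sign[of "int a" m] by linarith
    ultimately have "nat (m mod int a) > 0 \<and> int (nat (m mod int a)) \<in> T" by simp
    hence "a \<le> nat (m mod int a)" unfolding a_def by (rule Least_le)
    moreover have "m mod int a < int a" using a(1) by simp
    hence "nat (m mod int a) < a" using a(1) by (subst nat_less_iff) auto
    ultimately show False by simp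
  qed
  have "m \<in> range (\<lambda>q. int a * q)" if "m \<in> T" for m
    using mod0[OF that] minus_mult_div_eq_mod[of m "int a"] by (intro image_eqI[of _ _ "m div int a"]) auto
  hence "T = range (\<lambda>q. int a * q)" using mult' by blast
  thus ?thesis by (rule that[of "int a", rotated]) simp
qed

text \<open>A character defined on a subgroup, as a subgroup of the product of \<open>M\<close> and
  Q/Z with trivial fibre over zero. In this form the union of a chain is simply a union of
  sets.\<close>

definition char_graph :: "('x, 'b) ring_scheme \<Rightarrow> ('x \<times> qz) set \<Rightarrow> bool" where
  "char_graph M G \<longleftrightarrow> G \<subseteq> carrier M \<times> UNIV \<and> (\<zero>\<^bsub>M\<^esub>, 0) \<in> G \<and>
    (\<forall>x a y b. (x, a) \<in> G \<longrightarrow> (y, b) \<in> G \<longrightarrow> (x \<oplus>\<^bsub>M\<^esub> y, a + b) \<in> G) \<and>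
    (\<forall>x a. (x, a) \<in> G \<longrightarrow> (\<ominus>\<^bsub>M\<^esub> x, - a) \<in> G) \<and> (\<forall>a. (\<zero>\<^bsub>M\<^esub>, a) \<in> G \<longrightarrow> a = 0)"

context
  fixes M :: "('x, 'b) ring_scheme" and G :: "('x \<times> qz) set"
  assumes M: "abelian_group M" and G: "char_graph M G"
begin

interpretation M: abelian_group M by (rule M)

lemma char_graphD:
  "(\<zero>\<^bsub>M\<^esub>, 0) \<in> G" "\<lbrakk>(x, a) \<in> G; (y, b) \<in> G\<rbrakk> \<Longrightarrow> (x \<oplus>\<^bsub>M\<^esub> y, a + b) \<in> G" "(x, a) \<in> G \<Longrightarrow> (\<ominus>\<^bsub>M\<^esub> x, - a) \<in> G"
  "(\<zero>\<^bsub>M\<^esub>, a) \<in> G \<Longrightarrow> a = 0" "(x, a) \<in> G \<Longrightarrow> x \<in> carrier M"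
  using G by (auto simp: char_graph_def)

lemma char_graph_unique: "\<lbrakk>(x, a) \<in> G; (x, b) \<in> G\<rbrakk> \<Longrightarrow> a = b"
  using char_graphD(4)[of "a - b"] char_graphD(2)[of x a "\<ominus>\<^bsub>M\<^esub> x" "- b"] char_graphD(3,5) by (simp add: M.r_neg)

lemma char_graph_multiple:
  fixes m :: int
  assumes g: "(g, a) \<in> G" shows "([m] \<cdot>\<^bsub>M\<^esub> g, qz_scale m a) \<in> G"
proof -
  have gc: "g \<in> carrier M" by (rule char_graphD(5)[OF g])
  have n: "([int n] \<cdot>\<^bsub>M\<^esub> g, qz_scale (int n) a) \<in> G" for n
  proof (induction n)
    case (Suc n)
    have "[int (Suc n)] \<cdot>\<^bsub>M\<^esub> g = [int n] \<cdot>\<^bsub>M\<^esub> g \<oplus>\<^bsub>M\<^esub> g" using M.add.int_pow_mult[OF gc, of "int n" 1] gc by (simp add: add.commute)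
    moreover have "qz_scale (int (Suc n)) a = qz_scale (int n) a + a" using qz_scale_add[of "int n" 1 a] by (simp add: qz_scale_one add.commute)
    ultimately show ?case using char_graphD(2)[OF Suc g] by simp
  qed (use char_graphD(1) in \<open>simp add: qz_scale_zero add_pow_def\<close>)
  show ?thesis
  proof (cases "m \<ge> 0")
    case False
    thus ?thesis using char_graphD(3)[OF n[of "nat (- m)"]] M.add.int_pow_neg[OF gc, of m] qz_scale_minus[of m a] M.add.int_pow_closed[OF gc, of m] by simp
  qed (use n[of "nat m"] in simp)
qed

text \<open>\<open>n\<close> is the order of \<open>g\<close> modulo the domain of the partial
  character, with \<open>n = 0\<close> standing for infinite order.\<close>

lemma char_graph_order:
  assumes g: "g \<in> carrier M"
  obtains n :: int where "n \<ge> 0" "\<And>m. (\<exists>a. ([m] \<cdot>\<^bsub>M\<^esub> g, a) \<in> G) \<longleftrightarrow> n dvd m"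
proof (rule int_subgroup_cyclic)
  let ?T = "{m :: int. \<exists>a. ([m] \<cdot>\<^bsub>M\<^esub> g, a) \<in> G}"
  show "0 \<in> ?T" using char_graphD(1) by (auto simp: add_pow_def)
  show "m - l \<in> ?T" if "m \<in> ?T" "l \<in> ?T" for m l
    using that char_graphD(2)[OF _ char_graphD(3)] M.add.int_pow_mult[OF g, of m "- l"] M.add.int_pow_neg[OF g, of l] by fastforce
  fix n assume "n \<ge> 0" and T: "?T = range (\<lambda>q. n * q)"
  have "(\<exists>a. ([m] \<cdot>\<^bsub>M\<^esub> g, a) \<in> G) \<longleftrightarrow> n dvd m" for m using T by (auto simp: dvd_def set_eq_iff image_iff)
  thus thesis using that \<open>n \<ge> 0\<close> by blast
qed

text \<open>The only constraints on a value \<open>y\<close> for \<open>g\<close> come from those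
  multiples of \<open>g\<close> that already have a value; if \<open>y\<close> respects them, adding
  multiples of \<open>(g, y)\<close> keeps the fibre over zero trivial.\<close>

lemma char_graph_adjoin:
  assumes g: "g \<in> carrier M" and y: "\<And>(m :: int) a. ([m] \<cdot>\<^bsub>M\<^esub> g, a) \<in> G \<Longrightarrow> a = qz_scale m y"
  shows "\<exists>G'. char_graph M G' \<and> G \<subseteq> G' \<and> (g, y) \<in> G'"
proof -
  let ?g = "\<lambda>m :: int. [m] \<cdot>\<^bsub>M\<^esub> g"
  note gc = M.add.int_pow_closed[OF g] and ga = M.add.int_pow_mult[OF g] and gn = M.add.int_pow_neg[OF g]
  let ?G = "{(x \<oplus>\<^bsub>M\<^esub> ?g m, a + qz_scale m y) | x a m. (x, a) \<in> G}"
  have I: "(x, a) \<in> ?G" if "(x', a') \<in> G" "x = x' \<oplus>\<^bsub>M\<^esub> ?g m" "a = a' + qz_scale m y" for x a x' a' m using that by blast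
  have "char_graph M ?G"
    unfolding char_graph_def
  proof (intro conjI allI impI)
    show "?G \<subseteq> carrier M \<times> UNIV" using char_graphD(5) gc by auto
    show "(\<zero>\<^bsub>M\<^esub>, 0) \<in> ?G" by (rule I[OF char_graphD(1), where m = 0]) (simp_all add: qz_scale_zero add_pow_def)
    show "(x \<oplus>\<^bsub>M\<^esub> z, a + b) \<in> ?G" if xa: "(x, a) \<in> ?G" and zb: "(z, b) \<in> ?G" for x a z b
    proof -
      obtain x' a' m where x: "(x', a') \<in> G" "x = x' \<oplus>\<^bsub>M\<^esub> ?g m" "a = a' + qz_scale m y" using xa by blast
      obtain z' b' l where z: "(z', b') \<in> G" "z = z' \<oplus>\<^bsub>M\<^esub> ?g l" "b = b' + qz_scale l y" using zb by blast
      show ?thesis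
        by (rule I[OF char_graphD(2)[OF x(1) z(1)], where m = "m + l"])
          (use x z char_graphD(5) gc in \<open>simp_all add: ga qz_scale_add M.a_ac add_ac\<close>)
    qed
    show "(\<ominus>\<^bsub>M\<^esub> x, - a) \<in> ?G" if xa: "(x, a) \<in> ?G" for x a
    proof -
      obtain x' a' m where x: "(x', a') \<in> G" "x = x' \<oplus>\<^bsub>M\<^esub> ?g m" "a = a' + qz_scale m y" using xa by blast
      show ?thesis
        by (rule I[OF char_graphD(3)[OF x(1)], where m = "- m"]) (use x char_graphD(5)[OF x(1)] gc in \<open>simp_all add: gn qz_scale_minus M.minus_add\<close>)
    qed
    show "a = 0" if za: "(\<zero>\<^bsub>M\<^esub>, a) \<in> ?G" for a
    proof -
      obtain x' a' m where x: "(x', a') \<in> G" "\<zero>\<^bsub>M\<^esub> = x' \<oplus>\<^bsub>M\<^esub> ?g m" "a = a' + qz_scale m y" using za by blast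
      have "x' = ?g (- m)" using M.minus_equality[OF x(2)[symmetric] gc char_graphD(5)[OF x(1)]] gn by simp
      thus ?thesis using y[of "- m" a'] x by (simp add: qz_scale_minus)
    qed
  qed
  moreover have "(x, a) \<in> ?G" if "(x, a) \<in> G" for x a
    by (rule I[OF that, where m = 0]) (use char_graphD(5)[OF that] in \<open>simp_all add: qz_scale_zero add_pow_def\<close>)
  moreover have "(g, y) \<in> ?G" by (rule I[OF char_graphD(1), where m = 1]) (use g in \<open>simp_all add: qz_scale_one\<close>)
  ultimately show ?thesis by (intro exI[of _ ?G]) auto
qed

end

text \<open>Q/Z is divisible, hence injective. In a maximal graph every \<open>g\<close> has a
  value: the multiples of \<open>g\<close> in the domain are generated by one multiple
  \<open>n g\<close>, and it is enough to divide its value by \<open>n\<close>.\<close>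

lemma char_graph_extend:
  assumes M: "abelian_group M" and G0: "char_graph M G\<^sub>0"
  shows "\<exists>\<chi> \<in> chars M. \<forall>(x, a) \<in> G\<^sub>0. \<chi> x = a"
proof -
  interpret M: abelian_group M by (rule M)
  let ?S = "{G. char_graph M G \<and> G\<^sub>0 \<subseteq> G}"
  have "\<exists>G \<in> ?S. \<forall>H \<in> ?S. G \<subseteq> H \<longrightarrow> H = G"
  proof (rule subset_Zorn_nonempty)
    fix C assume C: "C \<noteq> {}" "subset.chain ?S C"
    have c: "char_graph M G" "G\<^sub>0 \<subseteq> G" if "G \<in> C" for G using C(2) that by (auto simp: subset_chain_def)
    have two: "\<exists>G \<in> C. u \<in> G \<and> v \<in> G" if "u \<in> \<Union>C" "v \<in> \<Union>C" for u v
      using C(2) that unfolding subset_chain_def by blast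
    have "char_graph M (\<Union>C)"
      unfolding char_graph_def
    proof (intro conjI allI impI)
      show "(x \<oplus>\<^bsub>M\<^esub> y, a + b) \<in> \<Union>C" if xy: "(x, a) \<in> \<Union>C" "(y, b) \<in> \<Union>C" for x a y b
        using two[OF xy] char_graphD(2)[OF M c(1)] by blast
      show "\<Union>C \<subseteq> carrier M \<times> UNIV" using char_graphD(5)[OF M c(1)] by auto
      show "(\<zero>\<^bsub>M\<^esub>, 0) \<in> \<Union>C" using C(1) char_graphD(1)[OF M c(1)] by blast
      show "(\<ominus>\<^bsub>M\<^esub> x, - a) \<in> \<Union>C" if "(x, a) \<in> \<Union>C" for x a using that char_graphD(3)[OF M c(1)] by blast
      show "a = 0" if "(\<zero>\<^bsub>M\<^esub>, a) \<in> \<Union>C" for a using that char_graphD(4)[OF M c(1)] by blast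
    qed
    thus "\<Union>C \<in> ?S" using C(1) c(2) by blast
  qed (use G0 in blast)
  then obtain G where GS: "G \<in> ?S" and max: "\<forall>H \<in> ?S. G \<subseteq> H \<longrightarrow> H = G" by (rule bexE)
  have G: "char_graph M G" "G\<^sub>0 \<subseteq> G" using GS by auto
  note D = char_graphD[OF M G(1)] and unique = char_graph_unique[OF M G(1)]
  have "\<exists>a. (g, a) \<in> G" if g: "g \<in> carrier M" for g
  proof -
    obtain n :: int where n: "n \<ge> 0" "\<And>m. (\<exists>a. ([m] \<cdot>\<^bsub>M\<^esub> g, a) \<in> G) \<longleftrightarrow> n dvd m" by (rule char_graph_order[OF M G(1) g]) blast
    have "\<exists>b. ([n] \<cdot>\<^bsub>M\<^esub> g, b) \<in> G" using n(2)[of n] by simp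
    then obtain b where b: "([n] \<cdot>\<^bsub>M\<^esub> g, b) \<in> G" by (rule exE)
    \<comment> \<open>For \<open>n = 0\<close> this is vacuous and any \<open>y\<close> will do:
      then \<open>b\<close> lies over zero, so \<open>b = 0\<close>.\<close>
    obtain y where "n > 0 \<longrightarrow> qz_scale n y = b" using qz_divisible by blast
    hence y: "qz_scale n y = b" using n(1) b D(4) by (cases "n = 0") (auto simp: qz_scale_zero add_pow_def)
    have "a = qz_scale m y" if m: "([m] \<cdot>\<^bsub>M\<^esub> g, a) \<in> G" for m a
    proof -
      obtain q where q: "m = n * q" using m n(2) by (auto simp: dvd_def)
      show ?thesis
        using unique[OF m] char_graph_multiple[OF M G(1) b, of q] by (simp add: q M.add.int_pow_pow g y[symmetric] qz_scale_scale mult.commute)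
    qed
    then obtain H where H: "char_graph M H" "G \<subseteq> H" "(g, y) \<in> H" using char_graph_adjoin[OF M G(1) g] by metis
    hence "H = G" using max G(2) by simp
    thus ?thesis using H(3) by blast
  qed
  then obtain \<chi> where \<chi>: "\<And>g. g \<in> carrier M \<Longrightarrow> (g, \<chi> g) \<in> G" by metis
  have "\<chi> \<in> chars M" by (rule add_mapsI) (use unique[OF \<chi> D(2)[OF \<chi> \<chi>]] in auto)
  moreover have "\<chi> x = a" if "(x, a) \<in> G\<^sub>0" for x a using unique[OF \<chi>[OF D(5)]] that G(2) by blast
  ultimately show ?thesis by blast
qed

lemma char_extend:
  assumes M: "abelian_group M" and U: "add_closed M U" and \<chi>: "\<And>x y. x \<in> U \<Longrightarrow> y \<in> U \<Longrightarrow> \<chi> (x \<oplus>\<^bsub>M\<^esub> y) = \<chi> x + (\<chi> y :: qz)"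
  shows "\<exists>\<chi>' \<in> chars M. \<forall>u \<in> U. \<chi>' u = \<chi> u"
proof -
  interpret M: abelian_group M by (rule M)
  have z: "\<chi> \<zero>\<^bsub>M\<^esub> = 0" using \<chi>[of "\<zero>\<^bsub>M\<^esub>" "\<zero>\<^bsub>M\<^esub>"] U by (simp add: add_closed_def)
  have n: "\<chi> (\<ominus>\<^bsub>M\<^esub> x) = - \<chi> x" if "x \<in> U" for x
    using \<chi>[of "\<ominus>\<^bsub>M\<^esub> x" x] z U that by (simp add: add_closed_def subset_iff M.l_neg eq_neg_iff_add_eq_0)
  define G where "G = (\<lambda>u. (u, \<chi> u)) ` U"
  have G: "(x, a) \<in> G \<longleftrightarrow> x \<in> U \<and> a = \<chi> x" for x a by (auto simp: G_def)
  have "G \<subseteq> carrier M \<times> UNIV" using U by (auto simp: G_def add_closed_def)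
  hence "char_graph M G" using U by (simp add: char_graph_def G add_closed_def z n \<chi>)
  from char_graph_extend[OF M this] show ?thesis by (force simp: G_def)
qed

text \<open>Q/Z is a cogenerator: start with the zero character on \<open>U\<close>, give
  \<open>g\<close> a nonzero value compatible with its order modulo \<open>U\<close>, and
  extend.\<close>

lemma char_separate:
  assumes M: "abelian_group M" and U: "add_closed M U" and g: "g \<in> carrier M" "g \<notin> U"
  shows "\<exists>\<chi> \<in> chars M. (\<forall>u \<in> U. \<chi> u = 0) \<and> \<chi> g \<noteq> 0"
proof -
  interpret M: abelian_group M by (rule M)
  have G: "char_graph M (U \<times> {0})" using U by (auto simp: char_graph_def add_closed_def)
  obtain n :: int where n: "n \<ge> 0" "\<And>m. [m] \<cdot>\<^bsub>M\<^esub> g \<in> U \<longleftrightarrow> n dvd m"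
    by (rule char_graph_order[OF M G g(1)]) auto
  have n1: "n \<noteq> 1" using n(2)[of 1] g by auto
  \<comment> \<open>The class of 1/n has order \<open>n\<close>, the order of \<open>g\<close>
    modulo \<open>U\<close>, and is nonzero because \<open>n\<close> is not 1. For infinite order
    any nonzero value is admissible, for instance 1/2.\<close>
  define x :: rat where "x = (if n = 0 then 1/2 else 1 / of_int n)"
  have "0 < x" "x < 1" using n(1) n1 by (auto simp: x_def)
  hence y: "to_qz x \<noteq> 0" unfolding zero_qz_def to_qz_eq_iff by (metis Ints_cases diff_zero of_int_0_less_iff of_int_less_1_iff less_le_not_le zless_imp_add1_zle add_0)
  have "(0::qz) = qz_scale m (to_qz x)" if m: "[m] \<cdot>\<^bsub>M\<^esub> g \<in> U" for m :: int
  proof (cases "n = 0")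
    case True
    thus ?thesis using m n(2)[of m] by (simp add: qz_scale_zero)
  next
    case False
    obtain q where "m = n * q" using m n(2) by (auto simp: dvd_def)
    hence "qz_scale m (to_qz x) = to_qz (of_int q)" using False by (simp add: x_def qz_scale_to_qz)
    also have "\<dots> = 0" unfolding zero_qz_def to_qz_eq_iff by simp
    finally show ?thesis by simp
  qed
  then obtain G' where G': "char_graph M G'" "U \<times> {0} \<subseteq> G'" "(g, to_qz x) \<in> G'"
    using char_graph_adjoin[OF M G g(1), of "to_qz x"] by blast
  obtain \<chi> where "\<chi> \<in> chars M" "\<forall>(x, a) \<in> G'. \<chi> x = a" using char_graph_extend[OF M G'(1)] by blast
  thus ?thesis using G' y by (intro bexI[of _ \<chi>]) auto
qed

section \<open>Functors\<close>

lemma left_module_self_iff: "ring k \<Longrightarrow> left_module (self_module k) M \<longleftrightarrow> left_module k M"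
proof -
  assume k: "ring k"
  have "ring (self_module k)"
  proof -
    interpret ring k by fact
    have "abelian_group (self_module k)" using left_module_self[OF k] by (rule left_moduleD(2))
    thus ?thesis
      by (intro ringI) (auto intro: monoidI simp: m_assoc l_distr r_distr)
  qed
  thus ?thesis using k by (auto simp: left_module_def left_module_axioms_def)
qed

lemma lin_maps_self [simp]: "lin_maps (self_module k) M N = lin_maps k M N"
  by (simp add: lin_maps_def)

context preadditive
begin

lemma k_ring: "ring k" using base_cring by (rule cring.axioms)

abbreviation "NT \<equiv> nat_trans k Q"

lemma k_lm: "left_module k (self_module k)" by (rule left_module_self[OF k_ring])

lemma k_ag: "abelian_group (self_module k)" by (rule lm_ag[OF k_lm])

lemma hom_lm: "p \<in> Ob Q \<Longrightarrow> q \<in> Ob Q \<Longrightarrow> left_module k (Hom Q p q)"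
  by (rule left_module_of_module[OF hom_module])

lemmas hom_ag = lm_ag[OF hom_lm]

lemma comp_closed: "\<lbrakk>p \<in> Ob Q; q \<in> Ob Q; s \<in> Ob Q; f \<in> Mor Q p q; g \<in> Mor Q q s\<rbrakk>
    \<Longrightarrow> Comp Q p q s g f \<in> Mor Q p s"
  using comp_linear_right[of p q s g] by (auto simp: lin_maps_def)

lemma QModI:
  assumes "\<And>p. p \<in> Ob Q \<Longrightarrow> left_module k (fobj X p)"
    and "\<And>p x. p \<in> Ob Q \<Longrightarrow> x \<in> El X p \<Longrightarrow> fmor X p p (Ide Q p) x = x"
    and "\<And>p q f. \<lbrakk>p \<in> Ob Q; q \<in> Ob Q; f \<in> Mor Q p q\<rbrakk> \<Longrightarrow> fmor X p q f \<in> lin_maps k (fobj X p) (fobj X q)"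
    and "\<And>p q s f g x. \<lbrakk>p \<in> Ob Q; q \<in> Ob Q; s \<in> Ob Q; f \<in> Mor Q p q; g \<in> Mor Q q s;
        x \<in> El X p\<rbrakk> \<Longrightarrow> fmor X p s (Comp Q p q s g f) x = fmor X q s g (fmor X p q f x)"
    and "\<And>p q x. \<lbrakk>p \<in> Ob Q; q \<in> Ob Q; x \<in> El X p\<rbrakk> \<Longrightarrow>
        (\<lambda>f. fmor X p q f x) \<in> lin_maps k (Hom Q p q) (fobj X q)"
  shows "X \<in> QMod k Q"
proof -
  interpret k: ring k by (rule k_ring)
  show ?thesis using assms
    by (auto simp: QAMod_def left_module_self_iff[OF k_ring] lin_maps_iff add_maps_def Pi_iff)
qed

lemma QModD:
  assumes X: "X \<in> QMod k Q"
  shows QMod_lm: "\<And>p. p \<in> Ob Q \<Longrightarrow> left_module k (fobj X p)"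
    and QMod_ag: "\<And>p. p \<in> Ob Q \<Longrightarrow> abelian_group (fobj X p)"
    and QMod_ide: "\<And>p x. p \<in> Ob Q \<Longrightarrow> x \<in> El X p \<Longrightarrow> fmor X p p (Ide Q p) x = x"
    and QMod_fmor: "\<And>p q f. \<lbrakk>p \<in> Ob Q; q \<in> Ob Q; f \<in> Mor Q p q\<rbrakk> \<Longrightarrow> fmor X p q f \<in> lin_maps k (fobj X p) (fobj X q)"
    and QMod_comp: "\<And>p q s f g x. \<lbrakk>p \<in> Ob Q; q \<in> Ob Q; s \<in> Ob Q; f \<in> Mor Q p q; g \<in> Mor Q q s;
        x \<in> El X p\<rbrakk> \<Longrightarrow> fmor X p s (Comp Q p q s g f) x = fmor X q s g (fmor X p q f x)"
    and QMod_lin: "\<And>p q x. \<lbrakk>p \<in> Ob Q; q \<in> Ob Q; x \<in> El X p\<rbrakk> \<Longrightarrow>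
        (\<lambda>f. fmor X p q f x) \<in> lin_maps k (Hom Q p q) (fobj X q)"
proof -
  interpret k: ring k by (rule k_ring)
  show lm: "\<And>p. p \<in> Ob Q \<Longrightarrow> left_module k (fobj X p)"
    and "\<And>p x. p \<in> Ob Q \<Longrightarrow> x \<in> El X p \<Longrightarrow> fmor X p p (Ide Q p) x = x"
    and fm: "\<And>p q f. \<lbrakk>p \<in> Ob Q; q \<in> Ob Q; f \<in> Mor Q p q\<rbrakk> \<Longrightarrow> fmor X p q f \<in> lin_maps k (fobj X p) (fobj X q)"
    and "\<And>p q s f g x. \<lbrakk>p \<in> Ob Q; q \<in> Ob Q; s \<in> Ob Q; f \<in> Mor Q p q; g \<in> Mor Q q s;
        x \<in> El X p\<rbrakk> \<Longrightarrow> fmor X p s (Comp Q p q s g f) x = fmor X q s g (fmor X p q f x)"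
    using X by (auto simp: QAMod_def left_module_self_iff[OF k_ring])
  show "\<And>p. p \<in> Ob Q \<Longrightarrow> abelian_group (fobj X p)" by (rule lm_ag[OF lm])
  show "(\<lambda>f. fmor X p q f x) \<in> lin_maps k (Hom Q p q) (fobj X q)"
    if "p \<in> Ob Q" "q \<in> Ob Q" "x \<in> El X p" for p q x
    using X that lin_maps_closed[OF fm[OF that(1,2)] that(3)]
    by (auto simp: QAMod_def lin_maps_iff add_maps_def)
qed

lemma fmor_closed: "\<lbrakk>X \<in> QMod k Q; p \<in> Ob Q; q \<in> Ob Q; f \<in> Mor Q p q; x \<in> El X p\<rbrakk>
    \<Longrightarrow> fmor X p q f x \<in> El X q"
  using QMod_fmor by (fastforce simp: lin_maps_def)

lemmas fmor_add_maps = lin_maps_add_maps[OF QMod_fmor]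
lemmas fmor_add = add_maps_add[OF fmor_add_maps]
lemmas fmor_add_arg = lin_maps_add[OF QMod_lin]
lemmas fmor_smult = lin_maps_smult[OF QMod_fmor]
lemmas fmor_smult_arg = lin_maps_smult[OF QMod_lin]

lemma fmor_zero: "\<lbrakk>X \<in> QMod k Q; p \<in> Ob Q; q \<in> Ob Q; f \<in> Mor Q p q\<rbrakk>
    \<Longrightarrow> fmor X p q f \<zero>\<^bsub>fobj X p\<^esub> = \<zero>\<^bsub>fobj X q\<^esub>"
  by (rule add_maps_zero[OF QMod_ag QMod_ag fmor_add_maps])

lemma fmor_minus: "\<lbrakk>X \<in> QMod k Q; p \<in> Ob Q; q \<in> Ob Q; f \<in> Mor Q p q;
    x \<in> El X p; y \<in> El X p\<rbrakk>
    \<Longrightarrow> fmor X p q f (x \<ominus>\<^bsub>fobj X p\<^esub> y) = fmor X p q f x \<ominus>\<^bsub>fobj X q\<^esub> fmor X p q f y"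
  by (rule add_maps_minus[OF QMod_ag QMod_ag fmor_add_maps])

lemma fmor_scalar:
  assumes X: "X \<in> QMod k Q" and p: "p \<in> Ob Q" and a: "a \<in> carrier k" and x: "x \<in> El X p"
  shows "fmor X p p (a \<odot>\<^bsub>Hom Q p p\<^esub> Ide Q p) x = a \<odot>\<^bsub>fobj X p\<^esub> x"
  using fmor_smult_arg[OF X p p x a ide_closed[OF p]] QMod_ide[OF X p x] by simp

text \<open>A scalar \<open>a\<close> acts on \<open>X p\<close> as the endomorphism
  \<open>a\<close> times the identity of \<open>p\<close>, and \<open>h\<close> commutes with
  endomorphisms.\<close>

lemma natural_lin_maps:
  assumes X: "X \<in> QMod k Q" and Y: "Y \<in> QMod k Q" and p: "p \<in> Ob Q"
    and h: "h \<in> add_maps (fobj X p) (fobj Y p)"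
    and nat: "\<And>f x. f \<in> Mor Q p p \<Longrightarrow> x \<in> El X p \<Longrightarrow> h (fmor X p p f x) = fmor Y p p f (h x)"
  shows "h \<in> lin_maps k (fobj X p) (fobj Y p)"
proof -
  have "h (a \<odot>\<^bsub>fobj X p\<^esub> x) = a \<odot>\<^bsub>fobj Y p\<^esub> h x" if a: "a \<in> carrier k" and x: "x \<in> El X p" for a x
    using nat[of "a \<odot>\<^bsub>Hom Q p p\<^esub> Ide Q p" x] fmor_scalar[OF X p a x]
      fmor_scalar[OF Y p a add_maps_closed[OF h x]] x
      left_module.lsmult_closed[OF hom_lm[OF p p] a ide_closed[OF p]] by simp
  thus ?thesis using h by (simp add: lin_maps_iff)
qed

lemma nat_transI:
  assumes X: "X \<in> QMod k Q" and Y: "Y \<in> QMod k Q"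
    and h: "\<And>p. p \<in> Ob Q \<Longrightarrow> h p \<in> add_maps (fobj X p) (fobj Y p)"
    and nat: "\<And>p q f x. \<lbrakk>p \<in> Ob Q; q \<in> Ob Q; f \<in> Mor Q p q; x \<in> El X p\<rbrakk> \<Longrightarrow>
      h q (fmor X p q f x) = fmor Y p q f (h p x)"
  shows "h \<in> NT X Y"
  using natural_lin_maps[OF X Y _ h nat] nat by (auto simp: nat_trans_def)

lemma nat_transD:
  assumes "h \<in> NT X Y"
  shows nat_lin: "\<And>p. p \<in> Ob Q \<Longrightarrow> h p \<in> lin_maps k (fobj X p) (fobj Y p)"
    and nat_add_maps: "\<And>p. p \<in> Ob Q \<Longrightarrow> h p \<in> add_maps (fobj X p) (fobj Y p)"
    and nat_closed: "\<And>p x. p \<in> Ob Q \<Longrightarrow> x \<in> El X p \<Longrightarrow> h p x \<in> El Y p"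
    and nat_add: "\<And>p x y. p \<in> Ob Q \<Longrightarrow> x \<in> El X p \<Longrightarrow> y \<in> El X p \<Longrightarrow>
       h p (x \<oplus>\<^bsub>fobj X p\<^esub> y) = h p x \<oplus>\<^bsub>fobj Y p\<^esub> h p y"
    and nat_natural: "\<And>p q f x. \<lbrakk>p \<in> Ob Q; q \<in> Ob Q; f \<in> Mor Q p q; x \<in> El X p\<rbrakk> \<Longrightarrow>
      h q (fmor X p q f x) = fmor Y p q f (h p x)"
proof -
  show 1: "\<And>p. p \<in> Ob Q \<Longrightarrow> h p \<in> lin_maps k (fobj X p) (fobj Y p)"
    and "\<And>p q f x. \<lbrakk>p \<in> Ob Q; q \<in> Ob Q; f \<in> Mor Q p q; x \<in> El X p\<rbrakk> \<Longrightarrow>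
      h q (fmor X p q f x) = fmor Y p q f (h p x)"
    using assms by (auto simp: nat_trans_def)
  show 2: "\<And>p. p \<in> Ob Q \<Longrightarrow> h p \<in> add_maps (fobj X p) (fobj Y p)"
    by (rule lin_maps_add_maps[OF 1])
  show "\<And>p x. p \<in> Ob Q \<Longrightarrow> x \<in> El X p \<Longrightarrow> h p x \<in> El Y p"
    by (rule add_maps_closed[OF 2])
  show "\<And>p x y. p \<in> Ob Q \<Longrightarrow> x \<in> El X p \<Longrightarrow> y \<in> El X p \<Longrightarrow>
       h p (x \<oplus>\<^bsub>fobj X p\<^esub> y) = h p x \<oplus>\<^bsub>fobj Y p\<^esub> h p y"
    by (rule add_maps_add[OF 2])
qed

lemma nat_trans_comp:
  assumes g: "g \<in> NT Y Z" and h: "h \<in> NT X Y"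
  shows "(\<lambda>p x. g p (h p x)) \<in> NT X Z"
  unfolding nat_trans_def mem_Collect_eq
proof (intro conjI ballI)
  show "(\<lambda>x. g p (h p x)) \<in> lin_maps k (fobj X p) (fobj Z p)" if "p \<in> Ob Q" for p
    by (rule lin_maps_comp[OF nat_lin[OF g that] nat_lin[OF h that]])
  show "g q (h q (fmor X p q f x)) = fmor Z p q f (g p (h p x))"
    if "p \<in> Ob Q" "q \<in> Ob Q" "f \<in> Mor Q p q" "x \<in> El X p" for p q f x
    using nat_natural[OF h that] nat_natural[OF g that(1-3) nat_closed[OF h that(1,4)]] by simp
qed

lemma nat_zero:
  assumes "X \<in> QMod k Q" "Y \<in> QMod k Q" "h \<in> NT X Y" "p \<in> Ob Q"
  shows "h p \<zero>\<^bsub>fobj X p\<^esub> = \<zero>\<^bsub>fobj Y p\<^esub>"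
  by (rule add_maps_zero[OF QMod_ag[OF assms(1,4)] QMod_ag[OF assms(2,4)] nat_add_maps[OF assms(3,4)]])

lemma nat_minus:
  assumes "X \<in> QMod k Q" "Y \<in> QMod k Q" "h \<in> NT X Y" "p \<in> Ob Q"
    "x \<in> El X p" "y \<in> El X p"
  shows "h p (x \<ominus>\<^bsub>fobj X p\<^esub> y) = h p x \<ominus>\<^bsub>fobj Y p\<^esub> h p y"
  by (rule add_maps_minus[OF QMod_ag[OF assms(1,4)] QMod_ag[OF assms(2,4)] nat_add_maps[OF assms(3,4)] assms(5,6)])

end

section \<open>Representable, sub-, free, transported and dual functors\<close>

definition hom_fun :: "('k, 'o, 'm) lincat \<Rightarrow> 'o \<Rightarrow> ('o, 'm, 'k, 'm) modfun" where
  "hom_fun Q q = \<lparr>fobj = Hom Q q, fmor = Comp Q q\<rparr>"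

definition sub_fun :: "('o, 'm, 'a, 'x) modfun \<Rightarrow> ('o \<Rightarrow> 'x set) \<Rightarrow> ('o, 'm, 'a, 'x) modfun" where
  "sub_fun X U = \<lparr>fobj = (\<lambda>p. (fobj X p)\<lparr>carrier := U p\<rparr>), fmor = fmor X\<rparr>"

definition free_fun :: "('k, 'o, 'm) lincat \<Rightarrow> 'i set \<Rightarrow> ('i \<Rightarrow> 'o) \<Rightarrow> ('o, 'm, 'k, 'i \<Rightarrow> 'm) modfun" where
  "free_fun Q I b = \<lparr>fobj = (\<lambda>p. dsum_module I (\<lambda>i. Hom Q (b i) p)),
     fmor = (\<lambda>p q f c. \<lambda>i\<in>I. Comp Q (b i) p q f (c i))\<rparr>"

definition transport_fun :: "('o \<Rightarrow> 'x \<Rightarrow> 'y) \<Rightarrow> ('o, 'm, 'k, 'x) modfun \<Rightarrow> ('o, 'm, 'k, 'y) modfun" where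
  "transport_fun \<iota> X = \<lparr>fobj = (\<lambda>p. transport (\<iota> p) (fobj X p)),
     fmor = (\<lambda>p q f y. \<iota> q (fmor X p q f (inv_into (El X p) (\<iota> p) y)))\<rparr>"

text \<open>\<open>char_fun\<close> is the Pontryagin dual \<open>Hom\<^sub>\<int>(X(-), \<rat>/\<int>)\<close>, a functor on the opposite category.\<close>

definition char_fun :: "('o, 'm, 'k, 'x) modfun \<Rightarrow> ('o, 'm, 'k, 'x \<Rightarrow> qz) modfun" where
  "char_fun X = \<lparr>fobj = (\<lambda>p. \<lparr>carrier = chars (fobj X p) \<inter> extensional (El X p),
       mult = undefined, one = undefined, zero = (\<lambda>x\<in>El X p. 0),
       add = (\<lambda>\<chi> \<psi>. \<lambda>x\<in>El X p. \<chi> x + \<psi> x),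
       smult = (\<lambda>a \<chi>. \<lambda>x\<in>El X p. \<chi> (a \<odot>\<^bsub>fobj X p\<^esub> x))\<rparr>),
     fmor = (\<lambda>p q f \<chi>. \<lambda>x\<in>El X q. \<chi> (fmor X q p f x))\<rparr>"

lemma hom_fun_simps [simp]: "fobj (hom_fun Q q) = Hom Q q" "fmor (hom_fun Q q) = Comp Q q"
  by (auto simp: hom_fun_def)

lemma sub_fun_simps [simp]: "fobj (sub_fun X U) p = (fobj X p)\<lparr>carrier := U p\<rparr>" "fmor (sub_fun X U) = fmor X"
  by (auto simp: sub_fun_def)

lemma free_fun_simps [simp]: "fobj (free_fun Q I b) p = dsum_module I (\<lambda>i. Hom Q (b i) p)"
  "fmor (free_fun Q I b) p q f c = (\<lambda>i\<in>I. Comp Q (b i) p q f (c i))"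
  by (auto simp: free_fun_def)

lemma transport_fun_simps [simp]: "fobj (transport_fun \<iota> X) p = transport (\<iota> p) (fobj X p)"
  "fmor (transport_fun \<iota> X) p q f y = \<iota> q (fmor X p q f (inv_into (El X p) (\<iota> p) y))"
  by (auto simp: transport_fun_def)

lemma char_fun_simps:
  "El (char_fun X) p = chars (fobj X p) \<inter> extensional (El X p)"
  "\<zero>\<^bsub>fobj (char_fun X) p\<^esub> = (\<lambda>x\<in>El X p. 0)"
  "\<chi> \<oplus>\<^bsub>fobj (char_fun X) p\<^esub> \<psi> = (\<lambda>x\<in>El X p. \<chi> x + \<psi> x)"
  "a \<odot>\<^bsub>fobj (char_fun X) p\<^esub> \<chi> = (\<lambda>x\<in>El X p. \<chi> (a \<odot>\<^bsub>fobj X p\<^esub> x))"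
  "fmor (char_fun X) p q f \<chi> = (\<lambda>x\<in>El X q. \<chi> (fmor X q p f x))"
  by (auto simp: char_fun_def)

lemma op_cat_simps [simp]: "Ob (op_cat Q) = Ob Q" "Hom (op_cat Q) p q = Hom Q q p"
  "Comp (op_cat Q) p q s g f = Comp Q s q p f g" "Ide (op_cat Q) = Ide Q" "op_cat (op_cat Q) = Q"
  by (auto simp: op_cat_def)

context preadditive
begin

lemma op_preadditive: "preadditive k (op_cat Q)"
proof (rule preadditive.intro)
  show "(\<lambda>f. Comp (op_cat Q) p q s g f) \<in> lin_maps k (Hom (op_cat Q) p q) (Hom (op_cat Q) p s)"
    if "p \<in> Ob (op_cat Q)" "q \<in> Ob (op_cat Q)" "s \<in> Ob (op_cat Q)" "g \<in> Mor (op_cat Q) q s" for p q s g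
    using comp_linear_left[of s q p g] that by simp
  show "(\<lambda>g. Comp (op_cat Q) p q s g f) \<in> lin_maps k (Hom (op_cat Q) q s) (Hom (op_cat Q) p s)"
    if "p \<in> Ob (op_cat Q)" "q \<in> Ob (op_cat Q)" "s \<in> Ob (op_cat Q)" "f \<in> Mor (op_cat Q) p q" for p q s f
    using comp_linear_right[of s q p f] that by simp
qed (auto simp: base_cring hom_module ide_closed comp_ide comp_assoc)

lemma hom_fun_QMod: "q \<in> Ob Q \<Longrightarrow> hom_fun Q q \<in> QMod k Q"
  by (rule QModI) (auto simp: hom_lm comp_ide comp_linear_right comp_linear_left comp_assoc)

lemma sub_fun_QMod:
  assumes X: "X \<in> QMod k Q" and U: "\<And>p. p \<in> Ob Q \<Longrightarrow> submodule (U p) k (fobj X p)"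
    and cl: "\<And>p q f u. \<lbrakk>p \<in> Ob Q; q \<in> Ob Q; f \<in> Mor Q p q; u \<in> U p\<rbrakk> \<Longrightarrow> fmor X p q f u \<in> U q"
  shows "sub_fun X U \<in> QMod k Q"
proof -
  have Uc: "u \<in> El X p" if "p \<in> Ob Q" "u \<in> U p" for p u
    using submoduleD(1)[OF QMod_lm[OF X] U] that by blast
  show ?thesis
  proof (rule QModI)
    show "fmor (sub_fun X U) p q f \<in> lin_maps k (fobj (sub_fun X U) p) (fobj (sub_fun X U) q)"
      if "p \<in> Ob Q" "q \<in> Ob Q" "f \<in> Mor Q p q" for p q f
      using that QMod_fmor[OF X that] cl[OF that] Uc by (auto simp: lin_maps_def Pi_iff)
    show "(\<lambda>f. fmor (sub_fun X U) p q f x) \<in> lin_maps k (Hom Q p q) (fobj (sub_fun X U) q)"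
      if "p \<in> Ob Q" "q \<in> Ob Q" "x \<in> El (sub_fun X U) p" for p q x
      using that QMod_lin[OF X that(1,2), of x] cl[OF that(1,2)] Uc by (auto simp: lin_maps_def Pi_iff)
  qed (use Uc QMod_ide[OF X] QMod_comp[OF X] left_module_submodule[OF QMod_lm[OF X] U] in auto)
qed

lemma sub_fun_incl:
  assumes "X \<in> QMod k Q" "\<And>p. p \<in> Ob Q \<Longrightarrow> submodule (U p) k (fobj X p)"
  shows "(\<lambda>p x. x) \<in> NT (sub_fun X U) X"
  using submoduleD(1)[OF QMod_lm[OF assms(1)] assms(2)] by (auto simp: nat_trans_def lin_maps_def)

lemma free_family: "\<forall>i\<in>I. b i \<in> Ob Q \<Longrightarrow> p \<in> Ob Q \<Longrightarrow> \<forall>i\<in>I. left_module k (Hom Q (b i) p)"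
  by (simp add: hom_lm)

lemma free_fun_QMod:
  assumes b: "\<forall>i\<in>I. b i \<in> Ob Q" shows "free_fun Q I b \<in> QMod k Q"
proof (rule QModI)
  show "left_module k (fobj (free_fun Q I b) p)" if "p \<in> Ob Q" for p
    using dsum_left_module[OF k_ring free_family[OF b that]] by simp
  show "fmor (free_fun Q I b) p p (Ide Q p) x = x" if p: "p \<in> Ob Q" and x: "x \<in> El (free_fun Q I b) p" for p x
  proof -
    have x: "x \<in> carrier (dsum_module I (\<lambda>i. Hom Q (b i) p))" using x by simp
    show ?thesis using dsumD(1)[OF x] dsumD(3)[OF x] comp_ide b p by (auto intro: extensionalityI[of _ I])
  qed
  have d1: "c i \<in> Mor Q (b i) p" if "c \<in> carrier (dsum_module I (\<lambda>i. Hom Q (b i) p))" "i \<in> I" for p c i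
    by (rule dsumD(1)[OF that])
  have Comp0: "Comp Q (b i) p q f \<zero>\<^bsub>Hom Q (b i) p\<^esub> = \<zero>\<^bsub>Hom Q (b i) q\<^esub>"
    if "p \<in> Ob Q" "q \<in> Ob Q" "f \<in> Mor Q p q" "i \<in> I" for p q f i
    using lin_maps_zero[OF hom_ag hom_ag comp_linear_right] b that by blast
  have Comp0': "Comp Q (b i) p q \<zero>\<^bsub>Hom Q p q\<^esub> f = \<zero>\<^bsub>Hom Q (b i) q\<^esub>"
    if "p \<in> Ob Q" "q \<in> Ob Q" "f \<in> Mor Q (b i) p" "i \<in> I" for p q f i
    using lin_maps_zero[OF hom_ag hom_ag comp_linear_left] b that by blast
  have cl: "(\<lambda>i\<in>I. Comp Q (b i) p q f (c i)) \<in> carrier (dsum_module I (\<lambda>i. Hom Q (b i) q))"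
    if pq: "p \<in> Ob Q" "q \<in> Ob Q" and f: "f \<in> Mor Q p q" and c: "c \<in> carrier (dsum_module I (\<lambda>i. Hom Q (b i) p))" for p q f c
  proof -
    have "{i \<in> I. Comp Q (b i) p q f (c i) \<noteq> \<zero>\<^bsub>Hom Q (b i) q\<^esub>} \<subseteq> dsupp I (\<lambda>i. Hom Q (b i) p) c"
      using Comp0[OF pq f] by auto
    from finite_subset[OF this dsumD(2)[OF c]] show ?thesis
      using dsumD(1)[OF c] pq f b by (auto simp: dsum_simps comp_closed cong: conj_cong)
  qed
  show "fmor (free_fun Q I b) p q f \<in> lin_maps k (fobj (free_fun Q I b) p) (fobj (free_fun Q I b) q)"
    if pq: "p \<in> Ob Q" "q \<in> Ob Q" "f \<in> Mor Q p q" for p q f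
    using cl[OF pq] b pq
    by (auto simp: lin_maps_def dsum_simps(2-) fun_eq_iff d1 lin_maps_add[OF comp_linear_right]
        lin_maps_smult[OF comp_linear_right])
  show "(\<lambda>f. fmor (free_fun Q I b) p q f x) \<in> lin_maps k (Hom Q p q) (fobj (free_fun Q I b) q)"
    if pq: "p \<in> Ob Q" "q \<in> Ob Q" and x: "x \<in> El (free_fun Q I b) p" for p q x
    using cl[OF pq] b pq x
    by (auto simp: lin_maps_def dsum_simps(2-) fun_eq_iff d1 lin_maps_add[OF comp_linear_left]
        lin_maps_smult[OF comp_linear_left])
  show "fmor (free_fun Q I b) p s (Comp Q p q s g f) x = fmor (free_fun Q I b) q s g (fmor (free_fun Q I b) p q f x)"
    if "p \<in> Ob Q" "q \<in> Ob Q" "s \<in> Ob Q" "f \<in> Mor Q p q" "g \<in> Mor Q q s"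
      "x \<in> El (free_fun Q I b) p" for p q s f g x
    using that b by (auto simp: fun_eq_iff d1 comp_assoc)
qed

lemma transport_fun_QMod:
  assumes X: "X \<in> QMod k Q" and \<iota>: "\<And>p. p \<in> Ob Q \<Longrightarrow> inj_on (\<iota> p) (El X p)"
  shows "transport_fun \<iota> X \<in> QMod k Q" "\<iota> \<in> NT X (transport_fun \<iota> X)"
    "(\<lambda>p. inv_into (El X p) (\<iota> p)) \<in> NT (transport_fun \<iota> X) X"
proof -
  note t = transport_lin_maps[OF QMod_lm[OF X] \<iota>]
  note c = fmor_closed[OF X]
  show 1: "transport_fun \<iota> X \<in> QMod k Q"
  proof (rule QModI)
    show "left_module k (fobj (transport_fun \<iota> X) p)" if "p \<in> Ob Q" for p
      using transport_left_module[OF QMod_lm[OF X that] \<iota>[OF that]] by simp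
    show "fmor (transport_fun \<iota> X) p q f \<in> lin_maps k (fobj (transport_fun \<iota> X) p) (fobj (transport_fun \<iota> X) q)"
      if "p \<in> Ob Q" "q \<in> Ob Q" "f \<in> Mor Q p q" for p q f
      using lin_maps_comp[OF t(1)[OF that(2,2)] lin_maps_comp[OF QMod_fmor[OF X that] t(2)[OF that(1,1)]]]
      by (simp add: transport_fun_def)
    show "(\<lambda>f. fmor (transport_fun \<iota> X) p q f x) \<in> lin_maps k (Hom Q p q) (fobj (transport_fun \<iota> X) q)"
      if "p \<in> Ob Q" "q \<in> Ob Q" "x \<in> El (transport_fun \<iota> X) p" for p q x
    proof -
      have "inv_into (El X p) (\<iota> p) x \<in> El X p"
        using that by (auto simp: transport_simps intro: inv_into_into)
      thus ?thesis using lin_maps_comp[OF t(1)[OF that(2,2)] QMod_lin[OF X that(1,2)]]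
        by (simp add: transport_fun_def)
    qed
  qed (use \<iota> c QMod_ide[OF X] QMod_comp[OF X] in \<open>auto simp: transport_simps\<close>)
  show "\<iota> \<in> NT X (transport_fun \<iota> X)"
    using t(1) \<iota> by (auto simp: nat_trans_def)
  show "(\<lambda>p. inv_into (El X p) (\<iota> p)) \<in> NT (transport_fun \<iota> X) X"
    using t(2) \<iota> c by (auto simp: nat_trans_def transport_simps)
qed

lemma char_fun_QMod:
  assumes X: "X \<in> QMod k Q" shows "char_fun X \<in> QMod k (op_cat Q)"
proof -
  interpret op: preadditive k "op_cat Q" by (rule op_preadditive)
  note ag = QMod_ag[OF X] and lm = QMod_lm[OF X]
  note am = ag_add_closed[OF ag]
  have cl: "(\<lambda>x\<in>El X p. \<chi> (h x)) \<in> chars (fobj X p)"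
    if "p \<in> Ob Q" "h \<in> add_maps (fobj X p) M" "\<chi> \<in> chars M" for p h \<chi> and M :: "('k, 'x) module"
    by (rule add_maps_cong[OF ag[OF that(1)] add_maps_comp[OF that(3,2)]]) simp
  show ?thesis
  proof (rule op.QModI; (unfold op_cat_simps)?)
    fix p assume p: "p \<in> Ob Q"
    show "left_module k (fobj (char_fun X) p)"
    proof (rule left_moduleI[OF k_ring])
      show "abelian_group (fobj (char_fun X) p)"
      proof (rule abelian_groupI)
        show "\<exists>y\<in>El (char_fun X) p. y \<oplus>\<^bsub>fobj (char_fun X) p\<^esub> \<chi> = \<zero>\<^bsub>fobj (char_fun X) p\<^esub>"
          if "\<chi> \<in> El (char_fun X) p" for \<chi>
          using that am[OF p] by (intro bexI[of _ "\<lambda>x\<in>El X p. - \<chi> x"])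
            (auto simp: char_fun_simps add_maps_def)
      qed (use am[OF p] in \<open>auto simp: char_fun_simps add_maps_def fun_eq_iff extensional_def add_ac\<close>)
      show "a \<odot>\<^bsub>fobj (char_fun X) p\<^esub> \<chi> \<in> El (char_fun X) p"
        if "a \<in> carrier k" "\<chi> \<in> El (char_fun X) p" for a \<chi>
        using cl[OF p left_module_smult_add_maps[OF lm[OF p] that(1)]] that by (auto simp: char_fun_simps)
      \<comment> \<open>The scalars act inside the argument of the character, which reverses
        products; commutativity of \<open>k\<close> restores the order.\<close>
      show "(a \<otimes>\<^bsub>k\<^esub> b) \<odot>\<^bsub>fobj (char_fun X) p\<^esub> \<chi> = a \<odot>\<^bsub>fobj (char_fun X) p\<^esub> (b \<odot>\<^bsub>fobj (char_fun X) p\<^esub> \<chi>)"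
        if "a \<in> carrier k" "b \<in> carrier k" "\<chi> \<in> El (char_fun X) p" for a b \<chi>
        using that cring.cring_simprules(14)[OF base_cring that(1,2)]
        by (auto simp: char_fun_simps fun_eq_iff left_module.lsmult_closed[OF lm[OF p]] left_module.lsmult_assoc[OF lm[OF p], symmetric])
    qed (auto simp: char_fun_simps fun_eq_iff extensional_def left_module.lsmult_closed[OF lm[OF p]]
        left_module.lsmult_l_distr[OF lm[OF p]] left_module.lsmult_one[OF lm[OF p]] add_maps_add am[OF p])
    show "fmor (char_fun X) p p (Ide Q p) \<chi> = \<chi>" if "\<chi> \<in> El (char_fun X) p" for \<chi>
      using that QMod_ide[OF X p] by (auto simp: char_fun_simps fun_eq_iff extensional_def)
    fix q assume q: "q \<in> Ob Q"
    have fcl: "fmor (char_fun X) p q f \<chi> \<in> El (char_fun X) q"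
      if "f \<in> Mor Q q p" "\<chi> \<in> El (char_fun X) p" for f \<chi>
      using cl[OF q fmor_add_maps[OF X q p that(1)]] that by (auto simp: char_fun_simps)
    show "fmor (char_fun X) p q f \<in> lin_maps k (fobj (char_fun X) p) (fobj (char_fun X) q)"
      if "f \<in> Mor Q q p" for f
      using fcl[OF that] that fmor_closed[OF X q p that] fmor_smult[OF X q p that]
      by (auto simp: lin_maps_def char_fun_simps(2-) fun_eq_iff left_module.lsmult_closed[OF lm[OF q]])
    show "(\<lambda>f. fmor (char_fun X) p q f \<chi>) \<in> lin_maps k (Hom Q q p) (fobj (char_fun X) q)"
      if "\<chi> \<in> El (char_fun X) p" for \<chi>
      using fcl that fmor_closed[OF X q p] fmor_add_arg[OF X q p] fmor_smult_arg[OF X q p] fmor_smult[OF X q p]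
      by (auto simp: lin_maps_def char_fun_simps fun_eq_iff left_module.lsmult_closed[OF lm[OF q]] add_maps_add)
    show "fmor (char_fun X) p s (Comp Q s q p f g) \<chi> = fmor (char_fun X) q s g (fmor (char_fun X) p q f \<chi>)"
      if "s \<in> Ob Q" "f \<in> Mor Q q p" "g \<in> Mor Q s q" "\<chi> \<in> El (char_fun X) p" for s f g \<chi>
      using that QMod_comp[OF X that(1) q p that(3,2)] fmor_closed[OF X that(1) q that(3)]
      by (auto simp: char_fun_simps fun_eq_iff)
  qed
qed

section \<open>The universal property of free functors, from the Yoneda lemma\<close>

definition free_lift :: "'i set \<Rightarrow> ('i \<Rightarrow> 'o) \<Rightarrow> ('o, 'm, 'k, 'y) modfun \<Rightarrow> ('i \<Rightarrow> 'y) \<Rightarrow> 'o \<Rightarrow> ('i \<Rightarrow> 'm) \<Rightarrow> 'y" where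
  "free_lift I b Y y p = dsum_lift (fobj Y p) I (\<lambda>i. Hom Q (b i) p) (\<lambda>i f. fmor Y (b i) p f (y i))"

lemma free_fun_ext:
  assumes b: "\<forall>i\<in>I. b i \<in> Ob Q" and p: "p \<in> Ob Q" and N: "abelian_group N"
    and g: "g \<in> add_maps (fobj (free_fun Q I b) p) N" and h: "h \<in> add_maps (fobj (free_fun Q I b) p) N"
    and eq: "\<And>i f. i \<in> I \<Longrightarrow> f \<in> Mor Q (b i) p \<Longrightarrow>
      g (dsum_inj I (\<lambda>i. Hom Q (b i) p) i f) = h (dsum_inj I (\<lambda>i. Hom Q (b i) p) i f)"
    and c: "c \<in> El (free_fun Q I b) p"
  shows "g c = h c"
  by (rule dsum_ext[OF family_abelian_group[OF free_family[OF b p]] N g[unfolded free_fun_simps]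
    h[unfolded free_fun_simps] eq c[unfolded free_fun_simps]])

lemma free_inj_closed:
  assumes b: "\<forall>i\<in>I. b i \<in> Ob Q" and p: "p \<in> Ob Q" and i: "i \<in> I" and f: "f \<in> Mor Q (b i) p"
  shows "dsum_inj I (\<lambda>i. Hom Q (b i) p) i f \<in> El (free_fun Q I b) p"
  using dsum_inj_closed[OF family_abelian_group[OF free_family[OF b p]], of f i] f by simp

lemma free_inj_fmor:
  assumes b: "\<forall>i\<in>I. b i \<in> Ob Q" and p: "p \<in> Ob Q" "q \<in> Ob Q" and i: "i \<in> I"
    and f: "f \<in> Mor Q (b i) p" and g: "g \<in> Mor Q p q"
  shows "fmor (free_fun Q I b) p q g (dsum_inj I (\<lambda>i. Hom Q (b i) p) i f) =
    dsum_inj I (\<lambda>i. Hom Q (b i) q) i (Comp Q (b i) p q g f)"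
  using lin_maps_zero[OF hom_ag hom_ag comp_linear_right] b p g
  by (auto simp: fun_eq_iff)

lemma free_lift:
  assumes b: "\<forall>i\<in>I. b i \<in> Ob Q" and Y: "Y \<in> QMod k Q" and y: "\<forall>i\<in>I. y i \<in> El Y (b i)"
  shows free_lift_nat: "free_lift I b Y y \<in> NT (free_fun Q I b) Y"
    and free_lift_gen: "\<And>p i f. p \<in> Ob Q \<Longrightarrow> i \<in> I \<Longrightarrow> f \<in> Mor Q (b i) p \<Longrightarrow>
      free_lift I b Y y p (dsum_inj I (\<lambda>i. Hom Q (b i) p) i f) = fmor Y (b i) p f (y i)"
proof -
  have hA: "\<forall>i\<in>I. (\<lambda>f. fmor Y (b i) p f (y i)) \<in> add_maps (Hom Q (b i) p) (fobj Y p)" if "p \<in> Ob Q" for p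
    using lin_maps_add_maps[OF QMod_lin[OF Y _ that]] b y by blast
  have add: "free_lift I b Y y p \<in> add_maps (fobj (free_fun Q I b) p) (fobj Y p)" if "p \<in> Ob Q" for p
    unfolding free_lift_def free_fun_simps
    by (rule dsum_lift_add_maps[OF family_abelian_group[OF free_family[OF b that]] QMod_ag[OF Y that] hA[OF that]])
  show gen: "free_lift I b Y y p (dsum_inj I (\<lambda>i. Hom Q (b i) p) i f) = fmor Y (b i) p f (y i)"
    if "p \<in> Ob Q" "i \<in> I" "f \<in> Mor Q (b i) p" for p i f
    unfolding free_lift_def
    using dsum_lift_inj[OF family_abelian_group[OF free_family[OF b that(1)]] QMod_ag[OF Y that(1)] hA[OF that(1)] that(2,3)] .
  note F = free_fun_QMod[OF b]
  show "free_lift I b Y y \<in> NT (free_fun Q I b) Y"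
  proof (rule nat_transI[OF F Y add])
    show "free_lift I b Y y q (fmor (free_fun Q I b) p q f c) = fmor Y p q f (free_lift I b Y y p c)"
      if pq: "p \<in> Ob Q" "q \<in> Ob Q" "f \<in> Mor Q p q" and c: "c \<in> El (free_fun Q I b) p" for p q f c
    proof (rule free_fun_ext[OF b pq(1) QMod_ag[OF Y pq(2)] _ _ _ c])
      show "(\<lambda>c. free_lift I b Y y q (fmor (free_fun Q I b) p q f c)) \<in> add_maps (fobj (free_fun Q I b) p) (fobj Y q)"
        by (rule add_maps_comp[OF add[OF pq(2)] fmor_add_maps[OF F pq]])
      show "(\<lambda>c. fmor Y p q f (free_lift I b Y y p c)) \<in> add_maps (fobj (free_fun Q I b) p) (fobj Y q)"
        by (rule add_maps_comp[OF fmor_add_maps[OF Y pq] add[OF pq(1)]])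
      show "free_lift I b Y y q (fmor (free_fun Q I b) p q f (dsum_inj I (\<lambda>i. Hom Q (b i) p) i g)) =
         fmor Y p q f (free_lift I b Y y p (dsum_inj I (\<lambda>i. Hom Q (b i) p) i g))"
        if "i \<in> I" "g \<in> Mor Q (b i) p" for i g
        unfolding free_inj_fmor[OF b pq(1,2) that pq(3)]
        using gen[OF pq(1) that] gen[OF pq(2) that(1) comp_closed[OF _ pq(1,2) that(2) pq(3)]]
          QMod_comp[OF Y _ pq(1,2) that(2) pq(3)] b y that by simp
    qed
  qed
qed

text \<open>The \<open>i\<close>-th generator is the identity of \<open>b i\<close> placed in
  summand \<open>i\<close>; every other element of that summand is a morphism applied to it.\<close>

lemma nat_trans_ext_free:
  assumes b: "\<forall>i\<in>I. b i \<in> Ob Q" and Y: "Y \<in> QMod k Q"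
    and g: "g \<in> NT (free_fun Q I b) Y" and h: "h \<in> NT (free_fun Q I b) Y"
    and eq: "\<And>i. i \<in> I \<Longrightarrow> g (b i) (dsum_inj I (\<lambda>j. Hom Q (b j) (b i)) i (Ide Q (b i))) =
      h (b i) (dsum_inj I (\<lambda>j. Hom Q (b j) (b i)) i (Ide Q (b i)))"
    and p: "p \<in> Ob Q" and c: "c \<in> El (free_fun Q I b) p"
  shows "g p c = h p c"
proof (rule free_fun_ext[OF b p QMod_ag[OF Y p] nat_add_maps[OF g p] nat_add_maps[OF h p] _ c])
  fix i f assume i: "i \<in> I" and f: "f \<in> Mor Q (b i) p"
  have bi: "b i \<in> Ob Q" using b i by blast
  let ?e = "dsum_inj I (\<lambda>j. Hom Q (b j) (b i)) i (Ide Q (b i))"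
  have e: "?e \<in> El (free_fun Q I b) (b i)" by (rule free_inj_closed[OF b bi i ide_closed[OF bi]])
  have "dsum_inj I (\<lambda>i. Hom Q (b i) p) i f = fmor (free_fun Q I b) (b i) p f ?e"
    using free_inj_fmor[OF b bi p i ide_closed[OF bi] f] comp_ide[OF bi p f] by simp
  thus "g p (dsum_inj I (\<lambda>i. Hom Q (b i) p) i f) = h p (dsum_inj I (\<lambda>i. Hom Q (b i) p) i f)"
    using nat_natural[OF g bi p f e] nat_natural[OF h bi p f e] eq[OF i] by simp
qed

text \<open>Choose preimages of the images of the generators. The values of \<open>E\<close> and
  \<open>B\<close> may live on any types here.\<close>

lemma free_fun_projective:
  assumes b: "\<forall>i\<in>I. b i \<in> Ob Q" and E: "E \<in> QMod k Q" and B: "B \<in> QMod k Q"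
    and g: "g \<in> NT E B" and h: "h \<in> NT (free_fun Q I b) B"
    and surj: "\<forall>p \<in> Ob Q. g p ` El E p = El B p"
  shows "\<exists>l \<in> NT (free_fun Q I b) E. \<forall>p \<in> Ob Q. \<forall>c \<in> El (free_fun Q I b) p. g p (l p c) = h p c"
proof -
  let ?e = "\<lambda>i. dsum_inj I (\<lambda>j. Hom Q (b j) (b i)) i (Ide Q (b i))"
  have e: "?e i \<in> El (free_fun Q I b) (b i)" if "i \<in> I" for i
    using free_inj_closed[OF b _ that ide_closed] b that by blast
  have "\<forall>i\<in>I. \<exists>y \<in> El E (b i). g (b i) y = h (b i) (?e i)"
  proof
    fix i assume i: "i \<in> I"
    hence bi: "b i \<in> Ob Q" using b by blast
    have "h (b i) (?e i) \<in> g (b i) ` El E (b i)"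
      using surj bi nat_closed[OF h bi e[OF i]] by auto
    thus "\<exists>y \<in> El E (b i). g (b i) y = h (b i) (?e i)" by auto
  qed
  then obtain y where y: "\<forall>i\<in>I. y i \<in> El E (b i)" "\<And>i. i \<in> I \<Longrightarrow> g (b i) (y i) = h (b i) (?e i)" by metis
  note l = free_lift_nat[OF b E y(1)]
  have gl: "(\<lambda>p c. g p (free_lift I b E y p c)) \<in> NT (free_fun Q I b) B"
    by (rule nat_trans_comp[OF g l])
  have "g p (free_lift I b E y p c) = h p c" if "p \<in> Ob Q" "c \<in> El (free_fun Q I b) p" for p c
  proof (rule nat_trans_ext_free[OF b B gl h _ that])
    fix i assume i: "i \<in> I"
    have bi: "b i \<in> Ob Q" using b i by blast
    show "g (b i) (free_lift I b E y (b i) (?e i)) = h (b i) (?e i)"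
      using free_lift_gen[OF b E y(1) bi i ide_closed[OF bi]] y i QMod_ide[OF E bi] by simp
  qed
  thus ?thesis using l by blast
qed

end

section \<open>The pseudo-radical and extension of natural transformations\<close>

lemma dsum_tuple_lin_maps:
  assumes g: "\<And>i. i \<in> I \<Longrightarrow> g i \<in> lin_maps R V (M i)"
    and fin: "\<And>v. v \<in> carrier V \<Longrightarrow> finite {i \<in> I. g i v \<noteq> \<zero>\<^bsub>M i\<^esub>}"
  shows "(\<lambda>v. \<lambda>i\<in>I. g i v) \<in> lin_maps R V (dsum_module I M)"
proof -
  have "(\<lambda>i\<in>I. g i v) \<in> carrier (dsum_module I M)" if "v \<in> carrier V" for v
    using fin[OF that] lin_maps_closed[OF g that] by (auto simp: dsum_simps cong: conj_cong)
  thus ?thesis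
    by (auto simp: lin_maps_iff add_maps_def dsum_simps(2-) fun_eq_iff lin_maps_add[OF g]
        lin_maps_smult[OF g])
qed

text \<open>A natural transformation from \<open>r(p, -)\<close> to \<open>X\<close>. Only
  additivity is demanded; linearity is recovered in \<open>radical_family_lin_maps\<close>.\<close>

definition radical_family :: "('k, 'o, 'm) lincat \<Rightarrow> ('o \<Rightarrow> 'm set) \<Rightarrow> ('o, 'm, 'a, 'x) modfun \<Rightarrow> 'o \<Rightarrow> ('o \<Rightarrow> 'm \<Rightarrow> 'x) \<Rightarrow> bool" where
  "radical_family Q r X p \<phi> \<longleftrightarrow>
     (\<forall>q \<in> Ob Q. \<forall>f \<in> pseudo_radical Q r p q. \<phi> q f \<in> El X q) \<and>
     (\<forall>q \<in> Ob Q. \<forall>f \<in> pseudo_radical Q r p q. \<forall>g \<in> pseudo_radical Q r p q.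
        \<phi> q (f \<oplus>\<^bsub>Hom Q p q\<^esub> g) = \<phi> q f \<oplus>\<^bsub>fobj X q\<^esub> \<phi> q g) \<and>
     (\<forall>q \<in> Ob Q. \<forall>s \<in> Ob Q. \<forall>f \<in> pseudo_radical Q r p q. \<forall>g \<in> Mor Q q s.
        \<phi> s (Comp Q p q s g f) = fmor X q s g (\<phi> q f))"

lemmas rf_closed = radical_family_def[THEN iffD1, THEN conjunct1]
  and rf_add = radical_family_def[THEN iffD1, THEN conjunct2, THEN conjunct1]
  and rf_nat = radical_family_def[THEN iffD1, THEN conjunct2, THEN conjunct2]

text \<open>By Yoneda, elements of \<open>X p\<close> are the maps from \<open>Q(p, -)\<close> to
  \<open>X\<close>. So the condition says that every map from \<open>r(p, -)\<close> to
  \<open>X\<close> extends to \<open>Q(p, -)\<close>, and as \<open>Q(p, -)\<close> is projective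
  this is the vanishing of Ext^1 from the quotient \<open>S\<langle>p\<rangle>\<close> to
  \<open>X\<close>.\<close>

definition radical_injective :: "('k, 'o, 'm) lincat \<Rightarrow> ('o \<Rightarrow> 'm set) \<Rightarrow> ('o, 'm, 'a, 'x) modfun \<Rightarrow> bool" where
  "radical_injective Q r X \<longleftrightarrow> (\<forall>p \<in> Ob Q. \<forall>\<phi>. radical_family Q r X p \<phi> \<longrightarrow>
     (\<exists>x \<in> El X p. \<forall>q \<in> Ob Q. \<forall>f \<in> pseudo_radical Q r p q. \<phi> q f = fmor X p q f x))"

lemma radical_injectiveD:
  assumes "radical_injective Q r X" "p \<in> Ob Q"
    "\<And>q f. q \<in> Ob Q \<Longrightarrow> f \<in> pseudo_radical Q r p q \<Longrightarrow> \<phi> q f \<in> El X q"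
    "\<And>q f g. \<lbrakk>q \<in> Ob Q; f \<in> pseudo_radical Q r p q; g \<in> pseudo_radical Q r p q\<rbrakk> \<Longrightarrow>
      \<phi> q (f \<oplus>\<^bsub>Hom Q p q\<^esub> g) = \<phi> q f \<oplus>\<^bsub>fobj X q\<^esub> \<phi> q g"
    "\<And>q s f g. \<lbrakk>q \<in> Ob Q; s \<in> Ob Q; f \<in> pseudo_radical Q r p q; g \<in> Mor Q q s\<rbrakk> \<Longrightarrow>
      \<phi> s (Comp Q p q s g f) = fmor X q s g (\<phi> q f)"
  shows "\<exists>x \<in> El X p. \<forall>q \<in> Ob Q. \<forall>f \<in> pseudo_radical Q r p q. \<phi> q f = fmor X p q f x"
  using assms(1)[unfolded radical_injective_def radical_family_def, rule_format, OF assms(2), of \<phi>] assms(3-5) by blast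

text \<open>The hypotheses without the Serre functor. They are passed to the opposite category
  together (\<open>op_shape\<close>), so each result in this locale also yields its dual.\<close>

locale shape = preadditive k Q for k :: "'k ring" and Q :: "('k, 'o, 'm) lincat" +
  fixes r :: "'o \<Rightarrow> 'm set"
  assumes nontrivial: "\<one>\<^bsub>k\<^esub> \<noteq> \<zero>\<^bsub>k\<^esub>" and her: "hereditary_ring k"
    and homfin: "hom_finite k Q" and locbd: "locally_bounded Q"
    and retraction: "strong_retraction k Q r" and nilpotent: "nilpotent_ideal k Q (pseudo_radical Q r)"
begin

abbreviation "rad \<equiv> pseudo_radical Q r"

section \<open>The splitting of endomorphism modules and the ideal property of the
  pseudo-radical\<close>

lemma rad_self: "rad p p = r p" by (simp add: pseudo_radical_def)

lemma r_submodule: "q \<in> Ob Q \<Longrightarrow> submodule (r q) k (Hom Q q q)"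
  using retraction by (auto simp: strong_retraction_def)

lemma coef_exists:
  assumes q: "q \<in> Ob Q" and g: "g \<in> Mor Q q q"
  shows "\<exists>a \<in> carrier k. g \<ominus>\<^bsub>Hom Q q q\<^esub> a \<odot>\<^bsub>Hom Q q q\<^esub> Ide Q q \<in> r q"
proof -
  interpret H: left_module k "Hom Q q q" by (rule hom_lm[OF q q])
  have "g \<in> scalars k Q q <+>\<^bsub>Hom Q q q\<^esub> r q" using retraction q g by (auto simp: strong_retraction_def)
  then obtain a \<rho> where a: "a \<in> carrier k" "\<rho> \<in> r q" "g = a \<odot>\<^bsub>Hom Q q q\<^esub> Ide Q q \<oplus>\<^bsub>Hom Q q q\<^esub> \<rho>"
    by (auto simp: set_add_def set_mult_def scalars_def)
  have "\<rho> \<in> Mor Q q q" using submoduleD(1)[OF hom_lm[OF q q] r_submodule[OF q]] a(2) by blast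
  moreover have "a \<odot>\<^bsub>Hom Q q q\<^esub> Ide Q q \<in> Mor Q q q" using H.lsmult_closed[OF a(1) ide_closed[OF q]] .
  ultimately have "g \<ominus>\<^bsub>Hom Q q q\<^esub> a \<odot>\<^bsub>Hom Q q q\<^esub> Ide Q q = \<rho>"
    using a(3) by (simp add: H.minus_eq H.a_ac H.r_neg1 H.r_neg)
  thus ?thesis using a by (intro bexI[of _ a]) simp_all
qed

lemma coef_unique:
  assumes q: "q \<in> Ob Q" and g: "g \<in> Mor Q q q" and a: "a \<in> carrier k" and b: "b \<in> carrier k"
    and ga: "g \<ominus>\<^bsub>Hom Q q q\<^esub> a \<odot>\<^bsub>Hom Q q q\<^esub> Ide Q q \<in> r q" and gb: "g \<ominus>\<^bsub>Hom Q q q\<^esub> b \<odot>\<^bsub>Hom Q q q\<^esub> Ide Q q \<in> r q"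
  shows "a = b"
proof -
  interpret H: left_module k "Hom Q q q" by (rule hom_lm[OF q q])
  interpret k: ring k by (rule k_ring)
  let ?i = "Ide Q q" and ?H = "Hom Q q q"
  have i: "?i \<in> carrier ?H" by (rule ide_closed[OF q])
  have ai: "a \<odot>\<^bsub>?H\<^esub> ?i \<in> carrier ?H" "b \<odot>\<^bsub>?H\<^esub> ?i \<in> carrier ?H" using H.lsmult_closed i a b by auto
  have "(g \<ominus>\<^bsub>?H\<^esub> b \<odot>\<^bsub>?H\<^esub> ?i) \<ominus>\<^bsub>?H\<^esub> (g \<ominus>\<^bsub>?H\<^esub> a \<odot>\<^bsub>?H\<^esub> ?i) = a \<odot>\<^bsub>?H\<^esub> ?i \<ominus>\<^bsub>?H\<^esub> b \<odot>\<^bsub>?H\<^esub> ?i"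
    using g ai by (simp add: H.minus_eq H.minus_add H.a_ac H.r_neg1 H.r_neg2)
  also have "\<dots> = (a \<ominus>\<^bsub>k\<^esub> b) \<odot>\<^bsub>?H\<^esub> ?i"
    using add_maps_minus[OF k_ag H.abelian_group_axioms
        lin_maps_add_maps[OF left_module_smult_point[OF hom_lm[OF q q] i]], of a b] a b
    by (simp add: a_minus_def a_inv_self_module)
  finally have "(a \<ominus>\<^bsub>k\<^esub> b) \<odot>\<^bsub>?H\<^esub> ?i \<in> r q"
    using submoduleD(6)[OF hom_lm[OF q q] r_submodule[OF q] gb ga] by simp
  moreover have ab: "a \<ominus>\<^bsub>k\<^esub> b \<in> carrier k" using a b by simp
  moreover have "scalars k Q q \<inter> r q = {\<zero>\<^bsub>?H\<^esub>}" using retraction q by (auto simp: strong_retraction_def)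
  ultimately have z: "(a \<ominus>\<^bsub>k\<^esub> b) \<odot>\<^bsub>?H\<^esub> ?i = \<zero>\<^bsub>?H\<^esub>" unfolding scalars_def by blast
  \<comment> \<open>The retraction recovers a scalar from its multiple of the identity, so the
    scalar \<open>a - b\<close> must be zero.\<close>
  obtain \<rho> where \<rho>: "\<rho> \<in> forms k ?H" "\<And>x. x \<in> carrier k \<Longrightarrow> \<rho> (x \<odot>\<^bsub>?H\<^esub> ?i) = x"
    using bspec[OF conjunct1[OF retraction[unfolded strong_retraction_def]] q] by auto
  have "\<rho> \<zero>\<^bsub>?H\<^esub> = \<zero>\<^bsub>k\<^esub>"
    using lin_maps_zero[OF H.abelian_group_axioms k_ag \<rho>(1)] by simp
  hence "a \<ominus>\<^bsub>k\<^esub> b = \<zero>\<^bsub>k\<^esub>" using \<rho>(2)[OF ab] z by simp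
  thus ?thesis using ag_minus_eq_zero[OF ring.axioms(1)[OF k_ring] a b] by simp
qed

text \<open>The component of \<open>g\<close> along the identity in the decomposition of
  \<open>Q(q, q)\<close> as scalars plus \<open>r q\<close>; it identifies
  \<open>Q(q, q) / r q\<close> with \<open>k\<close>.\<close>

definition coef :: "'o \<Rightarrow> 'm \<Rightarrow> 'k" where
  "coef q g = (THE a. a \<in> carrier k \<and> g \<ominus>\<^bsub>Hom Q q q\<^esub> a \<odot>\<^bsub>Hom Q q q\<^esub> Ide Q q \<in> r q)"

lemma coef_eqI:
  assumes "q \<in> Ob Q" "g \<in> Mor Q q q" "a \<in> carrier k" "g \<ominus>\<^bsub>Hom Q q q\<^esub> a \<odot>\<^bsub>Hom Q q q\<^esub> Ide Q q \<in> r q"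
  shows "coef q g = a"
  unfolding coef_def using assms coef_unique by (intro the_equality) auto

lemma coef:
  assumes "q \<in> Ob Q" "g \<in> Mor Q q q"
  shows "coef q g \<in> carrier k" "g \<ominus>\<^bsub>Hom Q q q\<^esub> coef q g \<odot>\<^bsub>Hom Q q q\<^esub> Ide Q q \<in> r q"
proof -
  obtain a where "a \<in> carrier k" "g \<ominus>\<^bsub>Hom Q q q\<^esub> a \<odot>\<^bsub>Hom Q q q\<^esub> Ide Q q \<in> r q" using coef_exists[OF assms] by blast
  thus "coef q g \<in> carrier k" "g \<ominus>\<^bsub>Hom Q q q\<^esub> coef q g \<odot>\<^bsub>Hom Q q q\<^esub> Ide Q q \<in> r q" using coef_eqI[OF assms] by auto
qed

lemma r_closed: "q \<in> Ob Q \<Longrightarrow> g \<in> r q \<Longrightarrow> g \<in> Mor Q q q"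
  using submoduleD(1)[OF hom_lm r_submodule] by blast

lemma coef_lin_maps: assumes q: "q \<in> Ob Q" shows "coef q \<in> forms k (Hom Q q q)"
proof -
  interpret H: left_module k "Hom Q q q" by (rule hom_lm[OF q q])
  interpret k: cring k by (rule base_cring)
  let ?i = "Ide Q q" and ?H = "Hom Q q q"
  note D = submoduleD[OF hom_lm[OF q q] r_submodule[OF q]]
  have i: "?i \<in> carrier ?H" by (rule ide_closed[OF q])
  note sc = H.lsmult_closed[OF _ i]
  have "coef q (g \<oplus>\<^bsub>?H\<^esub> h) = coef q g \<oplus>\<^bsub>k\<^esub> coef q h" if g: "g \<in> carrier ?H" "h \<in> carrier ?H" for g h
  proof (rule coef_eqI[OF q])
    have "g \<oplus>\<^bsub>?H\<^esub> h \<ominus>\<^bsub>?H\<^esub> (coef q g \<oplus>\<^bsub>k\<^esub> coef q h) \<odot>\<^bsub>?H\<^esub> ?i =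
      (g \<ominus>\<^bsub>?H\<^esub> coef q g \<odot>\<^bsub>?H\<^esub> ?i) \<oplus>\<^bsub>?H\<^esub> (h \<ominus>\<^bsub>?H\<^esub> coef q h \<odot>\<^bsub>?H\<^esub> ?i)"
      using g coef[OF q] i sc by (simp add: H.lsmult_l_distr H.minus_eq H.minus_add H.a_ac)
    thus "g \<oplus>\<^bsub>?H\<^esub> h \<ominus>\<^bsub>?H\<^esub> (coef q g \<oplus>\<^bsub>k\<^esub> coef q h) \<odot>\<^bsub>?H\<^esub> ?i \<in> r q"
      using D(3)[OF coef(2)[OF q g(1)] coef(2)[OF q g(2)]] by simp
  qed (use g coef[OF q] in auto)
  moreover have "coef q (a \<odot>\<^bsub>?H\<^esub> g) = a \<otimes>\<^bsub>k\<^esub> coef q g" if a: "a \<in> carrier k" and g: "g \<in> carrier ?H" for a g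
  proof (rule coef_eqI[OF q])
    have "a \<odot>\<^bsub>?H\<^esub> g \<ominus>\<^bsub>?H\<^esub> (a \<otimes>\<^bsub>k\<^esub> coef q g) \<odot>\<^bsub>?H\<^esub> ?i = a \<odot>\<^bsub>?H\<^esub> (g \<ominus>\<^bsub>?H\<^esub> coef q g \<odot>\<^bsub>?H\<^esub> ?i)"
      using g a coef[OF q] i sc
        add_maps_minus[OF H.abelian_group_axioms H.abelian_group_axioms left_module_smult_add_maps[OF hom_lm[OF q q] a]]
      by (simp add: H.lsmult_assoc)
    thus "a \<odot>\<^bsub>?H\<^esub> g \<ominus>\<^bsub>?H\<^esub> (a \<otimes>\<^bsub>k\<^esub> coef q g) \<odot>\<^bsub>?H\<^esub> ?i \<in> r q"
      using D(4)[OF a coef(2)[OF q g]] by simp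
  qed (use a g coef[OF q] H.lsmult_closed in auto)
  ultimately show ?thesis using coef(1)[OF q] by (auto simp: lin_maps_def)
qed

lemma coef_ide: "q \<in> Ob Q \<Longrightarrow> coef q (Ide Q q) = \<one>\<^bsub>k\<^esub>"
proof -
  assume q: "q \<in> Ob Q"
  interpret H: left_module k "Hom Q q q" by (rule hom_lm[OF q q])
  show ?thesis
    by (rule coef_eqI[OF q ide_closed[OF q] H.R.one_closed])
      (use ide_closed[OF q] submoduleD(2)[OF hom_lm[OF q q] r_submodule[OF q]] in
        \<open>simp add: H.lsmult_one H.minus_eq H.r_neg\<close>)
qed

lemma coef_rad: "q \<in> Ob Q \<Longrightarrow> g \<in> r q \<Longrightarrow> coef q g = \<zero>\<^bsub>k\<^esub>"
proof -
  assume q: "q \<in> Ob Q" and g: "g \<in> r q"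
  interpret H: left_module k "Hom Q q q" by (rule hom_lm[OF q q])
  show ?thesis
    by (rule coef_eqI[OF q r_closed[OF q g] H.R.zero_closed])
      (use r_closed[OF q g] g left_module_zero_smult[OF hom_lm[OF q q] ide_closed[OF q]] in
        \<open>simp add: H.minus_eq a_inv_zero_ag[OF H.abelian_group_axioms]\<close>)
qed

lemma coef_zero_rad: "q \<in> Ob Q \<Longrightarrow> g \<in> Mor Q q q \<Longrightarrow> coef q g = \<zero>\<^bsub>k\<^esub> \<Longrightarrow> g \<in> r q"
proof -
  assume q: "q \<in> Ob Q" and g: "g \<in> Mor Q q q" and z: "coef q g = \<zero>\<^bsub>k\<^esub>"
  interpret H: left_module k "Hom Q q q" by (rule hom_lm[OF q q])
  show ?thesis using coef(2)[OF q g] z g left_module_zero_smult[OF hom_lm[OF q q] ide_closed[OF q]]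
    by (simp add: H.minus_eq a_inv_zero_ag[OF H.abelian_group_axioms])
qed

text \<open>The projection of \<open>Q(p, q)\<close> onto \<open>r(p, q)\<close> along the scalars.
  Composing with it turns maps given on the pseudo-radical into maps on the whole projective,
  finitely generated module \<open>Q(p, q)\<close>.\<close>

definition rproj :: "'o \<Rightarrow> 'o \<Rightarrow> 'm \<Rightarrow> 'm" where
  "rproj p q g = (if p = q then g \<ominus>\<^bsub>Hom Q q q\<^esub> coef q g \<odot>\<^bsub>Hom Q q q\<^esub> Ide Q q else g)"

lemma rad_submodule: assumes "p \<in> Ob Q" "q \<in> Ob Q" shows "submodule (rad p q) k (Hom Q p q)"
proof -
  interpret H: left_module k "Hom Q p q" by (rule hom_lm[OF assms])
  have "submodule (Mor Q p q) k (Hom Q p q)"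
    by (rule left_submoduleI[OF hom_lm[OF assms]]) (auto simp: H.lsmult_closed)
  thus ?thesis using r_submodule[OF assms(2)] by (simp add: pseudo_radical_def)
qed

lemma rad_closed: "p \<in> Ob Q \<Longrightarrow> q \<in> Ob Q \<Longrightarrow> f \<in> rad p q \<Longrightarrow> f \<in> Mor Q p q"
  using submoduleD(1)[OF hom_lm rad_submodule] by blast

lemma rproj_lin_maps:
  assumes "p \<in> Ob Q" "q \<in> Ob Q" shows "rproj p q \<in> lin_maps k (Hom Q p q) (Hom Q p q)"
proof (cases "p = q")
  case True
  have "(\<lambda>g. g \<ominus>\<^bsub>Hom Q q q\<^esub> coef q g \<odot>\<^bsub>Hom Q q q\<^esub> Ide Q q) \<in> lin_maps k (Hom Q q q) (Hom Q q q)"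
    by (rule lin_maps_diff[OF hom_lm[OF assms(2,2)] lin_maps_id
          lin_maps_comp[OF left_module_smult_point[OF hom_lm[OF assms(2,2)] ide_closed[OF assms(2)]] coef_lin_maps[OF assms(2)]]])
  thus ?thesis using True by (simp add: rproj_def[abs_def])
qed (simp add: lin_maps_id rproj_def[abs_def])

lemma rproj_rad: "p \<in> Ob Q \<Longrightarrow> q \<in> Ob Q \<Longrightarrow> g \<in> Mor Q p q \<Longrightarrow> rproj p q g \<in> rad p q"
  using coef(2) by (auto simp: rproj_def pseudo_radical_def)

lemma rproj_id: "p \<in> Ob Q \<Longrightarrow> q \<in> Ob Q \<Longrightarrow> g \<in> rad p q \<Longrightarrow> rproj p q g = g"
proof (cases "p = q")
  assume q: "q \<in> Ob Q" "g \<in> rad p q" and pq: "p = q"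
  interpret H: left_module k "Hom Q q q" by (rule hom_lm[OF q(1,1)])
  have g: "g \<in> r q" using q pq by (simp add: rad_self)
  show ?thesis using g coef_rad[OF q(1) g] r_closed[OF q(1) g] left_module_zero_smult[OF hom_lm[OF q(1,1)] ide_closed[OF q(1)]] pq
    by (simp add: rproj_def H.minus_eq a_inv_zero_ag[OF H.abelian_group_axioms])
qed (simp add: rproj_def)

lemma hom_decomp:
  assumes q: "q \<in> Ob Q" and g: "g \<in> Mor Q q q"
  shows "g = coef q g \<odot>\<^bsub>Hom Q q q\<^esub> Ide Q q \<oplus>\<^bsub>Hom Q q q\<^esub> rproj q q g"
proof -
  interpret H: left_module k "Hom Q q q" by (rule hom_lm[OF q q])
  show ?thesis using g H.lsmult_closed[OF coef(1)[OF q g] ide_closed[OF q]]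
    by (simp add: rproj_def H.minus_eq H.a_ac H.r_neg1 H.r_neg)
qed

lemma fmor_decomp:
  assumes X: "X \<in> QMod k Q" and q: "q \<in> Ob Q" and g: "g \<in> Mor Q q q" and x: "x \<in> El X q"
  shows "fmor X q q g x = coef q g \<odot>\<^bsub>fobj X q\<^esub> x \<oplus>\<^bsub>fobj X q\<^esub> fmor X q q (rproj q q g) x"
proof -
  have "rproj q q g \<in> Mor Q q q" by (rule rad_closed[OF q q rproj_rad[OF q q g]])
  moreover have "coef q g \<odot>\<^bsub>Hom Q q q\<^esub> Ide Q q \<in> Mor Q q q"
    by (rule left_module.lsmult_closed[OF hom_lm[OF q q] coef(1)[OF q g] ide_closed[OF q]])
  ultimately show ?thesis
    using fmor_add_arg[OF X q q x] fmor_scalar[OF X q coef(1)[OF q g] x] by (subst hom_decomp[OF q g]) simp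
qed

text \<open>Between distinct objects \<open>r\<close> is everything, and a composite from
  \<open>p\<close> to \<open>p\<close> through another object lies in \<open>r p\<close> by
  hypothesis. What remains is composition of endomorphisms of one object, where \<open>g\<close> is
  split into a scalar and a radical part.\<close>

lemma rad_comp_left:
  assumes p: "p \<in> Ob Q" and q: "q \<in> Ob Q" and s: "s \<in> Ob Q" and f: "f \<in> rad p q" and g: "g \<in> Mor Q q s"
  shows "Comp Q p q s g f \<in> rad p s"
proof (cases "p = s")
  case False
  thus ?thesis using comp_closed[OF p q s rad_closed[OF p q f] g] by (simp add: pseudo_radical_def)
next
  case ps: True
  show ?thesis
  proof (cases "p = q")
    case False
    thus ?thesis using ps retraction p q rad_closed[OF p q f] g by (auto simp: strong_retraction_def pseudo_radical_def)
  next
    case pq: True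
    have fr: "f \<in> r q" "f \<in> Mor Q q q" using f pq r_closed[OF q] by (auto simp: rad_self)
    have g': "g \<in> Mor Q q q" using g ps pq by simp
    have rp: "rproj q q g \<in> r q" using rproj_rad[OF q q g'] by (simp add: rad_self)
    have "Comp Q q q q g f = coef q g \<odot>\<^bsub>Hom Q q q\<^esub> f \<oplus>\<^bsub>Hom Q q q\<^esub> Comp Q q q q (rproj q q g) f"
      using fmor_decomp[OF hom_fun_QMod[OF q] q g', of f] fr by simp
    moreover have "Comp Q q q q (rproj q q g) f \<in> r q" using retraction q fr rp by (auto simp: strong_retraction_def)
    ultimately show ?thesis
      using submoduleD(3,4)[OF hom_lm[OF q q] r_submodule[OF q]] fr coef(1)[OF q g'] ps pq by (simp add: rad_self)
  qed
qed

lemma rad_comp_right: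
  assumes p: "p \<in> Ob Q" and q: "q \<in> Ob Q" and s: "s \<in> Ob Q" and f: "f \<in> Mor Q p q" and g: "g \<in> rad q s"
  shows "Comp Q p q s g f \<in> rad p s"
proof (cases "p = s")
  case False
  thus ?thesis using comp_closed[OF p q s f rad_closed[OF q s g]] by (simp add: pseudo_radical_def)
next
  case ps: True
  show ?thesis
  proof (cases "p = q")
    case False
    thus ?thesis using ps retraction p q rad_closed[OF q s g] f by (auto simp: strong_retraction_def pseudo_radical_def)
  next
    case pq: True
    have gr: "g \<in> r q" "g \<in> Mor Q q q" using g ps pq r_closed[OF q] by (auto simp: rad_self)
    have f': "f \<in> Mor Q q q" using f pq by simp
    have rp: "rproj q q f \<in> r q" using rproj_rad[OF q q f'] by (simp add: rad_self)
    have c: "coef q f \<odot>\<^bsub>Hom Q q q\<^esub> Ide Q q \<in> Mor Q q q"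
      by (rule left_module.lsmult_closed[OF hom_lm[OF q q] coef(1)[OF q f'] ide_closed[OF q]])
    note l = comp_linear_right[OF q q q gr(2)]
    have "Comp Q q q q g f = coef q f \<odot>\<^bsub>Hom Q q q\<^esub> g \<oplus>\<^bsub>Hom Q q q\<^esub> Comp Q q q q g (rproj q q f)"
      by (subst hom_decomp[OF q f'])
        (use lin_maps_add[OF l c r_closed[OF q rp]] lin_maps_smult[OF l coef(1)[OF q f'] ide_closed[OF q]]
          comp_ide[OF q q gr(2)] in simp)
    moreover have "Comp Q q q q g (rproj q q f) \<in> r q" using retraction q gr rp by (auto simp: strong_retraction_def)
    ultimately show ?thesis
      using submoduleD(3,4)[OF hom_lm[OF q q] r_submodule[OF q]] gr coef(1)[OF q f'] ps pq by (simp add: rad_self)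
  qed
qed

lemma chains_carrier: "p \<in> Ob Q \<Longrightarrow> q \<in> Ob Q \<Longrightarrow> c \<in> chains Q rad n p q \<Longrightarrow> c \<in> Mor Q p q"
proof (induction n arbitrary: q c)
  case (Suc n)
  thus ?case using rad_closed comp_closed by fastforce
qed (auto split: if_splits simp: ide_closed)

text \<open>\<open>chains\<close> grows at its target by definition. Exhausting a functor by its
  radical filtration and passing to the opposite category both need growth at the source.\<close>

lemma chains_precomp:
  assumes p: "p \<in> Ob Q" and s: "s \<in> Ob Q" and f: "f \<in> rad p s"
  shows "q \<in> Ob Q \<Longrightarrow> c \<in> chains Q rad n s q \<Longrightarrow> Comp Q p s q c f \<in> chains Q rad (Suc n) p q"
proof (induction n arbitrary: q c)
  case 0
  hence [simp]: "q = s" and "c = Ide Q s" by (auto split: if_splits)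
  hence "Comp Q p s q c f = Comp Q p p s f (Ide Q p)" using comp_ide[OF p s rad_closed[OF p s f]] by simp
  thus ?case using f p by auto
next
  case (Suc n)
  then obtain u c' g where u: "u \<in> Ob Q" "c' \<in> chains Q rad n s u" "g \<in> rad u q" "c = Comp Q s u q g c'" by auto
  have "Comp Q p s q c f = Comp Q p u q g (Comp Q p s u c' f)"
    using comp_assoc[OF p s u(1) Suc.prems(1) rad_closed[OF p s f] chains_carrier[OF s u(1,2)] rad_closed[OF u(1) Suc.prems(1) u(3)]] u(4) by simp
  moreover have "Comp Q p s u c' f \<in> chains Q rad (Suc n) p u" using Suc.IH u by blast
  ultimately show ?case unfolding chains.simps(2)[of _ _ "Suc n"] using u by blast
qed

lemma chains_nilpotent: obtains N where "\<And>p q c. p \<in> Ob Q \<Longrightarrow> q \<in> Ob Q \<Longrightarrow> c \<in> chains Q rad N p q \<Longrightarrow> c = \<zero>\<^bsub>Hom Q p q\<^esub>"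
proof -
  obtain N where N: "\<And>p q. p \<in> Ob Q \<Longrightarrow> q \<in> Ob Q \<Longrightarrow> ideal_power k Q rad N p q = {\<zero>\<^bsub>Hom Q p q\<^esub>}"
    using nilpotent by (auto simp: nilpotent_ideal_def)
  have "chains Q rad N p q \<subseteq> ideal_power k Q rad N p q" for p q by (auto simp: ideal_power_def submod_gen_def)
  thus ?thesis using that N by blast
qed

section \<open>Finite generation and local boundedness\<close>

definition gens :: "'o \<Rightarrow> 'o \<Rightarrow> 'm set" where
  "gens p q = (SOME S. finite S \<and> S \<subseteq> Mor Q p q \<and> submod_gen k (Hom Q p q) S = Mor Q p q)"

lemma gens:
  assumes "p \<in> Ob Q" "q \<in> Ob Q"
  shows gens_finite: "finite (gens p q)" and gens_subset: "gens p q \<subseteq> Mor Q p q"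
    and gens_induct: "\<And>H g. submodule H k (Hom Q p q) \<Longrightarrow> gens p q \<subseteq> H \<Longrightarrow> g \<in> Mor Q p q \<Longrightarrow> g \<in> H"
proof -
  have "\<exists>S. finite S \<and> S \<subseteq> Mor Q p q \<and> submod_gen k (Hom Q p q) S = Mor Q p q"
    using homfin assms by (auto simp: hom_finite_def fin_gen_module_def)
  from someI_ex[OF this, folded gens_def]
  have *: "finite (gens p q)" "gens p q \<subseteq> Mor Q p q" "submod_gen k (Hom Q p q) (gens p q) = Mor Q p q" by auto
  thus "finite (gens p q)" "gens p q \<subseteq> Mor Q p q" by auto
  show "g \<in> H" if "submodule H k (Hom Q p q)" "gens p q \<subseteq> H" "g \<in> Mor Q p q" for H g
    using submod_gen_submodule(3)[OF hom_lm[OF assms] *(2) that(1,2)] *(3) that(3) by blast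
qed

lemma hom_rel_proj: "p \<in> Ob Q \<Longrightarrow> q \<in> Ob Q \<Longrightarrow> rel_proj k (Hom Q p q) {\<zero>\<^bsub>Hom Q p q\<^esub>}"
  using homfin projective_module_rel_proj by (auto simp: hom_finite_def)

lemma hom_coords:
  assumes "p \<in> Ob Q" "q \<in> Ob Q"
  obtains \<xi> where "\<xi> \<in> lin_maps k (Hom Q p q) (coords k (Hom Q p q))"
    "\<And>g. g \<in> Mor Q p q \<Longrightarrow> lincomb k (Hom Q p q) (\<xi> g) = g"
  by (rule rel_proj_zero_coords[OF k_ring hom_lm[OF assms] hom_rel_proj[OF assms]]) (rule that)

definition targets :: "'o \<Rightarrow> 'o set" where "targets p = {q \<in> Ob Q. \<not> zero_module (Hom Q p q)}"

lemma targets_finite: "p \<in> Ob Q \<Longrightarrow> finite (targets p)"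
  using locbd by (auto simp: locally_bounded_def targets_def)

lemma not_target: "p \<in> Ob Q \<Longrightarrow> q \<in> Ob Q \<Longrightarrow> q \<notin> targets p \<Longrightarrow> f \<in> Mor Q p q \<Longrightarrow> f = \<zero>\<^bsub>Hom Q p q\<^esub>"
  by (auto simp: targets_def zero_module_def)

section \<open>Subfunctors and the radical filtration\<close>

definition subfun :: "('o, 'm, 'k, 'v) modfun \<Rightarrow> ('o \<Rightarrow> 'v set) \<Rightarrow> bool" where
  "subfun V U \<longleftrightarrow> (\<forall>p \<in> Ob Q. submodule (U p) k (fobj V p)) \<and>
    (\<forall>p \<in> Ob Q. \<forall>q \<in> Ob Q. \<forall>f \<in> Mor Q p q. \<forall>u \<in> U p. fmor V p q f u \<in> U q)"

lemma subfunD: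
  assumes "subfun V U"
  shows "p \<in> Ob Q \<Longrightarrow> submodule (U p) k (fobj V p)"
    "\<lbrakk>p \<in> Ob Q; q \<in> Ob Q; f \<in> Mor Q p q; u \<in> U p\<rbrakk> \<Longrightarrow> fmor V p q f u \<in> U q"
  using assms by (auto simp: subfun_def)

lemma subfun_QMod: "V \<in> QMod k Q \<Longrightarrow> subfun V U \<Longrightarrow> sub_fun V U \<in> QMod k Q"
  by (rule sub_fun_QMod) (auto simp: subfun_def)

text \<open>The preimage in \<open>V\<close> of the part of \<open>V / U\<close> that is killed by
  \<open>r\<close>.\<close>

definition rad_step :: "('o, 'm, 'k, 'v) modfun \<Rightarrow> ('o \<Rightarrow> 'v set) \<Rightarrow> 'o \<Rightarrow> 'v set" where
  "rad_step V U p = {v \<in> El V p. \<forall>q \<in> Ob Q. \<forall>f \<in> rad p q. fmor V p q f v \<in> U q}"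

lemma rad_step_subfun:
  assumes V: "V \<in> QMod k Q" and U: "subfun V U"
  shows "subfun V (rad_step V U)" "\<And>p. p \<in> Ob Q \<Longrightarrow> U p \<subseteq> rad_step V U p"
proof -
  note D = submoduleD[OF QMod_lm[OF V] subfunD(1)[OF U]]
  show "U p \<subseteq> rad_step V U p" if "p \<in> Ob Q" for p
    using D(1)[OF that that] subfunD(2)[OF U that] rad_closed[OF that] by (auto simp: rad_step_def)
  show "subfun V (rad_step V U)"
    unfolding subfun_def
  proof (intro conjI ballI)
    fix p assume p: "p \<in> Ob Q"
    interpret M: left_module k "fobj V p" by (rule QMod_lm[OF V p])
    show "submodule (rad_step V U p) k (fobj V p)"
      by (rule left_submoduleI[OF QMod_lm[OF V p]])
        (use D(2-4) rad_closed[OF p] in \<open>auto simp: rad_step_def fmor_zero[OF V p] fmor_add[OF V p] fmor_smult[OF V p] M.lsmult_closed\<close>)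
    fix q f v assume q: "q \<in> Ob Q" and f: "f \<in> Mor Q p q" and v: "v \<in> rad_step V U p"
    have vc: "v \<in> El V p" using v by (simp add: rad_step_def)
    have "fmor V q s g (fmor V p q f v) \<in> U s" if s: "s \<in> Ob Q" and g: "g \<in> rad q s" for s g
    proof -
      have gf: "Comp Q p q s g f \<in> rad p s" by (rule rad_comp_right[OF p q s f g])
      have "fmor V p s (Comp Q p q s g f) v \<in> U s" using v s gf by (simp add: rad_step_def)
      thus ?thesis using QMod_comp[OF V p q s f rad_closed[OF q s g] vc] by simp
    qed
    thus "fmor V p q f v \<in> rad_step V U q" using fmor_closed[OF V p q f vc] by (simp add: rad_step_def)
  qed
qed

text \<open>If \<open>\<xi> v\<close> is zero, the second clause of \<open>rel_proj\<close> puts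
  \<open>v\<close> itself into \<open>U\<close>. Thus \<open>U\<close> is the kernel of a map into a
  free module, the form in which projectivity of \<open>V / U\<close> passes to further
  quotients.\<close>

lemma rel_proj_kernel_eq:
  assumes "rel_proj k V U" "left_module k V" "U \<subseteq> carrier V"
  obtains \<xi> where "\<xi> \<in> lin_maps k V (coords k V)" "U = {v \<in> carrier V. \<xi> v = \<zero>\<^bsub>coords k V\<^esub>}"
    "\<And>v. v \<in> carrier V \<Longrightarrow> v \<ominus>\<^bsub>V\<^esub> lincomb k V (\<xi> v) \<in> U"
proof -
  obtain \<xi> where \<xi>: "\<xi> \<in> lin_maps k V (coords k V)" "\<forall>u \<in> U. \<xi> u = \<zero>\<^bsub>coords k V\<^esub>"
    "\<And>v. v \<in> carrier V \<Longrightarrow> v \<ominus>\<^bsub>V\<^esub> lincomb k V (\<xi> v) \<in> U"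
    using assms(1) by (auto simp: rel_proj_def)
  interpret V: left_module k V by fact
  have z: "lincomb k V \<zero>\<^bsub>coords k V\<^esub> = \<zero>\<^bsub>V\<^esub>"
    by (rule lin_maps_zero[OF lm_ag[OF coords_left_module[OF k_ring]] V.abelian_group_axioms lincomb_lin_maps[OF k_ring assms(2)]])
  have "v \<in> U" if "v \<in> carrier V" "\<xi> v = \<zero>\<^bsub>coords k V\<^esub>" for v
    using \<xi>(3)[OF that(1)] that z by (simp add: V.minus_eq a_inv_zero_ag[OF V.abelian_group_axioms])
  hence "U = {v \<in> carrier V. \<xi> v = \<zero>\<^bsub>coords k V\<^esub>}" using \<xi>(2) assms(3) by auto
  thus ?thesis using that \<xi> by blast
qed

lemma QMod_module: "V \<in> QMod k Q \<Longrightarrow> p \<in> Ob Q \<Longrightarrow> module k (fobj V p)"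
  by (rule module_of_left_module[OF base_cring QMod_lm])

text \<open>\<open>v\<close> lies in \<open>rad_step V U p\<close> iff for every \<open>f\<close> in
  \<open>r(p, q)\<close> the element \<open>f v\<close> has zero coordinates modulo
  \<open>U q\<close>. Finitely many \<open>q\<close> and finitely many generators of each
  \<open>r(p, q)\<close> suffice to test this, so all these coordinates together map into a direct
  sum and \<open>rel_proj_kernel\<close> applies.\<close>

lemma rad_step_rel_proj:
  fixes V :: "('o, 'm, 'k, 'v) modfun"
  assumes V: "V \<in> QMod k Q" and U: "subfun V U" and rp: "\<And>p. p \<in> Ob Q \<Longrightarrow> rel_proj k (fobj V p) (U p)" and p: "p \<in> Ob Q"
  shows "rel_proj k (fobj V p) (rad_step V U p)"
proof -
  note D = submoduleD[OF QMod_lm[OF V] subfunD(1)[OF U]]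
  have "\<forall>q\<in>Ob Q. \<exists>\<xi>. \<xi> \<in> lin_maps k (fobj V q) (coords k (fobj V q)) \<and> U q = {v \<in> El V q. \<xi> v = \<zero>\<^bsub>coords k (fobj V q)\<^esub>}"
  proof
    fix q assume q: "q \<in> Ob Q"
    show "\<exists>\<xi>. \<xi> \<in> lin_maps k (fobj V q) (coords k (fobj V q)) \<and> U q = {v \<in> El V q. \<xi> v = \<zero>\<^bsub>coords k (fobj V q)\<^esub>}"
      by (rule rel_proj_kernel_eq[OF rp[OF q] QMod_lm[OF V q] D(1)[OF q q]]) blast
  qed
  hence "\<exists>\<xi>. \<forall>q\<in>Ob Q. \<xi> q \<in> lin_maps k (fobj V q) (coords k (fobj V q)) \<and> U q = {v \<in> El V q. \<xi> q v = \<zero>\<^bsub>coords k (fobj V q)\<^esub>}"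
    by (rule bchoice)
  then obtain \<xi> where \<xi>: "\<And>q. q \<in> Ob Q \<Longrightarrow> \<xi> q \<in> lin_maps k (fobj V q) (coords k (fobj V q))"
    "\<And>q. q \<in> Ob Q \<Longrightarrow> U q = {v \<in> El V q. \<xi> q v = \<zero>\<^bsub>coords k (fobj V q)\<^esub>}" by blast
  define J where "J = (SIGMA q : targets p. gens p q \<times> El V q)"
  \<comment> \<open>The projections of the generators of \<open>Q(p, q)\<close> generate
    \<open>r(p, q)\<close>.\<close>
  define w where "w q f v = fmor V p q (rproj p q f) v" for q f v
  have tO: "q \<in> Ob Q" if "q \<in> targets p" for q using that by (simp add: targets_def)
  have rpf: "rproj p q f \<in> rad p q" "rproj p q f \<in> Mor Q p q" if "q \<in> Ob Q" "f \<in> Mor Q p q" for q f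
    using rproj_rad[OF p that] rad_closed[OF p that(1)] by auto
  have wl: "w q f \<in> lin_maps k (fobj V p) (fobj V q)" if "q \<in> Ob Q" "f \<in> Mor Q p q" for q f
    using QMod_fmor[OF V p that(1) rpf(2)[OF that]] by (simp add: w_def[abs_def])
  have gc: "f \<in> Mor Q p q" if "q \<in> Ob Q" "f \<in> gens p q" for q f using gens_subset[OF p that(1)] that(2) by blast
  define \<theta> where "\<theta> v = (\<lambda>i\<in>J. case i of (q, f, e) \<Rightarrow> \<xi> q (w q f v) e)" for v
  have \<xi>w: "(\<lambda>v. \<xi> q (w q f v)) \<in> lin_maps k (fobj V p) (coords k (fobj V q))" if "q \<in> Ob Q" "f \<in> gens p q" for q f
    by (rule lin_maps_comp[OF \<xi>(1)[OF that(1)] wl[OF that(1) gc[OF that]]])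
  have \<xi>wc: "\<xi> q (w q f v) \<in> carrier (coords k (fobj V q))" if "q \<in> Ob Q" "f \<in> gens p q" "v \<in> El V p" for q f v
    by (rule lin_maps_closed[OF \<xi>w[OF that(1,2)] that(3)])
  have "(\<lambda>v. \<lambda>i\<in>J. case i of (q, f, e) \<Rightarrow> \<xi> q (w q f v) e) \<in> lin_maps k (fobj V p) (free_module k J)"
  proof (rule dsum_tuple_lin_maps)
    show "(\<lambda>v. case i of (q, f, e) \<Rightarrow> \<xi> q (w q f v) e) \<in> forms k (fobj V p)" if "i \<in> J" for i
    proof -
      obtain q f e where i: "i = (q, f, e)" by (cases i) auto
      hence "q \<in> Ob Q" "f \<in> gens p q" "e \<in> El V q" using \<open>i \<in> J\<close> tO by (auto simp: J_def)
      thus ?thesis using lin_maps_comp[OF dsum_proj_lin_maps \<xi>w[unfolded coords_def]] by (simp add: i)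
    qed
    fix v assume v: "v \<in> El V p"
    have "{i \<in> J. (case i of (q, f, e) \<Rightarrow> \<xi> q (w q f v) e) \<noteq> \<zero>\<^bsub>self_module k\<^esub>} \<subseteq>
        (SIGMA q : targets p. SIGMA f : gens p q. {e \<in> El V q. \<xi> q (w q f v) e \<noteq> \<zero>\<^bsub>k\<^esub>})"
      by (auto simp: J_def)
    moreover have "finite \<dots>"
    proof (intro finite_SigmaI targets_finite[OF p])
      show "finite (gens p q)" if "q \<in> targets p" for q using gens_finite[OF p tO[OF that]] .
      show "finite {e \<in> El V q. \<xi> q (w q f v) e \<noteq> \<zero>\<^bsub>k\<^esub>}" if "q \<in> targets p" "f \<in> gens p q" for q f
        using dsumD(2)[OF \<xi>wc[OF tO[OF that(1)] that(2) v, unfolded coords_def]] by simp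
    qed
    ultimately show "finite {i \<in> J. (case i of (q, f, e) \<Rightarrow> \<xi> q (w q f v) e) \<noteq> \<zero>\<^bsub>self_module k\<^esub>}" by (rule finite_subset)
  qed
  hence "\<theta> \<in> lin_maps k (fobj V p) (free_module k J)" by (simp add: \<theta>_def[abs_def])
  note rk = rel_proj_kernel[OF her QMod_module[OF V p] this]
  have "{v \<in> El V p. \<theta> v = (\<lambda>i\<in>J. \<zero>\<^bsub>k\<^esub>)} = rad_step V U p"
  proof (intro equalityI subsetI)
    fix v assume "v \<in> rad_step V U p"
    hence v: "v \<in> El V p" and vU: "\<And>q f. q \<in> Ob Q \<Longrightarrow> f \<in> rad p q \<Longrightarrow> fmor V p q f v \<in> U q" by (auto simp: rad_step_def)
    have "\<xi> q (w q f v) e = \<zero>\<^bsub>k\<^esub>" if "(q, f, e) \<in> J" for q f e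
    proof -
      have q: "q \<in> Ob Q" "f \<in> gens p q" "e \<in> El V q" using that tO by (auto simp: J_def)
      have "w q f v \<in> U q" unfolding w_def by (rule vU[OF q(1) rpf(1)[OF q(1) gc[OF q(1,2)]]])
      thus ?thesis using \<xi>(2)[OF q(1)] q(3) by (auto simp: coords_def dsum_simps)
    qed
    thus "v \<in> {v \<in> El V p. \<theta> v = (\<lambda>i\<in>J. \<zero>\<^bsub>k\<^esub>)}" using v by (auto simp: \<theta>_def fun_eq_iff)
  next
    fix v assume "v \<in> {v \<in> El V p. \<theta> v = (\<lambda>i\<in>J. \<zero>\<^bsub>k\<^esub>)}"
    hence v: "v \<in> El V p" and z: "\<theta> v = (\<lambda>i\<in>J. \<zero>\<^bsub>k\<^esub>)" by auto
    have "fmor V p q f v \<in> U q" if q: "q \<in> Ob Q" and f: "f \<in> rad p q" for q f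
    proof (cases "q \<in> targets p")
      case False
      have "f = \<zero>\<^bsub>Hom Q p q\<^esub>" by (rule not_target[OF p q False rad_closed[OF p q f]])
      thus ?thesis
        using lin_maps_zero[OF hom_ag[OF p q] QMod_ag[OF V q] QMod_lin[OF V p q v]] D(2)[OF q q] by simp
    next
      case True
      have g: "w q g v \<in> U q" if g: "g \<in> gens p q" for g
      proof -
        have "\<xi> q (w q g v) e = \<zero>\<^bsub>k\<^esub>" if "e \<in> El V q" for e
        proof -
          have "(q, g, e) \<in> J" using True g that by (simp add: J_def)
          thus ?thesis using fun_cong[OF z, of "(q, g, e)"] by (simp add: \<theta>_def)
        qed
        hence "\<xi> q (w q g v) = \<zero>\<^bsub>coords k (fobj V q)\<^esub>"
          using dsumD(3)[OF \<xi>wc[OF q g v, unfolded coords_def]] by (auto simp: coords_def dsum_simps fun_eq_iff extensional_def)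
        thus ?thesis using \<xi>(2)[OF q] lin_maps_closed[OF wl[OF q gc[OF q g]] v] by simp
      qed
      define H where "H = {g \<in> Mor Q p q. fmor V p q (rproj p q g) v \<in> U q}"
      have l: "(\<lambda>g. fmor V p q (rproj p q g) v) \<in> lin_maps k (Hom Q p q) (fobj V q)"
        by (rule lin_maps_comp[OF QMod_lin[OF V p q v] rproj_lin_maps[OF p q]])
      interpret Hm: left_module k "Hom Q p q" by (rule hom_lm[OF p q])
      have "submodule H k (Hom Q p q)"
        by (rule left_submoduleI[OF hom_lm[OF p q]])
          (use D(2-4)[OF q q] in \<open>auto simp: H_def Hm.lsmult_closed lin_maps_zero[OF hom_ag[OF p q] QMod_ag[OF V q] l]
            lin_maps_add[OF l] lin_maps_smult[OF l]\<close>)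
      hence "f \<in> H" by (rule gens_induct[OF p q]) (use g gc[OF q] rad_closed[OF p q f] in \<open>auto simp: H_def w_def\<close>)
      thus ?thesis using rproj_id[OF p q f] by (simp add: H_def)
    qed
    thus "v \<in> rad_step V U p" using v by (simp add: rad_step_def)
  qed
  thus ?thesis using rk by simp
qed

end

section \<open>Extension of maps into radical injective functors\<close>

context shape
begin

text \<open>For \<open>e\<close> in \<open>rad_step V U p\<close> the family sending
  \<open>f\<close> in \<open>r(p, -)\<close> to \<open>\<phi> (f e)\<close> makes sense, as
  \<open>f e\<close> lies in \<open>U\<close>; radical injectivity represents it by some
  \<open>x e\<close>. The choice need not be linear in \<open>e\<close>. A dual basis of
  \<open>rad_step V U p / U p\<close> repairs this: \<open>v\<close> is split into a part
  \<open>u v\<close> in \<open>U\<close>, treated by \<open>\<phi>\<close>, and a combination of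
  elements \<open>e\<close>, sent to the same combination of the \<open>x e\<close>.\<close>

lemma rad_step_extend:
  fixes V :: "('o, 'm, 'k, 'v) modfun" and X :: "('o, 'm, 'k, 'x) modfun"
  assumes X: "X \<in> QMod k Q" and inj: "radical_injective Q r X" and V: "V \<in> QMod k Q" and U: "subfun V U"
    and rp: "\<And>p. p \<in> Ob Q \<Longrightarrow> rel_proj k (fobj V p) (U p)" and \<phi>: "\<phi> \<in> NT (sub_fun V U) X"
  shows "\<exists>\<psi> \<in> NT (sub_fun V (rad_step V U)) X. \<forall>p \<in> Ob Q. \<forall>u \<in> U p. \<psi> p u = \<phi> p u"
proof -
  note D = submoduleD[OF QMod_lm[OF V] subfunD(1)[OF U]]
  note SU = subfun_QMod[OF V U]
  note U' = rad_step_subfun[OF V U]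
  note SU' = subfun_QMod[OF V U'(1)]
  have \<phi>a: "\<phi> p (u \<oplus>\<^bsub>fobj V p\<^esub> v) = \<phi> p u \<oplus>\<^bsub>fobj X p\<^esub> \<phi> p v" if "p \<in> Ob Q" "u \<in> U p" "v \<in> U p" for p u v
    using nat_add[OF \<phi> that(1), of u v] that by simp
  have \<phi>c: "\<phi> p u \<in> El X p" if "p \<in> Ob Q" "u \<in> U p" for p u
    using nat_closed[OF \<phi> that(1), of u] that by simp
  have \<phi>n: "\<phi> q (fmor V p q f u) = fmor X p q f (\<phi> p u)" if "p \<in> Ob Q" "q \<in> Ob Q" "f \<in> Mor Q p q" "u \<in> U p" for p q f u
    using nat_natural[OF \<phi> that(1-3), of u] that(4) by simp
  have fU: "fmor V p q f v \<in> U q" if "p \<in> Ob Q" "q \<in> Ob Q" "f \<in> rad p q" "v \<in> rad_step V U p" for p q f v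
    using that by (simp add: rad_step_def)
  have U'c: "v \<in> El V p" if "v \<in> rad_step V U p" for v p using that by (simp add: rad_step_def)
  have point: "\<exists>\<psi>. \<psi> \<in> lin_maps k (fobj (sub_fun V (rad_step V U)) p) (fobj X p) \<and> (\<forall>u \<in> U p. \<psi> u = \<phi> p u) \<and>
     (\<forall>q \<in> Ob Q. \<forall>f \<in> rad p q. \<forall>v \<in> rad_step V U p. \<phi> q (fmor V p q f v) = fmor X p q f (\<psi> v))"
    if p: "p \<in> Ob Q" for p
  proof -
    define M where "M = (fobj V p)\<lparr>carrier := rad_step V U p\<rparr>"
    have Ms [simp]: "carrier M = rad_step V U p" "add M = add (fobj V p)" "zero M = zero (fobj V p)" "smult M = smult (fobj V p)"
      by (auto simp: M_def)
    have lM: "left_module k M" using QMod_lm[OF SU' p] by (simp add: M_def)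
    interpret M: left_module k M by (rule lM)
    interpret Xp: left_module k "fobj X p" by (rule QMod_lm[OF X p])
    obtain \<xi> where \<xi>: "\<xi> \<in> lin_maps k (fobj V p) (coords k (fobj V p))" "U p = {v \<in> El V p. \<xi> v = \<zero>\<^bsub>coords k (fobj V p)\<^esub>}"
      by (rule rel_proj_kernel_eq[OF rp[OF p] QMod_lm[OF V p] D(1)[OF p p]]) blast
    \<comment> \<open>The dual basis of \<open>V p / U p\<close> also embeds the smaller quotient
      \<open>rad_step V U p / U p\<close> into a free module, so that quotient has a dual basis of
      its own, made of elements of \<open>M\<close>.\<close>
    have "\<xi> \<in> lin_maps k M (free_module k (El V p))"
      using lin_maps_restrict[OF \<xi>(1), of "rad_step V U p"] U'c unfolding M_def coords_def by blast
    from rel_proj_kernel[OF her module_of_left_module[OF base_cring lM] this]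
    have "rel_proj k M {v \<in> carrier M. \<xi> v = (\<lambda>i\<in>El V p. \<zero>\<^bsub>k\<^esub>)}" .
    also have "{v \<in> carrier M. \<xi> v = (\<lambda>i\<in>El V p. \<zero>\<^bsub>k\<^esub>)} = U p"
      using U'(2)[OF p] U'c by (auto simp: \<xi>(2) coords_def dsum_simps)
    finally have rM: "rel_proj k M (U p)" .
    obtain \<xi>' where \<xi>': "\<xi>' \<in> lin_maps k M (coords k M)" "U p = {v \<in> carrier M. \<xi>' v = \<zero>\<^bsub>coords k M\<^esub>}"
      "\<And>v. v \<in> carrier M \<Longrightarrow> v \<ominus>\<^bsub>M\<^esub> lincomb k M (\<xi>' v) \<in> U p"
      by (rule rel_proj_kernel_eq[OF rM lM]) (use U'(2)[OF p] in auto)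
    have "\<forall>e \<in> rad_step V U p. \<exists>x \<in> El X p. \<forall>q \<in> Ob Q. \<forall>f \<in> rad p q. \<phi> q (fmor V p q f e) = fmor X p q f x"
    proof
      fix e assume e: "e \<in> rad_step V U p"
      show "\<exists>x \<in> El X p. \<forall>q \<in> Ob Q. \<forall>f \<in> rad p q. \<phi> q (fmor V p q f e) = fmor X p q f x"
        by (rule radical_injectiveD[OF inj p, where \<phi> = "\<lambda>q f. \<phi> q (fmor V p q f e)"])
          (use \<phi>c \<phi>a \<phi>n fU[OF p _ _ e] rad_closed[OF p] fmor_add_arg[OF V p _ U'c[OF e]] QMod_comp[OF V p _ _ _ _ U'c[OF e]] in auto)
    qed
    then obtain x where x: "\<And>e. e \<in> rad_step V U p \<Longrightarrow> x e \<in> El X p"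
      "\<And>e q f. e \<in> rad_step V U p \<Longrightarrow> q \<in> Ob Q \<Longrightarrow> f \<in> rad p q \<Longrightarrow> \<phi> q (fmor V p q f e) = fmor X p q f (x e)" by metis
    define \<sigma> where "\<sigma> = dsum_lift (fobj X p) (carrier M) (\<lambda>_. self_module k) (\<lambda>e a. a \<odot>\<^bsub>fobj X p\<^esub> x e)"
    have \<sigma>: "\<sigma> \<in> lin_maps k (coords k M) (fobj X p)"
      unfolding \<sigma>_def coords_def by (rule free_lift_lin_maps[OF k_ring QMod_lm[OF X p]]) (use x in auto)
    note lc = lincomb_lin_maps[OF k_ring lM]
    define u where "u v = v \<ominus>\<^bsub>M\<^esub> lincomb k M (\<xi>' v)" for v
    have u: "u \<in> lin_maps k M M" unfolding u_def by (rule lin_maps_diff[OF lM lin_maps_id lin_maps_comp[OF lc \<xi>'(1)]])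
    have uU: "u v \<in> U p" if "v \<in> carrier M" for v using \<xi>'(3)[OF that] by (simp add: u_def)
    have "u \<in> lin_maps k M ((fobj V p)\<lparr>carrier := U p\<rparr>)" using u uU by (auto simp: lin_maps_def)
    moreover have "\<phi> p \<in> lin_maps k ((fobj V p)\<lparr>carrier := U p\<rparr>) (fobj X p)" using nat_lin[OF \<phi> p] by simp
    ultimately have \<phi>u: "(\<lambda>v. \<phi> p (u v)) \<in> lin_maps k M (fobj X p)" by (rule lin_maps_comp[rotated])
    define \<psi> where "\<psi> v = \<phi> p (u v) \<oplus>\<^bsub>fobj X p\<^esub> \<sigma> (\<xi>' v)" for v
    have \<psi>: "\<psi> \<in> lin_maps k M (fobj X p)"
      unfolding \<psi>_def by (rule lin_maps_plus[OF QMod_lm[OF X p] \<phi>u lin_maps_comp[OF \<sigma> \<xi>'(1)]])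
    have "\<psi> v = \<phi> p v" if v: "v \<in> U p" for v
    proof -
      have vM: "v \<in> carrier M" and z: "\<xi>' v = \<zero>\<^bsub>coords k M\<^esub>" using v \<xi>'(2) by auto
      have "lincomb k M \<zero>\<^bsub>coords k M\<^esub> = \<zero>\<^bsub>M\<^esub>" "\<sigma> \<zero>\<^bsub>coords k M\<^esub> = \<zero>\<^bsub>fobj X p\<^esub>"
        using add_maps_zero[OF lm_ag[OF coords_left_module[OF k_ring]]] lin_maps_add_maps[OF lc] lin_maps_add_maps[OF \<sigma>]
          M.abelian_group_axioms Xp.abelian_group_axioms by blast+
      moreover have "v \<ominus>\<^bsub>M\<^esub> \<zero>\<^bsub>M\<^esub> = v" using vM a_inv_zero_ag[OF M.abelian_group_axioms] M.r_zero[OF vM] by (simp add: a_minus_def)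
      ultimately show ?thesis using z \<phi>c[OF p v] by (simp add: \<psi>_def u_def)
    qed
    moreover have "\<phi> q (fmor V p q f v) = fmor X p q f (\<psi> v)" if q: "q \<in> Ob Q" and f: "f \<in> rad p q" and v: "v \<in> rad_step V U p" for q f v
    proof -
      note fH = rad_closed[OF p q f]
      have vM: "v \<in> carrier M" using v by simp
      have cM: "\<xi>' v \<in> carrier (coords k M)" by (rule lin_maps_closed[OF \<xi>'(1) vM])
      have lM': "lincomb k M (\<xi>' v) \<in> carrier M" by (rule lin_maps_closed[OF lc cM])
      have fM: "fmor V p q f \<in> lin_maps k M ((fobj V q)\<lparr>carrier := U q\<rparr>)"
        using QMod_fmor[OF V p q fH] fU[OF p q f] U'c by (auto simp: lin_maps_def Pi_iff)
      \<comment> \<open>On each generator this is the defining property of \<open>x e\<close>;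
        linearity carries it to all combinations.\<close>
      have key: "\<phi> q (fmor V p q f (lincomb k M c)) = fmor X p q f (\<sigma> c)" if c: "c \<in> carrier (coords k M)" for c
      proof (rule free_ext[OF k_ring QMod_ag[OF X q] _ _ _ c[unfolded coords_def]])
        have "\<phi> q \<in> add_maps ((fobj V q)\<lparr>carrier := U q\<rparr>) (fobj X q)" using nat_add_maps[OF \<phi> q] by simp
        thus "(\<lambda>c. \<phi> q (fmor V p q f (lincomb k M c))) \<in> add_maps (free_module k (carrier M)) (fobj X q)"
          using add_maps_comp[OF _ add_maps_comp[OF lin_maps_add_maps[OF fM] lin_maps_add_maps[OF lc[unfolded coords_def]]]] by blast
        show "(\<lambda>c. fmor X p q f (\<sigma> c)) \<in> add_maps (free_module k (carrier M)) (fobj X q)"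
          by (rule add_maps_comp[OF fmor_add_maps[OF X p q fH] lin_maps_add_maps[OF \<sigma>[unfolded coords_def]]])
        fix e a assume e: "e \<in> carrier M" and a: "a \<in> carrier k"
        have e': "e \<in> rad_step V U p" using e by simp
        have "\<phi> q (fmor V p q f (lincomb k M (dsum_inj (carrier M) (\<lambda>_. self_module k) e a))) = a \<odot>\<^bsub>fobj X q\<^esub> \<phi> q (fmor V p q f e)"
          using lincomb_inj[OF k_ring lM e a] fmor_smult[OF V p q fH a U'c[OF e']]
            lin_maps_smult[OF nat_lin[OF \<phi> q] a, of "fmor V p q f e"] fU[OF p q f e'] by simp
        moreover have "fmor X p q f (\<sigma> (dsum_inj (carrier M) (\<lambda>_. self_module k) e a)) = a \<odot>\<^bsub>fobj X q\<^esub> fmor X p q f (x e)"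
          unfolding \<sigma>_def using free_lift_inj[OF k_ring QMod_lm[OF X p], of "carrier M" x e a] x(1) e a
            fmor_smult[OF X p q fH a x(1)[OF e']] by simp
        ultimately show "\<phi> q (fmor V p q f (lincomb k M (dsum_inj (carrier M) (\<lambda>_. self_module k) e a))) =
            fmor X p q f (\<sigma> (dsum_inj (carrier M) (\<lambda>_. self_module k) e a))" using x(2)[OF e' q f] by simp
      qed
      have vu: "v = u v \<oplus>\<^bsub>M\<^esub> lincomb k M (\<xi>' v)" using vM lM' unfolding u_def by (simp only: M.minus_eq M.a_assoc M.l_neg M.r_zero M.a_inv_closed)
      have "fmor V p q f v = fmor V p q f (u v) \<oplus>\<^bsub>fobj V q\<^esub> fmor V p q f (lincomb k M (\<xi>' v))"
        using fmor_add[OF V p q fH, of "u v" "lincomb k M (\<xi>' v)"] uU[OF vM] D(1)[OF p p] lM' U'c vu by auto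
      hence "\<phi> q (fmor V p q f v) = \<phi> q (fmor V p q f (u v)) \<oplus>\<^bsub>fobj X q\<^esub> \<phi> q (fmor V p q f (lincomb k M (\<xi>' v)))"
        using \<phi>a[OF q] subfunD(2)[OF U p q fH uU[OF vM]] fU[OF p q f] lM' by simp
      also have "\<dots> = fmor X p q f (\<phi> p (u v)) \<oplus>\<^bsub>fobj X q\<^esub> fmor X p q f (\<sigma> (\<xi>' v))"
        using \<phi>n[OF p q fH uU[OF vM]] key[OF cM] by simp
      also have "\<dots> = fmor X p q f (\<psi> v)"
        using fmor_add[OF X p q fH \<phi>c[OF p uU[OF vM]] lin_maps_closed[OF \<sigma> cM]] by (simp add: \<psi>_def)
      finally show ?thesis .
    qed
    ultimately show ?thesis using \<psi> by (intro exI[of _ \<psi>]) (simp add: M_def)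
  qed
  hence "\<exists>\<psi>. \<forall>p \<in> Ob Q. \<psi> p \<in> lin_maps k (fobj (sub_fun V (rad_step V U)) p) (fobj X p) \<and> (\<forall>u \<in> U p. \<psi> p u = \<phi> p u) \<and>
     (\<forall>q \<in> Ob Q. \<forall>f \<in> rad p q. \<forall>v \<in> rad_step V U p. \<phi> q (fmor V p q f v) = fmor X p q f (\<psi> p v))"
    by (intro bchoice) blast
  then obtain \<psi> where \<psi>: "\<And>p. p \<in> Ob Q \<Longrightarrow> \<psi> p \<in> lin_maps k (fobj (sub_fun V (rad_step V U)) p) (fobj X p)"
    "\<And>p u. p \<in> Ob Q \<Longrightarrow> u \<in> U p \<Longrightarrow> \<psi> p u = \<phi> p u"
    "\<And>p q f v. \<lbrakk>p \<in> Ob Q; q \<in> Ob Q; f \<in> rad p q; v \<in> rad_step V U p\<rbrakk> \<Longrightarrow> \<phi> q (fmor V p q f v) = fmor X p q f (\<psi> p v)" by blast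
  \<comment> \<open>Radical morphisms land in \<open>U\<close>, where \<open>\<psi>\<close> agrees
    with \<open>\<phi>\<close>. For general endomorphisms the scalar part is then covered by
    linearity.\<close>
  have rn: "\<psi> q (fmor V p q f v) = fmor X p q f (\<psi> p v)" if "p \<in> Ob Q" "q \<in> Ob Q" "f \<in> rad p q" "v \<in> rad_step V U p" for p q f v
    using \<psi>(2)[OF that(2) fU[OF that]] \<psi>(3)[OF that] by simp
  have "\<psi> \<in> NT (sub_fun V (rad_step V U)) X"
  proof (rule nat_transI[OF SU' X lin_maps_add_maps[OF \<psi>(1)]])
    fix p q f v assume p: "p \<in> Ob Q" and q: "q \<in> Ob Q" and f: "f \<in> Mor Q p q" and v: "v \<in> El (sub_fun V (rad_step V U)) p"
    have v': "v \<in> rad_step V U p" using v by simp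
    show "\<psi> q (fmor (sub_fun V (rad_step V U)) p q f v) = fmor X p q f (\<psi> p v)"
    proof (cases "p = q")
      case False
      thus ?thesis using rn[OF p q _ v'] f by (simp add: pseudo_radical_def)
    next
      case True
      hence f': "f \<in> Mor Q q q" and vq: "v \<in> rad_step V U q" using f v' by auto
      note rf = rproj_rad[OF q q f'] and cf = coef(1)[OF q f']
      have a: "coef q f \<odot>\<^bsub>fobj V q\<^esub> v \<in> rad_step V U q"
        using submoduleD(4)[OF QMod_lm[OF V q] subfunD(1)[OF U'(1) q] cf vq] .
      have b: "fmor V q q (rproj q q f) v \<in> rad_step V U q" using subfunD(2)[OF U'(1) q q rad_closed[OF q q rf] vq] .
      have "\<psi> q (fmor V q q f v) = \<psi> q (coef q f \<odot>\<^bsub>fobj V q\<^esub> v) \<oplus>\<^bsub>fobj X q\<^esub> \<psi> q (fmor V q q (rproj q q f) v)"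
        using fmor_decomp[OF V q f' U'c[OF vq]] lin_maps_add[OF \<psi>(1)[OF q], of "coef q f \<odot>\<^bsub>fobj V q\<^esub> v"] a b by simp
      also have "\<dots> = coef q f \<odot>\<^bsub>fobj X q\<^esub> \<psi> q v \<oplus>\<^bsub>fobj X q\<^esub> fmor X q q (rproj q q f) (\<psi> q v)"
        using lin_maps_smult[OF \<psi>(1)[OF q] cf, of v] vq rn[OF q q rf vq] by simp
      also have "\<dots> = fmor X q q f (\<psi> q v)"
        using fmor_decomp[OF X q f' lin_maps_closed[OF \<psi>(1)[OF q]], of v] vq by simp
      finally show ?thesis using True by simp
    qed
  qed
  thus ?thesis using \<psi>(2) by blast
qed

text \<open>Nilpotency of the pseudo-radical makes the filtration \<open>U, rad_step V U, \<dots>\<close> reach \<open>V\<close>.\<close>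

lemma rad_step_exhausts:
  assumes V: "V \<in> QMod k Q" and U: "subfun V U"
  obtains N where "\<And>p. p \<in> Ob Q \<Longrightarrow> (rad_step V ^^ N) U p = El V p"
proof -
  have ch: "v \<in> (rad_step V ^^ n) U p"
    if "p \<in> Ob Q" "v \<in> El V p" "\<And>q c. q \<in> Ob Q \<Longrightarrow> c \<in> chains Q rad n p q \<Longrightarrow> fmor V p q c v \<in> U q" for n p v
    using that
  proof (induction n arbitrary: p v)
    case 0
    thus ?case using QMod_ide[OF V 0(1,2)] 0(3)[of p "Ide Q p"] by simp
  next
    case (Suc n)
    have "fmor V p s f v \<in> (rad_step V ^^ n) U s" if s: "s \<in> Ob Q" and f: "f \<in> rad p s" for s f
    proof (rule Suc.IH[OF s fmor_closed[OF V Suc.prems(1) s rad_closed[OF Suc.prems(1) s f] Suc.prems(2)]])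
      fix q c assume q: "q \<in> Ob Q" and c: "c \<in> chains Q rad n s q"
      show "fmor V s q c (fmor V p s f v) \<in> U q"
        using Suc.prems(3)[OF q chains_precomp[OF Suc.prems(1) s f q c]]
          QMod_comp[OF V Suc.prems(1) s q rad_closed[OF Suc.prems(1) s f] chains_carrier[OF s q c] Suc.prems(2)] by simp
    qed
    hence "v \<in> rad_step V ((rad_step V ^^ n) U) p" using Suc.prems(2) by (subst rad_step_def) blast
    thus ?case by simp
  qed
  obtain N where N: "\<And>p q c. p \<in> Ob Q \<Longrightarrow> q \<in> Ob Q \<Longrightarrow> c \<in> chains Q rad N p q \<Longrightarrow> c = \<zero>\<^bsub>Hom Q p q\<^esub>"
    by (rule chains_nilpotent) blast
  have "v \<in> (rad_step V ^^ N) U p" if p: "p \<in> Ob Q" and v: "v \<in> El V p" for p v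
  proof (rule ch[OF p v])
    fix q c assume q: "q \<in> Ob Q" and c: "c \<in> chains Q rad N p q"
    show "fmor V p q c v \<in> U q"
      using N[OF p q c] lin_maps_zero[OF hom_ag[OF p q] QMod_ag[OF V q] QMod_lin[OF V p q v]]
        submoduleD(2)[OF QMod_lm[OF V q] subfunD(1)[OF U q]] by simp
  qed
  moreover have "subfun V ((rad_step V ^^ n) U)" for n
    by (induction n) (auto intro: U rad_step_subfun[OF V])
  ultimately have "(rad_step V ^^ N) U p = El V p" if "p \<in> Ob Q" for p
    using submoduleD(1)[OF QMod_lm[OF V that] subfunD(1)[OF _ that]] that by blast
  thus ?thesis using that by blast
qed

text \<open>Climb the radical filtration. The induction carries \<open>rel_proj\<close> along, since
  every single step needs a projective quotient at the stage already reached.\<close>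

theorem radical_injective_extend:
  assumes X: "X \<in> QMod k Q" and inj: "radical_injective Q r X" and V: "V \<in> QMod k Q" and U: "subfun V U"
    and rp: "\<And>p. p \<in> Ob Q \<Longrightarrow> rel_proj k (fobj V p) (U p)" and \<phi>: "\<phi> \<in> NT (sub_fun V U) X"
  shows "\<exists>\<psi> \<in> NT V X. \<forall>p \<in> Ob Q. \<forall>u \<in> U p. \<psi> p u = \<phi> p u"
proof -
  have it: "subfun V ((rad_step V ^^ n) U) \<and> (\<forall>p \<in> Ob Q. U p \<subseteq> (rad_step V ^^ n) U p \<and> rel_proj k (fobj V p) ((rad_step V ^^ n) U p)) \<and>
    (\<exists>\<psi> \<in> NT (sub_fun V ((rad_step V ^^ n) U)) X. \<forall>p \<in> Ob Q. \<forall>u \<in> U p. \<psi> p u = \<phi> p u)" for n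
  proof (induction n)
    case 0
    thus ?case using U rp \<phi> by auto
  next
    case (Suc n)
    then obtain \<psi> where \<psi>: "\<psi> \<in> NT (sub_fun V ((rad_step V ^^ n) U)) X" "\<And>p u. p \<in> Ob Q \<Longrightarrow> u \<in> U p \<Longrightarrow> \<psi> p u = \<phi> p u"
      and S: "subfun V ((rad_step V ^^ n) U)" and r: "\<And>p. p \<in> Ob Q \<Longrightarrow> rel_proj k (fobj V p) ((rad_step V ^^ n) U p)"
      and sub: "\<And>p. p \<in> Ob Q \<Longrightarrow> U p \<subseteq> (rad_step V ^^ n) U p" by blast
    obtain \<psi>' where "\<psi>' \<in> NT (sub_fun V (rad_step V ((rad_step V ^^ n) U))) X"
      "\<And>p u. p \<in> Ob Q \<Longrightarrow> u \<in> (rad_step V ^^ n) U p \<Longrightarrow> \<psi>' p u = \<psi> p u"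
      using rad_step_extend[OF X inj V S r \<psi>(1)] by blast
    thus ?case
      using rad_step_subfun[OF V S] rad_step_rel_proj[OF V S r] sub \<psi>(2)
      by (auto intro!: bexI[of _ \<psi>'] simp: subset_iff)
  qed
  obtain N where N: "\<And>p. p \<in> Ob Q \<Longrightarrow> (rad_step V ^^ N) U p = El V p"
    by (rule rad_step_exhausts[OF V U]) blast
  obtain \<psi> where \<psi>: "\<psi> \<in> NT (sub_fun V ((rad_step V ^^ N) U)) X" "\<forall>p \<in> Ob Q. \<forall>u \<in> U p. \<psi> p u = \<phi> p u"
    using it[of N] by blast
  have "\<psi> \<in> NT V X"
    by (rule nat_transI[OF V X]) (use nat_add_maps[OF \<psi>(1)] nat_natural[OF \<psi>(1)] N in auto)
  thus ?thesis using \<psi>(2) by blast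
qed

text \<open>A map that vanishes on the kernel of \<open>\<eta>\<close> descends to the image of
  \<open>\<eta>\<close>, a subfunctor of \<open>Y\<close>. This form is applied to differentials of
  resolutions and to embeddings.\<close>

lemma radical_injective_extend_along:
  assumes X: "X \<in> QMod k Q" and inj: "radical_injective Q r X" and V: "V \<in> QMod k Q" and Y: "Y \<in> QMod k Q"
    and \<eta>: "\<eta> \<in> NT V Y" and \<theta>: "\<theta> \<in> NT V X"
    and rp: "\<And>p. p \<in> Ob Q \<Longrightarrow> rel_proj k (fobj Y p) (\<eta> p ` El V p)"
    and ker: "\<And>p v. \<lbrakk>p \<in> Ob Q; v \<in> El V p; \<eta> p v = \<zero>\<^bsub>fobj Y p\<^esub>\<rbrakk> \<Longrightarrow> \<theta> p v = \<zero>\<^bsub>fobj X p\<^esub>"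
  shows "\<exists>\<psi> \<in> NT Y X. \<forall>p \<in> Ob Q. \<forall>v \<in> El V p. \<psi> p (\<eta> p v) = \<theta> p v"
proof -
  let ?U = "\<lambda>p. \<eta> p ` El V p"
  have \<eta>U: "fmor Y p q f (\<eta> p v) \<in> ?U q" if "p \<in> Ob Q" "q \<in> Ob Q" "f \<in> Mor Q p q" "v \<in> El V p" for p q f v
    using nat_natural[OF \<eta> that, symmetric] fmor_closed[OF V that] by simp
  have U: "subfun Y ?U"
    unfolding subfun_def using lin_maps_image[OF QMod_lm[OF V] QMod_lm[OF Y] nat_lin[OF \<eta>]] \<eta>U by auto
  have "\<exists>\<phi>. \<phi> \<in> add_maps ((fobj Y p)\<lparr>carrier := ?U p\<rparr>) (fobj X p) \<and> (\<forall>v \<in> El V p. \<phi> (\<eta> p v) = \<theta> p v)" if p: "p \<in> Ob Q" for p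
    using add_maps_factor[OF QMod_ag[OF V p] QMod_ag[OF Y p] QMod_ag[OF X p] nat_add_maps[OF \<eta> p] nat_add_maps[OF \<theta> p] ker[OF p]] by blast
  then obtain \<phi> where \<phi>: "\<And>p. p \<in> Ob Q \<Longrightarrow> \<phi> p \<in> add_maps ((fobj Y p)\<lparr>carrier := ?U p\<rparr>) (fobj X p)"
    "\<And>p v. p \<in> Ob Q \<Longrightarrow> v \<in> El V p \<Longrightarrow> \<phi> p (\<eta> p v) = \<theta> p v" by metis
  have "\<phi> \<in> NT (sub_fun Y ?U) X"
  proof (rule nat_transI[OF subfun_QMod[OF Y U] X])
    show "\<phi> p \<in> add_maps (fobj (sub_fun Y ?U) p) (fobj X p)" if "p \<in> Ob Q" for p using \<phi>(1)[OF that] by simp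
    fix p q f u assume p: "p \<in> Ob Q" and q: "q \<in> Ob Q" and f: "f \<in> Mor Q p q" and "u \<in> El (sub_fun Y ?U) p"
    then obtain v where v: "v \<in> El V p" "u = \<eta> p v" by auto
    show "\<phi> q (fmor (sub_fun Y ?U) p q f u) = fmor X p q f (\<phi> p u)"
      using nat_natural[OF \<eta> p q f v(1)] nat_natural[OF \<theta> p q f v(1)] \<phi>(2)[OF p v(1)] \<phi>(2)[OF q fmor_closed[OF V p q f v(1)]] v(2) by simp
  qed
  from radical_injective_extend[OF X inj Y U rp this] show ?thesis using \<phi>(2) by auto
qed

end

section \<open>The opposite category, and embeddings into free modules\<close>

context shape
begin

lemma op_rad: "pseudo_radical (op_cat Q) r p q = rad q p"
  by (auto simp: pseudo_radical_def)

lemma op_chains: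
  assumes p: "p \<in> Ob Q"
  shows "q \<in> Ob Q \<Longrightarrow> chains (op_cat Q) (pseudo_radical (op_cat Q) r) n p q \<subseteq> chains Q rad n q p"
proof (induction n arbitrary: q)
  case 0
  thus ?case by auto
next
  case (Suc n)
  show ?case
  proof
    fix c assume "c \<in> chains (op_cat Q) (pseudo_radical (op_cat Q) r) (Suc n) p q"
    then obtain s f g where s: "s \<in> Ob Q" "f \<in> chains (op_cat Q) (pseudo_radical (op_cat Q) r) n p s" "g \<in> rad q s"
      and c: "c = Comp Q q s p f g" unfolding chains.simps(2) op_rad by auto
    have "f \<in> chains Q rad n s p" using Suc.IH[OF s(1)] s(2) by blast
    from chains_precomp[OF Suc.prems s(1,3) p this] show "c \<in> chains Q rad (Suc n) q p" by (simp only: c)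
  qed
qed

lemma op_shape: "shape k (op_cat Q) r"
proof -
  have 1: "hom_finite k (op_cat Q)" using homfin by (simp add: hom_finite_def)
  have 2: "locally_bounded (op_cat Q)" using locbd by (simp add: locally_bounded_def)
  have 3: "strong_retraction k (op_cat Q) r"
    using retraction by (simp add: strong_retraction_def scalars_def)
  obtain N where N: "\<And>p q. p \<in> Ob Q \<Longrightarrow> q \<in> Ob Q \<Longrightarrow> ideal_power k Q rad N p q = {\<zero>\<^bsub>Hom Q p q\<^esub>}"
    using nilpotent by (auto simp: nilpotent_ideal_def)
  have "ideal_power k (op_cat Q) (pseudo_radical (op_cat Q) r) N p q = {\<zero>\<^bsub>Hom Q q p\<^esub>}"
    if p: "p \<in> Ob Q" and q: "q \<in> Ob Q" for p q
  proof -
    have "ideal_power k (op_cat Q) (pseudo_radical (op_cat Q) r) N p q \<subseteq> ideal_power k Q rad N q p"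
      using op_chains[OF p q, of N] by (auto simp: ideal_power_def submod_gen_def)
    moreover have "\<zero>\<^bsub>Hom Q q p\<^esub> \<in> ideal_power k (op_cat Q) (pseudo_radical (op_cat Q) r) N p q"
      using submoduleD(2)[OF hom_lm[OF q p]] by (auto simp: ideal_power_def submod_gen_def)
    ultimately show ?thesis using N[OF q p] by blast
  qed
  hence 4: "nilpotent_ideal k (op_cat Q) (pseudo_radical (op_cat Q) r)" by (auto simp: nilpotent_ideal_def)
  show ?thesis
    by (intro shape.intro shape_axioms.intro op_preadditive nontrivial her 1 2 3 4)
qed

text \<open>A scalar multiple of \<open>f\<close> is \<open>f\<close> followed by a multiple of an
  identity, so naturality supplies the linearity.\<close>

lemma radical_family_lin_maps:
  assumes X: "X \<in> QMod k Q" and p: "p \<in> Ob Q" and q: "q \<in> Ob Q"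
    and cl: "\<And>q f. q \<in> Ob Q \<Longrightarrow> f \<in> rad p q \<Longrightarrow> \<phi> q f \<in> El X q"
    and add: "\<And>q f g. \<lbrakk>q \<in> Ob Q; f \<in> rad p q; g \<in> rad p q\<rbrakk> \<Longrightarrow> \<phi> q (f \<oplus>\<^bsub>Hom Q p q\<^esub> g) = \<phi> q f \<oplus>\<^bsub>fobj X q\<^esub> \<phi> q g"
    and nat: "\<And>q s f g. \<lbrakk>q \<in> Ob Q; s \<in> Ob Q; f \<in> rad p q; g \<in> Mor Q q s\<rbrakk> \<Longrightarrow>
      \<phi> s (Comp Q p q s g f) = fmor X q s g (\<phi> q f)"
  shows "(\<lambda>g. \<phi> q (rproj p q g)) \<in> lin_maps k (Hom Q p q) (fobj X q)"
proof -
  have "\<phi> q (a \<odot>\<^bsub>Hom Q p q\<^esub> f) = a \<odot>\<^bsub>fobj X q\<^esub> \<phi> q f" if a: "a \<in> carrier k" and f: "f \<in> rad p q" for a f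
  proof -
    note fH = rad_closed[OF p q f]
    have "Comp Q p q q (a \<odot>\<^bsub>Hom Q q q\<^esub> Ide Q q) f = a \<odot>\<^bsub>Hom Q p q\<^esub> f"
      using fmor_scalar[OF hom_fun_QMod[OF p] q a, of f] fH by simp
    moreover have "a \<odot>\<^bsub>Hom Q q q\<^esub> Ide Q q \<in> Mor Q q q"
      by (rule left_module.lsmult_closed[OF hom_lm[OF q q] a ide_closed[OF q]])
    ultimately show ?thesis using nat[OF q q f] fmor_scalar[OF X q a cl[OF q f]] by metis
  qed
  hence "\<phi> q \<in> lin_maps k ((Hom Q p q)\<lparr>carrier := rad p q\<rparr>) (fobj X q)"
    using cl[OF q] add[OF q] by (auto simp: lin_maps_def)
  moreover have "rproj p q \<in> lin_maps k (Hom Q p q) ((Hom Q p q)\<lparr>carrier := rad p q\<rparr>)"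
    using rproj_lin_maps[OF p q] rproj_rad[OF p q] by (auto simp: lin_maps_def)
  ultimately show ?thesis by (rule lin_maps_comp)
qed

lemma hom_free_embedding:
  assumes "p \<in> Ob Q" "q \<in> Ob Q"
  obtains \<eta> where "\<eta> \<in> lin_maps k (Hom Q p q) (free_module k (Mor Q p q))"
    "\<And>g. g \<in> Mor Q p q \<Longrightarrow> \<eta> g = (\<lambda>i\<in>Mor Q p q. \<zero>\<^bsub>k\<^esub>) \<Longrightarrow> g = \<zero>\<^bsub>Hom Q p q\<^esub>"
proof -
  obtain \<xi> where \<xi>: "\<xi> \<in> lin_maps k (Hom Q p q) (coords k (Hom Q p q))"
    "\<And>g. g \<in> Mor Q p q \<Longrightarrow> lincomb k (Hom Q p q) (\<xi> g) = g"
    by (rule hom_coords[OF assms]) blast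
  have "lincomb k (Hom Q p q) \<zero>\<^bsub>coords k (Hom Q p q)\<^esub> = \<zero>\<^bsub>Hom Q p q\<^esub>"
    by (rule lin_maps_zero[OF lm_ag[OF coords_left_module[OF k_ring]] hom_ag[OF assms] lincomb_lin_maps[OF k_ring hom_lm[OF assms]]])
  hence "g = \<zero>\<^bsub>Hom Q p q\<^esub>" if "g \<in> Mor Q p q" "\<xi> g = (\<lambda>i\<in>Mor Q p q. \<zero>\<^bsub>k\<^esub>)" for g
    using \<xi>(2)[OF that(1)] that(2) by (simp add: coords_def dsum_simps)
  thus ?thesis using that[of \<xi>] \<xi>(1) by (simp add: coords_def)
qed

text \<open>At each object a free functor is a direct sum of projective modules
  \<open>Q(b i, p)\<close>, and each of them embeds into a free module by its dual basis.\<close>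

lemma free_fun_embedding:
  fixes b :: "'i \<Rightarrow> 'o"
  assumes b: "\<forall>i\<in>I. b i \<in> Ob Q" and p: "p \<in> Ob Q"
  shows "\<exists>(J :: ('i \<times> 'm) set) \<theta>. \<theta> \<in> lin_maps k (fobj (free_fun Q I b) p) (free_module k J) \<and>
    (\<forall>c \<in> El (free_fun Q I b) p. \<theta> c = (\<lambda>i\<in>J. \<zero>\<^bsub>k\<^esub>) \<longrightarrow> c = \<zero>\<^bsub>fobj (free_fun Q I b) p\<^esub>)"
proof -
  let ?D = "\<lambda>i. free_module k (Mor Q (b i) p)"
  have "\<forall>i\<in>I. \<exists>\<eta>. \<eta> \<in> lin_maps k (Hom Q (b i) p) (?D i) \<and>
    (\<forall>g \<in> Mor Q (b i) p. \<eta> g = (\<lambda>i\<in>Mor Q (b i) p. \<zero>\<^bsub>k\<^esub>) \<longrightarrow> g = \<zero>\<^bsub>Hom Q (b i) p\<^esub>)"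
  proof
    fix i assume "i \<in> I"
    hence "b i \<in> Ob Q" using b by blast
    from hom_free_embedding[OF this p] show "\<exists>\<eta>. \<eta> \<in> lin_maps k (Hom Q (b i) p) (?D i) \<and>
      (\<forall>g \<in> Mor Q (b i) p. \<eta> g = (\<lambda>i\<in>Mor Q (b i) p. \<zero>\<^bsub>k\<^esub>) \<longrightarrow> g = \<zero>\<^bsub>Hom Q (b i) p\<^esub>)"
      by metis
  qed
  then obtain \<eta> where \<eta>: "\<And>i. i \<in> I \<Longrightarrow> \<eta> i \<in> lin_maps k (Hom Q (b i) p) (?D i)"
    "\<And>i g. i \<in> I \<Longrightarrow> g \<in> Mor Q (b i) p \<Longrightarrow> \<eta> i g = (\<lambda>i\<in>Mor Q (b i) p. \<zero>\<^bsub>k\<^esub>) \<Longrightarrow> g = \<zero>\<^bsub>Hom Q (b i) p\<^esub>"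
    by (metis bchoice)
  define J where "J = (SIGMA i : I. Mor Q (b i) p)"
  let ?F = "dsum_module I (\<lambda>i. Hom Q (b i) p)"
  define \<theta> where "\<theta> c = (\<lambda>j\<in>J. \<eta> (fst j) (c (fst j)) (snd j))" for c
  have \<eta>0: "\<eta> i \<zero>\<^bsub>Hom Q (b i) p\<^esub> = (\<lambda>e\<in>Mor Q (b i) p. \<zero>\<^bsub>k\<^esub>)" if "i \<in> I" for i
    using lin_maps_zero[OF hom_ag[OF _ p] lm_ag[OF free_left_module[OF k_ring]] \<eta>(1)[OF that]] b that
    by (simp add: dsum_simps)
  have "(\<lambda>c. \<lambda>j\<in>J. \<eta> (fst j) (c (fst j)) (snd j)) \<in> lin_maps k ?F (free_module k J)"
  proof (rule dsum_tuple_lin_maps)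
    fix j assume "j \<in> J"
    hence j: "fst j \<in> I" "snd j \<in> Mor Q (b (fst j)) p" by (auto simp: J_def)
    show "(\<lambda>c. \<eta> (fst j) (c (fst j)) (snd j)) \<in> forms k ?F"
      by (rule lin_maps_comp[OF dsum_proj_lin_maps[OF j(2)] lin_maps_comp[OF \<eta>(1)[OF j(1)]
        dsum_proj_lin_maps[OF j(1), where M = "\<lambda>i. Hom Q (b i) p"]]])
  next
    fix c assume c: "c \<in> carrier ?F"
    have "{j \<in> J. \<eta> (fst j) (c (fst j)) (snd j) \<noteq> \<zero>\<^bsub>self_module k\<^esub>} \<subseteq>
      (SIGMA i : dsupp I (\<lambda>i. Hom Q (b i) p) c. {e \<in> Mor Q (b i) p. \<eta> i (c i) e \<noteq> \<zero>\<^bsub>k\<^esub>})"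
      using \<eta>0 by (fastforce simp: J_def)
    moreover have "finite \<dots>"
    proof (rule finite_SigmaI[OF dsumD(2)[OF c]])
      fix i assume i: "i \<in> dsupp I (\<lambda>i. Hom Q (b i) p) c"
      have "\<eta> i (c i) \<in> carrier (?D i)"
        using lin_maps_closed[OF \<eta>(1), of i "c i"] dsumD(1)[OF c, of i] i by simp
      from dsumD(2)[OF this] show "finite {e \<in> Mor Q (b i) p. \<eta> i (c i) e \<noteq> \<zero>\<^bsub>k\<^esub>}" by simp
    qed
    ultimately show "finite {j \<in> J. \<eta> (fst j) (c (fst j)) (snd j) \<noteq> \<zero>\<^bsub>self_module k\<^esub>}" by (rule finite_subset)
  qed
  hence \<theta>: "\<theta> \<in> lin_maps k ?F (free_module k J)" by (simp add: \<theta>_def[abs_def])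
  have "c = \<zero>\<^bsub>?F\<^esub>" if c: "c \<in> carrier ?F" and z: "\<theta> c = (\<lambda>i\<in>J. \<zero>\<^bsub>k\<^esub>)" for c
  proof -
    have "c i = \<zero>\<^bsub>Hom Q (b i) p\<^esub>" if i: "i \<in> I" for i
    proof (rule \<eta>(2)[OF i dsumD(1)[OF c i]])
      have "\<eta> i (c i) e = \<zero>\<^bsub>k\<^esub>" if "e \<in> Mor Q (b i) p" for e
        using fun_cong[OF z, of "(i, e)"] i that by (simp add: \<theta>_def J_def)
      moreover have "\<eta> i (c i) \<in> extensional (Mor Q (b i) p)"
        by (rule dsumD(3)[OF lin_maps_closed[OF \<eta>(1)[OF i] dsumD(1)[OF c i]]])
      ultimately show "\<eta> i (c i) = (\<lambda>e\<in>Mor Q (b i) p. \<zero>\<^bsub>k\<^esub>)"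
        by (auto simp: fun_eq_iff extensional_def)
    qed
    thus ?thesis using dsumD(3)[OF c] by (auto simp: dsum_simps fun_eq_iff extensional_def)
  qed
  thus ?thesis using \<theta> by (intro exI[of _ J] exI[of _ \<theta>]) simp
qed

lemma rel_proj_of_embedding:
  assumes V: "module k V" and \<theta>: "\<theta> \<in> lin_maps k V (free_module k J)"
    and inj: "\<And>v. v \<in> carrier V \<Longrightarrow> \<theta> v = (\<lambda>i\<in>J. \<zero>\<^bsub>k\<^esub>) \<longleftrightarrow> v \<in> U" and U: "U \<subseteq> carrier V"
  shows "rel_proj k V U"
proof -
  have "{v \<in> carrier V. \<theta> v = (\<lambda>i\<in>J. \<zero>\<^bsub>k\<^esub>)} = U" using inj U by auto
  thus ?thesis using rel_proj_kernel[OF her V \<theta>] by simp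
qed

end

text \<open>The Serre functor enters only through the functionals \<open>t q\<close> on \<open>Q(q, \<sigma> q)\<close>, the images of the
  identities: the pairing \<open>t q (g f)\<close> of \<open>f \<in> Q(q, s)\<close> with \<open>g \<in> Q(s, \<sigma> q)\<close> is perfect.\<close>

locale frob = shape k Q r for k :: "'k ring" and Q :: "('k, 'o, 'm) lincat" and r +
  fixes \<sigma> \<sigma>' :: "'o \<Rightarrow> 'o" and t :: "'o \<Rightarrow> 'm \<Rightarrow> 'k"
  assumes sigma: "p \<in> Ob Q \<Longrightarrow> \<sigma> p \<in> Ob Q" "p \<in> Ob Q \<Longrightarrow> \<sigma>' p \<in> Ob Q"
      "p \<in> Ob Q \<Longrightarrow> \<sigma> (\<sigma>' p) = p" "p \<in> Ob Q \<Longrightarrow> \<sigma>' (\<sigma> p) = p"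
    and t_lin: "p \<in> Ob Q \<Longrightarrow> t p \<in> forms k (Hom Q p (\<sigma> p))"
    and left_ex: "\<lbrakk>q \<in> Ob Q; s \<in> Ob Q; \<zeta> \<in> forms k (Hom Q s (\<sigma> q))\<rbrakk> \<Longrightarrow>
      \<exists>f \<in> Mor Q q s. \<forall>g \<in> Mor Q s (\<sigma> q). t q (Comp Q q s (\<sigma> q) g f) = \<zeta> g"
    and left_zero: "\<lbrakk>q \<in> Ob Q; s \<in> Ob Q; f \<in> Mor Q q s;
      \<forall>g \<in> Mor Q s (\<sigma> q). t q (Comp Q q s (\<sigma> q) g f) = \<zero>\<^bsub>k\<^esub>\<rbrakk> \<Longrightarrow> f = \<zero>\<^bsub>Hom Q q s\<^esub>"
    and right_ex: "\<lbrakk>q \<in> Ob Q; s \<in> Ob Q; \<zeta> \<in> forms k (Hom Q q s)\<rbrakk> \<Longrightarrow>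
      \<exists>g \<in> Mor Q s (\<sigma> q). \<forall>f \<in> Mor Q q s. t q (Comp Q q s (\<sigma> q) g f) = \<zeta> f"
    and right_zero: "\<lbrakk>q \<in> Ob Q; s \<in> Ob Q; g \<in> Mor Q s (\<sigma> q);
      \<forall>f \<in> Mor Q q s. t q (Comp Q q s (\<sigma> q) g f) = \<zero>\<^bsub>k\<^esub>\<rbrakk> \<Longrightarrow> g = \<zero>\<^bsub>Hom Q s (\<sigma> q)\<^esub>"
begin

text \<open>Reading composites backwards exchanges the left and right axioms, and
  \<open>\<sigma>'\<close> takes the place of \<open>\<sigma>\<close>.\<close>

lemma op_frob: "frob k (op_cat Q) r \<sigma>' \<sigma> (\<lambda>q. t (\<sigma>' q))"
proof -
  note O = sigma(2)
  show ?thesis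
  proof (intro frob.intro op_shape frob_axioms.intro; (unfold op_cat_simps)?)
    show "t (\<sigma>' p) \<in> forms k (Hom Q (\<sigma>' p) p)" if "p \<in> Ob Q" for p
      using t_lin[OF O[OF that]] sigma(3)[OF that] by simp
    show "\<exists>f\<in>Mor Q s q. \<forall>g\<in>Mor Q (\<sigma>' q) s. t (\<sigma>' q) (Comp Q (\<sigma>' q) s q f g) = \<zeta> g"
      if "q \<in> Ob Q" "s \<in> Ob Q" "\<zeta> \<in> forms k (Hom Q (\<sigma>' q) s)" for q s \<zeta>
      using right_ex[OF O[OF that(1)] that(2,3)] sigma(3)[OF that(1)] by simp
    show "f = \<zero>\<^bsub>Hom Q s q\<^esub>" if "q \<in> Ob Q" "s \<in> Ob Q" "f \<in> Mor Q s q"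
      "\<forall>g\<in>Mor Q (\<sigma>' q) s. t (\<sigma>' q) (Comp Q (\<sigma>' q) s q f g) = \<zero>\<^bsub>k\<^esub>" for q s f
      using right_zero[OF O[OF that(1)] that(2)] sigma(3)[OF that(1)] that(3,4) by simp
    show "\<exists>g\<in>Mor Q (\<sigma>' q) s. \<forall>f\<in>Mor Q s q. t (\<sigma>' q) (Comp Q (\<sigma>' q) s q f g) = \<zeta> f"
      if "q \<in> Ob Q" "s \<in> Ob Q" "\<zeta> \<in> forms k (Hom Q s q)" for q s \<zeta>
      using left_ex[OF O[OF that(1)] that(2)] sigma(3)[OF that(1)] that(3) by simp
    show "g = \<zero>\<^bsub>Hom Q (\<sigma>' q) s\<^esub>" if "q \<in> Ob Q" "s \<in> Ob Q" "g \<in> Mor Q (\<sigma>' q) s"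
      "\<forall>f\<in>Mor Q s q. t (\<sigma>' q) (Comp Q (\<sigma>' q) s q f g) = \<zero>\<^bsub>k\<^esub>" for q s g
      using left_zero[OF O[OF that(1)] that(2,3)] sigma(3)[OF that(1)] that(4) by simp
  qed (use sigma in auto)
qed

section \<open>Socle elements, and kernels of surjections between radical injective functors\<close>

lemma left_cancel:
  assumes q: "q \<in> Ob Q" and s: "s \<in> Ob Q" and f: "f \<in> Mor Q q s" and f': "f' \<in> Mor Q q s"
    and eq: "\<And>g. g \<in> Mor Q s (\<sigma> q) \<Longrightarrow> t q (Comp Q q s (\<sigma> q) g f) = t q (Comp Q q s (\<sigma> q) g f')"
  shows "f = f'"
proof -
  interpret H: abelian_group "Hom Q q s" by (rule hom_ag[OF q s])
  have kag: "abelian_group (self_module k)" by (rule k_ag)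
  have "f \<ominus>\<^bsub>Hom Q q s\<^esub> f' = \<zero>\<^bsub>Hom Q q s\<^esub>"
  proof (rule left_zero[OF q s H.minus_closed[OF f f']], intro ballI)
    fix g assume g: "g \<in> Mor Q s (\<sigma> q)"
    note l = lin_maps_add_maps[OF lin_maps_comp[OF t_lin[OF q] comp_linear_right[OF q s sigma(1)[OF q] g]]]
    have "t q (Comp Q q s (\<sigma> q) g (f \<ominus>\<^bsub>Hom Q q s\<^esub> f')) =
      t q (Comp Q q s (\<sigma> q) g f) \<ominus>\<^bsub>self_module k\<^esub> t q (Comp Q q s (\<sigma> q) g f')"
      by (rule add_maps_minus[OF H.abelian_group_axioms kag l f f'])
    thus "t q (Comp Q q s (\<sigma> q) g (f \<ominus>\<^bsub>Hom Q q s\<^esub> f')) = \<zero>\<^bsub>k\<^esub>"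
      using ag_minus_eq_zero[OF kag add_maps_closed[OF l f] add_maps_closed[OF l f']] eq[OF g] by simp
  qed
  thus ?thesis using ag_minus_eq_zero[OF H.abelian_group_axioms f f'] by simp
qed

text \<open>The pairing represents the functional \<open>coef p\<close> by a morphism from
  \<open>\<sigma>' p\<close> to \<open>p\<close>. It generates the copy of
  \<open>S\<langle>p\<rangle>\<close> inside \<open>Q(\<sigma>' p, -)\<close>.\<close>

definition socle :: "'o \<Rightarrow> 'm" where
  "socle p = (SOME s. s \<in> Mor Q (\<sigma>' p) p \<and> (\<forall>g \<in> Mor Q p p. t (\<sigma>' p) (Comp Q (\<sigma>' p) p p g s) = coef p g))"

lemma socle:
  assumes p: "p \<in> Ob Q"
  shows socle_closed: "socle p \<in> Mor Q (\<sigma>' p) p"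
    and socle_t: "\<And>g. g \<in> Mor Q p p \<Longrightarrow> t (\<sigma>' p) (Comp Q (\<sigma>' p) p p g (socle p)) = coef p g"
proof -
  have "\<exists>s. s \<in> Mor Q (\<sigma>' p) p \<and> (\<forall>g \<in> Mor Q p p. t (\<sigma>' p) (Comp Q (\<sigma>' p) p p g s) = coef p g)"
    using left_ex[OF sigma(2)[OF p] p, of "coef p"] coef_lin_maps[OF p] sigma(3)[OF p] by auto
  from someI_ex[OF this, folded socle_def]
  show "socle p \<in> Mor Q (\<sigma>' p) p"
    "\<And>g. g \<in> Mor Q p p \<Longrightarrow> t (\<sigma>' p) (Comp Q (\<sigma>' p) p p g (socle p)) = coef p g" by auto
qed

text \<open>Paired with any \<open>g\<close>, the composite gives \<open>coef p (g f)\<close>, which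
  is zero because \<open>g f\<close> lies in \<open>r p\<close>; the pairing is
  nondegenerate.\<close>

lemma rad_socle:
  assumes p: "p \<in> Ob Q" and q: "q \<in> Ob Q" and f: "f \<in> rad p q"
  shows "Comp Q (\<sigma>' p) p q f (socle p) = \<zero>\<^bsub>Hom Q (\<sigma>' p) q\<^esub>"
proof (rule left_zero[OF sigma(2)[OF p] q comp_closed[OF sigma(2)[OF p] p q socle_closed[OF p] rad_closed[OF p q f]]], intro ballI)
  fix g assume "g \<in> Mor Q q (\<sigma> (\<sigma>' p))"
  hence g: "g \<in> Mor Q q p" using sigma(3)[OF p] by simp
  have gf: "Comp Q p q p g f \<in> r p" using rad_comp_left[OF p q p f g] by (simp add: rad_self)
  show "t (\<sigma>' p) (Comp Q (\<sigma>' p) q (\<sigma> (\<sigma>' p)) g (Comp Q (\<sigma>' p) p q f (socle p))) = \<zero>\<^bsub>k\<^esub>"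
    using comp_assoc[OF sigma(2)[OF p] p q p socle_closed[OF p] rad_closed[OF p q f] g] sigma(3)[OF p]
      socle_t[OF p r_closed[OF p gf]] coef_rad[OF p gf] by simp
qed

lemma fmor_socle:
  assumes X: "X \<in> QMod k Q" and p: "p \<in> Ob Q" and q: "q \<in> Ob Q" and f: "f \<in> rad p q" and z: "z \<in> El X (\<sigma>' p)"
  shows "fmor X p q f (fmor X (\<sigma>' p) p (socle p) z) = \<zero>\<^bsub>fobj X q\<^esub>"
  using QMod_comp[OF X sigma(2)[OF p] p q socle_closed[OF p] rad_closed[OF p q f] z, symmetric] rad_socle[OF p q f]
    lin_maps_zero[OF hom_ag[OF sigma(2)[OF p] q] QMod_ag[OF X q] QMod_lin[OF X sigma(2)[OF p] q z]] by simp

text \<open>For radical injective \<open>X\<close>, extend the map \<open>S\<langle>p\<rangle> \<rightarrow> X\<close> given by \<open>x\<close> along the inclusion of \<open>S\<langle>p\<rangle>\<close>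
  into \<open>Q(\<sigma>' p, -)\<close> as the subfunctor generated by \<open>socle p\<close>.\<close>

lemma socle_generates:
  assumes X: "X \<in> QMod k Q" and inj: "radical_injective Q r X" and p: "p \<in> Ob Q" and x: "x \<in> El X p"
    and rx: "\<And>q f. q \<in> Ob Q \<Longrightarrow> f \<in> rad p q \<Longrightarrow> fmor X p q f x = \<zero>\<^bsub>fobj X q\<^esub>"
  shows "\<exists>z \<in> El X (\<sigma>' p). x = fmor X (\<sigma>' p) p (socle p) z"
proof -
  let ?p = "\<sigma>' p" and ?s = "socle p"
  have p': "?p \<in> Ob Q" by (rule sigma(2)[OF p])
  have sV: "?s \<in> Mor Q ?p p" by (rule socle_closed[OF p])
  interpret Hp: left_module k "Hom Q ?p p" by (rule hom_lm[OF p' p])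
  have tl: "t ?p \<in> forms k (Hom Q ?p p)" using t_lin[OF p'] sigma(3)[OF p] by simp
  have V: "hom_fun Q p \<in> QMod k Q" "hom_fun Q ?p \<in> QMod k Q" using hom_fun_QMod p p' by auto
  define \<eta> where "\<eta> q f = Comp Q ?p p q f ?s" for q f
  have \<eta>: "\<eta> \<in> NT (hom_fun Q p) (hom_fun Q ?p)"
    by (rule nat_transI[OF V])
      (use lin_maps_add_maps[OF comp_linear_left[OF p' p _ sV]] comp_assoc[OF p' p _ _ sV] in \<open>auto simp: \<eta>_def[abs_def]\<close>)
  have \<theta>: "(\<lambda>q f. fmor X p q f x) \<in> NT (hom_fun Q p) X"
    by (rule nat_transI[OF V(1) X]) (use lin_maps_add_maps[OF QMod_lin[OF X p _ x]] QMod_comp[OF X p _ _ _ _ x] in auto)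
  have \<eta>p: "\<eta> p f = coef p f \<odot>\<^bsub>Hom Q ?p p\<^esub> ?s" if f: "f \<in> Mor Q p p" for f
    using fmor_decomp[OF V(2) p f, of ?s] sV rad_socle[OF p p rproj_rad[OF p p f]] Hp.lsmult_closed[OF coef(1)[OF p f] sV] by (simp add: \<eta>_def)
  have ker: "fmor X p q f x = \<zero>\<^bsub>fobj X q\<^esub>" if q: "q \<in> Ob Q" and f: "f \<in> Mor Q p q" and z: "\<eta> q f = \<zero>\<^bsub>Hom Q ?p q\<^esub>" for q f
  proof (rule rx[OF q], cases "q = p")
    case True
    have "coef p f = \<zero>\<^bsub>k\<^esub>"
      using socle_t[OF p, of f] f z True lin_maps_zero[OF Hp.abelian_group_axioms k_ag tl] by (simp add: \<eta>_def)
    thus "f \<in> rad p q" using coef_zero_rad[OF p, of f] f True by (simp add: rad_self)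
  qed (use f in \<open>simp add: pseudo_radical_def\<close>)
  \<comment> \<open>Away from \<open>p\<close> the image of \<open>\<eta>\<close> is zero. At
    \<open>p\<close> it consists of the multiples of \<open>socle p\<close>, and the functional
    \<open>t\<close> splits them off, since it takes the value \<open>coef p (Ide Q p) = 1\<close>
    on \<open>socle p\<close>.\<close>
  have rp: "rel_proj k (Hom Q ?p q) (\<eta> q ` Mor Q p q)" if q: "q \<in> Ob Q" for q
  proof (cases "q = p")
    case False
    hence "\<eta> q f = \<zero>\<^bsub>Hom Q ?p q\<^esub>" if "f \<in> Mor Q p q" for f
      using rad_socle[OF p q, of f] that by (simp add: \<eta>_def pseudo_radical_def)
    hence "\<eta> q ` Mor Q p q = {\<zero>\<^bsub>Hom Q ?p q\<^esub>}" using ag_zero_closed[OF hom_ag[OF p q]] by auto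
    thus ?thesis using hom_rel_proj[OF p' q] by simp
  next
    case True
    obtain \<xi> where \<xi>: "\<xi> \<in> lin_maps k (Hom Q ?p p) (coords k (Hom Q ?p p))"
      "\<And>g. g \<in> Mor Q ?p p \<Longrightarrow> lincomb k (Hom Q ?p p) (\<xi> g) = g"
      by (rule hom_coords[OF p' p]) blast
    \<comment> \<open>The projection that kills the multiples of \<open>socle p\<close>; a dual
      basis of \<open>Q(\<sigma>' p, p)\<close> composed with it is one of the quotient.\<close>
    define m where "m v = v \<ominus>\<^bsub>Hom Q ?p p\<^esub> t ?p v \<odot>\<^bsub>Hom Q ?p p\<^esub> ?s" for v
    have m: "m \<in> lin_maps k (Hom Q ?p p) (Hom Q ?p p)"
      unfolding m_def by (rule lin_maps_diff[OF hom_lm[OF p' p] lin_maps_id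
        lin_maps_comp[OF left_module_smult_point[OF hom_lm[OF p' p] sV] tl]])
    have "\<xi> (m (\<eta> p f)) = \<zero>\<^bsub>coords k (Hom Q ?p p)\<^esub>" if f: "f \<in> Mor Q p p" for f
    proof -
      have "t ?p (\<eta> p f) = coef p f" using socle_t[OF p f] by (simp add: \<eta>_def)
      hence "m (\<eta> p f) = \<zero>\<^bsub>Hom Q ?p p\<^esub>"
        using \<eta>p[OF f] Hp.lsmult_closed[OF coef(1)[OF p f] sV] by (simp add: m_def Hp.minus_eq Hp.r_neg)
      thus ?thesis
        using lin_maps_zero[OF hom_ag[OF p' p] lm_ag[OF coords_left_module[OF k_ring]] \<xi>(1)] by simp
    qed
    moreover have "v \<ominus>\<^bsub>Hom Q ?p p\<^esub> lincomb k (Hom Q ?p p) (\<xi> (m v)) \<in> \<eta> p ` Mor Q p p" if v: "v \<in> Mor Q ?p p" for v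
    proof -
      have a: "t ?p v \<in> carrier k" using lin_maps_closed[OF tl v] by simp
      let ?f = "t ?p v \<odot>\<^bsub>Hom Q p p\<^esub> Ide Q p"
      have "v \<ominus>\<^bsub>Hom Q ?p p\<^esub> m v = t ?p v \<odot>\<^bsub>Hom Q ?p p\<^esub> ?s"
        using v Hp.lsmult_closed[OF a sV] by (simp add: m_def Hp.minus_eq Hp.minus_add Hp.a_ac Hp.r_neg1 Hp.r_neg2 Hp.r_neg)
      moreover have "\<eta> p ?f = t ?p v \<odot>\<^bsub>Hom Q ?p p\<^esub> ?s" using fmor_scalar[OF V(2) p a, of ?s] sV by (simp add: \<eta>_def)
      moreover have "?f \<in> Mor Q p p" using left_module.lsmult_closed[OF hom_lm[OF p p] a ide_closed[OF p]] .
      ultimately show ?thesis using \<xi>(2)[OF lin_maps_closed[OF m v]] by (metis image_eqI)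
    qed
    ultimately have "rel_proj k (Hom Q ?p p) (\<eta> p ` Mor Q p p)"
      unfolding rel_proj_def by (intro bexI[OF _ lin_maps_comp[OF \<xi>(1) m]]) auto
    thus ?thesis using True by simp
  qed
  obtain \<psi> where \<psi>: "\<psi> \<in> NT (hom_fun Q ?p) X" "\<And>q f. q \<in> Ob Q \<Longrightarrow> f \<in> Mor Q p q \<Longrightarrow> \<psi> q (\<eta> q f) = fmor X p q f x"
    using radical_injective_extend_along[OF X inj V \<eta> \<theta>] rp ker by auto
  have "x = \<psi> p (\<eta> p (Ide Q p))" using \<psi>(2)[OF p ide_closed[OF p]] QMod_ide[OF X p x] by simp
  also have "\<eta> p (Ide Q p) = Comp Q ?p ?p p ?s (Ide Q ?p)" using comp_ide[OF p' p sV] by (simp add: \<eta>_def)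
  also have "\<psi> p \<dots> = fmor X ?p p ?s (\<psi> ?p (Ide Q ?p))" using nat_natural[OF \<psi>(1) p' p sV, of "Ide Q ?p"] ide_closed[OF p'] by simp
  finally show ?thesis using nat_closed[OF \<psi>(1) p', of "Ide Q ?p"] ide_closed[OF p'] by (intro bexI[of _ "\<psi> ?p (Ide Q ?p)"]) auto
qed

lemma radical_injective_image:
  assumes "radical_injective Q r Y" and i: "i \<in> NT X Y" and p: "p \<in> Ob Q" and \<phi>: "radical_family Q r X p \<phi>"
  shows "\<exists>y \<in> El Y p. \<forall>q \<in> Ob Q. \<forall>f \<in> rad p q. i q (\<phi> q f) = fmor Y p q f y"
proof -
  note cl = rf_closed[OF \<phi>] and add = rf_add[OF \<phi>] and nat = rf_nat[OF \<phi>]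
  show ?thesis
    by (rule radical_injectiveD[OF assms(1) p, where \<phi> = "\<lambda>q f. i q (\<phi> q f)"])
      (use cl add nat nat_closed[OF i] nat_add[OF i] nat_natural[OF i] in auto)
qed

text \<open>Represent the family in \<open>Y\<close> by \<open>y\<close>. Its image in
  \<open>Z\<close> is killed by \<open>r\<close>, because the family takes values in
  \<open>X\<close>; by \<open>socle_generates\<close> it is \<open>socle p\<close> applied to some
  \<open>z\<close>. Lift \<open>z\<close> to \<open>Y\<close> and subtract \<open>socle p\<close>
  applied to the lift: the difference lies in \<open>X\<close>, and as \<open>r\<close> kills what
  was subtracted it still represents the family.\<close>

lemma radical_injective_kernel:
  assumes X: "X \<in> QMod k Q" and Y: "Y \<in> QMod k Q" and Z: "Z \<in> QMod k Q"
    and i: "i \<in> NT X Y" and g: "g \<in> NT Y Z"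
    and inj: "\<And>p. p \<in> Ob Q \<Longrightarrow> inj_on (i p) (El X p)"
    and exact: "\<And>p. p \<in> Ob Q \<Longrightarrow> i p ` El X p = {y \<in> El Y p. g p y = \<zero>\<^bsub>fobj Z p\<^esub>}"
    and surj: "\<And>p. p \<in> Ob Q \<Longrightarrow> g p ` El Y p = El Z p"
    and EY: "radical_injective Q r Y" and EZ: "radical_injective Q r Z"
  shows "radical_injective Q r X"
  unfolding radical_injective_def
proof (intro ballI allI impI)
  fix p \<phi> assume p: "p \<in> Ob Q" and \<phi>: "radical_family Q r X p \<phi>"
  note cl = rf_closed[OF \<phi>]
  obtain y where y: "y \<in> El Y p" "\<And>q f. q \<in> Ob Q \<Longrightarrow> f \<in> rad p q \<Longrightarrow> i q (\<phi> q f) = fmor Y p q f y"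
    using radical_injective_image[OF EY i p \<phi>] by blast
  have "fmor Z p q f (g p y) = \<zero>\<^bsub>fobj Z q\<^esub>" if q: "q \<in> Ob Q" and f: "f \<in> rad p q" for q f
  proof -
    have "i q (\<phi> q f) \<in> i q ` El X q" using cl q f by blast
    hence "g q (i q (\<phi> q f)) = \<zero>\<^bsub>fobj Z q\<^esub>" using exact[OF q] by simp
    thus ?thesis using nat_natural[OF g p q rad_closed[OF p q f] y(1)] y(2)[OF q f] by simp
  qed
  then obtain z where z: "z \<in> El Z (\<sigma>' p)" "g p y = fmor Z (\<sigma>' p) p (socle p) z"
    using socle_generates[OF Z EZ p nat_closed[OF g p y(1)]] by blast
  have p': "\<sigma>' p \<in> Ob Q" by (rule sigma(2)[OF p])
  obtain z' where z': "z' \<in> El Y (\<sigma>' p)" "g (\<sigma>' p) z' = z" using surj[OF p'] z(1) by (metis imageE)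
  let ?w = "fmor Y (\<sigma>' p) p (socle p) z'"
  have w: "?w \<in> El Y p" by (rule fmor_closed[OF Y p' p socle_closed[OF p] z'(1)])
  have yw: "y \<ominus>\<^bsub>fobj Y p\<^esub> ?w \<in> El Y p"
    using abelian_group.minus_closed[OF QMod_ag[OF Y p] y(1) w] .
  have "g p (y \<ominus>\<^bsub>fobj Y p\<^esub> ?w) = \<zero>\<^bsub>fobj Z p\<^esub>"
    using nat_minus[OF Y Z g p y(1) w] nat_natural[OF g p' p socle_closed[OF p] z'(1)] z z'(2)
      ag_minus_eq_zero[OF QMod_ag[OF Z p]] nat_closed[OF g p y(1)] by simp
  hence "y \<ominus>\<^bsub>fobj Y p\<^esub> ?w \<in> i p ` El X p" using exact[OF p] yw by simp
  then obtain x where x: "x \<in> El X p" "i p x = y \<ominus>\<^bsub>fobj Y p\<^esub> ?w" by (metis imageE)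
  have "\<phi> q f = fmor X p q f x" if q: "q \<in> Ob Q" and f: "f \<in> rad p q" for q f
  proof -
    note fH = rad_closed[OF p q f]
    interpret Yq: abelian_group "fobj Y q" by (rule QMod_ag[OF Y q])
    have "i q (fmor X p q f x) = fmor Y p q f y \<ominus>\<^bsub>fobj Y q\<^esub> \<zero>\<^bsub>fobj Y q\<^esub>"
      using nat_natural[OF i p q fH x(1)] x(2) fmor_minus[OF Y p q fH y(1) w] fmor_socle[OF Y p q f z'(1)] by simp
    also have "\<dots> = i q (\<phi> q f)"
      using y(2)[OF q f] fmor_closed[OF Y p q fH y(1)] a_inv_zero_ag[OF Yq.abelian_group_axioms] by (simp add: Yq.minus_eq)
    finally show ?thesis using inj[OF q] cl q f fmor_closed[OF X p q fH x(1)] by (metis inj_onD)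
  qed
  thus "\<exists>x\<in>El X p. \<forall>q\<in>Ob Q. \<forall>f\<in>rad p q. \<phi> q f = fmor X p q f x" using x(1) by blast
qed

end

section \<open>Free functors, projective functors and their duals\<close>

text \<open>The index type \<open>'o \<times> 'x\<close> suffices: the standard cover of
  \<open>P\<close> has one summand for each element of \<open>P\<close>, and the embedding in
  \<open>radical_injective_retract\<close> is indexed in the same way.\<close>

definition retract_of_free :: "'k ring \<Rightarrow> ('k, 'o, 'm) lincat \<Rightarrow> ('o, 'm, 'k, 'x) modfun \<Rightarrow> bool" where
  "retract_of_free k Q P \<longleftrightarrow> (\<exists>(I :: ('o \<times> 'x) set) b \<kappa> \<rho>. (\<forall>i \<in> I. b i \<in> Ob Q) \<and>
     \<kappa> \<in> nat_trans k Q P (free_fun Q I b) \<and> \<rho> \<in> nat_trans k Q (free_fun Q I b) P \<and>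
     (\<forall>p \<in> Ob Q. \<forall>x \<in> El P p. \<rho> p (\<kappa> p x) = x))"

lemma retract_of_freeE:
  fixes P :: "('o, 'm, 'k, 'x) modfun"
  assumes "retract_of_free k Q P"
  obtains I :: "('o \<times> 'x) set" and b and \<kappa> and \<rho> where "\<forall>i \<in> I. b i \<in> Ob Q" "\<kappa> \<in> nat_trans k Q P (free_fun Q I b)"
    "\<rho> \<in> nat_trans k Q (free_fun Q I b) P" "\<And>p x. p \<in> Ob Q \<Longrightarrow> x \<in> El P p \<Longrightarrow> \<rho> p (\<kappa> p x) = x"
  using assms unfolding retract_of_free_def by (elim exE conjE) (rule that, assumption+, simp)

context preadditive
begin

lemma free_retract_lift:
  assumes b: "\<forall>i \<in> I. b i \<in> Ob Q" and \<kappa>: "\<kappa> \<in> NT P (free_fun Q I b)"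
    and \<rho>: "\<rho> \<in> NT (free_fun Q I b) P" and id: "\<And>p x. p \<in> Ob Q \<Longrightarrow> x \<in> El P p \<Longrightarrow> \<rho> p (\<kappa> p x) = x"
    and E: "E \<in> QMod k Q" and B: "B \<in> QMod k Q"
    and g: "g \<in> NT E B" and h: "h \<in> NT P B"
    and surj: "\<forall>p \<in> Ob Q. g p ` El E p = El B p"
  shows "\<exists>l \<in> NT P E. \<forall>p \<in> Ob Q. \<forall>x \<in> El P p. g p (l p x) = h p x"
proof -
  obtain l where l: "l \<in> NT (free_fun Q I b) E"
    "\<And>p c. p \<in> Ob Q \<Longrightarrow> c \<in> El (free_fun Q I b) p \<Longrightarrow> g p (l p c) = h p (\<rho> p c)"
    using free_fun_projective[OF b E B g nat_trans_comp[OF h \<rho>] surj] by blast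
  have "g p (l p (\<kappa> p x)) = h p x" if "p \<in> Ob Q" "x \<in> El P p" for p x
    using l(2)[OF that(1) nat_closed[OF \<kappa> that]] id[OF that] by simp
  thus ?thesis using nat_trans_comp[OF l(1) \<kappa>] by (intro bexI[of _ "\<lambda>p x. l p (\<kappa> p x)"]) auto
qed

text \<open>\<open>projective_functor\<close> tests on one type of words only; this gives lifting
  against functors with values on any types, as is needed to compare a resolution of a stalk with a
  representable functor.\<close>

lemma retract_of_free_lift:
  assumes P: "retract_of_free k Q P" and E: "E \<in> QMod k Q" and B: "B \<in> QMod k Q"
    and g: "g \<in> NT E B" and h: "h \<in> NT P B"
    and surj: "\<forall>p \<in> Ob Q. g p ` El E p = El B p"
  shows "\<exists>l \<in> NT P E. \<forall>p \<in> Ob Q. \<forall>x \<in> El P p. g p (l p x) = h p x"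
  by (rule retract_of_freeE[OF P]) (rule free_retract_lift[OF _ _ _ _ E B g h surj])

lemma retract_of_free_projective: "P \<in> QMod k Q \<Longrightarrow> retract_of_free k Q P \<Longrightarrow> projective_functor k Q P"
  unfolding projective_functor_def by (blast intro: retract_of_free_lift)

section \<open>Standard covers\<close>

definition elements :: "('o, 'm, 'k, 'x) modfun \<Rightarrow> ('o \<times> 'x) set" where
  "elements X = (SIGMA q : Ob Q. El X q)"

definition cover_map :: "('o, 'm, 'k, 'x) modfun \<Rightarrow> 'o \<Rightarrow> ('o \<times> 'x \<Rightarrow> 'm) \<Rightarrow> 'x" where
  "cover_map X = free_lift (elements X) fst X snd"

lemma elements_Ob: "\<forall>i \<in> elements X. fst i \<in> Ob Q"
  by (auto simp: elements_def)

lemma cover: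
  assumes X: "X \<in> QMod k Q"
  shows cover_QMod: "free_fun Q (elements X) fst \<in> QMod k Q"
    and cover_map: "cover_map X \<in> NT (free_fun Q (elements X) fst) X"
    and cover_surj: "\<And>p. p \<in> Ob Q \<Longrightarrow> cover_map X p ` El (free_fun Q (elements X) fst) p = El X p"
proof -
  have y: "\<forall>i \<in> elements X. snd i \<in> El X (fst i)" by (auto simp: elements_def)
  show "free_fun Q (elements X) fst \<in> QMod k Q" by (rule free_fun_QMod[OF elements_Ob])
  show 1: "cover_map X \<in> NT (free_fun Q (elements X) fst) X"
    unfolding cover_map_def by (rule free_lift_nat[OF elements_Ob X y])
  show "cover_map X p ` El (free_fun Q (elements X) fst) p = El X p" if p: "p \<in> Ob Q" for p
  proof (intro equalityI subsetI)
    show "x \<in> El X p" if "x \<in> cover_map X p ` El (free_fun Q (elements X) fst) p" for x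
      using that by (elim imageE) (simp only: nat_closed[OF 1 p])
    fix x assume x: "x \<in> El X p"
    have i: "(p, x) \<in> elements X" using p x by (simp add: elements_def)
    let ?c = "dsum_inj (elements X) (\<lambda>i. Hom Q (fst i) p) (p, x) (Ide Q p)"
    have c: "?c \<in> El (free_fun Q (elements X) fst) p"
      by (rule free_inj_closed[OF elements_Ob p i]) (simp add: ide_closed[OF p])
    have e: "cover_map X p ?c = x"
      using free_lift_gen[OF elements_Ob X y p i, of "Ide Q p"] ide_closed[OF p] QMod_ide[OF X p x] by (simp add: cover_map_def)
    show "x \<in> cover_map X p ` El (free_fun Q (elements X) fst) p"
      by (rule image_eqI[where f = "cover_map X p", OF e[symmetric] c])
  qed
qed

lemma free_words_inj:
  "inj_on (support_list (\<lambda>i f. (fst i, f, snd i)) I (\<lambda>i. \<zero>\<^bsub>Hom Q (fst i) p\<^esub>)) (El (free_fun Q I fst) p)"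
  using support_list_inj[of "\<lambda>i f. (fst i, f, snd i)" I "\<lambda>i. Hom Q (fst i) p"] by (auto simp: prod_eq_iff)

text \<open>The functor version of \<open>projective_module_rel_proj\<close>: copy \<open>P\<close>
  and its standard cover to the type of words and lift the identity.\<close>

lemma projective_functor_retract:
  fixes P :: "('o, 'm, 'k, 'x) modfun"
  assumes P: "projective_functor k Q P" shows "retract_of_free k Q P"
proof -
  have PQ: "P \<in> QMod k Q" using P by (simp add: projective_functor_def)
  let ?I = "elements P"
  let ?F = "free_fun Q ?I fst"
  let ?s = "\<lambda>p. support_list (\<lambda>i f. (fst i, f, snd i)) ?I (\<lambda>i. \<zero>\<^bsub>Hom Q (fst i) p\<^esub>)"
  let ?t = "\<lambda>(p::'o) x. [(undefined :: 'o, undefined :: 'm, x)]"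
  have ti: "inj_on (?t p) (El P p)" for p by (auto intro: inj_onI)
  note E = transport_fun_QMod[OF cover_QMod[OF PQ], of ?s, OF free_words_inj]
  note B = transport_fun_QMod[OF PQ, of ?t, OF ti]
  let ?E = "transport_fun ?s ?F" and ?B = "transport_fun ?t P"
  define g where "g p y = ?t p (cover_map P p (inv_into (El ?F p) (?s p) y))" for p y
  have g: "g \<in> NT ?E ?B"
    unfolding g_def by (rule nat_trans_comp[OF B(2) nat_trans_comp[OF cover_map[OF PQ] E(3)]])
  have "g p ` El ?E p = El ?B p" if p: "p \<in> Ob Q" for p
  proof -
    have "g p ` (?s p ` El ?F p) = ?t p ` (cover_map P p ` El ?F p)"
      unfolding image_image g_def by (rule image_cong[OF refl]) (simp only: inv_into_f_f[OF free_words_inj])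
    thus ?thesis using cover_surj[OF PQ p] unfolding transport_fun_simps transport_simps by simp
  qed
  then obtain l where l: "l \<in> NT P ?E" "\<And>p x. p \<in> Ob Q \<Longrightarrow> x \<in> El P p \<Longrightarrow> g p (l p x) = ?t p x"
    using bspec[OF bspec[OF bspec[OF bspec[OF conjunct2[OF P[unfolded projective_functor_def]] E(1)] B(1)] g] B(2)] by blast
  have "cover_map P p (inv_into (El ?F p) (?s p) (l p x)) = x" if "p \<in> Ob Q" "x \<in> El P p" for p x
    using l(2)[OF that] by (simp add: g_def)
  thus ?thesis
    unfolding retract_of_free_def using nat_trans_comp[OF E(3) l(1)] cover_map[OF PQ] elements_Ob by blast
qed

end

section \<open>Duals of projective functors, and the way back from the double dual\<close>

context shape
begin

lemma gens_eq:
  assumes "p \<in> Ob Q" "q \<in> Ob Q" and N: "left_module k N"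
    and f: "f \<in> lin_maps k (Hom Q p q) N" and h: "h \<in> lin_maps k (Hom Q p q) N"
    and eq: "\<And>g. g \<in> gens p q \<Longrightarrow> f g = h g" and g: "g \<in> Mor Q p q"
  shows "f g = h g"
proof -
  let ?H = "{g \<in> Mor Q p q. f g \<ominus>\<^bsub>N\<^esub> h g = \<zero>\<^bsub>N\<^esub>}"
  note H = hom_lm[OF assms(1,2)]
  have iff: "f g \<ominus>\<^bsub>N\<^esub> h g = \<zero>\<^bsub>N\<^esub> \<longleftrightarrow> f g = h g" if "g \<in> Mor Q p q" for g
    by (rule ag_minus_eq_zero[OF lm_ag[OF N] lin_maps_closed[OF f that] lin_maps_closed[OF h that]])
  have "g \<in> ?H"
    by (rule gens_induct[OF assms(1,2) lin_maps_kernel[OF H N lin_maps_diff[OF N f h]] _ g])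
      (use gens_subset[OF assms(1,2)] eq iff in auto)
  thus ?thesis using iff g by simp
qed

text \<open>Evaluating the family at the \<open>i\<close>-th generator gives an additive map from
  \<open>r(b i, p)\<close> to Q/Z. It extends to \<open>Q(b i, p)\<close> because Q/Z is injective,
  and the summands of a free functor impose no compatibility on these extensions. Together they form
  a character of the free functor at \<open>p\<close>, which is pulled back to
  \<open>P\<close>.\<close>

lemma char_retract_radical_injective:
  fixes P :: "('o, 'm, 'k, 'x) modfun"
  assumes P: "P \<in> QMod k Q" and ret: "retract_of_free k Q P"
  shows "radical_injective (op_cat Q) r (char_fun P)"
  unfolding radical_injective_def op_rad op_cat_simps
proof (intro ballI allI impI)
  obtain I :: "('o \<times> 'x) set" and b \<kappa> \<rho> where b: "\<forall>i \<in> I. b i \<in> Ob Q" and \<kappa>: "\<kappa> \<in> NT P (free_fun Q I b)"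
    and \<rho>: "\<rho> \<in> NT (free_fun Q I b) P" and id: "\<And>p x. p \<in> Ob Q \<Longrightarrow> x \<in> El P p \<Longrightarrow> \<rho> p (\<kappa> p x) = x"
    by (rule retract_of_freeE[OF ret]) blast
  let ?F = "free_fun Q I b"
  have F: "?F \<in> QMod k Q" by (rule free_fun_QMod[OF b])
  fix p \<phi> assume p: "p \<in> Ob Q" and \<phi>: "radical_family (op_cat Q) r (char_fun P) p \<phi>"
  note cl = rf_closed[OF \<phi>, unfolded op_rad op_cat_simps] and add = rf_add[OF \<phi>, unfolded op_rad op_cat_simps] and nat = rf_nat[OF \<phi>, unfolded op_rad op_cat_simps]
  define \<delta> where "\<delta> i = dsum_inj I (\<lambda>j. Hom Q (b j) (b i)) i (Ide Q (b i))" for i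
  have \<delta>: "\<delta> i \<in> El ?F (b i)" if "i \<in> I" for i
    unfolding \<delta>_def using free_inj_closed[OF b _ that ide_closed] b that by blast
  define e where "e i = \<rho> (b i) (\<delta> i)" for i
  have e: "e i \<in> El P (b i)" if "i \<in> I" for i
    unfolding e_def using nat_closed[OF \<rho> _ \<delta>[OF that]] b that by blast
  have \<rho>e: "\<rho> s (dsum_inj I (\<lambda>j. Hom Q (b j) s) i g) = fmor P (b i) s g (e i)"
    if i: "i \<in> I" and s: "s \<in> Ob Q" and g: "g \<in> Mor Q (b i) s" for i s g
  proof -
    have bi: "b i \<in> Ob Q" using b i by blast
    have "dsum_inj I (\<lambda>j. Hom Q (b j) s) i g = fmor ?F (b i) s g (\<delta> i)"
      unfolding \<delta>_def using free_inj_fmor[OF b bi s i ide_closed[OF bi] g] comp_ide[OF bi s g] by simp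
    thus ?thesis using nat_natural[OF \<rho> bi s g \<delta>[OF i]] by (simp add: e_def)
  qed
  have "\<forall>i\<in>I. \<exists>\<zeta> \<in> chars (Hom Q (b i) p). \<forall>f \<in> rad (b i) p. \<zeta> f = \<phi> (b i) f (e i)"
  proof
    fix i assume i: "i \<in> I"
    hence bi: "b i \<in> Ob Q" using b by blast
    show "\<exists>\<zeta> \<in> chars (Hom Q (b i) p). \<forall>f \<in> rad (b i) p. \<zeta> f = \<phi> (b i) f (e i)"
      by (rule char_extend[OF hom_ag[OF bi p] submodule_add_closed[OF hom_lm[OF bi p] rad_submodule[OF bi p]]])
        (use add bi e[OF i] in \<open>simp add: char_fun_simps\<close>)
  qed
  then obtain \<zeta> where \<zeta>: "\<And>i. i \<in> I \<Longrightarrow> \<zeta> i \<in> chars (Hom Q (b i) p)"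
    "\<And>i f. i \<in> I \<Longrightarrow> f \<in> rad (b i) p \<Longrightarrow> \<zeta> i f = \<phi> (b i) f (e i)" by metis
  note fam = family_abelian_group[OF free_family[OF b p]]
  have \<zeta>A: "\<forall>i\<in>I. \<zeta> i \<in> chars (Hom Q (b i) p)" using \<zeta>(1) by blast
  define \<Omega> where "\<Omega> = dsum_lift qz_group I (\<lambda>i. Hom Q (b i) p) \<zeta>"
  have \<Omega>: "\<Omega> \<in> chars (fobj ?F p)" unfolding \<Omega>_def free_fun_simps by (rule dsum_lift_add_maps[OF fam qz_group_abelian \<zeta>A])
  have \<Omega>i: "\<Omega> (dsum_inj I (\<lambda>i. Hom Q (b i) p) i g) = \<zeta> i g" if "i \<in> I" "g \<in> Mor Q (b i) p" for i g
    unfolding \<Omega>_def by (rule dsum_lift_inj[OF fam qz_group_abelian \<zeta>A that])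
  \<comment> \<open>By additivity it suffices to look at one morphism \<open>g\<close> in summand
    \<open>i\<close>, and naturality of the family moves \<open>g\<close> onto the generator
    \<open>e i\<close>.\<close>
  have key: "\<Omega> (fmor ?F s p f c) = \<phi> s f (\<rho> s c)" if s: "s \<in> Ob Q" and f: "f \<in> rad s p" and c: "c \<in> El ?F s" for s f c
  proof (rule free_fun_ext[OF b s qz_group_abelian _ _ _ c])
    note fH = rad_closed[OF s p f]
    show "(\<lambda>c. \<Omega> (fmor ?F s p f c)) \<in> chars (fobj ?F s)" by (rule add_maps_comp[OF \<Omega> fmor_add_maps[OF F s p fH]])
    have "\<phi> s f \<in> chars (fobj P s)" using cl s f by (simp add: char_fun_simps)
    thus "(\<lambda>c. \<phi> s f (\<rho> s c)) \<in> chars (fobj ?F s)" by (rule add_maps_comp[OF _ nat_add_maps[OF \<rho> s]])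
    fix i g assume i: "i \<in> I" and g: "g \<in> Mor Q (b i) s"
    have bi: "b i \<in> Ob Q" using b i by blast
    have fg: "Comp Q (b i) s p f g \<in> rad (b i) p" by (rule rad_comp_right[OF bi s p g f])
    have "\<Omega> (fmor ?F s p f (dsum_inj I (\<lambda>i. Hom Q (b i) s) i g)) = \<phi> (b i) (Comp Q (b i) s p f g) (e i)"
      unfolding free_inj_fmor[OF b s p i g fH] using \<Omega>i[OF i rad_closed[OF bi p fg]] \<zeta>(2)[OF i fg] by simp
    also have "\<dots> = \<phi> s f (\<rho> s (dsum_inj I (\<lambda>i. Hom Q (b i) s) i g))"
      using nat bi s f g e[OF i] \<rho>e[OF i s g] by (simp add: char_fun_simps)
    finally show "\<Omega> (fmor ?F s p f (dsum_inj I (\<lambda>i. Hom Q (b i) s) i g)) = \<phi> s f (\<rho> s (dsum_inj I (\<lambda>i. Hom Q (b i) s) i g))" .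
  qed
  define \<omega> where "\<omega> = (\<lambda>y\<in>El P p. \<Omega> (\<kappa> p y))"
  have "(\<lambda>y. \<Omega> (\<kappa> p y)) \<in> chars (fobj P p)" by (rule add_maps_comp[OF \<Omega> nat_add_maps[OF \<kappa> p]])
  hence \<omega>: "\<omega> \<in> El (char_fun P) p"
    using add_maps_cong[OF QMod_ag[OF P p], of "\<lambda>y. \<Omega> (\<kappa> p y)" qz_group \<omega>] by (simp add: \<omega>_def char_fun_simps)
  have "\<phi> q f = fmor (char_fun P) p q f \<omega>" if q: "q \<in> Ob Q" and f: "f \<in> rad q p" for q f
  proof -
    have "\<phi> q f \<in> extensional (El P q)" using cl q f by (simp add: char_fun_simps)
    moreover have "\<phi> q f y = \<omega> (fmor P q p f y)" if y: "y \<in> El P q" for y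
      using key[OF q f nat_closed[OF \<kappa> q y]] nat_natural[OF \<kappa> q p rad_closed[OF q p f] y] id[OF q y]
        fmor_closed[OF P q p rad_closed[OF q p f] y] by (simp add: \<omega>_def)
    ultimately show ?thesis by (auto simp: char_fun_simps fun_eq_iff extensional_def)
  qed
  thus "\<exists>x\<in>El (char_fun P) p. \<forall>q\<in>Ob Q. \<forall>f\<in>rad q p. \<phi> q f = fmor (char_fun P) p q f x"
    using \<omega> by blast
qed

text \<open>A family on \<open>r(p, -)\<close> is determined on finitely many generators, so being given by an element
  of \<open>X p\<close> is a question about one element of a finite direct sum, which characters decide.\<close>

lemma radical_injective_double_char:
  fixes X :: "('o, 'm, 'k, 'x) modfun"
  assumes X: "X \<in> QMod k Q" and inj: "radical_injective Q r (char_fun (char_fun X))"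
  shows "radical_injective Q r X"
  unfolding radical_injective_def
proof (intro ballI allI impI)
  fix p \<phi> assume p: "p \<in> Ob Q" and \<phi>: "radical_family Q r X p \<phi>"
  note cl = rf_closed[OF \<phi>] and add = rf_add[OF \<phi>] and nat = rf_nat[OF \<phi>]
  define J where "J = (SIGMA q : targets p. gens p q)"
  define \<psi> where "\<psi> j = rproj p (fst j) (snd j)" for j :: "'o \<times> 'm"
  have J: "fst j \<in> Ob Q" "snd j \<in> Mor Q p (fst j)" "\<psi> j \<in> rad p (fst j)" "\<psi> j \<in> Mor Q p (fst j)" if "j \<in> J" for j
  proof -
    show q: "fst j \<in> Ob Q" using that by (auto simp: J_def targets_def)
    show g: "snd j \<in> Mor Q p (fst j)" using that gens_subset[OF p q] by (auto simp: J_def)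
    show f: "\<psi> j \<in> rad p (fst j)" using rproj_rad[OF p q g] by (simp add: \<psi>_def)
    show "\<psi> j \<in> Mor Q p (fst j)" by (rule rad_closed[OF p q f])
  qed
  have finJ: "finite J" unfolding J_def
    by (rule finite_SigmaI[OF targets_finite[OF p]]) (auto simp: targets_def intro: gens_finite[OF p])
  let ?D = "dsum_module J (\<lambda>j. fobj X (fst j))"
  have fam: "\<forall>j\<in>J. left_module k (fobj X (fst j))" using QMod_lm[OF X] J(1) by blast
  note famA = family_abelian_group[OF fam]
  have D: "left_module k ?D" by (rule dsum_left_module[OF k_ring fam])
  \<comment> \<open>\<open>m x\<close> lists the actions on \<open>x\<close> of the generators of
    \<open>r(p, -)\<close>, and \<open>d\<close> the values that the family prescribes for them. The
    family comes from \<open>x\<close> exactly when \<open>d = m x\<close>.\<close>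
  define m where "m x = (\<lambda>j\<in>J. fmor X p (fst j) (\<psi> j) x)" for x
  have m: "m \<in> lin_maps k (fobj X p) ?D"
    unfolding m_def by (rule dsum_tuple_lin_maps) (use QMod_fmor[OF X p J(1,4)] finJ in auto)
  define d where "d = (\<lambda>j\<in>J. \<phi> (fst j) (\<psi> j))"
  have d: "d \<in> carrier ?D" using cl J finJ by (auto simp: d_def dsum_simps)
  have "d \<in> m ` El X p"
  proof (rule ccontr)
    assume "d \<notin> m ` El X p"
    then obtain \<omega> where \<omega>: "\<omega> \<in> chars ?D" "\<And>x. x \<in> El X p \<Longrightarrow> \<omega> (m x) = 0" "\<omega> d \<noteq> 0"
      using char_separate[OF lm_ag[OF D] submodule_add_closed[OF D lin_maps_image[OF QMod_lm[OF X p] D m]] d] by blast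
    let ?in = "dsum_inj J (\<lambda>j. fobj X (fst j))"
    define W where "W j y = \<omega> (?in j y)" for j y
    have \<omega>in: "W j \<in> chars (fobj X (fst j))" if "j \<in> J" for j
      unfolding W_def by (rule add_maps_comp[OF \<omega>(1) dsum_inj_add_maps[OF famA that]])
    have in0: "W j \<zero>\<^bsub>fobj X (fst j)\<^esub> = 0" if "j \<in> J" for j
      using char_zero[OF QMod_ag[OF X J(1)[OF that]] \<omega>in[OF that]] .
    have sum: "\<omega> c = (\<Sum>j\<in>J. W j (c j))" if c: "c \<in> carrier ?D" for c
    proof (rule dsum_ext[OF famA qz_group_abelian \<omega>(1) _ _ c])
      show "(\<lambda>c. \<Sum>j\<in>J. W j (c j)) \<in> chars ?D"
      proof (rule add_mapsI)
        fix x y assume x: "x \<in> carrier ?D" and y: "y \<in> carrier ?D"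
        have "W j ((x \<oplus>\<^bsub>?D\<^esub> y) j) = W j (x j) + W j (y j)" if j: "j \<in> J" for j
          using add_maps_add[OF \<omega>in[OF j] dsumD(1)[OF x j] dsumD(1)[OF y j]] j by (simp add: dsum_simps)
        thus "(\<Sum>j\<in>J. W j ((x \<oplus>\<^bsub>?D\<^esub> y) j)) = (\<Sum>j\<in>J. W j (x j)) \<oplus>\<^bsub>qz_group\<^esub> (\<Sum>j\<in>J. W j (y j))"
          by (simp add: sum.distrib)
      qed simp
      fix i x assume i: "i \<in> J" and x: "x \<in> El X (fst i)"
      have "(\<Sum>j\<in>J. W j (?in i x j)) = (\<Sum>j\<in>J. if j = i then W i x else 0)"
        by (rule sum.cong[OF refl]) (use in0 in auto)
      thus "\<omega> (?in i x) = (\<Sum>j\<in>J. W j (?in i x j))" using i finJ unfolding W_def[of i x, symmetric] by simp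
    qed
    let ?X = "char_fun X"
    \<comment> \<open>Evaluation at \<open>\<phi> q f\<close>: the image of the family in the double
      dual, where the hypothesis represents it by some \<open>\<chi>\<close>.\<close>
    define \<Phi> where "\<Phi> q f = (\<lambda>\<beta>\<in>El ?X q. \<beta> (\<phi> q f))" for q f
    have X': "?X \<in> QMod k (op_cat Q)" by (rule char_fun_QMod[OF X])
    interpret op: preadditive k "op_cat Q" by (rule op_preadditive)
    have plus: "\<alpha> \<oplus>\<^bsub>fobj ?X q\<^esub> \<beta> \<in> El ?X q" if "q \<in> Ob Q" "\<alpha> \<in> El ?X q" "\<beta> \<in> El ?X q" for q \<alpha> \<beta>
      using ag_add_closed[OF op.QMod_ag[OF X']] that by simp
    have "\<exists>\<chi> \<in> El (char_fun ?X) p. \<forall>q \<in> Ob Q. \<forall>f \<in> rad p q. \<Phi> q f = fmor (char_fun ?X) p q f \<chi>"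
    proof (rule radical_injectiveD[OF inj p])
      show "\<Phi> q f \<in> El (char_fun ?X) q" if "q \<in> Ob Q" "f \<in> rad p q" for q f
        using plus[OF that(1)] cl that by (auto simp: \<Phi>_def char_fun_simps(1) intro!: add_mapsI) (simp add: char_fun_simps)
      show "\<Phi> q (f \<oplus>\<^bsub>Hom Q p q\<^esub> g) = \<Phi> q f \<oplus>\<^bsub>fobj (char_fun ?X) q\<^esub> \<Phi> q g" if "q \<in> Ob Q" "f \<in> rad p q" "g \<in> rad p q" for q f g
        using add cl that by (auto simp: \<Phi>_def char_fun_simps fun_eq_iff add_maps_add)
      show "\<Phi> s (Comp Q p q s g f) = fmor (char_fun ?X) q s g (\<Phi> q f)"
        if q: "q \<in> Ob Q" and s: "s \<in> Ob Q" and f: "f \<in> rad p q" and g: "g \<in> Mor Q q s" for q s f g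
      proof -
        have "fmor ?X s q g \<beta> \<in> El ?X q" if "\<beta> \<in> El ?X s" for \<beta>
          using op.fmor_closed[OF X', of s q g \<beta>] q s g that by simp
        moreover have "\<phi> s (Comp Q p q s g f) = fmor X q s g (\<phi> q f)" "\<phi> q f \<in> El X q" using nat cl q s f g by blast+
        ultimately show ?thesis by (simp add: \<Phi>_def char_fun_simps(5)[of ?X] fun_eq_iff) (simp add: char_fun_simps(5))
      qed
    qed
    then obtain \<chi> where \<chi>: "\<chi> \<in> El (char_fun ?X) p"
      "\<And>q f. q \<in> Ob Q \<Longrightarrow> f \<in> rad p q \<Longrightarrow> \<Phi> q f = fmor (char_fun ?X) p q f \<chi>" by blast
    have \<chi>c: "\<chi> \<in> chars (fobj ?X p)" using \<chi>(1) by (simp add: char_fun_simps(1)[of ?X])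
    have \<chi>e: "\<beta> (\<phi> q f) = \<chi> (\<lambda>x\<in>El X p. \<beta> (fmor X p q f x))" if "q \<in> Ob Q" "f \<in> rad p q" "\<beta> \<in> El ?X q" for q f \<beta>
      using fun_cong[OF \<chi>(2)[OF that(1,2)], of \<beta>] that(3) by (simp add: \<Phi>_def char_fun_simps(5)[of ?X]) (simp add: char_fun_simps(5))
    \<comment> \<open>For the full index set this character of \<open>X p\<close> is
      \<open>\<omega>\<close> after \<open>m\<close>, which is zero. But \<open>\<chi>\<close> sends
      it to \<open>\<omega> d\<close>, because \<open>\<chi>\<close> represents the family on each
      generator; this contradicts the choice of \<open>\<omega>\<close>.\<close>
    let ?S = "\<lambda>J'. \<lambda>x\<in>El X p. \<Sum>j\<in>J'. W j (m x j)"
    have "?S J' \<in> El ?X p \<and> (\<Sum>j\<in>J'. W j (d j)) = \<chi> (?S J')" if "finite J'" "J' \<subseteq> J" for J'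
      using that
    proof (induction J' rule: finite_induct)
      case empty
      have "?S {} = \<zero>\<^bsub>fobj ?X p\<^esub>" by (simp add: char_fun_simps)
      moreover have "\<zero>\<^bsub>fobj ?X p\<^esub> \<in> El ?X p"
        using ag_zero_closed[OF op.QMod_ag[OF X']] p by simp
      moreover have "\<chi> \<zero>\<^bsub>fobj ?X p\<^esub> = 0" using char_zero[OF op.QMod_ag[OF X'] \<chi>c] p by simp
      ultimately show ?case by simp
    next
      case (insert j J')
      have j: "j \<in> J" using insert.prems by blast
      let ?\<beta> = "\<lambda>y\<in>El X (fst j). W j y"
      have \<beta>: "?\<beta> \<in> El ?X (fst j)"
        using add_maps_cong[OF QMod_ag[OF X J(1)[OF j]] \<omega>in[OF j], of ?\<beta>] by (simp add: char_fun_simps)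
      let ?T = "\<lambda>x\<in>El X p. ?\<beta> (fmor X p (fst j) (\<psi> j) x)"
      have T: "?T \<in> El ?X p"
        using op.fmor_closed[OF X', of "fst j" p "\<psi> j" ?\<beta>] J[OF j] p \<beta> by (simp add: char_fun_simps(5))
      have S: "?S J' \<in> El ?X p" and e: "(\<Sum>j\<in>J'. W j (d j)) = \<chi> (?S J')"
        using insert.IH insert.prems by blast+
      have eq: "?S (insert j J') = ?T \<oplus>\<^bsub>fobj ?X p\<^esub> ?S J'"
        using insert.hyps fmor_closed[OF X p J(1)[OF j] J(4)[OF j]] j by (auto simp: char_fun_simps fun_eq_iff m_def)
      have "\<chi> ?T = W j (d j)"
        using \<chi>e[OF J(1,3)[OF j] \<beta>] cl J(1,3)[OF j] j by (simp add: d_def)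
      hence val: "\<chi> (?T \<oplus>\<^bsub>fobj ?X p\<^esub> ?S J') = W j (d j) + (\<Sum>j\<in>J'. W j (d j))"
        using add_maps_add[OF \<chi>c T S] e by (simp only: qz_group_simps)
      show ?case unfolding eq
        by (intro conjI plus[OF p T S] trans[OF sum.insert[OF insert.hyps] val[symmetric]])
    qed
    from this[OF finJ order_refl] have "\<omega> d = \<chi> (?S J)" using sum[OF d] by simp
    also have "?S J = \<zero>\<^bsub>fobj ?X p\<^esub>"
      using sum[OF lin_maps_closed[OF m]] \<omega>(2) by (auto simp: char_fun_simps fun_eq_iff)
    also have "\<chi> \<zero>\<^bsub>fobj ?X p\<^esub> = 0" using char_zero[OF op.QMod_ag[OF X'] \<chi>c] p by simp
    finally show False using \<omega>(3) by simp
  qed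
  then obtain x where x: "x \<in> El X p" "d = m x" by blast
  have "\<phi> q f = fmor X p q f x" if q: "q \<in> Ob Q" and f: "f \<in> rad p q" for q f
  proof -
    have l1: "(\<lambda>g. \<phi> q (rproj p q g)) \<in> lin_maps k (Hom Q p q) (fobj X q)"
      by (rule radical_family_lin_maps[OF X p q]) (use cl add nat in auto)
    have l2: "(\<lambda>g. fmor X p q (rproj p q g) x) \<in> lin_maps k (Hom Q p q) (fobj X q)"
      by (rule lin_maps_comp[OF QMod_lin[OF X p q x(1)] rproj_lin_maps[OF p q]])
    have "\<phi> q (rproj p q f) = fmor X p q (rproj p q f) x"
    proof (cases "q \<in> targets p")
      case True
      show ?thesis
      proof (rule gens_eq[OF p q QMod_lm[OF X q] l1 l2 _ rad_closed[OF p q f]])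
        show "\<phi> q (rproj p q g) = fmor X p q (rproj p q g) x" if "g \<in> gens p q" for g
          using fun_cong[OF x(2), of "(q, g)"] True that by (simp add: d_def m_def J_def \<psi>_def)
      qed
    next
      case False
      thus ?thesis using not_target[OF p q False rad_closed[OF p q f]]
          lin_maps_zero[OF hom_ag[OF p q] QMod_ag[OF X q] l1]
          lin_maps_zero[OF hom_ag[OF p q] QMod_ag[OF X q] l2] by simp
    qed
    thus ?thesis using rproj_id[OF p q f] by simp
  qed
  thus "\<exists>x\<in>El X p. \<forall>q\<in>Ob Q. \<forall>f\<in>rad p q. \<phi> q f = fmor X p q f x" using x(1) by blast
qed

end

section \<open>Free functors are radical injective; radical injective functors that are pointwise
  projective are retracts of free ones\<close>

context frob
begin

text \<open>The \<open>i\<close>-th component of the family, followed by \<open>t\<close>, is a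
  functional on \<open>Q(p, \<sigma> (b i))\<close>; the pairing represents it by \<open>h i\<close>
  from \<open>b i\<close> to \<open>p\<close>. Pairing with arbitrary morphisms shows that the
  \<open>i\<close>-th component of the family is composition with \<open>h i\<close>. What remains
  is that \<open>h\<close> lies in the direct sum.\<close>

lemma free_fun_radical_injective:
  assumes b: "\<forall>i\<in>I. b i \<in> Ob Q" shows "radical_injective Q r (free_fun Q I b)"
  unfolding radical_injective_def
proof (intro ballI allI impI)
  let ?F = "free_fun Q I b"
  have F: "?F \<in> QMod k Q" by (rule free_fun_QMod[OF b])
  fix p \<phi> assume p: "p \<in> Ob Q" and \<phi>: "radical_family Q r ?F p \<phi>"
  note cl = rf_closed[OF \<phi>] and add = rf_add[OF \<phi>] and nat = rf_nat[OF \<phi>]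
  have \<Phi>: "(\<lambda>g. \<phi> q (rproj p q g)) \<in> lin_maps k (Hom Q p q) (dsum_module I (\<lambda>i. Hom Q (b i) q))" if "q \<in> Ob Q" for q
    using radical_family_lin_maps[OF F p that, of \<phi>] cl add nat by simp
  have bi: "b i \<in> Ob Q" if "i \<in> I" for i using b that by blast
  have \<phi>c: "\<phi> q f i \<in> Mor Q (b i) q" if "q \<in> Ob Q" "f \<in> rad p q" "i \<in> I" for q f i
    using cl that dsumD(1)[of "\<phi> q f" I "\<lambda>i. Hom Q (b i) q" i] by simp
  define \<zeta> where "\<zeta> i g = t (b i) (\<phi> (\<sigma> (b i)) (rproj p (\<sigma> (b i)) g) i)" for i g
  have \<zeta>: "\<zeta> i \<in> forms k (Hom Q p (\<sigma> (b i)))" if i: "i \<in> I" for i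
    unfolding \<zeta>_def
    by (rule lin_maps_comp[OF t_lin[OF bi[OF i]] lin_maps_comp[OF dsum_proj_lin_maps[OF i, where M = "\<lambda>i'. Hom Q (b i') (\<sigma> (b i))"] \<Phi>[OF sigma(1)[OF bi[OF i]]]]])
  have "\<forall>i\<in>I. \<exists>h. h \<in> Mor Q (b i) p \<and> (\<forall>g \<in> Mor Q p (\<sigma> (b i)). t (b i) (Comp Q (b i) p (\<sigma> (b i)) g h) = \<zeta> i g)"
    using left_ex[OF bi p \<zeta>] by blast
  then obtain h where h: "\<And>i. i \<in> I \<Longrightarrow> h i \<in> Mor Q (b i) p"
    "\<And>i g. i \<in> I \<Longrightarrow> g \<in> Mor Q p (\<sigma> (b i)) \<Longrightarrow> t (b i) (Comp Q (b i) p (\<sigma> (b i)) g (h i)) = \<zeta> i g"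
    by (metis bchoice)
  let ?src = "{q \<in> Ob Q. \<not> zero_module (Hom Q q p)}"
  let ?B = "SIGMA q : ?src. gens p (\<sigma> q)"
  \<comment> \<open>If \<open>h i\<close> is nonzero, \<open>b i\<close> is one of the finitely many
    sources of \<open>p\<close>, and the functional is nonzero on one of finitely many generators.
    So \<open>i\<close> lies in the support of one of finitely many values of the family, each an
    element of a direct sum.\<close>
  have "dsupp I (\<lambda>i. Hom Q (b i) p) h \<subseteq>
    (\<Union>(q, f) \<in> ?B. {i \<in> I. \<phi> (\<sigma> q) (rproj p (\<sigma> q) f) i \<noteq> \<zero>\<^bsub>Hom Q (b i) (\<sigma> q)\<^esub>})"
  proof
    fix i assume "i \<in> dsupp I (\<lambda>i. Hom Q (b i) p) h"
    hence i: "i \<in> I" and nz: "h i \<noteq> \<zero>\<^bsub>Hom Q (b i) p\<^esub>" by auto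
    note s = sigma(1)[OF bi[OF i]]
    have src: "b i \<in> ?src" using bi[OF i] h(1)[OF i] nz by (auto simp: zero_module_def)
    have "\<exists>f \<in> gens p (\<sigma> (b i)). \<phi> (\<sigma> (b i)) (rproj p (\<sigma> (b i)) f) i \<noteq> \<zero>\<^bsub>Hom Q (b i) (\<sigma> (b i))\<^esub>"
    proof (rule ccontr)
      assume "\<not> ?thesis"
      hence z: "\<zeta> i f = \<zero>\<^bsub>k\<^esub>" if "f \<in> gens p (\<sigma> (b i))" for f
        using that lin_maps_zero[OF hom_ag[OF bi[OF i] s] k_ag t_lin[OF bi[OF i]]]
        by (simp add: \<zeta>_def)
      have "(\<lambda>_. \<zero>\<^bsub>k\<^esub>) \<in> forms k (Hom Q p (\<sigma> (b i)))"
        using add_maps_const_zero[OF k_ag] left_module_smult_zero[OF k_lm]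
        by (simp add: lin_maps_iff)
      from gens_eq[OF p s k_lm \<zeta>[OF i] this z]
      have "h i = \<zero>\<^bsub>Hom Q (b i) p\<^esub>" using left_zero[OF bi[OF i] p h(1)[OF i]] h(2)[OF i] by simp
      thus False using nz by simp
    qed
    thus "i \<in> (\<Union>(q, f) \<in> ?B. {i \<in> I. \<phi> (\<sigma> q) (rproj p (\<sigma> q) f) i \<noteq> \<zero>\<^bsub>Hom Q (b i) (\<sigma> q)\<^esub>})"
      using i src by blast
  qed
  moreover have "finite (\<Union>(q, f) \<in> ?B. {i \<in> I. \<phi> (\<sigma> q) (rproj p (\<sigma> q) f) i \<noteq> \<zero>\<^bsub>Hom Q (b i) (\<sigma> q)\<^esub>})"
  proof (rule finite_UN_I)
    show "finite ?B"
      by (rule finite_SigmaI) (use locbd p sigma(1) gens_finite[OF p] in \<open>auto simp: locally_bounded_def\<close>)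
    fix x assume "x \<in> ?B"
    then obtain q f where x: "x = (q, f)" and q: "q \<in> Ob Q" and f: "f \<in> gens p (\<sigma> q)" by auto
    have "f \<in> Mor Q p (\<sigma> q)" using f gens_subset[OF p sigma(1)[OF q]] by blast
    hence "\<phi> (\<sigma> q) (rproj p (\<sigma> q) f) \<in> carrier (dsum_module I (\<lambda>i. Hom Q (b i) (\<sigma> q)))"
      by (rule lin_maps_closed[OF \<Phi>[OF sigma(1)[OF q]]])
    from dsumD(2)[OF this] show "finite (case x of (q, f) \<Rightarrow> {i \<in> I. \<phi> (\<sigma> q) (rproj p (\<sigma> q) f) i \<noteq> \<zero>\<^bsub>Hom Q (b i) (\<sigma> q)\<^esub>})"
      by (simp add: x)
  qed
  ultimately have fin: "finite (dsupp I (\<lambda>i. Hom Q (b i) p) h)" by (rule finite_subset)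
  let ?x = "\<lambda>i\<in>I. h i"
  have x: "?x \<in> El ?F p" using fin h(1) by (auto simp: dsum_simps cong: conj_cong)
  have "\<phi> q f = fmor ?F p q f ?x" if q: "q \<in> Ob Q" and f: "f \<in> rad p q" for q f
  proof (rule extensionalityI)
    note fH = rad_closed[OF p q f]
    show "\<phi> q f \<in> extensional I" using cl q f dsumD(3)[of "\<phi> q f" I "\<lambda>i. Hom Q (b i) q"] by simp
    show "fmor ?F p q f ?x \<in> extensional I" by simp
    fix i assume i: "i \<in> I"
    note s = sigma(1)[OF bi[OF i]] and hi = h(1)[OF i]
    have "\<phi> q f i = Comp Q (b i) p q f (h i)"
    proof (rule left_cancel[OF bi[OF i] q \<phi>c[OF q f i] comp_closed[OF bi[OF i] p q hi fH]])
      fix g assume g: "g \<in> Mor Q q (\<sigma> (b i))"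
      have gf: "Comp Q p q (\<sigma> (b i)) g f \<in> rad p (\<sigma> (b i))" by (rule rad_comp_left[OF p q s f g])
      have "\<phi> (\<sigma> (b i)) (Comp Q p q (\<sigma> (b i)) g f) = fmor ?F q (\<sigma> (b i)) g (\<phi> q f)" using nat q s f g by blast
      hence "Comp Q (b i) q (\<sigma> (b i)) g (\<phi> q f i) = \<phi> (\<sigma> (b i)) (Comp Q p q (\<sigma> (b i)) g f) i" using i by simp
      hence "t (b i) (Comp Q (b i) q (\<sigma> (b i)) g (\<phi> q f i)) = \<zeta> i (Comp Q p q (\<sigma> (b i)) g f)"
        using rproj_id[OF p s gf] by (simp add: \<zeta>_def)
      also have "\<dots> = t (b i) (Comp Q (b i) p (\<sigma> (b i)) (Comp Q p q (\<sigma> (b i)) g f) (h i))"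
        using h(2)[OF i rad_closed[OF p s gf]] by simp
      also have "\<dots> = t (b i) (Comp Q (b i) q (\<sigma> (b i)) g (Comp Q (b i) p q f (h i)))"
        using comp_assoc[OF bi[OF i] p q s hi fH g] by simp
      finally show "t (b i) (Comp Q (b i) q (\<sigma> (b i)) g (\<phi> q f i)) = t (b i) (Comp Q (b i) q (\<sigma> (b i)) g (Comp Q (b i) p q f (h i)))" .
    qed
    thus "\<phi> q f i = fmor ?F p q f ?x i" using i by simp
  qed
  thus "\<exists>x\<in>El ?F p. \<forall>q\<in>Ob Q. \<forall>f\<in>rad p q. \<phi> q f = fmor ?F p q f x" using x by blast
qed

text \<open>\<open>K\<close> embeds into the free functor on generators \<open>w \<in> K q\<close> placed at \<open>\<sigma>' q\<close>, because
  \<open>Hom\<^sub>k(Q(-, q), k)\<close> is isomorphic to \<open>Q(\<sigma>' q, -)\<close>; the embedding splits pointwise over \<open>k\<close>.\<close>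

lemma radical_injective_retract:
  fixes K :: "('o, 'm, 'k, 'x) modfun"
  assumes K: "K \<in> QMod k Q" and inj: "radical_injective Q r K"
    and proj: "\<And>p. p \<in> Ob Q \<Longrightarrow> rel_proj k (fobj K p) {\<zero>\<^bsub>fobj K p\<^esub>}"
  shows "retract_of_free k Q K"
proof -
  let ?I = "elements K"
  define b where "b i = \<sigma>' (fst i)" for i :: "'o \<times> 'x"
  have b: "\<forall>i\<in>?I. b i \<in> Ob Q" using sigma(2) by (auto simp: elements_def b_def)
  have iO: "fst i \<in> Ob Q" "snd i \<in> El K (fst i)" "b i \<in> Ob Q" "\<sigma> (b i) = fst i" if "i \<in> ?I" for i
    using that b sigma(3) by (auto simp: elements_def b_def)
  let ?F = "free_fun Q ?I b"
  have F: "?F \<in> QMod k Q" by (rule free_fun_QMod[OF b])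
  have "\<forall>q\<in>Ob Q. \<exists>\<xi>. \<xi> \<in> lin_maps k (fobj K q) (coords k (fobj K q)) \<and> (\<forall>v\<in>El K q. lincomb k (fobj K q) (\<xi> v) = v)"
  proof
    fix q assume q: "q \<in> Ob Q"
    show "\<exists>\<xi>. \<xi> \<in> lin_maps k (fobj K q) (coords k (fobj K q)) \<and> (\<forall>v\<in>El K q. lincomb k (fobj K q) (\<xi> v) = v)"
      by (rule rel_proj_zero_coords[OF k_ring QMod_lm[OF K q] proj[OF q]]) blast
  qed
  then obtain \<xi> where \<xi>: "\<And>q. q \<in> Ob Q \<Longrightarrow> \<xi> q \<in> lin_maps k (fobj K q) (coords k (fobj K q))"
    "\<And>q v. q \<in> Ob Q \<Longrightarrow> v \<in> El K q \<Longrightarrow> lincomb k (fobj K q) (\<xi> q v) = v" by (metis bchoice)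
  have ev: "(\<lambda>v. \<xi> (fst i) v (snd i)) \<in> forms k (fobj K (fst i))" if "i \<in> ?I" for i
    by (rule lin_maps_comp[OF dsum_proj_lin_maps[OF iO(2)[OF that]] \<xi>(1)[OF iO(1)[OF that], unfolded coords_def]])
  \<comment> \<open>For \<open>i = (q, w)\<close> the functional on \<open>Q(p, q)\<close> that
    takes \<open>g\<close> to the \<open>w\<close>-coordinate of \<open>g u\<close> is represented
    by a morphism from \<open>\<sigma>' q\<close> to \<open>p\<close>.\<close>
  define kap where "kap p u i = (SOME f. f \<in> Mor Q (b i) p \<and>
    (\<forall>g \<in> Mor Q p (fst i). t (b i) (Comp Q (b i) p (fst i) g f) = \<xi> (fst i) (fmor K p (fst i) g u) (snd i)))" for p u i
  have kap: "kap p u i \<in> Mor Q (b i) p \<and>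
    (\<forall>g \<in> Mor Q p (fst i). t (b i) (Comp Q (b i) p (fst i) g (kap p u i)) = \<xi> (fst i) (fmor K p (fst i) g u) (snd i))"
    if p: "p \<in> Ob Q" and u: "u \<in> El K p" and i: "i \<in> ?I" for p u i
    unfolding kap_def
  proof (rule someI_ex)
    have "(\<lambda>g. \<xi> (fst i) (fmor K p (fst i) g u) (snd i)) \<in> forms k (Hom Q p (\<sigma> (b i)))"
      using lin_maps_comp[OF ev[OF i] QMod_lin[OF K p iO(1)[OF i] u]] iO(4)[OF i] by simp
    from left_ex[OF iO(3)[OF i] p this] show "\<exists>f. f \<in> Mor Q (b i) p \<and>
      (\<forall>g \<in> Mor Q p (fst i). t (b i) (Comp Q (b i) p (fst i) g f) = \<xi> (fst i) (fmor K p (fst i) g u) (snd i))"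
      using iO(4)[OF i] by auto
  qed
  have kc: "kap p u i \<in> Mor Q (b i) p" if "p \<in> Ob Q" "u \<in> El K p" "i \<in> ?I" for p u i
    using kap[OF that] by blast
  have kt: "t (b i) (Comp Q (b i) p (fst i) g (kap p u i)) = \<xi> (fst i) (fmor K p (fst i) g u) (snd i)"
    if "p \<in> Ob Q" "u \<in> El K p" "i \<in> ?I" "g \<in> Mor Q p (fst i)" for p u i g
    using kap[OF that(1-3)] that(4) by blast
  have tc: "(\<lambda>f. t (b i) (Comp Q (b i) p (fst i) g f)) \<in> forms k (Hom Q (b i) p)"
    if "p \<in> Ob Q" "i \<in> ?I" "g \<in> Mor Q p (fst i)" for p i g
    using lin_maps_comp[OF t_lin[OF iO(3)[OF that(2)]] comp_linear_right[OF iO(3)[OF that(2)] that(1), of "\<sigma> (b i)" g]] that iO(1,4)[OF that(2)] by simp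
  have cancel: "f = f'" if "p \<in> Ob Q" "i \<in> ?I" "f \<in> Mor Q (b i) p" "f' \<in> Mor Q (b i) p"
    "\<And>g. g \<in> Mor Q p (fst i) \<Longrightarrow> t (b i) (Comp Q (b i) p (fst i) g f) = t (b i) (Comp Q (b i) p (fst i) g f')" for p i f f'
    using left_cancel[OF iO(3)[OF that(2)] that(1,3,4)] that(5) iO(4)[OF that(2)] by simp
  have klin: "(\<lambda>u. kap p u i) \<in> lin_maps k (fobj K p) (Hom Q (b i) p)" if p: "p \<in> Ob Q" and i: "i \<in> ?I" for p i
  proof -
    interpret Kp: left_module k "fobj K p" by (rule QMod_lm[OF K p])
    interpret H: left_module k "Hom Q (b i) p" by (rule hom_lm[OF iO(3)[OF i] p])
    have "kap p (u \<oplus>\<^bsub>fobj K p\<^esub> v) i = kap p u i \<oplus>\<^bsub>Hom Q (b i) p\<^esub> kap p v i"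
      if u: "u \<in> El K p" and v: "v \<in> El K p" for u v
    proof (rule cancel[OF p i])
      fix g assume g: "g \<in> Mor Q p (fst i)"
      show "t (b i) (Comp Q (b i) p (fst i) g (kap p (u \<oplus>\<^bsub>fobj K p\<^esub> v) i)) =
        t (b i) (Comp Q (b i) p (fst i) g (kap p u i \<oplus>\<^bsub>Hom Q (b i) p\<^esub> kap p v i))"
        using lin_maps_add[OF tc[OF p i g] kc[OF p u i] kc[OF p v i]] kt[OF p _ i g]
          fmor_add[OF K p iO(1)[OF i] g u v] u v
          lin_maps_add[OF ev[OF i] fmor_closed[OF K p iO(1)[OF i] g u] fmor_closed[OF K p iO(1)[OF i] g v]]
        by simp
    qed (use kc[OF p _ i] u v in auto)
    moreover have "kap p (a \<odot>\<^bsub>fobj K p\<^esub> u) i = a \<odot>\<^bsub>Hom Q (b i) p\<^esub> kap p u i"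
      if a: "a \<in> carrier k" and u: "u \<in> El K p" for a u
    proof (rule cancel[OF p i])
      fix g assume g: "g \<in> Mor Q p (fst i)"
      show "t (b i) (Comp Q (b i) p (fst i) g (kap p (a \<odot>\<^bsub>fobj K p\<^esub> u) i)) =
        t (b i) (Comp Q (b i) p (fst i) g (a \<odot>\<^bsub>Hom Q (b i) p\<^esub> kap p u i))"
        using lin_maps_smult[OF tc[OF p i g] a kc[OF p u i]] kt[OF p _ i g] fmor_smult[OF K p iO(1)[OF i] g a u] a u
          lin_maps_smult[OF ev[OF i] a fmor_closed[OF K p iO(1)[OF i] g u]] Kp.lsmult_closed by simp
    qed (use kc[OF p _ i] a u Kp.lsmult_closed H.lsmult_closed in auto)
    ultimately show ?thesis using kc[OF p _ i] by (auto simp: lin_maps_def)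
  qed
  \<comment> \<open>A component vanishes as soon as its functional does so on generators. This
    leaves finitely many nonzero components, which puts \<open>\<kappa>\<close> into the direct
    sum.\<close>
  have kzero: "kap p u i = \<zero>\<^bsub>Hom Q (b i) p\<^esub>"
    if p: "p \<in> Ob Q" and u: "u \<in> El K p" and i: "i \<in> ?I"
      and z: "fst i \<in> targets p \<Longrightarrow> \<forall>g \<in> gens p (fst i). \<xi> (fst i) (fmor K p (fst i) g u) (snd i) = \<zero>\<^bsub>k\<^esub>" for p u i
  proof -
    note q = iO(1)[OF i]
    have l: "(\<lambda>g. \<xi> (fst i) (fmor K p (fst i) g u) (snd i)) \<in> forms k (Hom Q p (fst i))"
      by (rule lin_maps_comp[OF ev[OF i] QMod_lin[OF K p q u]])
    have l0: "(\<lambda>_. \<zero>\<^bsub>k\<^esub>) \<in> forms k (Hom Q p (fst i))"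
      using add_maps_const_zero[OF k_ag] left_module_smult_zero[OF k_lm]
      by (simp add: lin_maps_iff)
    have "\<xi> (fst i) (fmor K p (fst i) g u) (snd i) = \<zero>\<^bsub>k\<^esub>" if g: "g \<in> Mor Q p (fst i)" for g
    proof (cases "fst i \<in> targets p")
      case True
      show ?thesis by (rule gens_eq[OF p q k_lm l l0 _ g]) (use z True in auto)
    next
      case False
      show ?thesis using not_target[OF p q False g]
          lin_maps_zero[OF hom_ag[OF p q] k_ag l] by simp
    qed
    thus ?thesis using left_zero[OF iO(3)[OF i] p kc[OF p u i]] kt[OF p u i] iO(4)[OF i] by simp
  qed
  define \<kappa> where "\<kappa> p u = (\<lambda>i\<in>?I. kap p u i)" for p u
  have \<kappa>lin: "\<kappa> p \<in> lin_maps k (fobj K p) (fobj ?F p)" if p: "p \<in> Ob Q" for p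
    unfolding \<kappa>_def[abs_def] free_fun_simps
  proof (rule dsum_tuple_lin_maps[OF klin[OF p]])
    fix u assume u: "u \<in> El K p"
    let ?T = "SIGMA q : targets p. \<Union>g \<in> gens p q. {w \<in> El K q. \<xi> q (fmor K p q g u) w \<noteq> \<zero>\<^bsub>k\<^esub>}"
    have "i \<in> ?T" if i: "i \<in> ?I" and nz: "kap p u i \<noteq> \<zero>\<^bsub>Hom Q (b i) p\<^esub>" for i
    proof -
      have "fst i \<in> targets p" and "\<exists>g \<in> gens p (fst i). \<xi> (fst i) (fmor K p (fst i) g u) (snd i) \<noteq> \<zero>\<^bsub>k\<^esub>"
        using kzero[OF p u i] nz by blast+
      thus ?thesis using iO(2)[OF i] by (cases i) auto
    qed
    hence "dsupp ?I (\<lambda>i. Hom Q (b i) p) (kap p u) \<subseteq> ?T" by blast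
    moreover have "finite ?T"
    proof (intro finite_SigmaI targets_finite[OF p] finite_UN_I)
      fix q assume "q \<in> targets p"
      hence q: "q \<in> Ob Q" by (simp add: targets_def)
      show "finite (gens p q)" by (rule gens_finite[OF p q])
      fix g assume "g \<in> gens p q"
      hence "\<xi> q (fmor K p q g u) \<in> carrier (coords k (fobj K q))"
        using lin_maps_closed[OF \<xi>(1)[OF q] fmor_closed[OF K p q _ u]] gens_subset[OF p q] by blast
      from dsumD(2)[OF this[unfolded coords_def]]
      show "finite {w \<in> El K q. \<xi> q (fmor K p q g u) w \<noteq> \<zero>\<^bsub>k\<^esub>}" by simp
    qed
    ultimately show "finite (dsupp ?I (\<lambda>i. Hom Q (b i) p) (kap p u))" by (rule finite_subset)
  qed
  have \<kappa>: "\<kappa> \<in> NT K ?F"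
  proof (rule nat_transI[OF K F lin_maps_add_maps[OF \<kappa>lin]])
    fix p q f u assume p: "p \<in> Ob Q" and q: "q \<in> Ob Q" and f: "f \<in> Mor Q p q" and u: "u \<in> El K p"
    have "kap q (fmor K p q f u) i = Comp Q (b i) p q f (kap p u i)" if i: "i \<in> ?I" for i
    proof (rule cancel[OF q i kc[OF q fmor_closed[OF K p q f u] i] comp_closed[OF iO(3)[OF i] p q kc[OF p u i] f]])
      fix g assume g: "g \<in> Mor Q q (fst i)"
      show "t (b i) (Comp Q (b i) q (fst i) g (kap q (fmor K p q f u) i)) =
          t (b i) (Comp Q (b i) q (fst i) g (Comp Q (b i) p q f (kap p u i)))"
        using kt[OF q fmor_closed[OF K p q f u] i g] QMod_comp[OF K p q iO(1)[OF i] f g u]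
          kt[OF p u i comp_closed[OF p q iO(1)[OF i] f g]] comp_assoc[OF iO(3)[OF i] p q iO(1)[OF i] kc[OF p u i] f g] by simp
    qed
    thus "\<kappa> q (fmor K p q f u) = fmor ?F p q f (\<kappa> p u)" by (auto simp: \<kappa>_def fun_eq_iff)
  qed
  \<comment> \<open>Applying \<open>t\<close> to the components placed at \<open>p\<close> reads off
    the coordinates of \<open>u\<close> (the case where \<open>g\<close> is the identity), so
    \<open>R p\<close> is a linear left inverse of \<open>\<kappa> p\<close>. No naturality is
    claimed for it.\<close>
  define R where "R p c = lincomb k (fobj K p) (\<lambda>w\<in>El K p. t (\<sigma>' p) (c (p, w)))" for p c
  have Rlin: "R p \<in> lin_maps k (fobj ?F p) (fobj K p)" if p: "p \<in> Ob Q" for p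
  proof -
    have "(\<lambda>c. \<lambda>w\<in>El K p. t (\<sigma>' p) (c (p, w))) \<in> lin_maps k (fobj ?F p) (coords k (fobj K p))"
      unfolding coords_def free_fun_simps
    proof (rule dsum_tuple_lin_maps)
      fix w assume "w \<in> El K p"
      hence i: "(p, w) \<in> ?I" using p by (simp add: elements_def)
      have "t (\<sigma>' p) \<in> forms k (Hom Q (b (p, w)) p)" using t_lin[OF sigma(2)[OF p]] sigma(3)[OF p] by (simp add: b_def)
      from lin_maps_comp[OF this dsum_proj_lin_maps[OF i, where M = "\<lambda>i. Hom Q (b i) p"]]
      show "(\<lambda>c. t (\<sigma>' p) (c (p, w))) \<in> forms k (dsum_module ?I (\<lambda>i. Hom Q (b i) p))" .
    next
      fix c assume c: "c \<in> carrier (dsum_module ?I (\<lambda>i. Hom Q (b i) p))"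
      have t0: "t (\<sigma>' p) \<zero>\<^bsub>Hom Q (\<sigma>' p) p\<^esub> = \<zero>\<^bsub>k\<^esub>"
        using lin_maps_zero[OF hom_ag[OF sigma(2)[OF p] sigma(1)[OF sigma(2)[OF p]]] k_ag t_lin[OF sigma(2)[OF p]]] sigma(3)[OF p] by simp
      have "{w \<in> El K p. t (\<sigma>' p) (c (p, w)) \<noteq> \<zero>\<^bsub>self_module k\<^esub>} \<subseteq> snd ` (dsupp ?I (\<lambda>i. Hom Q (b i) p) c)"
      proof
        fix w assume w: "w \<in> {w \<in> El K p. t (\<sigma>' p) (c (p, w)) \<noteq> \<zero>\<^bsub>self_module k\<^esub>}"
        hence "(p, w) \<in> dsupp ?I (\<lambda>i. Hom Q (b i) p) c" using p t0 by (auto simp: elements_def b_def)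
        thus "w \<in> snd ` (dsupp ?I (\<lambda>i. Hom Q (b i) p) c)" by force
      qed
      thus "finite {w \<in> El K p. t (\<sigma>' p) (c (p, w)) \<noteq> \<zero>\<^bsub>self_module k\<^esub>}"
        by (rule finite_subset) (rule finite_imageI[OF dsumD(2)[OF c]])
    qed
    from lin_maps_comp[OF lincomb_lin_maps[OF k_ring QMod_lm[OF K p]] this] show ?thesis by (simp add: R_def[abs_def])
  qed
  have R\<kappa>: "R p (\<kappa> p u) = u" if p: "p \<in> Ob Q" and u: "u \<in> El K p" for p u
  proof -
    have "t (\<sigma>' p) (\<kappa> p u (p, w)) = \<xi> p u w" if "w \<in> El K p" for w
    proof -
      have i: "(p, w) \<in> ?I" using p that by (simp add: elements_def)
      show ?thesis
        using kt[OF p u i, of "Ide Q p"] ide_closed[OF p] comp_ide[OF _ p, of "\<sigma>' p" "kap p u (p, w)"] kc[OF p u i] sigma(2)[OF p] QMod_ide[OF K p u] i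
        by (simp add: \<kappa>_def b_def)
    qed
    moreover have "\<xi> p u \<in> extensional (El K p)"
      using dsumD(3)[OF lin_maps_closed[OF \<xi>(1)[OF p] u, unfolded coords_def]] .
    ultimately have "(\<lambda>w\<in>El K p. t (\<sigma>' p) (\<kappa> p u (p, w))) = \<xi> p u"
      by (auto simp: fun_eq_iff extensional_def)
    thus ?thesis using \<xi>(2)[OF p u] by (simp add: R_def)
  qed
  let ?U = "\<lambda>p. \<kappa> p ` El K p"
  have rp: "rel_proj k (fobj ?F p) (?U p)" if p: "p \<in> Ob Q" for p
  proof -
    obtain J :: "(('o \<times> 'x) \<times> 'm) set" and \<theta> where \<theta>: "\<theta> \<in> lin_maps k (fobj ?F p) (free_module k J)"
      "\<And>c. c \<in> El ?F p \<Longrightarrow> \<theta> c = (\<lambda>i\<in>J. \<zero>\<^bsub>k\<^esub>) \<Longrightarrow> c = \<zero>\<^bsub>fobj ?F p\<^esub>"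
      using free_fun_embedding[OF b p] by blast
    note Fp = QMod_lm[OF F p]
    \<comment> \<open>The image of \<open>\<kappa> p\<close> is the kernel of \<open>m\<close>,
      whose values lie in a module that embeds into a free one.\<close>
    define m where "m c = c \<ominus>\<^bsub>fobj ?F p\<^esub> \<kappa> p (R p c)" for c
    have m: "m \<in> lin_maps k (fobj ?F p) (fobj ?F p)"
      unfolding m_def by (rule lin_maps_diff[OF Fp lin_maps_id lin_maps_comp[OF \<kappa>lin[OF p] Rlin[OF p]]])
    have \<theta>0: "\<theta> \<zero>\<^bsub>fobj ?F p\<^esub> = (\<lambda>i\<in>J. \<zero>\<^bsub>k\<^esub>)"
      using lin_maps_zero[OF QMod_ag[OF F p] lm_ag[OF free_left_module[OF k_ring]] \<theta>(1)] by (simp add: dsum_simps)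
    note Rc = lin_maps_closed[OF Rlin[OF p]]
    note \<kappa>c = lin_maps_closed[OF \<kappa>lin[OF p]]
    show ?thesis
    proof (rule rel_proj_of_embedding[OF QMod_module[OF F p] lin_maps_comp[OF \<theta>(1) m]])
      show "?U p \<subseteq> El ?F p" using \<kappa>c by blast
      fix c assume c: "c \<in> El ?F p"
      have "\<theta> (m c) = (\<lambda>i\<in>J. \<zero>\<^bsub>k\<^esub>) \<longleftrightarrow> m c = \<zero>\<^bsub>fobj ?F p\<^esub>"
        using \<theta>(2)[OF lin_maps_closed[OF m c]] \<theta>0 by auto
      also have "\<dots> \<longleftrightarrow> c = \<kappa> p (R p c)"
        unfolding m_def by (rule ag_minus_eq_zero[OF QMod_ag[OF F p] c \<kappa>c[OF Rc[OF c]]])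
      also have "\<dots> \<longleftrightarrow> c \<in> ?U p"
      proof
        show "c \<in> ?U p" if "c = \<kappa> p (R p c)" by (rule image_eqI[where f = "\<kappa> p", OF that Rc[OF c]])
        show "c = \<kappa> p (R p c)" if "c \<in> ?U p" using that R\<kappa>[OF p] by auto
      qed
      finally show "\<theta> (m c) = (\<lambda>i\<in>J. \<zero>\<^bsub>k\<^esub>) \<longleftrightarrow> c \<in> ?U p" .
    qed
  qed
  \<comment> \<open>The quotient of the free functor by \<open>K\<close> being pointwise projective,
    the identity of \<open>K\<close> extends along \<open>\<kappa>\<close>; the extension is the
    natural retraction that \<open>R\<close> need not be.\<close>
  have idn: "(\<lambda>p u. u) \<in> NT K K" by (rule nat_transI[OF K K lin_maps_add_maps[OF lin_maps_id]]) simp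
  have "u = \<zero>\<^bsub>fobj K p\<^esub>" if "p \<in> Ob Q" "u \<in> El K p" "\<kappa> p u = \<zero>\<^bsub>fobj ?F p\<^esub>" for p u
    using R\<kappa>[OF that(1,2)] lin_maps_zero[OF QMod_ag[OF F that(1)] QMod_ag[OF K that(1)] Rlin[OF that(1)]] that(3) by simp
  from radical_injective_extend_along[OF K inj K F \<kappa> idn rp this]
  show ?thesis unfolding retract_of_free_def using b \<kappa> by blast
qed

end

section \<open>Projective resolutions\<close>

lemma concat_inj_lengths: "map length xs = map length ys \<Longrightarrow> concat xs = concat ys \<Longrightarrow> xs = ys"
proof (induction xs arbitrary: ys)
  case (Cons x xs)
  then obtain y ys' where "ys = y # ys'" "length x = length y" "map length xs = map length ys'" by (cases ys) auto
  thus ?case using Cons by auto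
qed simp

text \<open>Lets all terms of a resolution live on one type. Since the letters may come from a
  one-element type, the boundaries of concatenated words can only be stored in a length:
  \<open>pad\<close> lengthens a word so that its total length encodes the number \<open>n\<close>
  together with the original length, and \<open>flat\<close> uses the list of block lengths as
  \<open>n\<close>.\<close>

lemma words_encoding: "\<exists>enc :: ('o \<times> 'm \<times> ('o, 'm, 'x) words) list \<Rightarrow> ('o, 'm, 'x) words. inj enc"
proof -
  define pad :: "nat \<Rightarrow> ('o, 'm, 'x) words \<Rightarrow> ('o, 'm, 'x) words" where
    "pad n w = replicate (prod_encode (n, length w) - length w) undefined @ w" for n w
  have len: "length (pad n w) = prod_encode (n, length w)" for n w
    using le_prod_encode_2[of "length w" n] by (simp add: pad_def)
  have pad: "n = n' \<and> w = w'" if e: "pad n w = pad n' w'" for n n' w w'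
  proof -
    have "prod_encode (n, length w) = prod_encode (n', length w')" using len[of n w] len[of n' w'] e by simp
    hence "n = n'" "length w = length w'" by (auto simp: prod_encode_eq)
    thus ?thesis using e by (simp add: pad_def)
  qed
  define flat where "flat xs = pad (list_encode (map length xs)) (concat xs)" for xs :: "('o, 'm, 'x) words list"
  have flat: "xs = ys" if "flat xs = flat ys" for xs ys
    using pad[OF that[unfolded flat_def]] concat_inj_lengths[of xs ys] by (simp add: list_encode_eq)
  define hd' where "hd' x = (case x of (a, b, w) \<Rightarrow> (a, b, undefined) # w)" for x :: "'o \<times> 'm \<times> ('o, 'm, 'x) words"
  have hd': "inj hd'" by (auto simp: inj_def hd'_def)
  have "inj (\<lambda>xs. flat (map hd' xs))"
    by (rule injI) (use flat map_injective[OF _ hd'] in blast)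
  thus ?thesis by blast
qed

section \<open>Kernels, covers on a fixed type, and existence of resolutions\<close>

definition ker_fun :: "('o, 'm, 'k, 'x) modfun \<Rightarrow> ('o, 'm, 'k, 'y) modfun \<Rightarrow> ('o \<Rightarrow> 'x \<Rightarrow> 'y) \<Rightarrow> ('o, 'm, 'k, 'x) modfun" where
  "ker_fun X Y g = sub_fun X (\<lambda>p. {x \<in> El X p. g p x = \<zero>\<^bsub>fobj Y p\<^esub>})"

lemma ker_fun_simps:
  "El (ker_fun X Y g) p = {x \<in> El X p. g p x = \<zero>\<^bsub>fobj Y p\<^esub>}"
  "zero (fobj (ker_fun X Y g) p) = zero (fobj X p)"
  by (simp_all add: ker_fun_def)

definition char_map :: "('o, 'm, 'k, 'x) modfun \<Rightarrow> ('o \<Rightarrow> 'x \<Rightarrow> 'y) \<Rightarrow> 'o \<Rightarrow> ('y \<Rightarrow> qz) \<Rightarrow> 'x \<Rightarrow> qz" where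
  "char_map X h p \<beta> = (\<lambda>x\<in>El X p. \<beta> (h p x))"

context preadditive
begin

lemma ker_fun:
  assumes X: "X \<in> QMod k Q" and Y: "Y \<in> QMod k Q" and g: "g \<in> NT X Y"
  shows ker_fun_QMod: "ker_fun X Y g \<in> QMod k Q" and ker_fun_incl: "(\<lambda>p x. x) \<in> NT (ker_fun X Y g) X"
proof -
  have sub: "submodule {x \<in> El X p. g p x = \<zero>\<^bsub>fobj Y p\<^esub>} k (fobj X p)" if "p \<in> Ob Q" for p
    by (rule lin_maps_kernel[OF QMod_lm[OF X that] QMod_lm[OF Y that] nat_lin[OF g that]])
  show "ker_fun X Y g \<in> QMod k Q"
    unfolding ker_fun_def
    by (rule sub_fun_QMod[OF X sub]) (auto simp: fmor_closed[OF X] nat_natural[OF g] fmor_zero[OF Y])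
  show "(\<lambda>p x. x) \<in> NT (ker_fun X Y g) X"
    unfolding ker_fun_def by (rule sub_fun_incl[OF X sub])
qed

lemma nat_trans_onto_ker:
  assumes h: "h \<in> NT W X" and X: "X \<in> QMod k Q" and W: "W \<in> QMod k Q" and Y: "Y \<in> QMod k Q" and g: "g \<in> NT X Y"
    and im: "\<And>p x. p \<in> Ob Q \<Longrightarrow> x \<in> El W p \<Longrightarrow> g p (h p x) = \<zero>\<^bsub>fobj Y p\<^esub>"
  shows "h \<in> NT W (ker_fun X Y g)"
  by (rule nat_transI[OF W ker_fun_QMod[OF X Y g]])
    (use im nat_closed[OF h] nat_add[OF h] nat_natural[OF h] in \<open>auto intro!: add_mapsI simp: ker_fun_def\<close>)

text \<open>\<open>enc\<close> selects the type of the cover: the identity for the first term of a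
  resolution, and the map of \<open>words_encoding\<close> for all later ones.\<close>

lemma transported_cover:
  fixes Z :: "('o, 'm, 'k, 'z) modfun" and enc :: "('o \<times> 'm \<times> 'z) list \<Rightarrow> 'w"
  assumes Z: "Z \<in> QMod k Q" and enc: "inj enc"
  shows "\<exists>P :: ('o, 'm, 'k, 'w) modfun. \<exists>\<epsilon>. projective_functor k Q P \<and> \<epsilon> \<in> NT P Z \<and>
    (\<forall>p \<in> Ob Q. \<epsilon> p ` El P p = El Z p)"
proof -
  let ?I = "elements Z"
  let ?F = "free_fun Q ?I fst"
  define \<iota> where "\<iota> p c = enc (support_list (\<lambda>i f. (fst i, f, snd i)) ?I (\<lambda>i. \<zero>\<^bsub>Hom Q (fst i) p\<^esub>) c)" for p c
  have \<iota>: "inj_on (\<iota> p) (El ?F p)" for p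
    using free_words_inj[of ?I p] enc unfolding \<iota>_def inj_on_def by auto
  note T = transport_fun_QMod[OF cover_QMod[OF Z], of \<iota>, OF \<iota>]
  let ?P = "transport_fun \<iota> ?F" and ?inv = "\<lambda>p. inv_into (El ?F p) (\<iota> p)"
  have id: "\<iota> p (?inv p y) = y" if "y \<in> El ?P p" for p y
    using that unfolding transport_fun_simps transport_simps by (rule f_inv_into_f)
  have "projective_functor k Q ?P"
    unfolding projective_functor_def
    by (blast intro: T(1) free_retract_lift[OF elements_Ob T(3,2) id])
  moreover have "(\<lambda>p y. cover_map Z p (?inv p y)) \<in> NT ?P Z" by (rule nat_trans_comp[OF cover_map[OF Z] T(3)])
  moreover have "(\<lambda>y. cover_map Z p (?inv p y)) ` El ?P p = El Z p" if p: "p \<in> Ob Q" for p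
  proof -
    have "(\<lambda>y. cover_map Z p (?inv p y)) ` (\<iota> p ` El ?F p) = cover_map Z p ` El ?F p"
      unfolding image_image by (rule image_cong[OF refl]) (simp only: inv_into_f_f[OF \<iota>])
    thus ?thesis using cover_surj[OF Z p] unfolding transport_fun_simps transport_simps by simp
  qed
  ultimately show ?thesis by (intro exI[of _ ?P] exI[of _ "\<lambda>p y. cover_map Z p (?inv p y)"]) blast
qed

lemma projective_functor_QMod: "projective_functor k Q P \<Longrightarrow> P \<in> QMod k Q"
  by (simp add: projective_functor_def)

theorem projective_resolution_exists:
  fixes X :: "('o, 'm, 'k, 'x) modfun"
  assumes X: "X \<in> QMod k Q" shows "\<exists>R. projective_resolution k Q X R"
proof -
  have "inj (\<lambda>w :: ('o, 'm, 'x) words. w)" by simp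
  from transported_cover[OF X this] obtain P0 :: "('o, 'm, 'k, ('o, 'm, 'x) words) modfun" and e where
    P0: "projective_functor k Q P0" and e: "e \<in> NT P0 X" "\<And>p. p \<in> Ob Q \<Longrightarrow> e p ` El P0 p = El X p"
    by blast
  obtain enc :: "('o \<times> 'm \<times> ('o, 'm, 'x) words) list \<Rightarrow> ('o, 'm, 'x) words" where enc: "inj enc"
    using words_encoding by blast
  have "\<forall>Z :: ('o, 'm, 'k, ('o, 'm, 'x) words) modfun \<in> QMod k Q.
    \<exists>C :: ('o, 'm, 'k, ('o, 'm, 'x) words) modfun \<times> ('o \<Rightarrow> ('o, 'm, 'x) words \<Rightarrow> ('o, 'm, 'x) words).
      projective_functor k Q (fst C) \<and> snd C \<in> NT (fst C) Z \<and>
      (\<forall>p \<in> Ob Q. snd C p ` El (fst C) p = El Z p)"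
    using transported_cover[OF _ enc] by fastforce
  then obtain C :: "('o, 'm, 'k, ('o, 'm, 'x) words) modfun \<Rightarrow> ('o, 'm, 'k, ('o, 'm, 'x) words) modfun \<times> ('o \<Rightarrow> ('o, 'm, 'x) words \<Rightarrow> ('o, 'm, 'x) words)"
    where C: "\<And>Z. Z \<in> QMod k Q \<Longrightarrow> projective_functor k Q (fst (C Z))" "\<And>Z. Z \<in> QMod k Q \<Longrightarrow> snd (C Z) \<in> NT (fst (C Z)) Z"
      "\<And>Z p. Z \<in> QMod k Q \<Longrightarrow> p \<in> Ob Q \<Longrightarrow> snd (C Z) p ` El (fst (C Z)) p = El Z p"
    by (metis (no_types, lifting) bchoice)
  \<comment> \<open>The successive syzygies, with the kernel of \<open>e\<close> as number 0;
    \<open>Z n\<close> is a subfunctor of \<open>P n\<close>, and \<open>P (Suc n)\<close> is the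
    chosen cover of \<open>Z n\<close>.\<close>
  define Z where "Z n = ((\<lambda>Z. ker_fun (fst (C Z)) Z (snd (C Z))) ^^ n) (ker_fun P0 X e)" for n
  have Zs: "Z 0 = ker_fun P0 X e" "Z (Suc n) = ker_fun (fst (C (Z n))) (Z n) (snd (C (Z n)))" for n
    by (simp_all add: Z_def)
  note P0Q = projective_functor_QMod[OF P0]
  have ZQ: "Z n \<in> QMod k Q" for n
    by (induction n) (auto simp: Zs ker_fun_QMod[OF P0Q X e(1)] ker_fun_QMod[OF projective_functor_QMod[OF C(1)]] C(2))
  define P where "P n = (case n of 0 \<Rightarrow> P0 | Suc m \<Rightarrow> fst (C (Z m)))" for n
  have Ps [simp]: "P 0 = P0" "P (Suc n) = fst (C (Z n))" for n by (simp_all add: P_def)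
  have incl: "(\<lambda>p x. x) \<in> NT (Z n) (P n)" for n
    by (cases n) (simp_all add: Zs ker_fun_incl[OF P0Q X e(1)] ker_fun_incl[OF projective_functor_QMod[OF C(1)] ZQ C(2)] ZQ)
  have "projective_functor k Q (P n)" for n by (cases n) (simp_all add: P0 C(1) ZQ)
  moreover have "snd (C (Z n)) \<in> NT (P (Suc n)) (P n)" for n
    using nat_trans_comp[OF incl[of n] C(2)[OF ZQ]] by simp
  moreover have "snd (C (Z 0)) p ` El (P 1) p = {x \<in> El (P 0) p. e p x = \<zero>\<^bsub>fobj X p\<^esub>}" if "p \<in> Ob Q" for p
    using C(3)[OF ZQ[of 0] that] by (simp add: Zs(1) ker_fun_simps)
  moreover have "snd (C (Z (Suc n))) p ` El (P (Suc (Suc n))) p =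
      {x \<in> El (P (Suc n)) p. snd (C (Z n)) p x = \<zero>\<^bsub>fobj (P n) p\<^esub>}" if "p \<in> Ob Q" for p n
  proof -
    have "zero (fobj (Z n) p) = zero (fobj (P n) p)" by (cases n) (simp_all add: Zs ker_fun_simps)
    thus ?thesis using C(3)[OF ZQ[of "Suc n"] that] by (simp add: Zs(2)[of n] ker_fun_simps)
  qed
  ultimately have "projective_resolution k Q X (P, \<lambda>n. snd (C (Z n)), e)"
    using e unfolding projective_resolution_def by simp
  thus ?thesis by blast
qed

lemma char_map:
  assumes X: "X \<in> QMod k Q" and Y: "Y \<in> QMod k Q" and h: "h \<in> NT X Y"
  shows "char_map X h \<in> nat_trans k (op_cat Q) (char_fun Y) (char_fun X)"
proof -
  interpret op: preadditive k "op_cat Q" by (rule op_preadditive)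
  note am = ag_add_closed[OF QMod_ag[OF X]]
  show ?thesis
  proof (rule op.nat_transI[OF char_fun_QMod[OF Y] char_fun_QMod[OF X]])
    show "char_map X h p \<in> add_maps (fobj (char_fun Y) p) (fobj (char_fun X) p)" if "p \<in> Ob (op_cat Q)" for p
      using that am nat_closed[OF h] nat_add[OF h]
      by (auto simp: char_map_def char_fun_simps add_maps_def fun_eq_iff)
    show "char_map X h q (fmor (char_fun Y) p q f \<beta>) = fmor (char_fun X) p q f (char_map X h p \<beta>)"
      if "p \<in> Ob (op_cat Q)" "q \<in> Ob (op_cat Q)" "f \<in> Mor (op_cat Q) p q" "\<beta> \<in> El (char_fun Y) p" for p q f \<beta>
      using that nat_closed[OF h] nat_natural[OF h, of q p f] fmor_closed[OF X, of q p f]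
      by (auto simp: char_map_def char_fun_simps fun_eq_iff)
  qed
qed

end

section \<open>Radical injectivity and finite projective dimension\<close>

context frob
begin

lemma radical_injective_of_retract:
  assumes i: "i \<in> NT X Y" and j: "j \<in> NT Y X"
    and id: "\<And>p x. p \<in> Ob Q \<Longrightarrow> x \<in> El X p \<Longrightarrow> j p (i p x) = x" and inj: "radical_injective Q r Y"
  shows "radical_injective Q r X"
  unfolding radical_injective_def
proof (intro ballI allI impI)
  fix p \<phi> assume p: "p \<in> Ob Q" and \<phi>: "radical_family Q r X p \<phi>"
  note cl = rf_closed[OF \<phi>]
  obtain y where y: "y \<in> El Y p" "\<And>q f. q \<in> Ob Q \<Longrightarrow> f \<in> rad p q \<Longrightarrow> i q (\<phi> q f) = fmor Y p q f y"
    using radical_injective_image[OF inj i p \<phi>] by blast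
  have "\<phi> q f = fmor X p q f (j p y)" if q: "q \<in> Ob Q" and f: "f \<in> rad p q" for q f
  proof -
    have "\<phi> q f \<in> El X q" using cl q f by blast
    hence "\<phi> q f = j q (i q (\<phi> q f))" using id[OF q] by simp
    thus ?thesis using y(2)[OF q f] nat_natural[OF j p q rad_closed[OF p q f] y(1)] by simp
  qed
  thus "\<exists>x\<in>El X p. \<forall>q\<in>Ob Q. \<forall>f\<in>rad p q. \<phi> q f = fmor X p q f x"
    using nat_closed[OF j p y(1)] by blast
qed

lemma projective_radical_injective:
  fixes P :: "('o, 'm, 'k, 'x) modfun"
  assumes "projective_functor k Q P" shows "radical_injective Q r P"
proof -
  obtain I :: "('o \<times> 'x) set" and b \<kappa> \<rho> where b: "\<forall>i \<in> I. b i \<in> Ob Q" and \<kappa>: "\<kappa> \<in> NT P (free_fun Q I b)"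
    and \<rho>: "\<rho> \<in> NT (free_fun Q I b) P" and id: "\<And>p x. p \<in> Ob Q \<Longrightarrow> x \<in> El P p \<Longrightarrow> \<rho> p (\<kappa> p x) = x"
    by (rule retract_of_freeE[OF projective_functor_retract[OF assms]]) blast
  show ?thesis by (rule radical_injective_of_retract[OF \<kappa> \<rho> id free_fun_radical_injective[OF b]])
qed

text \<open>Pointwise a projective functor sits inside a free functor, hence inside a free module.
  So kernels of maps out of and into projective functors fall under
  \<open>rel_proj_kernel\<close>.\<close>

lemma projective_embedding:
  fixes P :: "('o, 'm, 'k, 'x) modfun"
  assumes P: "projective_functor k Q P" and p: "p \<in> Ob Q"
  shows "\<exists>(J :: (('o \<times> 'x) \<times> 'm) set) \<theta>. \<theta> \<in> lin_maps k (fobj P p) (free_module k J) \<and>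
    (\<forall>c \<in> El P p. \<theta> c = (\<lambda>i\<in>J. \<zero>\<^bsub>k\<^esub>) \<longleftrightarrow> c = \<zero>\<^bsub>fobj P p\<^esub>)"
proof -
  note PQ = projective_functor_QMod[OF P]
  obtain I :: "('o \<times> 'x) set" and b \<kappa> \<rho> where b: "\<forall>i \<in> I. b i \<in> Ob Q" and \<kappa>: "\<kappa> \<in> NT P (free_fun Q I b)"
    and \<rho>: "\<rho> \<in> NT (free_fun Q I b) P" and id: "\<And>p x. p \<in> Ob Q \<Longrightarrow> x \<in> El P p \<Longrightarrow> \<rho> p (\<kappa> p x) = x"
    by (rule retract_of_freeE[OF projective_functor_retract[OF P]]) blast
  note F = free_fun_QMod[OF b]
  obtain J :: "(('o \<times> 'x) \<times> 'm) set" and \<theta> where \<theta>: "\<theta> \<in> lin_maps k (fobj (free_fun Q I b) p) (free_module k J)"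
    "\<And>c. c \<in> El (free_fun Q I b) p \<Longrightarrow> \<theta> c = (\<lambda>i\<in>J. \<zero>\<^bsub>k\<^esub>) \<Longrightarrow> c = \<zero>\<^bsub>fobj (free_fun Q I b) p\<^esub>"
    using free_fun_embedding[OF b p] by blast
  note l = lin_maps_comp[OF \<theta>(1) nat_lin[OF \<kappa> p]]
  have "c = \<zero>\<^bsub>fobj P p\<^esub>" if c: "c \<in> El P p" and z: "\<theta> (\<kappa> p c) = (\<lambda>i\<in>J. \<zero>\<^bsub>k\<^esub>)" for c
    using \<theta>(2)[OF nat_closed[OF \<kappa> p c] z] id[OF p c] nat_zero[OF F PQ \<rho> p] by simp
  moreover have "\<theta> (\<kappa> p \<zero>\<^bsub>fobj P p\<^esub>) = (\<lambda>i\<in>J. \<zero>\<^bsub>k\<^esub>)"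
    using lin_maps_zero[OF QMod_ag[OF PQ p] lm_ag[OF free_left_module[OF k_ring]] l] by (simp add: dsum_simps)
  ultimately show ?thesis using l by (intro exI[of _ J] exI[of _ "\<lambda>c. \<theta> (\<kappa> p c)"]) blast
qed

text \<open>The kernel \<open>?K\<close> of a cover is radical injective by
  \<open>radical_injective_kernel\<close>, and pointwise a submodule of a free module, hence
  projective by heredity. By \<open>radical_injective_retract\<close> it is a projective functor, so
  the resolution stops at degree 1.\<close>

theorem radical_injective_finite_proj_dim:
  fixes X :: "('o, 'm, 'k, 'x) modfun"
  assumes X: "X \<in> QMod k Q" and inj: "radical_injective Q r X"
  shows "finite_proj_dim k Q X"
proof -
  have "inj (\<lambda>w :: ('o, 'm, 'x) words. w)" by simp
  from transported_cover[OF X this] obtain P0 :: "('o, 'm, 'k, ('o, 'm, 'x) words) modfun" and e where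
    P0: "projective_functor k Q P0" and e: "e \<in> NT P0 X" "\<And>p. p \<in> Ob Q \<Longrightarrow> e p ` El P0 p = El X p"
    by blast
  note P0Q = projective_functor_QMod[OF P0]
  let ?K = "ker_fun P0 X e"
  note K = ker_fun_QMod[OF P0Q X e(1)] and incl = ker_fun_incl[OF P0Q X e(1)]
  have Kc: "x \<in> El P0 p" if "x \<in> El ?K p" for p x using that by (simp add: ker_fun_simps)
  have "radical_injective Q r ?K"
    by (rule radical_injective_kernel[OF K P0Q X incl e(1) _ _ e(2) projective_radical_injective[OF P0] inj])
      (auto simp: inj_on_def ker_fun_simps)
  moreover have "rel_proj k (fobj ?K p) {\<zero>\<^bsub>fobj ?K p\<^esub>}" if p: "p \<in> Ob Q" for p
  proof -
    obtain J :: "(('o \<times> ('o, 'm, 'x) words) \<times> 'm) set" and \<theta> where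
      \<theta>: "\<theta> \<in> lin_maps k (fobj P0 p) (free_module k J)"
      "\<And>c. c \<in> El P0 p \<Longrightarrow> \<theta> c = (\<lambda>i\<in>J. \<zero>\<^bsub>k\<^esub>) \<longleftrightarrow> c = \<zero>\<^bsub>fobj P0 p\<^esub>"
      using projective_embedding[OF P0 p] by blast
    show ?thesis
      by (rule rel_proj_of_embedding[OF QMod_module[OF K p] lin_maps_comp[OF \<theta>(1) nat_lin[OF incl p]]])
        (use \<theta>(2) Kc submoduleD(2)[OF QMod_lm[OF P0Q p]] ag_zero_closed[OF QMod_ag[OF K p]] in
          \<open>auto simp: ker_fun_simps(2)\<close>)
  qed
  ultimately have "projective_functor k Q ?K" by (intro retract_of_free_projective K radical_injective_retract)
  \<comment> \<open>A resolution has a term in every degree. From degree 2 on it is this zero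
    functor inside \<open>?K\<close>, so that every differential is an inclusion, given by the
    identity function.\<close>
  let ?O = "sub_fun ?K (\<lambda>p. {\<zero>\<^bsub>fobj ?K p\<^esub>})"
  have zsub: "submodule {\<zero>\<^bsub>fobj ?K p\<^esub>} k (fobj ?K p)" if "p \<in> Ob Q" for p
    by (rule left_submoduleI[OF QMod_lm[OF K that]])
      (use abelian_group.axioms(1)[OF QMod_ag[OF K that]] left_module_smult_zero[OF QMod_lm[OF K that]] in
        \<open>auto simp: abelian_monoid.zero_closed abelian_monoid.l_zero\<close>)
  have O: "?O \<in> QMod k Q" by (rule sub_fun_QMod[OF K zsub]) (auto simp: fmor_zero[OF K])
  have "projective_functor k Q ?O"
    unfolding projective_functor_def
  proof (intro conjI O ballI impI)
    fix E :: "('o, 'm, 'k, ('o, 'm, ('o, 'm, 'x) words) words) modfun" and B :: "('o, 'm, 'k, ('o, 'm, ('o, 'm, 'x) words) words) modfun" and g h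
    assume E: "E \<in> QMod k Q" and B: "B \<in> QMod k Q" and g: "g \<in> NT E B" and h: "h \<in> NT ?O B"
    have "(\<lambda>p x. \<zero>\<^bsub>fobj E p\<^esub>) \<in> NT ?O E"
      by (rule nat_transI[OF O E]) (auto simp: add_maps_const_zero[OF QMod_ag[OF E]] fmor_zero[OF E])
    moreover have "g p \<zero>\<^bsub>fobj E p\<^esub> = h p x" if "p \<in> Ob Q" "x \<in> El ?O p" for p x
      using nat_zero[OF E B g that(1)] nat_zero[OF O B h that(1)] that(2) by simp
    ultimately show "\<exists>l\<in>NT ?O E. \<forall>p\<in>Ob Q. \<forall>x\<in>El ?O p. g p (l p x) = h p x"
      by (intro bexI[of _ "\<lambda>p x. \<zero>\<^bsub>fobj E p\<^esub>"] ballI) blast+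
  qed
  define P where "P n = (case n of 0 \<Rightarrow> P0 | Suc m \<Rightarrow> if m = 0 then ?K else ?O)" for n
  have Ps: "P 0 = P0" "P (Suc 0) = ?K" "P (Suc (Suc n)) = ?O" for n by (simp_all add: P_def)
  have "projective_functor k Q (P n)" for n
    using P0 \<open>projective_functor k Q ?K\<close> \<open>projective_functor k Q ?O\<close> by (simp add: P_def split: nat.split)
  moreover have "(\<lambda>p x. x) \<in> NT (P (Suc n)) (P n)" for n
  proof -
    have "(\<lambda>p x. x) \<in> NT ?O ?O" by (auto simp: nat_trans_def lin_maps_id)
    thus ?thesis using incl sub_fun_incl[OF K zsub] by (cases n; cases "n - 1") (auto simp: Ps)
  qed
  moreover have "(\<lambda>x. x) ` El (P (Suc (Suc n))) p = {x \<in> El (P (Suc n)) p. x = \<zero>\<^bsub>fobj (P n) p\<^esub>}" if "p \<in> Ob Q" for p n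
    using ag_zero_closed[OF QMod_ag[OF K that]]
    by (cases n; cases "n - 1") (auto simp: Ps ker_fun_simps)
  ultimately have "projective_resolution k Q X (P, \<lambda>n p x. x, e)"
    unfolding projective_resolution_def using e by (simp add: Ps ker_fun_simps)
  moreover have "zero_module (fobj (P n) p)" if "n > 1" for n p
  proof -
    obtain m where "n = Suc (Suc m)" using \<open>n > 1\<close> by (metis One_nat_def less_imp_Suc_add add_Suc)
    thus ?thesis by (simp add: Ps zero_module_def)
  qed
  ultimately show ?thesis unfolding finite_proj_dim_def by blast
qed

text \<open>Dualising into the injective group Q/Z is exact, so the cokernel \<open>Z\<close>
  becomes the kernel of a surjection between duals, and \<open>radical_injective_kernel\<close>
  applies over the opposite category.\<close>

lemma char_radical_injective_cokernel:
  assumes X: "X \<in> QMod k Q" and Y: "Y \<in> QMod k Q" and Z: "Z \<in> QMod k Q"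
    and i: "i \<in> NT X Y" and g: "g \<in> NT Y Z"
    and inj: "\<And>p. p \<in> Ob Q \<Longrightarrow> inj_on (i p) (El X p)"
    and exact: "\<And>p. p \<in> Ob Q \<Longrightarrow> i p ` El X p = {y \<in> El Y p. g p y = \<zero>\<^bsub>fobj Z p\<^esub>}"
    and surj: "\<And>p. p \<in> Ob Q \<Longrightarrow> g p ` El Y p = El Z p"
    and EY: "radical_injective (op_cat Q) r (char_fun Y)" and EX: "radical_injective (op_cat Q) r (char_fun X)"
  shows "radical_injective (op_cat Q) r (char_fun Z)"
proof -
  interpret op: frob k "op_cat Q" r \<sigma>' \<sigma> "\<lambda>q. t (\<sigma>' q)" by (rule op_frob)
  show ?thesis
  proof (rule op.radical_injective_kernel[OF char_fun_QMod[OF Z] char_fun_QMod[OF Y] char_fun_QMod[OF X]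
        char_map[OF Y Z g] char_map[OF X Y i] _ _ _ EY EX])
    fix p assume "p \<in> Ob (op_cat Q)"
    hence p: "p \<in> Ob Q" by simp
    note sur = surj[OF p]
    show "inj_on (char_map Y g p) (El (char_fun Z) p)"
    proof (rule inj_onI)
      fix \<alpha> \<beta> assume \<alpha>: "\<alpha> \<in> El (char_fun Z) p" and \<beta>: "\<beta> \<in> El (char_fun Z) p"
        and eq: "char_map Y g p \<alpha> = char_map Y g p \<beta>"
      have "\<alpha> z = \<beta> z" if z: "z \<in> El Z p" for z
      proof -
        obtain y where "y \<in> El Y p" "z = g p y" using sur z by (metis imageE)
        thus ?thesis using fun_cong[OF eq, of y] by (simp add: char_map_def)
      qed
      thus "\<alpha> = \<beta>" using \<alpha> \<beta> by (auto simp: char_fun_simps intro: extensionalityI)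
    qed
    show "char_map Y g p ` El (char_fun Z) p =
      {\<omega> \<in> El (char_fun Y) p. char_map X i p \<omega> = \<zero>\<^bsub>fobj (char_fun X) p\<^esub>}"
    proof (intro equalityI subsetI)
      fix \<omega> assume "\<omega> \<in> char_map Y g p ` El (char_fun Z) p"
      then obtain \<beta> where \<beta>: "\<beta> \<in> El (char_fun Z) p" "\<omega> = char_map Y g p \<beta>" by blast
      have "\<beta> \<zero>\<^bsub>fobj Z p\<^esub> = 0" using \<beta>(1) char_zero[OF QMod_ag[OF Z p]] by (simp add: char_fun_simps)
      moreover have "g p (i p x) = \<zero>\<^bsub>fobj Z p\<^esub>" "i p x \<in> El Y p" if "x \<in> El X p" for x
        using exact[OF p] that by auto
      ultimately have "char_map X i p \<omega> = \<zero>\<^bsub>fobj (char_fun X) p\<^esub>" by (auto simp: \<beta>(2) char_map_def char_fun_simps)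
      thus "\<omega> \<in> {\<omega> \<in> El (char_fun Y) p. char_map X i p \<omega> = \<zero>\<^bsub>fobj (char_fun X) p\<^esub>}"
        using op.nat_closed[OF char_map[OF Y Z g], of p \<beta>] p \<beta> by simp
    next
      fix \<omega> assume "\<omega> \<in> {\<omega> \<in> El (char_fun Y) p. char_map X i p \<omega> = \<zero>\<^bsub>fobj (char_fun X) p\<^esub>}"
      hence \<omega>: "\<omega> \<in> chars (fobj Y p)" "\<omega> \<in> extensional (El Y p)" and z: "char_map X i p \<omega> = \<zero>\<^bsub>fobj (char_fun X) p\<^esub>"
        by (auto simp: char_fun_simps)
      have z': "\<omega> (i p x) = 0" if "x \<in> El X p" for x using fun_cong[OF z, of x] that by (simp add: char_map_def char_fun_simps)
      have "\<omega> y = 0" if "y \<in> El Y p" "g p y = \<zero>\<^bsub>fobj Z p\<^esub>" for y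
      proof -
        have "y \<in> i p ` El X p" using exact[OF p] that by simp
        thus ?thesis using z' by auto
      qed
      hence "\<exists>\<beta> \<in> add_maps ((fobj Z p)\<lparr>carrier := g p ` El Y p\<rparr>) qz_group. \<forall>y \<in> El Y p. \<beta> (g p y) = \<omega> y"
        by (intro add_maps_factor[OF QMod_ag[OF Y p] QMod_ag[OF Z p] qz_group_abelian nat_add_maps[OF g p] \<omega>(1)]) simp
      then obtain \<beta>' where \<beta>': "\<beta>' \<in> chars (fobj Z p)" "\<And>y. y \<in> El Y p \<Longrightarrow> \<beta>' (g p y) = \<omega> y"
        unfolding sur by (auto simp: add_maps_def)
      define \<beta> where "\<beta> = restrict \<beta>' (El Z p)"
      have \<beta>g: "\<beta> (g p y) = \<omega> y" if "y \<in> El Y p" for y using \<beta>'(2)[OF that] nat_closed[OF g p that] by (simp add: \<beta>_def)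
      have "\<beta> \<in> chars (fobj Z p)" by (rule add_maps_cong[OF QMod_ag[OF Z p] \<beta>'(1)]) (simp add: \<beta>_def)
      hence "\<beta> \<in> El (char_fun Z) p" by (simp add: char_fun_simps \<beta>_def)
      moreover have "\<omega> = char_map Y g p \<beta>"
        using \<omega>(2) \<beta>g by (auto simp: char_map_def fun_eq_iff extensional_def)
      ultimately show "\<omega> \<in> char_map Y g p ` El (char_fun Z) p" by blast
    qed
    show "char_map X i p ` El (char_fun Y) p = El (char_fun X) p"
    proof (intro equalityI subsetI)
      show "\<beta> \<in> El (char_fun X) p" if "\<beta> \<in> char_map X i p ` El (char_fun Y) p" for \<beta>
        using op.nat_closed[OF char_map[OF X Y i]] p that by auto
      fix \<beta> assume "\<beta> \<in> El (char_fun X) p"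
      hence \<beta>: "\<beta> \<in> chars (fobj X p)" "\<beta> \<in> extensional (El X p)" by (auto simp: char_fun_simps)
      have "\<beta> x = 0" if x: "x \<in> El X p" "i p x = \<zero>\<^bsub>fobj Y p\<^esub>" for x
      proof -
        have "x = \<zero>\<^bsub>fobj X p\<^esub>"
          by (rule inj_onD[OF inj[OF p] _ x(1) ag_zero_closed[OF QMod_ag[OF X p]]]) (use x(2) nat_zero[OF X Y i p] in simp)
        thus ?thesis using char_zero[OF QMod_ag[OF X p] \<beta>(1)] by simp
      qed
      hence "\<exists>\<chi> \<in> add_maps ((fobj Y p)\<lparr>carrier := i p ` El X p\<rparr>) qz_group. \<forall>x \<in> El X p. \<chi> (i p x) = \<beta> x"
        by (intro add_maps_factor[OF QMod_ag[OF X p] QMod_ag[OF Y p] qz_group_abelian nat_add_maps[OF i p] \<beta>(1)]) simp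
      then obtain \<chi> where \<chi>: "\<chi> \<in> add_maps ((fobj Y p)\<lparr>carrier := i p ` El X p\<rparr>) qz_group" "\<And>x. x \<in> El X p \<Longrightarrow> \<chi> (i p x) = \<beta> x" by blast
      have "\<exists>\<omega> \<in> chars (fobj Y p). \<forall>u \<in> i p ` El X p. \<omega> u = \<chi> u"
        by (rule char_extend[OF QMod_ag[OF Y p] add_maps_image_closed[OF QMod_ag[OF X p] QMod_ag[OF Y p] nat_add_maps[OF i p]]])
          (use add_maps_add[OF \<chi>(1)] in simp)
      then obtain \<omega> where \<omega>: "\<omega> \<in> chars (fobj Y p)" "\<And>x. x \<in> El X p \<Longrightarrow> \<omega> (i p x) = \<beta> x" using \<chi>(2) by auto
      have "restrict \<omega> (El Y p) \<in> El (char_fun Y) p"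
        using add_maps_cong[OF QMod_ag[OF Y p] \<omega>(1), of "restrict \<omega> (El Y p)"] by (simp add: char_fun_simps)
      moreover have "\<beta> = char_map X i p (restrict \<omega> (El Y p))"
        using \<beta>(2) \<omega>(2) nat_closed[OF i p] by (auto simp: char_map_def fun_eq_iff extensional_def)
      ultimately show "\<beta> \<in> char_map X i p ` El (char_fun Y) p" by blast
    qed
  qed
qed

lemma char_zero_radical_injective:
  assumes X: "X \<in> QMod k Q" and z: "\<And>p. p \<in> Ob Q \<Longrightarrow> zero_module (fobj X p)"
  shows "radical_injective (op_cat Q) r (char_fun X)"
proof -
  interpret op: preadditive k "op_cat Q" by (rule op_preadditive)
  have triv: "\<alpha> = \<beta>" if "p \<in> Ob Q" "\<alpha> \<in> El (char_fun X) p" "\<beta> \<in> El (char_fun X) p" for p \<alpha> \<beta>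
    using that z[OF that(1)] char_zero[OF QMod_ag[OF X that(1)], of \<alpha>] char_zero[OF QMod_ag[OF X that(1)], of \<beta>]
    by (auto simp: char_fun_simps zero_module_def intro!: extensionalityI[of \<alpha> _ \<beta>])
  show ?thesis
    unfolding radical_injective_def op_rad op_cat_simps
  proof (intro ballI allI impI)
    fix p \<phi> assume p: "p \<in> Ob Q" and \<phi>: "radical_family (op_cat Q) r (char_fun X) p \<phi>"
    note cl = rf_closed[OF \<phi>, unfolded op_rad op_cat_simps]
    have x: "\<zero>\<^bsub>fobj (char_fun X) p\<^esub> \<in> El (char_fun X) p"
      using ag_zero_closed[OF op.QMod_ag[OF char_fun_QMod[OF X]]] p by simp
    have "\<phi> q f = fmor (char_fun X) p q f \<zero>\<^bsub>fobj (char_fun X) p\<^esub>" if q: "q \<in> Ob Q" and f: "f \<in> rad q p" for q f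
      using triv[OF q] cl q f op.fmor_closed[OF char_fun_QMod[OF X], of p q f, OF _ _ _ x] p rad_closed[OF q p f] by simp
    thus "\<exists>x\<in>El (char_fun X) p. \<forall>q\<in>Ob Q. \<forall>f\<in>rad q p. \<phi> q f = fmor (char_fun X) p q f x" using x by blast
  qed
qed

text \<open>Descend along the syzygies: \<open>K (Suc N)\<close> is zero, \<open>K n\<close> is the
  cokernel of \<open>K (Suc n)\<close> in \<open>P (Suc n)\<close>, and \<open>X\<close> is the
  cokernel of \<open>K 0\<close> in \<open>P 0\<close>. The duals of the projective terms are
  radical injective.\<close>

theorem finite_proj_dim_char_radical_injective:
  fixes X :: "('o, 'm, 'k, 'x) modfun"
  assumes X: "X \<in> QMod k Q" and fpd: "finite_proj_dim k Q X"
  shows "radical_injective (op_cat Q) r (char_fun X)"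
proof -
  obtain P :: "nat \<Rightarrow> ('o, 'm, 'k, ('o, 'm, 'x) words) modfun" and d e N where
    res: "projective_resolution k Q X (P, d, e)" and zero: "\<And>n p. n > N \<Longrightarrow> p \<in> Ob Q \<Longrightarrow> zero_module (fobj (P n) p)"
    using fpd unfolding finite_proj_dim_def by blast
  have P: "projective_functor k Q (P n)" and d: "d n \<in> NT (P (Suc n)) (P n)" and e: "e \<in> NT (P 0) X" for n
    using res by (auto simp: projective_resolution_def)
  have es: "e p ` El (P 0) p = El X p"
    and d0: "d 0 p ` El (P 1) p = {x \<in> El (P 0) p. e p x = \<zero>\<^bsub>fobj X p\<^esub>}"
    and dS: "d (Suc n) p ` El (P (Suc (Suc n))) p = {x \<in> El (P (Suc n)) p. d n p x = \<zero>\<^bsub>fobj (P n) p\<^esub>}"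
    if "p \<in> Ob Q" for p n using res that by (auto simp: projective_resolution_def)
  note PQ = projective_functor_QMod[OF P]
  note EP = char_retract_radical_injective[OF PQ projective_functor_retract[OF P]]
  \<comment> \<open>\<open>K n\<close> is the kernel of the map out of \<open>P n\<close>, which is
    the augmentation for \<open>n = 0\<close> and \<open>d m\<close> for
    \<open>n = Suc m\<close>.\<close>
  define K where "K n = (case n of 0 \<Rightarrow> ker_fun (P 0) X e | Suc m \<Rightarrow> ker_fun (P (Suc m)) (P m) (d m))" for n
  have K: "K n \<in> QMod k Q" "(\<lambda>p x. x) \<in> NT (K n) (P n)" "zero (fobj (K n) p) = zero (fobj (P n) p)" for n p
    using ker_fun[OF PQ X e] ker_fun[OF PQ PQ d] by (auto simp: K_def ker_fun_simps split: nat.split)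
  have Kd: "d n p ` El (P (Suc n)) p = El (K n) p" if "p \<in> Ob Q" for n p
    using d0[OF that] dS[OF that] by (cases n) (simp_all add: K_def ker_fun_simps)
  have dK: "d n \<in> NT (P (Suc n)) (K n)" for n
  proof (cases n)
    case 0
    show ?thesis unfolding 0 K_def nat.case
      by (rule nat_trans_onto_ker[OF d PQ PQ X e]) (use d0 in auto)
  next
    case (Suc m)
    show ?thesis unfolding Suc K_def nat.case
      by (rule nat_trans_onto_ker[OF d PQ PQ PQ d]) (use dS in blast)
  qed
  have KS: "El (K (Suc n)) p = {x \<in> El (P (Suc n)) p. d n p x = \<zero>\<^bsub>fobj (K n) p\<^esub>}" for n p
    by (simp add: K(3)) (simp add: K_def ker_fun_simps)
  have EK: "radical_injective (op_cat Q) r (char_fun (K 0))"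
  proof (rule inc_induct[of 0 "Suc N"])
    show "radical_injective (op_cat Q) r (char_fun (K (Suc N)))"
    proof (rule char_zero_radical_injective[OF K(1)])
      fix p assume p: "p \<in> Ob Q"
      have "zero (fobj (K (Suc N)) p) \<in> El (K (Suc N)) p"
        by (rule ag_zero_closed[OF QMod_ag[OF K(1) p]])
      thus "zero_module (fobj (K (Suc N)) p)"
        using zero[OF lessI p] by (auto simp: zero_module_def KS K(3))
    qed
    fix n assume ih: "radical_injective (op_cat Q) r (char_fun (K (Suc n)))"
    show "radical_injective (op_cat Q) r (char_fun (K n))"
      by (rule char_radical_injective_cokernel[OF K(1) PQ K(1) K(2) dK _ _ Kd EP ih]) (simp_all add: inj_on_def KS)
  qed simp
  show ?thesis
    by (rule char_radical_injective_cokernel[OF K(1) PQ X K(2) e _ _ es EP EK]) (simp_all add: inj_on_def K_def ker_fun_simps)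
qed

theorem radical_injective_iff_finite_proj_dim:
  fixes X :: "('o, 'm, 'k, 'x) modfun"
  assumes X: "X \<in> QMod k Q"
  shows "radical_injective Q r X \<longleftrightarrow> finite_proj_dim k Q X"
    and "radical_injective (op_cat Q) r (char_fun X) \<longleftrightarrow> finite_proj_dim k Q X"
proof -
  interpret op: frob k "op_cat Q" r \<sigma>' \<sigma> "\<lambda>q. t (\<sigma>' q)" by (rule op_frob)
  note X' = char_fun_QMod[OF X]
  have 1: "radical_injective Q r X \<Longrightarrow> finite_proj_dim k Q X" by (rule radical_injective_finite_proj_dim[OF X])
  have 2: "finite_proj_dim k Q X \<Longrightarrow> radical_injective (op_cat Q) r (char_fun X)" by (rule finite_proj_dim_char_radical_injective[OF X])
  have 3: "radical_injective Q r X" if "radical_injective (op_cat Q) r (char_fun X)"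
    using op.finite_proj_dim_char_radical_injective[OF X' op.radical_injective_finite_proj_dim[OF X' that]]
      radical_injective_double_char[OF X] by simp
  show "radical_injective Q r X \<longleftrightarrow> finite_proj_dim k Q X" "radical_injective (op_cat Q) r (char_fun X) \<longleftrightarrow> finite_proj_dim k Q X"
    using 1 2 3 by blast+
qed

end

section \<open>Stalk functors and Ext\<close>

text \<open>Assumes only what computing with cosets needs, so that it applies to
  \<open>nat_module\<close> through closure facts, without the module axioms for it.\<close>

lemma zero_quot_module_iff:
  assumes K: "\<And>x. x \<in> K \<Longrightarrow> \<zero>\<^bsub>M\<^esub> \<oplus>\<^bsub>M\<^esub> x = x" and N: "\<zero>\<^bsub>M\<^esub> \<in> N" "\<And>x y. x \<in> N \<Longrightarrow> y \<in> N \<Longrightarrow> x \<oplus>\<^bsub>M\<^esub> y \<in> N"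
    "\<And>x y. x \<in> N \<Longrightarrow> y \<in> N \<Longrightarrow> \<exists>n \<in> N. n \<oplus>\<^bsub>M\<^esub> x = y" and NK: "N \<subseteq> K"
  shows "zero_module (quot_module (M\<lparr>carrier := K\<rparr>) N) \<longleftrightarrow> K \<subseteq> N"
proof -
  let ?c = "\<lambda>x. (\<lambda>n. n \<oplus>\<^bsub>M\<^esub> x) ` N"
  have "N +>\<^bsub>M\<lparr>carrier := K\<rparr>\<^esub> x = ?c x" for x by (auto simp: a_r_coset_def r_coset_def)
  hence zm: "zero_module (quot_module (M\<lparr>carrier := K\<rparr>) N) \<longleftrightarrow> ?c ` K = {N}"
    by (simp add: zero_module_def quot_module_simps)
  have self: "?c x = N" if "x \<in> N" for x using N(2)[OF _ that] N(3)[OF that] by (auto simp: image_iff)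
  show ?thesis unfolding zm
  proof
    assume e: "?c ` K = {N}"
    show "K \<subseteq> N"
    proof
      fix x assume x: "x \<in> K"
      have "?c x = N" using imageI[OF x, of ?c] e by simp
      hence "\<zero>\<^bsub>M\<^esub> \<oplus>\<^bsub>M\<^esub> x \<in> N" using N(1) by blast
      thus "x \<in> N" using K[OF x] by simp
    qed
  next
    assume "K \<subseteq> N"
    thus "?c ` K = {N}" using self NK N(1) by auto
  qed
qed

lemma zero_quot_group_iff:
  assumes "abelian_group M" and N: "add_closed M N" and NK: "N \<subseteq> K" and K: "K \<subseteq> carrier M"
  shows "zero_module (quot_module (M\<lparr>carrier := K\<rparr>) N) \<longleftrightarrow> K \<subseteq> N"
proof (rule zero_quot_module_iff[OF _ _ _ _ NK])
  interpret M: abelian_group M by fact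
  show "\<exists>n \<in> N. n \<oplus>\<^bsub>M\<^esub> x = y" if "x \<in> N" "y \<in> N" for x y
    using that N by (intro bexI[of _ "y \<oplus>\<^bsub>M\<^esub> \<ominus>\<^bsub>M\<^esub> x"]) (auto simp: add_closed_def M.a_assoc M.l_neg subset_iff)
qed (use assms N in \<open>auto simp: add_closed_def abelian_monoid.l_zero[OF abelian_group.axioms(1)]\<close>)

section \<open>Scalars in the algebra, and the underlying \<open>k\<close>-linear functor\<close>

lemma assoc_algebra_scalar:
  assumes "assoc_algebra k A"
  shows "a \<in> carrier k \<Longrightarrow> scal A a \<in> carrier A"
    and "\<lbrakk>a \<in> carrier k; b \<in> carrier k\<rbrakk> \<Longrightarrow> scal A (a \<oplus>\<^bsub>k\<^esub> b) = scal A a \<oplus>\<^bsub>A\<^esub> scal A b"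
    and "\<lbrakk>a \<in> carrier k; b \<in> carrier k\<rbrakk> \<Longrightarrow> scal A (a \<otimes>\<^bsub>k\<^esub> b) = scal A a \<otimes>\<^bsub>A\<^esub> scal A b"
    and "scal A \<one>\<^bsub>k\<^esub> = \<one>\<^bsub>A\<^esub>"
    and "\<lbrakk>a \<in> carrier k; x \<in> carrier A\<rbrakk> \<Longrightarrow> scal A a \<otimes>\<^bsub>A\<^esub> x = x \<otimes>\<^bsub>A\<^esub> scal A a"
proof -
  interpret A: ring A using assms by (simp add: assoc_algebra_def)
  interpret M: module k A using assms by (simp add: assoc_algebra_def)
  have l: "(a \<odot>\<^bsub>A\<^esub> x) \<otimes>\<^bsub>A\<^esub> y = a \<odot>\<^bsub>A\<^esub> (x \<otimes>\<^bsub>A\<^esub> y)" "x \<otimes>\<^bsub>A\<^esub> (a \<odot>\<^bsub>A\<^esub> y) = a \<odot>\<^bsub>A\<^esub> (x \<otimes>\<^bsub>A\<^esub> y)"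
    if "a \<in> carrier k" "x \<in> carrier A" "y \<in> carrier A" for a x y using assms that by (auto simp: assoc_algebra_def)
  show "a \<in> carrier k \<Longrightarrow> scal A a \<in> carrier A" by simp
  show "\<lbrakk>a \<in> carrier k; b \<in> carrier k\<rbrakk> \<Longrightarrow> scal A (a \<oplus>\<^bsub>k\<^esub> b) = scal A a \<oplus>\<^bsub>A\<^esub> scal A b" by (rule M.smult_l_distr) auto
  show "\<lbrakk>a \<in> carrier k; b \<in> carrier k\<rbrakk> \<Longrightarrow> scal A (a \<otimes>\<^bsub>k\<^esub> b) = scal A a \<otimes>\<^bsub>A\<^esub> scal A b"
    by (simp add: l(1) M.smult_assoc1)
  show "scal A \<one>\<^bsub>k\<^esub> = \<one>\<^bsub>A\<^esub>" by simp
  show "\<lbrakk>a \<in> carrier k; x \<in> carrier A\<rbrakk> \<Longrightarrow> scal A a \<otimes>\<^bsub>A\<^esub> x = x \<otimes>\<^bsub>A\<^esub> scal A a" by (simp add: l)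
qed

lemma forget_simps [simp]:
  "El (forget A X) p = El X p" "add (fobj (forget A X) p) = add (fobj X p)"
  "zero (fobj (forget A X) p) = zero (fobj X p)" "fmor (forget A X) = fmor X"
  "smult (fobj (forget A X) p) = (\<lambda>a x. scal A a \<odot>\<^bsub>fobj X p\<^esub> x)"
  by (auto simp: forget_def)

lemma (in preadditive) forget_QMod:
  assumes A: "assoc_algebra k A" and X: "X \<in> QAMod k Q A" shows "forget A X \<in> QMod k Q"
proof (rule QModI)
  note sc = assoc_algebra_scalar[OF A]
  have lm: "left_module A (fobj X p)" if "p \<in> Ob Q" for p using X that by (simp add: QAMod_def)
  show "left_module k (fobj (forget A X) p)" if p: "p \<in> Ob Q" for p
  proof -
    interpret M: left_module A "fobj X p" by (rule lm[OF p])
    have ag: "abelian_group (fobj (forget A X) p)"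
    proof (rule abelian_groupI)
      show "\<exists>y\<in>El (forget A X) p. y \<oplus>\<^bsub>fobj (forget A X) p\<^esub> x = \<zero>\<^bsub>fobj (forget A X) p\<^esub>"
        if "x \<in> El (forget A X) p" for x
        using that M.l_neg by (auto intro!: bexI[of _ "\<ominus>\<^bsub>fobj X p\<^esub> x"])
    qed (auto simp: M.a_ac)
    show ?thesis
      by (rule left_moduleI[OF k_ring ag])
        (simp_all add: sc(1-4) M.lsmult_closed M.lsmult_l_distr M.lsmult_r_distr M.lsmult_assoc M.lsmult_one)
  qed
  show "fmor (forget A X) p q f \<in> lin_maps k (fobj (forget A X) p) (fobj (forget A X) q)"
    if "p \<in> Ob Q" "q \<in> Ob Q" "f \<in> Mor Q p q" for p q f
    using X that sc(1) by (simp add: QAMod_def lin_maps_def Pi_iff)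
  show "(\<lambda>f. fmor (forget A X) p q f x) \<in> lin_maps k (Hom Q p q) (fobj (forget A X) q)"
    if "p \<in> Ob Q" "q \<in> Ob Q" "x \<in> El (forget A X) p" for p q x
    using X that by (simp add: QAMod_def lin_maps_def Pi_iff)
qed (use X in \<open>auto simp: QAMod_def\<close>)

text \<open>Exactness in degree \<open>Suc j\<close> of the complex of natural transformations from
  the resolution to \<open>Y\<close>: cocycles are coboundaries. Both Ext and, through the dual, Tor
  are reduced to it.\<close>

definition hom_exact ::
  "'k ring \<Rightarrow> ('k, 'o, 'm) lincat \<Rightarrow> (nat \<Rightarrow> ('o, 'm, 'k, 'u) modfun) \<Rightarrow> (nat \<Rightarrow> 'o \<Rightarrow> 'u \<Rightarrow> 'u) \<Rightarrow>
    ('o, 'm, 'k, 'y) modfun \<Rightarrow> nat \<Rightarrow> bool" where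
  "hom_exact k Q P d Y j \<longleftrightarrow> (\<forall>\<eta> \<in> nat_trans k Q (P (Suc j)) Y.
     (\<forall>p \<in> Ob Q. \<forall>x \<in> El (P (Suc (Suc j))) p. \<eta> p (d (Suc j) p x) = \<zero>\<^bsub>fobj Y p\<^esub>) \<longrightarrow>
     (\<exists>\<eta>' \<in> nat_trans k Q (P j) Y. \<forall>p \<in> Ob Q. \<forall>x \<in> El (P (Suc j)) p. \<eta> p x = \<eta>' p (d j p x)))"

section \<open>Ext computed from a resolution\<close>

context preadditive
begin

lemma resolutionD:
  assumes "projective_resolution k Q U (P, d, e)"
  shows res_proj: "projective_functor k Q (P n)" and res_d: "d n \<in> NT (P (Suc n)) (P n)"
    and res_e: "e \<in> NT (P 0) U"
    and res_surj: "p \<in> Ob Q \<Longrightarrow> e p ` El (P 0) p = El U p"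
    and res_exact0: "p \<in> Ob Q \<Longrightarrow> d 0 p ` El (P (Suc 0)) p = {x \<in> El (P 0) p. e p x = \<zero>\<^bsub>fobj U p\<^esub>}"
    and res_exact: "p \<in> Ob Q \<Longrightarrow> d (Suc n) p ` El (P (Suc (Suc n))) p = {x \<in> El (P (Suc n)) p. d n p x = \<zero>\<^bsub>fobj (P n) p\<^esub>}"
  using assms by (auto simp: projective_resolution_def)

lemma res_dd:
  assumes "projective_resolution k Q U (P, d, e)" "p \<in> Ob Q" "x \<in> El (P (Suc (Suc n))) p"
  shows "d n p (d (Suc n) p x) = \<zero>\<^bsub>fobj (P n) p\<^esub>"
  using res_exact[OF assms(1,2), of n] assms(3) by blast

lemma nat_module_simps:
  "carrier (nat_module k Q A U X) = NT U (forget A X) \<inter> (\<Pi>\<^sub>E p\<in>Ob Q. extensional (El U p))"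
  "\<zero>\<^bsub>nat_module k Q A U X\<^esub> = (\<lambda>p\<in>Ob Q. \<lambda>u\<in>El U p. \<zero>\<^bsub>fobj X p\<^esub>)"
  "\<eta> \<oplus>\<^bsub>nat_module k Q A U X\<^esub> \<theta> = (\<lambda>p\<in>Ob Q. \<lambda>u\<in>El U p. \<eta> p u \<oplus>\<^bsub>fobj X p\<^esub> \<theta> p u)"
  by (simp_all add: nat_module_def)

lemma nat_restrict:
  assumes U: "U \<in> QMod k Q" and Y: "Y \<in> QMod k Q" and h: "h \<in> NT U Y"
    and eq: "\<And>p u. p \<in> Ob Q \<Longrightarrow> u \<in> El U p \<Longrightarrow> h' p u = h p u"
  shows "h' \<in> NT U Y"
proof (rule nat_transI[OF U Y])
  show "h' p \<in> add_maps (fobj U p) (fobj Y p)" if "p \<in> Ob Q" for p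
    by (rule add_maps_cong[OF QMod_ag[OF U that] nat_add_maps[OF h that] eq[OF that]])
  show "h' q (fmor U p q f x) = fmor Y p q f (h' p x)"
    if "p \<in> Ob Q" "q \<in> Ob Q" "f \<in> Mor Q p q" "x \<in> El U p" for p q f x
    using nat_natural[OF h that] eq that fmor_closed[OF U that] by simp
qed

lemma nat_trans_pointwise:
  assumes U: "U \<in> QMod k Q" and Y: "Y \<in> QMod k Q" and \<eta>: "\<eta> \<in> NT U Y" and \<theta>: "\<theta> \<in> NT U Y"
  shows "(\<lambda>p u. \<eta> p u \<oplus>\<^bsub>fobj Y p\<^esub> \<theta> p u) \<in> NT U Y" "(\<lambda>p u. \<eta> p u \<ominus>\<^bsub>fobj Y p\<^esub> \<theta> p u) \<in> NT U Y"
  by (rule nat_transI[OF U Y];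
      simp add: lin_maps_add_maps[OF lin_maps_plus[OF QMod_lm[OF Y] nat_lin[OF \<eta>] nat_lin[OF \<theta>]]]
        lin_maps_add_maps[OF lin_maps_diff[OF QMod_lm[OF Y] nat_lin[OF \<eta>] nat_lin[OF \<theta>]]] nat_natural[OF \<eta>] nat_natural[OF \<theta>]
        fmor_add[OF Y _ _ _ nat_closed[OF \<eta>] nat_closed[OF \<theta>]] fmor_minus[OF Y _ _ _ nat_closed[OF \<eta>] nat_closed[OF \<theta>]])+

text \<open>Elements of \<open>nat_module\<close> are undefined outside the carriers, whereas
  \<open>hom_exact\<close> quantifies over all natural transformations. Restriction to the carriers
  passes from one to the other.\<close>

lemma Ext_zero_iff:
  assumes Y: "forget A X \<in> QMod k Q" and R: "some_resolution k Q U = (P, d, e)" and res: "projective_resolution k Q U (P, d, e)"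
  shows "zero_module (Ext_module k Q A (Suc j) U X) \<longleftrightarrow> hom_exact k Q P d (forget A X) j"
proof -
  let ?N = "\<lambda>n. nat_module k Q A (P n) X"
  let ?\<delta> = "\<lambda>n. precomp Q (P (Suc n)) (d n)"
  note PQ = projective_functor_QMod[OF res_proj[OF res]]
  have \<delta>n: "(\<lambda>p x. \<eta> p (d n p x)) \<in> NT (P (Suc n)) (forget A X)" if "\<eta> \<in> NT (P n) (forget A X)" for \<eta> n
    by (rule nat_trans_comp[OF that res_d[OF res]])
  have \<delta>c: "?\<delta> n \<eta> \<in> carrier (?N (Suc n))" if "\<eta> \<in> carrier (?N n)" for n \<eta>
    using nat_restrict[OF PQ Y \<delta>n, of \<eta> n "?\<delta> n \<eta>"] that by (simp add: nat_module_simps precomp_def)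
  let ?K = "{\<eta> \<in> carrier (?N (Suc j)). ?\<delta> (Suc j) \<eta> = \<zero>\<^bsub>?N (Suc (Suc j))\<^esub>}"
  let ?I = "?\<delta> j ` carrier (?N j)"
  have zero: "?\<delta> (Suc j) \<eta> = \<zero>\<^bsub>?N (Suc (Suc j))\<^esub> \<longleftrightarrow>
      (\<forall>p \<in> Ob Q. \<forall>x \<in> El (P (Suc (Suc j))) p. \<eta> p (d (Suc j) p x) = \<zero>\<^bsub>fobj X p\<^esub>)" for \<eta>
    by (auto simp: nat_module_simps precomp_def fun_eq_iff)
  have IK: "?I \<subseteq> ?K"
  proof
    fix \<theta> assume "\<theta> \<in> ?I"
    then obtain \<eta> where \<eta>: "\<eta> \<in> carrier (?N j)" "\<theta> = ?\<delta> j \<eta>" by blast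
    have "\<theta> p (d (Suc j) p x) = \<zero>\<^bsub>fobj X p\<^esub>" if p: "p \<in> Ob Q" and x: "x \<in> El (P (Suc (Suc j))) p" for p x
      using nat_zero[OF PQ Y, of \<eta> j p] res_dd[OF res p x] nat_closed[OF res_d[OF res] p x] \<eta> p by (simp add: nat_module_simps precomp_def)
    thus "\<theta> \<in> ?K" using zero \<delta>c[OF \<eta>(1)] \<eta>(2) by simp
  qed
  have im: "?\<delta> j (\<lambda>p\<in>Ob Q. \<lambda>x\<in>El (P j) p. \<eta> p x) \<in> ?I" if \<eta>: "\<eta> \<in> NT (P j) (forget A X)" for \<eta>
  proof (rule imageI)
    define \<eta>r where "\<eta>r = (\<lambda>p\<in>Ob Q. \<lambda>x\<in>El (P j) p. \<eta> p x)"
    have "\<eta>r \<in> carrier (?N j)" using nat_restrict[OF PQ Y \<eta>, of \<eta>r] by (simp add: nat_module_simps \<eta>r_def)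
    thus "(\<lambda>p\<in>Ob Q. \<lambda>x\<in>El (P j) p. \<eta> p x) \<in> carrier (?N j)" by (simp only: \<eta>r_def)
  qed
  note dc = nat_closed[OF res_d[OF res]] and ag = QMod_ag[OF Y]
  have im: "(\<lambda>p\<in>Ob Q. \<lambda>x\<in>El (P (Suc j)) p. \<eta> p (d j p x)) \<in> ?I" if "\<eta> \<in> NT (P j) (forget A X)" for \<eta>
  proof -
    have "?\<delta> j (\<lambda>p\<in>Ob Q. \<lambda>x\<in>El (P j) p. \<eta> p x) = (\<lambda>p\<in>Ob Q. \<lambda>x\<in>El (P (Suc j)) p. \<eta> p (d j p x))"
      using dc by (auto simp: precomp_def fun_eq_iff)
    thus ?thesis using im[OF that] by simp
  qed
  have "zero_module (quot_module ((?N (Suc j))\<lparr>carrier := ?K\<rparr>) ?I) \<longleftrightarrow> ?K \<subseteq> ?I"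
  proof (rule zero_quot_module_iff)
    show "\<zero>\<^bsub>?N (Suc j)\<^esub> \<oplus>\<^bsub>?N (Suc j)\<^esub> \<eta> = \<eta>" if "\<eta> \<in> ?K" for \<eta>
    proof (rule PiE_ext)
      show "\<eta> \<in> (\<Pi>\<^sub>E p\<in>Ob Q. extensional (El (P (Suc j)) p))" using that by (simp add: nat_module_simps)
      fix p assume p: "p \<in> Ob Q"
      have "\<zero>\<^bsub>fobj X p\<^esub> \<oplus>\<^bsub>fobj X p\<^esub> \<eta> p u = \<eta> p u" if "u \<in> El (P (Suc j)) p" for u
        using abelian_monoid.l_zero[OF abelian_group.axioms(1)[OF ag[OF p]], of "\<eta> p u"] nat_closed[of \<eta> "P (Suc j)" "forget A X" p u] \<open>\<eta> \<in> ?K\<close> p that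
        by (simp add: nat_module_simps)
      thus "(\<zero>\<^bsub>?N (Suc j)\<^esub> \<oplus>\<^bsub>?N (Suc j)\<^esub> \<eta>) p = \<eta> p"
        by (intro extensionalityI[of _ "El (P (Suc j)) p"]) (use that p in \<open>auto simp: nat_module_simps PiE_iff\<close>)
    qed (simp add: nat_module_simps)
    have "(\<lambda>p u. \<zero>\<^bsub>fobj X p\<^esub>) \<in> NT (P j) (forget A X)"
      by (rule nat_transI[OF PQ Y]) (use fmor_zero[OF Y] add_maps_const_zero[OF ag] in auto)
    from im[OF this] show "\<zero>\<^bsub>?N (Suc j)\<^esub> \<in> ?I" by (simp only: nat_module_simps)
    fix \<alpha> \<beta> assume "\<alpha> \<in> ?I" "\<beta> \<in> ?I"
    then obtain \<eta> \<theta> where \<eta>: "\<eta> \<in> NT (P j) (forget A X)" "\<alpha> = ?\<delta> j \<eta>" and \<theta>: "\<theta> \<in> NT (P j) (forget A X)" "\<beta> = ?\<delta> j \<theta>"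
      by (auto simp: nat_module_simps)
    have "\<alpha> \<oplus>\<^bsub>?N (Suc j)\<^esub> \<beta> = (\<lambda>p\<in>Ob Q. \<lambda>x\<in>El (P (Suc j)) p. \<eta> p (d j p x) \<oplus>\<^bsub>fobj (forget A X) p\<^esub> \<theta> p (d j p x))"
      by (auto simp: \<eta>(2) \<theta>(2) nat_module_simps precomp_def fun_eq_iff)
    thus "\<alpha> \<oplus>\<^bsub>?N (Suc j)\<^esub> \<beta> \<in> ?I" using im[OF nat_trans_pointwise(1)[OF PQ Y \<eta>(1) \<theta>(1)]] by simp
    have "(\<theta> p u \<ominus>\<^bsub>fobj (forget A X) p\<^esub> \<eta> p u) \<oplus>\<^bsub>fobj X p\<^esub> \<eta> p u = \<theta> p u" if p: "p \<in> Ob Q" and u: "u \<in> El (P j) p" for p u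
    proof -
      interpret Yp: abelian_group "fobj (forget A X) p" by (rule ag[OF p])
      have "(\<theta> p u \<ominus>\<^bsub>fobj (forget A X) p\<^esub> \<eta> p u) \<oplus>\<^bsub>fobj (forget A X) p\<^esub> \<eta> p u = \<theta> p u"
        using nat_closed[OF \<eta>(1) p u] nat_closed[OF \<theta>(1) p u] by (simp only: Yp.minus_eq Yp.a_assoc Yp.l_neg Yp.r_zero Yp.a_inv_closed)
      thus ?thesis by simp
    qed
    thus "\<exists>\<gamma> \<in> ?I. \<gamma> \<oplus>\<^bsub>?N (Suc j)\<^esub> \<alpha> = \<beta>"
      using dc by (intro bexI[OF _ im[OF nat_trans_pointwise(2)[OF PQ Y \<theta>(1) \<eta>(1)]]])
        (auto simp: \<eta>(2) \<theta>(2) nat_module_simps precomp_def fun_eq_iff)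
  qed (rule IK)
  hence "zero_module (Ext_module k Q A (Suc j) U X) \<longleftrightarrow> ?K \<subseteq> ?I" by (simp add: Ext_module_def R cohomology_def)
  also have "\<dots> \<longleftrightarrow> hom_exact k Q P d (forget A X) j"
  proof
    assume KI: "?K \<subseteq> ?I"
    show "hom_exact k Q P d (forget A X) j"
      unfolding hom_exact_def
    proof (intro ballI impI)
      fix \<eta> assume \<eta>: "\<eta> \<in> NT (P (Suc j)) (forget A X)"
        and z: "\<forall>p\<in>Ob Q. \<forall>x\<in>El (P (Suc (Suc j))) p. \<eta> p (d (Suc j) p x) = \<zero>\<^bsub>fobj (forget A X) p\<^esub>"
      define \<eta>r where "\<eta>r = (\<lambda>p\<in>Ob Q. \<lambda>x\<in>El (P (Suc j)) p. \<eta> p x)"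
      have "\<eta>r \<in> ?K"
        using nat_restrict[OF PQ Y \<eta>, of \<eta>r] z zero[of \<eta>r] nat_closed[OF res_d[OF res]] by (simp add: nat_module_simps(1) \<eta>r_def)
      then obtain \<eta>' where \<eta>': "\<eta>' \<in> carrier (?N j)" "\<eta>r = ?\<delta> j \<eta>'" using KI by blast
      have "\<eta> p x = \<eta>' p (d j p x)" if "p \<in> Ob Q" "x \<in> El (P (Suc j)) p" for p x
        using fun_cong[OF fun_cong[OF \<eta>'(2), of p], of x] that by (simp add: \<eta>r_def precomp_def)
      thus "\<exists>\<eta>'\<in>NT (P j) (forget A X). \<forall>p\<in>Ob Q. \<forall>x\<in>El (P (Suc j)) p. \<eta> p x = \<eta>' p (d j p x)"
        using \<eta>'(1) by (auto simp: nat_module_simps)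
    qed
  next
    assume ex: "hom_exact k Q P d (forget A X) j"
    show "?K \<subseteq> ?I"
    proof
      fix \<eta> assume \<eta>: "\<eta> \<in> ?K"
      hence "\<eta> \<in> NT (P (Suc j)) (forget A X)" by (simp add: nat_module_simps)
      then obtain \<eta>' where \<eta>': "\<eta>' \<in> NT (P j) (forget A X)"
        "\<And>p x. p \<in> Ob Q \<Longrightarrow> x \<in> El (P (Suc j)) p \<Longrightarrow> \<eta> p x = \<eta>' p (d j p x)"
        using ex \<eta> zero unfolding hom_exact_def by auto
      define \<eta>r where "\<eta>r = (\<lambda>p\<in>Ob Q. \<lambda>x\<in>El (P j) p. \<eta>' p x)"
      have "\<eta>r \<in> carrier (?N j)" using nat_restrict[OF PQ Y \<eta>'(1), of \<eta>r] by (simp add: nat_module_simps \<eta>r_def)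
      moreover have "\<eta> = ?\<delta> j \<eta>r"
      proof (rule PiE_ext)
        show "\<eta> \<in> (\<Pi>\<^sub>E p\<in>Ob Q. extensional (El (P (Suc j)) p))" using \<eta> by (simp add: nat_module_simps)
        show "?\<delta> j \<eta>r \<in> (\<Pi>\<^sub>E p\<in>Ob Q. extensional (El (P (Suc j)) p))" by (simp add: precomp_def)
        fix p assume p: "p \<in> Ob Q"
        show "\<eta> p = ?\<delta> j \<eta>r p"
          by (rule extensionalityI[of _ "El (P (Suc j)) p"])
            (use \<eta> p \<eta>'(2)[OF p] nat_closed[OF res_d[OF res] p] in \<open>auto simp: nat_module_simps PiE_iff precomp_def \<eta>r_def\<close>)
      qed
      ultimately show "\<eta> \<in> ?I" by blast
    qed
  qed
  finally show ?thesis .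
qed

end

section \<open>The stalk functors\<close>

context shape
begin

lemma stalk_simps:
  "fobj (stalk Q r q) p = quot_module (Hom Q q p) (rad q p)"
  by (simp add: stalk_def)

text \<open>\<open>stalk\<close> takes the union over all representatives of a coset; since
  composing with \<open>f\<close> maps \<open>r\<close> into \<open>r\<close>, they all give the
  same coset.\<close>

lemma stalk_fmor:
  assumes q: "q \<in> Ob Q" and p: "p \<in> Ob Q" and s: "s \<in> Ob Q" and f: "f \<in> Mor Q p s" and g: "g \<in> Mor Q q p"
  shows "fmor (stalk Q r q) p s f (rad q p +>\<^bsub>Hom Q q p\<^esub> g) = rad q s +>\<^bsub>Hom Q q s\<^esub> Comp Q q p s f g"
proof -
  interpret H: left_module k "Hom Q q p" by (rule hom_lm[OF q p])
  interpret U: abelian_subgroup "rad q p" "Hom Q q p" by (rule submodule_abelian_subgroup[OF hom_lm[OF q p] rad_submodule[OF q p]])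
  have "rad q s +>\<^bsub>Hom Q q s\<^esub> Comp Q q p s f h = rad q s +>\<^bsub>Hom Q q s\<^esub> Comp Q q p s f g" if h: "h \<in> rad q p +>\<^bsub>Hom Q q p\<^esub> g" for h
  proof -
    have hc: "h \<in> Mor Q q p" using U.a_elemrcos_carrier[OF g h] .
    have "h \<ominus>\<^bsub>Hom Q q p\<^esub> g \<in> rad q p" using U.a_rcos_module[OF g hc] h by (simp add: a_minus_def)
    hence "Comp Q q p s f (h \<ominus>\<^bsub>Hom Q q p\<^esub> g) \<in> rad q s" by (rule rad_comp_left[OF q p s _ f])
    thus ?thesis
      using lin_maps_minus[OF hom_ag[OF q p] hom_ag[OF q s] comp_linear_right[OF q p s f] hc g]
        quot_module_eq[OF hom_lm[OF q s] rad_submodule[OF q s] comp_closed[OF q p s hc f] comp_closed[OF q p s g f]] by simp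
  qed
  moreover have "g \<in> rad q p +>\<^bsub>Hom Q q p\<^esub> g" using U.a_rcos_self[OF g] .
  ultimately have "(\<Union>h\<in>rad q p +>\<^bsub>Hom Q q p\<^esub> g. rad q s +>\<^bsub>Hom Q q s\<^esub> Comp Q q p s f h) = rad q s +>\<^bsub>Hom Q q s\<^esub> Comp Q q p s f g"
    by (intro UN_constant_eq ballI)
  thus ?thesis by (simp add: stalk_def)
qed

lemma stalk_QMod: assumes q: "q \<in> Ob Q" shows "stalk Q r q \<in> QMod k Q"
proof (rule QModI)
  note H = hom_lm[OF q] and R = rad_submodule[OF q]
  note qa = quot_module_add[OF H R] and qs = quot_module_smult[OF H R] and fm = stalk_fmor[OF q]
  have cl: "Comp Q q p s f g \<in> Mor Q q s" if "p \<in> Ob Q" "s \<in> Ob Q" "f \<in> Mor Q p s" "g \<in> Mor Q q p" for p s f g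
    by (rule comp_closed[OF q that(1,2,4,3)])
  show "left_module k (fobj (stalk Q r q) p)" if "p \<in> Ob Q" for p
    unfolding stalk_simps by (rule quot_left_module[OF H[OF that] R[OF that]])
  show "fmor (stalk Q r q) p p (Ide Q p) x = x" if "p \<in> Ob Q" "x \<in> El (stalk Q r q) p" for p x
    using that fm[OF that(1,1) ide_closed[OF that(1)]] comp_ide[OF q that(1)] by (auto simp: stalk_simps quot_module_simps(1))
  show "fmor (stalk Q r q) p s f \<in> lin_maps k (fobj (stalk Q r q) p) (fobj (stalk Q r q) s)"
    if p: "p \<in> Ob Q" and s: "s \<in> Ob Q" and f: "f \<in> Mor Q p s" for p s f
    using fm[OF p s f] qa[OF p p] qs[OF p p] qa[OF s s] qs[OF s s] cl[OF p s f]
      ag_add_closed[OF hom_ag[OF q p]] left_module.lsmult_closed[OF H[OF p]]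
    by (auto simp: lin_maps_def stalk_simps quot_module_simps(1) fmor_add[OF hom_fun_QMod[OF q] p s f, simplified]
        fmor_smult[OF hom_fun_QMod[OF q] p s f, simplified])
  show "fmor (stalk Q r q) p u (Comp Q p s u g f) x = fmor (stalk Q r q) s u g (fmor (stalk Q r q) p s f x)"
    if "p \<in> Ob Q" "s \<in> Ob Q" "u \<in> Ob Q" "f \<in> Mor Q p s" "g \<in> Mor Q s u" "x \<in> El (stalk Q r q) p" for p s u f g x
    using that fm comp_closed[OF that(1-5)] cl comp_assoc[OF q that(1-3) _ that(4,5)] by (auto simp: stalk_simps quot_module_simps(1))
  show "(\<lambda>f. fmor (stalk Q r q) p s f x) \<in> lin_maps k (Hom Q p s) (fobj (stalk Q r q) s)"
    if p: "p \<in> Ob Q" and s: "s \<in> Ob Q" and x: "x \<in> El (stalk Q r q) p" for p s x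
  proof -
    obtain g where g: "g \<in> Mor Q q p" "x = rad q p +>\<^bsub>Hom Q q p\<^esub> g" using x by (auto simp: stalk_simps quot_module_simps(1))
    show ?thesis
      using fm[OF p s _ g(1)] qa[OF s s] qs[OF s s] cl[OF p s _ g(1)] g
        ag_add_closed[OF hom_ag[OF p s]] left_module.lsmult_closed[OF hom_lm[OF p s]]
      by (auto simp: lin_maps_def stalk_simps quot_module_simps(1) lin_maps_add[OF comp_linear_left[OF q p s g(1)]]
          lin_maps_smult[OF comp_linear_left[OF q p s g(1)]])
  qed
qed

lemma stalk_proj:
  assumes q: "q \<in> Ob Q"
  shows "(\<lambda>p g. rad q p +>\<^bsub>Hom Q q p\<^esub> g) \<in> NT (hom_fun Q q) (stalk Q r q)"
  by (rule nat_transI[OF hom_fun_QMod[OF q] stalk_QMod[OF q]])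
    (use lin_maps_add_maps[OF quot_proj_lin_maps[OF hom_lm[OF q] rad_submodule[OF q]]] stalk_fmor[OF q] in
      \<open>auto simp: stalk_simps\<close>)

lemma stalk_zero_iff:
  assumes q: "q \<in> Ob Q" and p: "p \<in> Ob Q" and g: "g \<in> Mor Q q p"
  shows "rad q p +>\<^bsub>Hom Q q p\<^esub> g = \<zero>\<^bsub>fobj (stalk Q r q) p\<^esub> \<longleftrightarrow> g \<in> rad q p"
proof -
  interpret H: left_module k "Hom Q q p" by (rule hom_lm[OF q p])
  have "rad q p = rad q p +>\<^bsub>Hom Q q p\<^esub> \<zero>\<^bsub>Hom Q q p\<^esub>"
    using H.a_coset_add_zero submoduleD(1)[OF hom_lm[OF q p] rad_submodule[OF q p]] by simp
  hence "rad q p +>\<^bsub>Hom Q q p\<^esub> g = \<zero>\<^bsub>fobj (stalk Q r q) p\<^esub> \<longleftrightarrow> g \<ominus>\<^bsub>Hom Q q p\<^esub> \<zero>\<^bsub>Hom Q q p\<^esub> \<in> rad q p"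
    using quot_module_eq[OF hom_lm[OF q p] rad_submodule[OF q p] g H.zero_closed] by (simp add: stalk_simps quot_module_simps(2))
  thus ?thesis using g by (simp add: H.minus_eq a_inv_zero_ag[OF H.abelian_group_axioms])
qed

text \<open>Lift the augmentation of the resolution to \<open>\<beta>\<close> with values in
  \<open>Q(q, -)\<close>. On boundaries \<open>\<beta>\<close> lands in \<open>r(q, -)\<close>, so
  the family composed with \<open>\<beta>\<close> and \<open>d 0\<close> is a cocycle. If it is the
  coboundary of \<open>\<psi>\<close>, then the value of \<open>\<psi>\<close> at a lift of the
  identity represents the family, up to a correction.\<close>

lemma hom_exact_radical_injective:
  fixes Y :: "('o, 'm, 'k, 'y) modfun"
  assumes Y: "Y \<in> QMod k Q"
    and ex: "\<And>q. q \<in> Ob Q \<Longrightarrow> \<exists>(P :: nat \<Rightarrow> ('o, 'm, 'k, ('o, 'm, 'm set) words) modfun) d e. projective_resolution k Q (stalk Q r q) (P, d, e) \<and> hom_exact k Q P d Y 0"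
  shows "radical_injective Q r Y"
  unfolding radical_injective_def
proof (intro ballI allI impI)
  fix q \<phi> assume q: "q \<in> Ob Q" and \<phi>: "radical_family Q r Y q \<phi>"
  note cl = rf_closed[OF \<phi>] and add = rf_add[OF \<phi>] and nat = rf_nat[OF \<phi>]
  obtain P :: "nat \<Rightarrow> ('o, 'm, 'k, ('o, 'm, 'm set) words) modfun" and d e where
    res: "projective_resolution k Q (stalk Q r q) (P, d, e)" and ex0: "hom_exact k Q P d Y 0" using ex[OF q] by blast
  note PQ = projective_functor_QMod[OF res_proj[OF res]]
  let ?\<pi> = "\<lambda>p g. rad q p +>\<^bsub>Hom Q q p\<^esub> g"
  note \<pi> = stalk_proj[OF q] and H = hom_fun_QMod[OF q]
  have "\<exists>\<beta> \<in> NT (P 0) (hom_fun Q q). \<forall>p \<in> Ob Q. \<forall>x \<in> El (P 0) p. ?\<pi> p (\<beta> p x) = e p x"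
    by (rule retract_of_free_lift[OF projective_functor_retract[OF res_proj[OF res]] H stalk_QMod[OF q] \<pi> res_e[OF res]])
      (auto simp: stalk_simps quot_module_simps(1))
  then obtain \<beta> where \<beta>: "\<beta> \<in> NT (P 0) (hom_fun Q q)" "\<And>p x. p \<in> Ob Q \<Longrightarrow> x \<in> El (P 0) p \<Longrightarrow> ?\<pi> p (\<beta> p x) = e p x" by blast
  have \<beta>c: "\<beta> p x \<in> Mor Q q p" if "p \<in> Ob Q" "x \<in> El (P 0) p" for p x
    using nat_closed[OF \<beta>(1) that] by simp
  have \<beta>rad: "\<beta> p x \<in> rad q p" if "p \<in> Ob Q" "x \<in> El (P 0) p" "e p x = \<zero>\<^bsub>fobj (stalk Q r q) p\<^esub>" for p x
    using \<beta>(2)[OF that(1,2)] that(3) stalk_zero_iff[OF q that(1) \<beta>c[OF that(1,2)]] by simp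
  have dz: "d 0 p z \<in> El (P 0) p" "e p (d 0 p z) = \<zero>\<^bsub>fobj (stalk Q r q) p\<^esub>" if "p \<in> Ob Q" "z \<in> El (P (Suc 0)) p" for p z
    using res_exact0[OF res that(1)] that(2) by blast+
  define \<eta> where "\<eta> p z = \<phi> p (\<beta> p (d 0 p z))" for p z
  have \<eta>: "\<eta> \<in> NT (P (Suc 0)) Y"
  proof (rule nat_transI[OF PQ Y])
    show "\<eta> p \<in> add_maps (fobj (P (Suc 0)) p) (fobj Y p)" if p: "p \<in> Ob Q" for p
    proof (rule add_mapsI)
      show "\<eta> p x \<in> El Y p" if "x \<in> El (P (Suc 0)) p" for x
        using cl p \<beta>rad[OF p dz[OF p that]] by (simp add: \<eta>_def)
      show "\<eta> p (x \<oplus>\<^bsub>fobj (P (Suc 0)) p\<^esub> y) = \<eta> p x \<oplus>\<^bsub>fobj Y p\<^esub> \<eta> p y"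
        if x: "x \<in> El (P (Suc 0)) p" and y: "y \<in> El (P (Suc 0)) p" for x y
        using nat_add[OF res_d[OF res] p x y] nat_add[OF \<beta>(1) p dz(1)[OF p x] dz(1)[OF p y]] add p
          \<beta>rad[OF p dz[OF p x]] \<beta>rad[OF p dz[OF p y]] by (simp add: \<eta>_def)
    qed
    show "\<eta> s (fmor (P (Suc 0)) p s f x) = fmor Y p s f (\<eta> p x)"
      if p: "p \<in> Ob Q" and s: "s \<in> Ob Q" and f: "f \<in> Mor Q p s" and x: "x \<in> El (P (Suc 0)) p" for p s f x
      using nat_natural[OF res_d[OF res] p s f x] nat_natural[OF \<beta>(1) p s f dz(1)[OF p x]] nat p s f \<beta>rad[OF p dz[OF p x]]
      by (simp add: \<eta>_def)
  qed
  have "\<eta> p (d (Suc 0) p x) = \<zero>\<^bsub>fobj Y p\<^esub>" if p: "p \<in> Ob Q" and x: "x \<in> El (P (Suc (Suc 0))) p" for p x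
  proof -
    have z: "\<zero>\<^bsub>fobj (P 0) p\<^esub> = d 0 p \<zero>\<^bsub>fobj (P (Suc 0)) p\<^esub>" using nat_zero[OF PQ PQ res_d[OF res] p] by simp
    show ?thesis using res_dd[OF res p x] nat_zero[OF PQ Y \<eta> p] z by (simp add: \<eta>_def)
  qed
  then obtain \<psi> where \<psi>: "\<psi> \<in> NT (P 0) Y" "\<And>p z. p \<in> Ob Q \<Longrightarrow> z \<in> El (P (Suc 0)) p \<Longrightarrow> \<eta> p z = \<psi> p (d 0 p z)"
    using ex0 \<eta> unfolding hom_exact_def by blast
  note i = ide_closed[OF q]
  have "?\<pi> q (Ide Q q) \<in> El (stalk Q r q) q" using i by (auto simp: stalk_simps quot_module_simps(1))
  hence "?\<pi> q (Ide Q q) \<in> e q ` El (P 0) q" using res_surj[OF res q] by simp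
  then obtain y where y: "y \<in> El (P 0) q" "e q y = ?\<pi> q (Ide Q q)" by (rule imageE) simp
  interpret Hq: left_module k "Hom Q q q" by (rule hom_lm[OF q q])
  \<comment> \<open>\<open>\<beta> q y\<close> equals the identity only modulo \<open>r\<close>. The
    error \<open>\<rho>\<close> contributes \<open>f\<close> applied to
    \<open>\<phi> q \<rho>\<close>, which explains the subtraction in \<open>?x\<close>.\<close>
  define \<rho> where "\<rho> = \<beta> q y \<ominus>\<^bsub>Hom Q q q\<^esub> Ide Q q"
  have \<rho>: "\<rho> \<in> rad q q"
    using quot_module_eq[OF hom_lm[OF q q] rad_submodule[OF q q] \<beta>c[OF q y(1)] i] \<beta>(2)[OF q y(1)] y(2) by (simp add: \<rho>_def)
  have \<rho>c: "\<rho> \<in> Mor Q q q" by (rule rad_closed[OF q q \<rho>])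
  have \<beta>y: "\<beta> q y = Ide Q q \<oplus>\<^bsub>Hom Q q q\<^esub> \<rho>"
    using \<beta>c[OF q y(1)] i by (simp add: \<rho>_def Hq.minus_eq Hq.a_comm[of "\<beta> q y"] Hq.r_neg1 Hq.r_neg2)
  let ?x = "\<psi> q y \<ominus>\<^bsub>fobj Y q\<^esub> \<phi> q \<rho>"
  have \<psi>y: "\<psi> q y \<in> El Y q" and \<phi>\<rho>: "\<phi> q \<rho> \<in> El Y q" using nat_closed[OF \<psi>(1) q y(1)] cl q \<rho> by auto
  have "\<phi> p f = fmor Y q p f ?x" if p: "p \<in> Ob Q" and f: "f \<in> rad q p" for p f
  proof -
    note fc = rad_closed[OF q p f]
    interpret Yp: abelian_group "fobj Y p" by (rule QMod_ag[OF Y p])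
    let ?w = "fmor (P 0) q p f y"
    have w: "?w \<in> El (P 0) p" by (rule fmor_closed[OF PQ q p fc y(1)])
    \<comment> \<open>A radical \<open>f\<close> moves \<open>y\<close> to an element that dies in
      the stalk; it is therefore a boundary, where \<open>\<psi>\<close> is known.\<close>
    have "e p ?w = ?\<pi> p f" using nat_natural[OF res_e[OF res] q p fc y(1)] y(2) stalk_fmor[OF q q p fc i] comp_ide[OF q p fc] by simp
    hence "?w \<in> d 0 p ` El (P (Suc 0)) p" using res_exact0[OF res p] w stalk_zero_iff[OF q p fc] f by simp
    then obtain z where z: "z \<in> El (P (Suc 0)) p" "?w = d 0 p z" by blast
    have "fmor Y q p f (\<psi> q y) = \<phi> p (\<beta> p ?w)"
      using nat_natural[OF \<psi>(1) q p fc y(1)] z \<psi>(2)[OF p z(1)] by (simp add: \<eta>_def)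
    also have "\<beta> p ?w = Comp Q q q p f (Ide Q q) \<oplus>\<^bsub>Hom Q q p\<^esub> Comp Q q q p f \<rho>"
      using nat_natural[OF \<beta>(1) q p fc y(1)] \<beta>y lin_maps_add[OF comp_linear_right[OF q q p fc] i \<rho>c] by simp
    also have "\<phi> p \<dots> = \<phi> p f \<oplus>\<^bsub>fobj Y p\<^esub> fmor Y q p f (\<phi> q \<rho>)"
      using comp_ide[OF q p fc] add nat p q f fc \<rho> rad_comp_left[OF q q p \<rho> fc] by simp
    finally have "fmor Y q p f (\<psi> q y) = \<phi> p f \<oplus>\<^bsub>fobj Y p\<^esub> fmor Y q p f (\<phi> q \<rho>)" .
    thus ?thesis
      using fmor_minus[OF Y q p fc \<psi>y \<phi>\<rho>] fmor_closed[OF Y q p fc \<phi>\<rho>] cl p f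
      by (simp add: Yp.minus_eq Yp.a_assoc Yp.r_neg)
  qed
  thus "\<exists>x\<in>El Y q. \<forall>p\<in>Ob Q. \<forall>f\<in>rad q p. \<phi> p f = fmor Y q p f x"
    using abelian_group.minus_closed[OF QMod_ag[OF Y q] \<psi>y \<phi>\<rho>] by blast
qed

end

context frob
begin

lemma rel_proj_functional:
  assumes V: "module k V" and \<zeta>: "\<zeta> \<in> forms k V"
  shows "rel_proj k V {v \<in> carrier V. \<zeta> v = \<zero>\<^bsub>k\<^esub>}"
proof -
  have "(\<lambda>v. \<lambda>i\<in>{()}. \<zeta> v) \<in> lin_maps k V (dsum_module {()} (\<lambda>_. self_module k))"
    by (rule dsum_tuple_lin_maps) (use \<zeta> in auto)
  from rel_proj_of_embedding[OF V this, of "{v \<in> carrier V. \<zeta> v = \<zero>\<^bsub>k\<^esub>}"]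
  show ?thesis by (simp add: fun_eq_iff)
qed

text \<open>A cocycle vanishes on the kernel of \<open>d j\<close>, so it extends along
  \<open>d j\<close> once the cokernel of \<open>d j\<close> is pointwise projective. For
  \<open>j = Suc m\<close> this cokernel embeds into \<open>P m\<close>; for \<open>j = 0\<close> it
  is the stalk, which is zero away from \<open>q\<close> and embeds into \<open>k\<close> by
  \<open>coef\<close> at \<open>q\<close>.\<close>

lemma radical_injective_hom_exact:
  fixes Y :: "('o, 'm, 'k, 'y) modfun" and P :: "nat \<Rightarrow> ('o, 'm, 'k, ('o, 'm, 'm set) words) modfun"
  assumes Y: "Y \<in> QMod k Q" and inj: "radical_injective Q r Y" and q: "q \<in> Ob Q"
    and res: "projective_resolution k Q (stalk Q r q) (P, d, e)"
  shows "hom_exact k Q P d Y j"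
  unfolding hom_exact_def
proof (intro ballI impI)
  fix \<eta> assume \<eta>: "\<eta> \<in> NT (P (Suc j)) Y"
    and z: "\<forall>p\<in>Ob Q. \<forall>x\<in>El (P (Suc (Suc j))) p. \<eta> p (d (Suc j) p x) = \<zero>\<^bsub>fobj Y p\<^esub>"
  note PQ = projective_functor_QMod[OF res_proj[OF res]]
  note dn = res_d[OF res]
  let ?U = "\<lambda>p. d j p ` El (P (Suc j)) p"
  have rp: "rel_proj k (fobj (P j) p) (?U p)" if p: "p \<in> Ob Q" for p
  proof (cases j)
    case (Suc m)
    obtain J :: "(('o \<times> ('o, 'm, 'm set) words) \<times> 'm) set" and \<theta> where \<theta>: "\<theta> \<in> lin_maps k (fobj (P m) p) (free_module k J)"
      "\<And>c. c \<in> El (P m) p \<Longrightarrow> \<theta> c = (\<lambda>i\<in>J. \<zero>\<^bsub>k\<^esub>) \<longleftrightarrow> c = \<zero>\<^bsub>fobj (P m) p\<^esub>"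
      using projective_embedding[OF res_proj[OF res] p] by blast
    show ?thesis unfolding Suc
      by (rule rel_proj_of_embedding[OF QMod_module[OF PQ p] lin_maps_comp[OF \<theta>(1) nat_lin[OF dn p]]])
        (use \<theta>(2) nat_closed[OF dn p] in \<open>auto simp: res_exact[OF res p]\<close>)
  next
    case 0
    have U0: "?U p = {x \<in> El (P 0) p. e p x = \<zero>\<^bsub>fobj (stalk Q r q) p\<^esub>}"
      using res_exact0[OF res p] by (simp add: 0)
    note St = QMod_lm[OF stalk_QMod[OF q] p]
    have "\<exists>\<zeta> \<in> forms k (fobj (stalk Q r q) p). \<forall>c \<in> El (stalk Q r q) p. \<zeta> c = \<zero>\<^bsub>k\<^esub> \<longleftrightarrow> c = \<zero>\<^bsub>fobj (stalk Q r q) p\<^esub>"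
    proof (cases "p = q")
      case False
      have c0: "c = \<zero>\<^bsub>fobj (stalk Q r q) p\<^esub>" if c: "c \<in> El (stalk Q r q) p" for c
      proof -
        obtain g where g: "g \<in> Mor Q q p" "c = rad q p +>\<^bsub>Hom Q q p\<^esub> g"
          using c unfolding stalk_simps quot_module_simps(1) by blast
        thus ?thesis using stalk_zero_iff[OF q p g(1)] False by (simp add: pseudo_radical_def)
      qed
      have "(\<lambda>_. \<zero>\<^bsub>k\<^esub>) \<in> forms k (fobj (stalk Q r q) p)"
        using add_maps_const_zero[OF k_ag] left_module_smult_zero[OF k_lm]
        by (simp add: lin_maps_iff)
      thus ?thesis by (rule bexI[rotated]) (use c0 in simp)
    next
      case True
      note H = hom_lm[OF q q] and R = rad_submodule[OF q q]
      have "\<exists>\<zeta> \<in> add_maps (quot_module (Hom Q q q) (rad q q)) (self_module k). \<forall>g \<in> Mor Q q q. \<zeta> (rad q q +>\<^bsub>Hom Q q q\<^esub> g) = coef q g"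
        by (rule quot_module_lift[OF H R k_ag lin_maps_add_maps[OF coef_lin_maps[OF q]]])
          (use coef_rad[OF q] in \<open>simp add: rad_self\<close>)
      then obtain \<zeta> where \<zeta>: "\<zeta> \<in> add_maps (fobj (stalk Q r q) q) (self_module k)"
        "\<And>g. g \<in> Mor Q q q \<Longrightarrow> \<zeta> (rad q q +>\<^bsub>Hom Q q q\<^esub> g) = coef q g" by (auto simp: stalk_simps)
      have "\<zeta> \<in> forms k (fobj (stalk Q r q) q)"
        using \<zeta> quot_module_smult[OF H R] left_module.lsmult_closed[OF H] lin_maps_smult[OF coef_lin_maps[OF q]]
        by (auto simp: lin_maps_iff stalk_simps quot_module_simps(1))
      moreover have "\<zeta> c = \<zero>\<^bsub>k\<^esub> \<longleftrightarrow> c = \<zero>\<^bsub>fobj (stalk Q r q) q\<^esub>" if c: "c \<in> El (stalk Q r q) q" for c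
      proof -
        obtain g where g: "g \<in> Mor Q q q" "c = rad q q +>\<^bsub>Hom Q q q\<^esub> g"
          using c unfolding stalk_simps quot_module_simps(1) by blast
        thus ?thesis
          using stalk_zero_iff[OF q q g(1)] \<zeta>(2)[OF g(1)] coef_rad[OF q] coef_zero_rad[OF q g(1)] by (auto simp: rad_self)
      qed
      ultimately show ?thesis using True by blast
    qed
    then obtain \<zeta> where \<zeta>: "\<zeta> \<in> forms k (fobj (stalk Q r q) p)"
      "\<And>c. c \<in> El (stalk Q r q) p \<Longrightarrow> \<zeta> c = \<zero>\<^bsub>k\<^esub> \<longleftrightarrow> c = \<zero>\<^bsub>fobj (stalk Q r q) p\<^esub>" by blast
    have "{v \<in> El (P 0) p. \<zeta> (e p v) = \<zero>\<^bsub>k\<^esub>} = ?U p"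
      using \<zeta>(2) nat_closed[OF res_e[OF res] p] by (auto simp: U0)
    thus ?thesis using rel_proj_functional[OF QMod_module[OF PQ p] lin_maps_comp[OF \<zeta>(1) nat_lin[OF res_e[OF res] p]]] 0 by simp
  qed
  have "\<eta> p x = \<zero>\<^bsub>fobj Y p\<^esub>" if p: "p \<in> Ob Q" and x: "x \<in> El (P (Suc j)) p" and "d j p x = \<zero>\<^bsub>fobj (P j) p\<^esub>" for p x
  proof -
    have "x \<in> d (Suc j) p ` El (P (Suc (Suc j))) p" using res_exact[OF res p, of j] that by simp
    thus ?thesis by (rule imageE) (use z p in simp)
  qed
  from radical_injective_extend_along[OF Y inj PQ PQ dn \<eta> rp this]
  show "\<exists>\<eta>'\<in>NT (P j) Y. \<forall>p\<in>Ob Q. \<forall>x\<in>El (P (Suc j)) p. \<eta> p x = \<eta>' p (d j p x)" by metis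
qed

end

section \<open>Tensor products and Tor\<close>

text \<open>The map \<open>h\<close> is only additive (it may be a character), so killing the
  generators does not suffice: it must kill all their scalar multiples, which is why the condition
  quantifies over \<open>a\<close>.\<close>

lemma gen_quot_lift:
  assumes M: "left_module R M" and G: "abelian_group G" and h: "h \<in> add_maps M G"
    and S: "\<And>s. s \<in> S \<Longrightarrow> \<exists>x \<in> carrier M. \<exists>y \<in> carrier M. s = x \<ominus>\<^bsub>M\<^esub> y \<and>
      (\<forall>a \<in> carrier R. h (a \<odot>\<^bsub>M\<^esub> x) = h (a \<odot>\<^bsub>M\<^esub> y))"
  shows "\<exists>h' \<in> add_maps (quot_module M (submod_gen R M S)) G. \<forall>x \<in> carrier M. h' (submod_gen R M S +>\<^bsub>M\<^esub> x) = h x"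
proof -
  interpret M: left_module R M by fact
  interpret G: abelian_group G by fact
  have ha: "(\<lambda>x. h (a \<odot>\<^bsub>M\<^esub> x)) \<in> add_maps M G" if "a \<in> carrier R" for a
    by (rule add_maps_comp[OF h left_module_smult_add_maps[OF M that]])
  let ?H = "{c \<in> carrier M. \<forall>a \<in> carrier R. h (a \<odot>\<^bsub>M\<^esub> c) = \<zero>\<^bsub>G\<^esub>}"
  have SH: "S \<subseteq> ?H"
  proof
    fix s assume "s \<in> S"
    then obtain x y where xy: "x \<in> carrier M" "y \<in> carrier M" "s = x \<ominus>\<^bsub>M\<^esub> y"
      "\<And>a. a \<in> carrier R \<Longrightarrow> h (a \<odot>\<^bsub>M\<^esub> x) = h (a \<odot>\<^bsub>M\<^esub> y)" using S by blast
    have "h (a \<odot>\<^bsub>M\<^esub> s) = \<zero>\<^bsub>G\<^esub>" if a: "a \<in> carrier R" for a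
      using add_maps_minus[OF M.abelian_group_axioms G ha[OF a] xy(1,2)] xy(3) xy(4)[OF a] add_maps_closed[OF ha[OF a] xy(2)]
      by (simp add: G.minus_eq G.r_neg)
    thus "s \<in> ?H" using xy by simp
  qed
  have H: "submodule ?H R M"
  proof (rule left_submoduleI[OF M])
    show "\<zero>\<^bsub>M\<^esub> \<in> ?H" using add_maps_zero[OF M.abelian_group_axioms G ha] by simp
    show "x \<oplus>\<^bsub>M\<^esub> y \<in> ?H" if "x \<in> ?H" "y \<in> ?H" for x y using that add_maps_add[OF ha] by simp
    show "a \<odot>\<^bsub>M\<^esub> x \<in> ?H" if a: "a \<in> carrier R" and x: "x \<in> ?H" for a x
      using x a M.lsmult_assoc[of _ a x, symmetric] by (simp add: M.lsmult_closed)
  qed simp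
  note N = submod_gen_submodule[OF M, of S]
  have Sc: "S \<subseteq> carrier M" using SH by blast
  have "h u = \<zero>\<^bsub>G\<^esub>" if "u \<in> submod_gen R M S" for u
  proof -
    have "u \<in> ?H" using N(3)[OF Sc H SH] that by blast
    hence "h (\<one>\<^bsub>R\<^esub> \<odot>\<^bsub>M\<^esub> u) = \<zero>\<^bsub>G\<^esub>" and "u \<in> carrier M" by auto
    thus ?thesis by (simp add: M.lsmult_one)
  qed
  thus ?thesis by (rule quot_module_lift[OF M N(1)[OF Sc] G h])
qed

section \<open>Tensor products over the base ring\<close>

context
  fixes k :: "'k ring" and A :: "('k, 'a) module" and W :: "('k, 'w) module" and Y :: "('a, 'y) module"
  assumes A: "assoc_algebra k A" and W: "left_module k W" and Y: "left_module A Y"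
begin

abbreviation "TF \<equiv> tensor_free A W Y"
abbreviation "TM \<equiv> tensor_module k A W Y"
abbreviation "pt \<equiv> pure_tensor k A W Y"

lemma tensor_free_left_module: "left_module A TF"
  unfolding tensor_free_def using A by (intro dsum_left_module ballI left_module_self) (simp_all add: assoc_algebra_def)

lemma tensor_symbol:
  assumes w: "w \<in> carrier W" and y: "y \<in> carrier Y"
  shows tensor_symbol_closed: "tensor_symbol A W Y w y \<in> carrier TF"
    and tensor_symbol_smult: "a \<in> carrier A \<Longrightarrow> a \<odot>\<^bsub>TF\<^esub> tensor_symbol A W Y w y =
      dsum_inj (carrier W \<times> carrier Y) (\<lambda>_. self_module A) (w, y) a"
proof -
  interpret A: ring A using A by (simp add: assoc_algebra_def)
  have L: "dsum_inj (carrier W \<times> carrier Y) (\<lambda>_. self_module A) (w, y) \<in> lin_maps A (self_module A) TF"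
    unfolding tensor_free_def by (rule dsum_inj_lin_maps) (use w y left_module_self[OF A.ring_axioms] in auto)
  show "tensor_symbol A W Y w y \<in> carrier TF"
    unfolding tensor_symbol_def by (rule lin_maps_closed[OF L]) simp
  show "a \<odot>\<^bsub>TF\<^esub> tensor_symbol A W Y w y = dsum_inj (carrier W \<times> carrier Y) (\<lambda>_. self_module A) (w, y) a" if "a \<in> carrier A"
    using lin_maps_smult[OF L that, of "\<one>\<^bsub>A\<^esub>"] that by (simp add: tensor_symbol_def)
qed

lemma tensor_relations_closed: "tensor_relations k A W Y \<subseteq> carrier TF"
proof -
  interpret F: left_module A "TF" by (rule tensor_free_left_module)
  interpret W: left_module k W by (rule W)
  interpret Y: left_module A Y by (rule Y)
  note sc = assoc_algebra_scalar(1)[OF A]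
  show ?thesis unfolding tensor_relations_def Let_def
    by (intro Un_least subsetI; elim CollectE exE conjE; hypsubst;
        intro F.minus_closed F.a_closed F.lsmult_closed tensor_symbol_closed W.a_closed Y.a_closed W.lsmult_closed Y.lsmult_closed sc; assumption)
qed

lemmas tensor_gen = submod_gen_submodule[OF tensor_free_left_module tensor_relations_closed]

lemma tensor_module_left_module: "left_module A TM"
  unfolding tensor_module_def by (rule quot_left_module[OF tensor_free_left_module tensor_gen(1)])

lemma pure_tensor_closed: "w \<in> carrier W \<Longrightarrow> y \<in> carrier Y \<Longrightarrow> pt w y \<in> carrier TM"
  using tensor_symbol_closed by (auto simp: tensor_module_def quot_module_simps pure_tensor_def)

lemma pure_tensor:
  shows pure_tensor_add_left: "\<lbrakk>w \<in> carrier W; w' \<in> carrier W; y \<in> carrier Y\<rbrakk> \<Longrightarrow> pt (w \<oplus>\<^bsub>W\<^esub> w') y =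
      pt w y \<oplus>\<^bsub>TM\<^esub> pt w' y"
    and pure_tensor_add_right: "\<lbrakk>w \<in> carrier W; y \<in> carrier Y; y' \<in> carrier Y\<rbrakk> \<Longrightarrow> pt w (y \<oplus>\<^bsub>Y\<^esub> y') =
      pt w y \<oplus>\<^bsub>TM\<^esub> pt w y'"
    and pure_tensor_smult: "\<lbrakk>a \<in> carrier A; w \<in> carrier W; y \<in> carrier Y\<rbrakk> \<Longrightarrow> a \<odot>\<^bsub>TM\<^esub> pt w y =
      pt w (a \<odot>\<^bsub>Y\<^esub> y)"
proof -
  note F = tensor_free_left_module and N = tensor_gen(1)
  interpret F: left_module A "TF" by (rule F)
  interpret W: left_module k W by (rule W)
  interpret Y: left_module A Y by (rule Y)
  note tc = tensor_symbol_closed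
  have eq: "submod_gen A TF (tensor_relations k A W Y) +>\<^bsub>TF\<^esub> x =
      submod_gen A TF (tensor_relations k A W Y) +>\<^bsub>TF\<^esub> y"
    if "x \<ominus>\<^bsub>TF\<^esub> y \<in> tensor_relations k A W Y" "x \<in> carrier TF" "y \<in> carrier TF" for x y
    using quot_module_eq[OF F N that(2,3)] tensor_gen(2) that(1) by blast
  note add = quot_module_add[OF F N, symmetric] and sm = quot_module_smult[OF F N]
  show "\<lbrakk>w \<in> carrier W; w' \<in> carrier W; y \<in> carrier Y\<rbrakk> \<Longrightarrow> pt (w \<oplus>\<^bsub>W\<^esub> w') y =
      pt w y \<oplus>\<^bsub>TM\<^esub> pt w' y"
    unfolding pure_tensor_def tensor_module_def quot_module_add[OF F N tc tc]
    by (rule eq) (auto simp: tensor_relations_def Let_def tc)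
  show "\<lbrakk>w \<in> carrier W; y \<in> carrier Y; y' \<in> carrier Y\<rbrakk> \<Longrightarrow> pt w (y \<oplus>\<^bsub>Y\<^esub> y') =
      pt w y \<oplus>\<^bsub>TM\<^esub> pt w y'"
    unfolding pure_tensor_def tensor_module_def quot_module_add[OF F N tc tc]
    by (rule eq) (auto simp: tensor_relations_def Let_def tc)
  show "\<lbrakk>a \<in> carrier A; w \<in> carrier W; y \<in> carrier Y\<rbrakk> \<Longrightarrow> a \<odot>\<^bsub>TM\<^esub> pt w y =
      pt w (a \<odot>\<^bsub>Y\<^esub> y)"
    unfolding pure_tensor_def tensor_module_def quot_module_smult[OF F N _ tc]
    by (rule eq[symmetric]) (auto simp: tensor_relations_def Let_def tc F.lsmult_closed Y.lsmult_closed)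
qed

lemma tensor_module_ext:
  assumes N: "abelian_group N" and g: "g \<in> add_maps TM N" and h: "h \<in> add_maps TM N"
    and eq: "\<And>w y. w \<in> carrier W \<Longrightarrow> y \<in> carrier Y \<Longrightarrow> g (pt w y) = h (pt w y)"
    and c: "c \<in> carrier TM"
  shows "g c = h c"
proof -
  let ?F = "TF" and ?N = "submod_gen A TF (tensor_relations k A W Y)"
  interpret A: ring A using A by (simp add: assoc_algebra_def)
  have pr: "(\<lambda>x. ?N +>\<^bsub>?F\<^esub> x) \<in> lin_maps A ?F TM"
    unfolding tensor_module_def by (rule quot_proj_lin_maps[OF tensor_free_left_module tensor_gen(1)])
  obtain x where x: "x \<in> carrier ?F" "c = ?N +>\<^bsub>?F\<^esub> x" using c by (auto simp: tensor_module_def quot_module_simps)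
  have sy: "?N +>\<^bsub>?F\<^esub> dsum_inj (carrier W \<times> carrier Y) (\<lambda>_. self_module A) (w, y) a = pt w (a \<odot>\<^bsub>Y\<^esub> y)"
    if "a \<in> carrier A" "w \<in> carrier W" "y \<in> carrier Y" for a w y
    using tensor_symbol_smult[OF that(2,3,1)] lin_maps_smult[OF pr that(1) tensor_symbol_closed[OF that(2,3)]] pure_tensor_smult[OF that]
    by (simp add: pure_tensor_def)
  have "(\<lambda>x. g (?N +>\<^bsub>?F\<^esub> x)) x = (\<lambda>x. h (?N +>\<^bsub>?F\<^esub> x)) x"
  proof (rule dsum_ext[of "carrier W \<times> carrier Y" "\<lambda>_. self_module A", OF _ N])
    show "\<forall>i\<in>carrier W \<times> carrier Y. abelian_group (self_module A)"
      using lm_ag[OF left_module_self[OF A.ring_axioms]] by simp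
    show "(\<lambda>x. g (?N +>\<^bsub>?F\<^esub> x)) \<in> add_maps (dsum_module (carrier W \<times> carrier Y) (\<lambda>_. self_module A)) N"
      "(\<lambda>x. h (?N +>\<^bsub>?F\<^esub> x)) \<in> add_maps (dsum_module (carrier W \<times> carrier Y) (\<lambda>_. self_module A)) N"
      using add_maps_comp[OF g lin_maps_add_maps[OF pr]] add_maps_comp[OF h lin_maps_add_maps[OF pr]] by (simp_all add: tensor_free_def)
    show "x \<in> carrier (dsum_module (carrier W \<times> carrier Y) (\<lambda>_. self_module A))" using x(1) by (simp add: tensor_free_def)
    show "g (?N +>\<^bsub>?F\<^esub> dsum_inj (carrier W \<times> carrier Y) (\<lambda>_. self_module A) i a) = h (?N +>\<^bsub>?F\<^esub> dsum_inj (carrier W \<times> carrier Y) (\<lambda>_. self_module A) i a)"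
      if "i \<in> carrier W \<times> carrier Y" "a \<in> carrier (self_module A)" for i a
      using that sy[of a "fst i" "snd i"] eq left_module.lsmult_closed[OF Y] by (auto simp del: dsum_inj_apply)
  qed
  thus ?thesis using x(2) by simp
qed

text \<open>The target is just an abelian group, so that characters of the tensor product can be
  constructed. The scalars of \<open>A\<close> are kept on the side of \<open>Y\<close>: the symbol
  of \<open>w\<close> and \<open>y\<close> with coefficient \<open>a\<close> goes to
  \<open>\<beta> w (a y)\<close>.\<close>

lemma tensor_module_lift:
  assumes G: "abelian_group G"
    and add1: "\<And>y. y \<in> carrier Y \<Longrightarrow> (\<lambda>w. \<beta> w y) \<in> add_maps W G"
    and add2: "\<And>w. w \<in> carrier W \<Longrightarrow> \<beta> w \<in> add_maps Y G"
    and bal: "\<And>a w y. \<lbrakk>a \<in> carrier k; w \<in> carrier W; y \<in> carrier Y\<rbrakk> \<Longrightarrow> \<beta> (a \<odot>\<^bsub>W\<^esub> w) y = \<beta> w (scal A a \<odot>\<^bsub>Y\<^esub> y)"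
  shows "\<exists>\<Phi> \<in> add_maps TM G. \<forall>w \<in> carrier W. \<forall>y \<in> carrier Y. \<Phi> (pt w y) = \<beta> w y"
proof -
  let ?F = "TF" and ?t = "tensor_symbol A W Y"
  interpret A: ring A using A by (simp add: assoc_algebra_def)
  interpret F: left_module A "TF" by (rule tensor_free_left_module)
  interpret W: left_module k W by (rule W)
  interpret Y: left_module A Y by (rule Y)
  note sc = assoc_algebra_scalar[OF A]
  define \<psi> where "\<psi> = dsum_lift G (carrier W \<times> carrier Y) (\<lambda>_. self_module A) (\<lambda>i a. \<beta> (fst i) (a \<odot>\<^bsub>Y\<^esub> snd i))"
  have fam: "\<forall>i\<in>carrier W \<times> carrier Y. abelian_group (self_module A)"
    using lm_ag[OF left_module_self[OF A.ring_axioms]] by simp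
  have comp: "\<forall>i\<in>carrier W \<times> carrier Y. (\<lambda>a. \<beta> (fst i) (a \<odot>\<^bsub>Y\<^esub> snd i)) \<in> add_maps (self_module A) G"
    using add_maps_comp[OF add2 lin_maps_add_maps[OF left_module_smult_point[OF Y]]] by auto
  have \<psi>: "\<psi> \<in> add_maps ?F G" unfolding \<psi>_def tensor_free_def by (rule dsum_lift_add_maps[OF fam G comp])
  have \<psi>t: "\<psi> (a \<odot>\<^bsub>?F\<^esub> ?t w y) = \<beta> w (a \<odot>\<^bsub>Y\<^esub> y)" if "a \<in> carrier A" "w \<in> carrier W" "y \<in> carrier Y" for a w y
    using dsum_lift_inj[OF fam G comp, of "(w, y)" a] that tensor_symbol_smult[OF that(2,3,1)] by (simp add: \<psi>_def)
  have \<psi>a: "\<psi> (a \<odot>\<^bsub>?F\<^esub> (x \<oplus>\<^bsub>?F\<^esub> y)) = \<psi> (a \<odot>\<^bsub>?F\<^esub> x) \<oplus>\<^bsub>G\<^esub> \<psi> (a \<odot>\<^bsub>?F\<^esub> y)"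
    if "a \<in> carrier A" "x \<in> carrier ?F" "y \<in> carrier ?F" for a x y
    using that add_maps_add[OF \<psi>] by (simp add: F.lsmult_r_distr F.lsmult_closed)
  note tc = tensor_symbol_closed
  have "\<exists>h' \<in> add_maps TM G. \<forall>x \<in> carrier ?F. h' (submod_gen A ?F (tensor_relations k A W Y) +>\<^bsub>?F\<^esub> x) = \<psi> x"
    unfolding tensor_module_def
  proof (rule gen_quot_lift[OF tensor_free_left_module G \<psi>])
    fix s assume "s \<in> tensor_relations k A W Y"
    then consider
      w w' y where "s = ?t (w \<oplus>\<^bsub>W\<^esub> w') y \<ominus>\<^bsub>?F\<^esub> (?t w y \<oplus>\<^bsub>?F\<^esub> ?t w' y)" "w \<in> carrier W" "w' \<in> carrier W" "y \<in> carrier Y"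
      | w y y' where "s = ?t w (y \<oplus>\<^bsub>Y\<^esub> y') \<ominus>\<^bsub>?F\<^esub> (?t w y \<oplus>\<^bsub>?F\<^esub> ?t w y')" "w \<in> carrier W" "y \<in> carrier Y" "y' \<in> carrier Y"
      | b w y where "s = ?t (b \<odot>\<^bsub>W\<^esub> w) y \<ominus>\<^bsub>?F\<^esub> ?t w (scal A b \<odot>\<^bsub>Y\<^esub> y)" "b \<in> carrier k" "w \<in> carrier W" "y \<in> carrier Y"
      | b w y where "s = ?t w (b \<odot>\<^bsub>Y\<^esub> y) \<ominus>\<^bsub>?F\<^esub> (b \<odot>\<^bsub>?F\<^esub> ?t w y)" "b \<in> carrier A" "w \<in> carrier W" "y \<in> carrier Y"
      unfolding tensor_relations_def Let_def by blast
    thus "\<exists>x \<in> carrier ?F. \<exists>y \<in> carrier ?F. s = x \<ominus>\<^bsub>?F\<^esub> y \<and> (\<forall>a \<in> carrier A. \<psi> (a \<odot>\<^bsub>?F\<^esub> x) = \<psi> (a \<odot>\<^bsub>?F\<^esub> y))"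
    proof cases
      case 1
      show ?thesis
        by (rule bexI, rule bexI, rule conjI, rule 1)
          (use 1 in \<open>simp_all add: \<psi>a \<psi>t tc Y.lsmult_closed add_maps_add[OF add1]\<close>)
    next
      case 2
      show ?thesis
        by (rule bexI, rule bexI, rule conjI, rule 2)
          (use 2 in \<open>simp_all add: \<psi>a \<psi>t tc Y.lsmult_closed Y.lsmult_r_distr add_maps_add[OF add2]\<close>)
    next
      case 3
      \<comment> \<open>Scalars of \<open>k\<close> are central in \<open>A\<close>, so
        \<open>b\<close> may be moved past \<open>a\<close>.\<close>
      have "\<beta> (b \<odot>\<^bsub>W\<^esub> w) (a \<odot>\<^bsub>Y\<^esub> y) = \<beta> w (a \<odot>\<^bsub>Y\<^esub> (scal A b \<odot>\<^bsub>Y\<^esub> y))" if a: "a \<in> carrier A" for a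
        using bal[OF 3(2,3) Y.lsmult_closed[OF a 3(4)]] Y.lsmult_assoc[OF a sc(1)[OF 3(2)] 3(4)]
          Y.lsmult_assoc[OF sc(1)[OF 3(2)] a 3(4)] sc(5)[OF 3(2) a] by simp
      thus ?thesis
        by (intro bexI conjI) (rule 3(1), use 3 in \<open>simp_all add: \<psi>t tc sc(1) Y.lsmult_closed W.lsmult_closed\<close>)
    next
      case 4
      have "\<psi> (a \<odot>\<^bsub>?F\<^esub> (b \<odot>\<^bsub>?F\<^esub> ?t w y)) = \<beta> w (a \<odot>\<^bsub>Y\<^esub> (b \<odot>\<^bsub>Y\<^esub> y))" if a: "a \<in> carrier A" for a
        using \<psi>t[OF A.m_closed[OF a 4(2)] 4(3,4)] Y.lsmult_assoc[OF a 4(2,4)] F.lsmult_assoc[OF a 4(2) tc[OF 4(3,4)]] by simp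
      thus ?thesis
        by (intro bexI conjI) (rule 4(1), use 4 in \<open>simp_all add: \<psi>t tc Y.lsmult_closed F.lsmult_closed\<close>)
    qed
  qed
  then obtain \<Phi> where \<Phi>: "\<Phi> \<in> add_maps TM G"
    "\<And>x. x \<in> carrier ?F \<Longrightarrow> \<Phi> (submod_gen A ?F (tensor_relations k A W Y) +>\<^bsub>?F\<^esub> x) = \<psi> x" by blast
  have "\<Phi> (pt w y) = \<beta> w y" if "w \<in> carrier W" "y \<in> carrier Y" for w y
    using \<Phi>(2)[OF tc[OF that]] \<psi>t[OF A.one_closed that] that(2)
    by (simp add: pure_tensor_def F.lsmult_one[OF tc[OF that]] Y.lsmult_one)
  thus ?thesis using \<Phi>(1) by blast
qed

end

section \<open>Tensor products over the category, and their characters\<close>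

context preadditive
begin

context
  fixes A :: "('k, 'a) module" and W :: "('o, 'm, 'k, 'w) modfun" and X :: "('o, 'm, 'a, 'x) modfun"
  assumes A: "assoc_algebra k A" and W: "W \<in> QMod k (op_cat Q)" and X: "X \<in> QAMod k Q A"
begin

abbreviation "TM' q \<equiv> tensor_module k A (fobj W q) (fobj X q)"
abbreviation "TQ \<equiv> tensor_functor k Q A W X"
abbreviation "te \<equiv> tensor_element k Q A W X"

lemma coend_modules:
  assumes "q \<in> Ob Q" shows coend_left: "left_module k (fobj W q)" and coend_right: "left_module A (fobj X q)"
  using preadditive.QMod_lm[OF op_preadditive W] X assms by (simp_all add: QAMod_def)

lemmas coend_tensor = tensor_module_left_module[OF A coend_left coend_right]

lemma coend_family: "\<forall>q\<in>Ob Q. left_module A (TM' q)"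
  using coend_tensor by blast

lemma coend_sum_left_module: "left_module A (coend_sum k Q A W X)"
  unfolding coend_sum_def using A by (intro dsum_left_module[OF _ coend_family]) (simp add: assoc_algebra_def)

lemma coend_inj_lin_maps:
  "q \<in> Ob Q \<Longrightarrow> dsum_inj (Ob Q) TM' q \<in>
    lin_maps A (TM' q) (coend_sum k Q A W X)"
  unfolding coend_sum_def by (rule dsum_inj_lin_maps[OF coend_family])

lemma coend_symbol_closed:
  "\<lbrakk>q \<in> Ob Q; w \<in> El W q; x \<in> El X q\<rbrakk> \<Longrightarrow> coend_symbol k Q A W X q w x \<in> carrier (coend_sum k Q A W X)"
  unfolding coend_symbol_def
  by (rule lin_maps_closed[OF coend_inj_lin_maps pure_tensor_closed[OF A coend_left coend_right]])

lemma coend_fmor: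
  assumes "p \<in> Ob Q" "q \<in> Ob Q" "f \<in> Mor Q p q"
  shows coend_fmor_left: "w \<in> El W q \<Longrightarrow> fmor W q p f w \<in> El W p"
    and coend_fmor_right: "x \<in> El X p \<Longrightarrow> fmor X p q f x \<in> El X q"
    and coend_fmor_smult: "x \<in> El X p \<Longrightarrow> a \<in> carrier A \<Longrightarrow>
      fmor X p q f (a \<odot>\<^bsub>fobj X p\<^esub> x) = a \<odot>\<^bsub>fobj X q\<^esub> fmor X p q f x"
  using preadditive.fmor_closed[OF op_preadditive W, of q p f] X assms by (simp_all add: QAMod_def lin_maps_def Pi_iff)

lemma coend_relations_closed: "coend_relations k Q A W X \<subseteq> carrier (coend_sum k Q A W X)"
  using abelian_group.minus_closed[OF lm_ag[OF coend_sum_left_module]] coend_symbol_closed coend_fmor(1,2)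
  by (auto simp: coend_relations_def)

lemmas coend_gen = submod_gen_submodule[OF coend_sum_left_module coend_relations_closed]

lemma tensor_functor_left_module: "left_module A TQ"
  unfolding tensor_functor_def by (rule quot_left_module[OF coend_sum_left_module coend_gen(1)])

definition coend_map :: "'o \<Rightarrow> ('w \<times> 'x \<Rightarrow> 'a) set \<Rightarrow> ('o \<Rightarrow> ('w \<times> 'x \<Rightarrow> 'a) set) set" where
  "coend_map q z = submod_gen A (coend_sum k Q A W X) (coend_relations k Q A W X) +>\<^bsub>coend_sum k Q A W X\<^esub>
    dsum_inj (Ob Q) TM' q z"

lemma coend_proj_lin_maps:
  "(\<lambda>c. submod_gen A (coend_sum k Q A W X) (coend_relations k Q A W X) +>\<^bsub>coend_sum k Q A W X\<^esub> c)
    \<in> lin_maps A (coend_sum k Q A W X) TQ"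
  unfolding tensor_functor_def by (rule quot_proj_lin_maps[OF coend_sum_left_module coend_gen(1)])

lemma coend_map_lin_maps:
  "q \<in> Ob Q \<Longrightarrow> coend_map q \<in> lin_maps A (TM' q) TQ"
  using lin_maps_comp[OF coend_proj_lin_maps coend_inj_lin_maps] by (simp add: coend_map_def[abs_def] cong del: dsum_inj_apply)

lemma tensor_element_eq: "te q w x = coend_map q (pure_tensor k A (fobj W q) (fobj X q) w x)"
  by (simp add: tensor_element_def coend_symbol_def coend_map_def)

lemma tensor_element:
  assumes q: "q \<in> Ob Q"
  shows tensor_element_closed: "\<lbrakk>w \<in> El W q; x \<in> El X q\<rbrakk> \<Longrightarrow>
      te q w x \<in> carrier TQ"
    and tensor_element_add_left: "x \<in> El X q \<Longrightarrow>
      (\<lambda>w. te q w x) \<in> add_maps (fobj W q) TQ"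
    and tensor_element_add_right: "w \<in> El W q \<Longrightarrow>
      te q w \<in> add_maps (fobj X q) TQ"
    and tensor_element_smult: "\<lbrakk>a \<in> carrier A; w \<in> El W q; x \<in> El X q\<rbrakk> \<Longrightarrow>
      a \<odot>\<^bsub>TQ\<^esub> te q w x = te q w (a \<odot>\<^bsub>fobj X q\<^esub> x)"
proof -
  note T = A coend_left[OF q] coend_right[OF q] and L = coend_map_lin_maps[OF q]
  note pc = pure_tensor_closed[OF T]
  show "\<lbrakk>w \<in> El W q; x \<in> El X q\<rbrakk> \<Longrightarrow> te q w x \<in> carrier TQ"
    unfolding tensor_element_eq by (rule lin_maps_closed[OF L pc])
  show "(\<lambda>w. te q w x) \<in> add_maps (fobj W q) TQ" if "x \<in> El X q"
    unfolding tensor_element_eq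
    by (rule add_maps_comp[OF lin_maps_add_maps[OF L] add_mapsI]) (use that pc pure_tensor_add_left[OF T] in auto)
  show "te q w \<in> add_maps (fobj X q) TQ" if "w \<in> El W q"
    using add_maps_comp[OF lin_maps_add_maps[OF L] add_mapsI, of "fobj X q" "pure_tensor k A (fobj W q) (fobj X q) w"]
      that pc pure_tensor_add_right[OF T] by (simp add: tensor_element_eq[abs_def])
  show "a \<odot>\<^bsub>TQ\<^esub> te q w x = te q w (a \<odot>\<^bsub>fobj X q\<^esub> x)"
    if "a \<in> carrier A" "w \<in> El W q" "x \<in> El X q"
    using lin_maps_smult[OF L that(1) pc[OF that(2,3)]] pure_tensor_smult[OF T that] by (simp add: tensor_element_eq)
qed

lemma tensor_element_balanced:
  assumes p: "p \<in> Ob Q" and q: "q \<in> Ob Q" and f: "f \<in> Mor Q p q" and w: "w \<in> El W q" and x: "x \<in> El X p"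
  shows "te p (fmor W q p f w) x = te q w (fmor X p q f x)"
proof -
  have "coend_symbol k Q A W X p (fmor W q p f w) x \<ominus>\<^bsub>coend_sum k Q A W X\<^esub> coend_symbol k Q A W X q w (fmor X p q f x) \<in> coend_relations k Q A W X"
    unfolding coend_relations_def using assms by blast
  thus ?thesis unfolding tensor_element_def
    using quot_module_eq[OF coend_sum_left_module coend_gen(1) coend_symbol_closed[OF p coend_fmor_left[OF p q f w] x]
      coend_symbol_closed[OF q w coend_fmor_right[OF p q f x]]] coend_gen(2) by blast
qed

lemma tensor_functor_ext:
  assumes N: "abelian_group N" and g: "g \<in> add_maps TQ N" and h: "h \<in> add_maps TQ N"
    and eq: "\<And>q w x. q \<in> Ob Q \<Longrightarrow> w \<in> El W q \<Longrightarrow> x \<in> El X q \<Longrightarrow>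
      g (te q w x) = h (te q w x)"
    and c: "c \<in> carrier TQ"
  shows "g c = h c"
proof -
  let ?C = "coend_sum k Q A W X"
  let ?\<pi> = "\<lambda>c. submod_gen A ?C (coend_relations k Q A W X) +>\<^bsub>?C\<^esub> c"
  obtain x where x: "x \<in> carrier ?C" "c = ?\<pi> x" using c by (auto simp: tensor_functor_def quot_module_simps)
  note \<pi> = lin_maps_add_maps[OF coend_proj_lin_maps, unfolded coend_sum_def]
  have "(\<lambda>x. g (?\<pi> x)) x = (\<lambda>x. h (?\<pi> x)) x"
  proof (rule dsum_ext[OF family_abelian_group[OF coend_family] N])
    show "(\<lambda>x. g (?\<pi> x)) \<in> add_maps (dsum_module (Ob Q) TM') N"
      "(\<lambda>x. h (?\<pi> x)) \<in> add_maps (dsum_module (Ob Q) TM') N"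
      using add_maps_comp[OF g \<pi>] add_maps_comp[OF h \<pi>] by (simp_all add: coend_sum_def)
    show "x \<in> carrier (dsum_module (Ob Q) TM')" using x(1) by (simp add: coend_sum_def)
    fix q z assume q: "q \<in> Ob Q" and z: "z \<in> carrier (TM' q)"
    note L = lin_maps_add_maps[OF coend_map_lin_maps[OF q]]
    have "g (coend_map q z) = h (coend_map q z)"
      by (rule tensor_module_ext[OF A coend_left[OF q] coend_right[OF q] N add_maps_comp[OF g L] add_maps_comp[OF h L] _ z])
        (use eq[OF q] in \<open>simp add: tensor_element_eq\<close>)
    thus "g (?\<pi> (dsum_inj (Ob Q) TM' q z)) =
        h (?\<pi> (dsum_inj (Ob Q) TM' q z))" by (simp only: coend_map_def)
  qed
  thus ?thesis using x(2) by simp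
qed

lemma tensor_functor_lift:
  assumes G: "abelian_group G"
    and add1: "\<And>q x. q \<in> Ob Q \<Longrightarrow> x \<in> El X q \<Longrightarrow> (\<lambda>w. \<beta> q w x) \<in> add_maps (fobj W q) G"
    and add2: "\<And>q w. q \<in> Ob Q \<Longrightarrow> w \<in> El W q \<Longrightarrow> \<beta> q w \<in> add_maps (fobj X q) G"
    and nat: "\<And>p q f w x. \<lbrakk>p \<in> Ob Q; q \<in> Ob Q; f \<in> Mor Q p q; w \<in> El W q; x \<in> El X p\<rbrakk> \<Longrightarrow>
      \<beta> p (fmor W q p f w) x = \<beta> q w (fmor X p q f x)"
  shows "\<exists>\<Phi> \<in> add_maps TQ G. \<forall>q \<in> Ob Q. \<forall>w \<in> El W q. \<forall>x \<in> El X q.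
    \<Phi> (te q w x) = \<beta> q w x"
proof -
  let ?C = "coend_sum k Q A W X" and ?T = "\<lambda>q. TM' q"
  let ?s = "coend_symbol k Q A W X"
  interpret C: left_module A ?C by (rule coend_sum_left_module)
  have "\<exists>\<Phi>. \<Phi> \<in> add_maps (?T q) G \<and> (\<forall>w \<in> El W q. \<forall>x \<in> El X q.
      \<Phi> (pure_tensor k A (fobj W q) (fobj X q) w x) = \<beta> q w x)" if q: "q \<in> Ob Q" for q
  proof -
    \<comment> \<open>Balancing over \<open>k\<close> is the naturality condition for
      \<open>a\<close> times the identity of \<open>q\<close>.\<close>
    have "\<beta> q (a \<odot>\<^bsub>fobj W q\<^esub> w) x = \<beta> q w (scal A a \<odot>\<^bsub>fobj X q\<^esub> x)"
      if "a \<in> carrier k" "w \<in> El W q" "x \<in> El X q" for a w x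
      using nat[OF q q left_module.lsmult_closed[OF hom_lm[OF q q] that(1) ide_closed[OF q]] that(2,3)]
        preadditive.fmor_scalar[OF op_preadditive W, of q a w] fmor_scalar[OF forget_QMod[OF A X] q that(1), of x] q that by simp
    from tensor_module_lift[OF A coend_left[OF q] coend_right[OF q] G add1[OF q] add2[OF q] this] show ?thesis by blast
  qed
  then obtain \<Phi> where \<Phi>: "\<And>q. q \<in> Ob Q \<Longrightarrow> \<Phi> q \<in> add_maps (?T q) G"
    "\<And>q w x. q \<in> Ob Q \<Longrightarrow> w \<in> El W q \<Longrightarrow> x \<in> El X q \<Longrightarrow> \<Phi> q (pure_tensor k A (fobj W q) (fobj X q) w x) = \<beta> q w x"
    by metis
  define \<psi> where "\<psi> = dsum_lift G (Ob Q) ?T \<Phi>"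
  have comp: "\<forall>q\<in>Ob Q. \<Phi> q \<in> add_maps (?T q) G" using \<Phi>(1) by blast
  note fam = family_abelian_group[OF coend_family]
  have \<psi>: "\<psi> \<in> add_maps ?C G" unfolding \<psi>_def coend_sum_def by (rule dsum_lift_add_maps[OF fam G comp])
  have \<psi>s: "\<psi> (?s q w x) = \<beta> q w x" if "q \<in> Ob Q" "w \<in> El W q" "x \<in> El X q" for q w x
    using dsum_lift_inj[OF fam G comp that(1) pure_tensor_closed[OF A coend_left[OF that(1)] coend_right[OF that(1)] that(2,3)]] \<Phi>(2)[OF that]
    by (simp add: \<psi>_def coend_symbol_def)
  have sa: "a \<odot>\<^bsub>?C\<^esub> ?s q w x = ?s q w (a \<odot>\<^bsub>fobj X q\<^esub> x)"
    if "a \<in> carrier A" "q \<in> Ob Q" "w \<in> El W q" "x \<in> El X q" for a q w x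
    using lin_maps_smult[OF coend_inj_lin_maps[OF that(2)] that(1) pure_tensor_closed[OF A coend_left[OF that(2)] coend_right[OF that(2)] that(3,4)]]
      pure_tensor_smult[OF A coend_left[OF that(2)] coend_right[OF that(2)] that(1,3,4)] by (simp add: coend_symbol_def)
  note ax = left_module.lsmult_closed[OF coend_right]
  have "\<exists>h' \<in> add_maps TQ G. \<forall>x \<in> carrier ?C. h' (submod_gen A ?C (coend_relations k Q A W X) +>\<^bsub>?C\<^esub> x) = \<psi> x"
    unfolding tensor_functor_def
  proof (rule gen_quot_lift[OF coend_sum_left_module G \<psi>])
    fix s assume "s \<in> coend_relations k Q A W X"
    then obtain p q f w x where s: "s = ?s p (fmor W q p f w) x \<ominus>\<^bsub>?C\<^esub> ?s q w (fmor X p q f x)"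
      and p: "p \<in> Ob Q" and q: "q \<in> Ob Q" and f: "f \<in> Mor Q p q" and w: "w \<in> El W q" and x: "x \<in> El X p"
      unfolding coend_relations_def by blast
    note fw = coend_fmor_left[OF p q f w] and fx = coend_fmor_right[OF p q f x]
    have "\<psi> (a \<odot>\<^bsub>?C\<^esub> ?s p (fmor W q p f w) x) = \<psi> (a \<odot>\<^bsub>?C\<^esub> ?s q w (fmor X p q f x))" if a: "a \<in> carrier A" for a
      using nat[OF p q f w ax[OF p a x]] coend_fmor_smult[OF p q f x a] \<psi>s[OF p fw ax[OF p a x]] \<psi>s[OF q w ax[OF q a fx]]
      by (simp add: sa[OF a p fw x] sa[OF a q w fx])
    thus "\<exists>x \<in> carrier ?C. \<exists>y \<in> carrier ?C. s = x \<ominus>\<^bsub>?C\<^esub> y \<and> (\<forall>a \<in> carrier A. \<psi> (a \<odot>\<^bsub>?C\<^esub> x) = \<psi> (a \<odot>\<^bsub>?C\<^esub> y))"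
      using s coend_symbol_closed[OF p fw x] coend_symbol_closed[OF q w fx] by blast
  qed
  then obtain h' where h': "h' \<in> add_maps TQ G"
    "\<And>x. x \<in> carrier ?C \<Longrightarrow> h' (submod_gen A ?C (coend_relations k Q A W X) +>\<^bsub>?C\<^esub> x) = \<psi> x" by blast
  have "h' (te q w x) = \<beta> q w x" if "q \<in> Ob Q" "w \<in> El W q" "x \<in> El X q" for q w x
    using h'(2)[OF coend_symbol_closed[OF that]] \<psi>s[OF that] by (simp add: tensor_element_def)
  thus ?thesis using h'(1) by blast
qed

lemma tensor_char_nat:
  assumes \<chi>: "\<chi> \<in> chars TQ"
  shows "(\<lambda>q w. \<lambda>x\<in>El X q. \<chi> (te q w x)) \<in> nat_trans k (op_cat Q) W (char_fun (forget A X))"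
proof (rule preadditive.nat_transI[OF op_preadditive W char_fun_QMod[OF forget_QMod[OF A X]]])
  note am = QMod_ag[OF forget_QMod[OF A X]]
  note ta = tensor_element_add_left tensor_element_add_right
  show "(\<lambda>w. \<lambda>x\<in>El X q. \<chi> (te q w x)) \<in> add_maps (fobj W q) (fobj (char_fun (forget A X)) q)"
    if "q \<in> Ob (op_cat Q)" for q
  proof (rule add_mapsI)
    have q: "q \<in> Ob Q" using that by simp
    show "(\<lambda>x\<in>El X q. \<chi> (te q w x)) \<in> El (char_fun (forget A X)) q"
      if w: "w \<in> El W q" for w
      using ag_add_closed[OF am[OF q]] add_maps_comp[OF \<chi> ta(2)[OF q w]]
      by (simp add: char_fun_simps add_maps_def)
    show "(\<lambda>x\<in>El X q. \<chi> (te q (w \<oplus>\<^bsub>fobj W q\<^esub> w') x)) =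
        (\<lambda>x\<in>El X q. \<chi> (te q w x)) \<oplus>\<^bsub>fobj (char_fun (forget A X)) q\<^esub>
        (\<lambda>x\<in>El X q. \<chi> (te q w' x))"
      if w: "w \<in> El W q" "w' \<in> El W q" for w w'
      using add_maps_add[OF add_maps_comp[OF \<chi> ta(1)[OF q]] w] by (auto simp: char_fun_simps intro!: restrict_ext)
  qed
  show "(\<lambda>x\<in>El X q. \<chi> (te q (fmor W p q f w) x)) =
      fmor (char_fun (forget A X)) p q f (\<lambda>x\<in>El X p. \<chi> (te p w x))"
    if "p \<in> Ob (op_cat Q)" "q \<in> Ob (op_cat Q)" "f \<in> Mor (op_cat Q) p q" "w \<in> El W p" for p q f w
    using that tensor_element_balanced[of q p f w] coend_fmor_right[of q p f] by (auto simp: char_fun_simps intro!: restrict_ext)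
qed

text \<open>With \<open>tensor_char_nat\<close> this is the adjunction between tensoring with
  \<open>X\<close> and dualising, for the group Q/Z.\<close>

lemma tensor_char_exists:
  assumes \<eta>: "\<eta> \<in> nat_trans k (op_cat Q) W (char_fun (forget A X))"
  shows "\<exists>\<chi> \<in> chars TQ. \<forall>q \<in> Ob Q. \<forall>w \<in> El W q. \<forall>x \<in> El X q.
    \<chi> (te q w x) = \<eta> q w x"
proof (rule tensor_functor_lift[OF qz_group_abelian])
  note c = preadditive.nat_closed[OF op_preadditive \<eta>, simplified]
  show "(\<lambda>w. \<eta> q w x) \<in> add_maps (fobj W q) qz_group" if "q \<in> Ob Q" "x \<in> El X q" for q x
    using preadditive.nat_add[OF op_preadditive \<eta>] that by (auto simp: add_maps_def char_fun_simps)
  show "\<eta> q w \<in> add_maps (fobj X q) qz_group" if "q \<in> Ob Q" "w \<in> El W q" for q w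
    using c[OF that] by (auto simp: char_fun_simps add_maps_def)
  show "\<eta> p (fmor W q p f w) x = \<eta> q w (fmor X p q f x)"
    if "p \<in> Ob Q" "q \<in> Ob Q" "f \<in> Mor Q p q" "w \<in> El W q" "x \<in> El X p" for p q f w x
    using preadditive.nat_natural[OF op_preadditive \<eta>, of q p f w] that by (simp add: char_fun_simps)
qed

end

text \<open>Discharges the definite description in \<open>tensor_map\<close>: existence from the
  universal property, linearity and uniqueness because the tensor elements generate.\<close>

lemma tensor_map:
  assumes A: "assoc_algebra k A" and W: "W \<in> QMod k (op_cat Q)" and V: "V \<in> QMod k (op_cat Q)" and X: "X \<in> QAMod k Q A"
    and \<tau>: "\<tau> \<in> nat_trans k (op_cat Q) W V"
  shows tensor_map_add_maps: "tensor_map k Q A W V X \<tau> \<in> add_maps (tensor_functor k Q A W X) (tensor_functor k Q A V X)"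
    and tensor_map_element: "\<lbrakk>q \<in> Ob Q; w \<in> El W q; x \<in> El X q\<rbrakk> \<Longrightarrow>
      tensor_map k Q A W V X \<tau> (tensor_element k Q A W X q w x) = tensor_element k Q A V X q (\<tau> q w) x"
proof -
  let ?T = "tensor_functor k Q A W X" and ?S = "tensor_functor k Q A V X"
  note T = tensor_functor_left_module[OF A W X] and S = tensor_functor_left_module[OF A V X]
  interpret T: left_module A ?T by (rule T)
  interpret S: left_module A ?S by (rule S)
  note te = tensor_element_closed[OF A W X] and se = tensor_element_closed[OF A V X]
  note \<tau>c = preadditive.nat_closed[OF op_preadditive \<tau>, simplified]
  have "\<exists>h \<in> add_maps ?T ?S. \<forall>q \<in> Ob Q. \<forall>w \<in> El W q. \<forall>x \<in> El X q.
      h (tensor_element k Q A W X q w x) = tensor_element k Q A V X q (\<tau> q w) x"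
  proof (rule tensor_functor_lift[OF A W X S.abelian_group_axioms])
    show "(\<lambda>w. tensor_element k Q A V X q (\<tau> q w) x) \<in> add_maps (fobj W q) ?S" if "q \<in> Ob Q" "x \<in> El X q" for q x
      using add_maps_comp[OF tensor_element_add_left[OF A V X that] preadditive.nat_add_maps[OF op_preadditive \<tau>]] that by simp
    show "tensor_element k Q A V X q (\<tau> q w) \<in> add_maps (fobj X q) ?S" if "q \<in> Ob Q" "w \<in> El W q" for q w
      by (rule tensor_element_add_right[OF A V X that(1) \<tau>c[OF that]])
    show "tensor_element k Q A V X p (\<tau> p (fmor W q p f w)) x = tensor_element k Q A V X q (\<tau> q w) (fmor X p q f x)"
      if "p \<in> Ob Q" "q \<in> Ob Q" "f \<in> Mor Q p q" "w \<in> El W q" "x \<in> El X p" for p q f w x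
      using preadditive.nat_natural[OF op_preadditive \<tau>, of q p f w] tensor_element_balanced[OF A V X that(1-3) \<tau>c[OF that(2,4)] that(5)] that
      by simp
  qed
  then obtain h where h: "h \<in> add_maps ?T ?S" "\<And>q w x. q \<in> Ob Q \<Longrightarrow> w \<in> El W q \<Longrightarrow> x \<in> El X q \<Longrightarrow>
      h (tensor_element k Q A W X q w x) = tensor_element k Q A V X q (\<tau> q w) x" by blast
  have "h (a \<odot>\<^bsub>?T\<^esub> c) = a \<odot>\<^bsub>?S\<^esub> h c" if a: "a \<in> carrier A" and c: "c \<in> carrier ?T" for a c
  proof (rule tensor_functor_ext[OF A W X S.abelian_group_axioms add_maps_comp[OF h(1) left_module_smult_add_maps[OF T a]]
        add_maps_comp[OF left_module_smult_add_maps[OF S a] h(1)] _ c])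
    fix q w x assume q: "q \<in> Ob Q" and w: "w \<in> El W q" and x: "x \<in> El X q"
    show "h (a \<odot>\<^bsub>?T\<^esub> tensor_element k Q A W X q w x) = a \<odot>\<^bsub>?S\<^esub> h (tensor_element k Q A W X q w x)"
      using tensor_element_smult[OF A W X q a w x] tensor_element_smult[OF A V X q a \<tau>c[OF q w] x] h(2)[OF q w]
        left_module.lsmult_closed[OF coend_right[OF A W X q] a x] x by simp
  qed
  hence hl: "h \<in> lin_maps A ?T ?S" using h(1) by (simp add: lin_maps_iff)
  define g where "g = restrict h (carrier ?T)"
  let ?P = "\<lambda>h. h \<in> lin_maps A ?T ?S \<and> h \<in> extensional (carrier ?T) \<and>
    (\<forall>q \<in> Ob Q. \<forall>w \<in> El W q. \<forall>x \<in> El X q. h (tensor_element k Q A W X q w x) = tensor_element k Q A V X q (\<tau> q w) x)"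
  have "g \<in> lin_maps A ?T ?S"
    using hl by (simp add: g_def lin_maps_def T.lsmult_closed Pi_iff)
  hence g: "?P g" using h(2) te by (simp add: g_def)
  have "tensor_map k Q A W V X \<tau> = g" unfolding tensor_map_def
  proof (rule the_equality[of ?P, OF g])
    fix g' assume g': "?P g'"
    show "g' = g"
    proof (rule extensionalityI[of _ "carrier ?T"])
      show "g' c = g c" if "c \<in> carrier ?T" for c
        by (rule tensor_functor_ext[OF A W X S.abelian_group_axioms _ _ _ that]) (use g g' lin_maps_add_maps in auto)
    qed (use g g' in auto)
  qed
  thus "tensor_map k Q A W V X \<tau> \<in> add_maps ?T ?S" "\<lbrakk>q \<in> Ob Q; w \<in> El W q; x \<in> El X q\<rbrakk> \<Longrightarrow>
      tensor_map k Q A W V X \<tau> (tensor_element k Q A W X q w x) = tensor_element k Q A V X q (\<tau> q w) x"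
    using g lin_maps_add_maps by auto
qed

text \<open>A character of \<open>W \<otimes>\<^sub>Q X\<close> is a natural transformation from \<open>W\<close> to the dual of \<open>X\<close>, and characters
  detect exactness.\<close>

lemma Tor_zero_iff:
  assumes A: "assoc_algebra k A" and X: "X \<in> QAMod k Q A" and R: "some_resolution k (op_cat Q) W = (P, d, e)"
    and res: "projective_resolution k (op_cat Q) W (P, d, e)"
  shows "zero_module (Tor_module k Q A (Suc j) W X) \<longleftrightarrow> hom_exact k (op_cat Q) P d (char_fun (forget A X)) j"
proof -
  let ?M = "\<lambda>n. tensor_functor k Q A (P n) X" and ?X = "char_fun (forget A X)"
  let ?D = "\<lambda>n. tensor_map k Q A (P (Suc n)) (P n) X (d n)"
  let ?t = "\<lambda>n. tensor_element k Q A (P n) X"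
  interpret O: preadditive k "op_cat Q" by (rule op_preadditive)
  note PQ = O.projective_functor_QMod[OF O.res_proj[OF res]] and dn = O.res_d[OF res]
  note dc = O.nat_closed[OF dn, simplified]
  note M = tensor_functor_left_module[OF A PQ X]
  note Mg = lm_ag[OF M]
  note te = tensor_element_closed[OF A PQ X] and ext = tensor_functor_ext[OF A PQ X]
  note D = tensor_map_add_maps[OF A PQ PQ X dn] and De = tensor_map_element[OF A PQ PQ X dn]
  let ?K = "{x \<in> carrier (?M (Suc j)). ?D j x = \<zero>\<^bsub>?M j\<^esub>}" and ?I = "?D (Suc j) ` carrier (?M (Suc (Suc j)))"
  have "?D j (?D (Suc j) c) = \<zero>\<^bsub>?M j\<^esub>" if "c \<in> carrier (?M (Suc (Suc j)))" for c
  proof (rule ext[OF Mg add_maps_comp[OF D D] add_maps_const_zero[OF Mg] _ that])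
    show "?D j (?D (Suc j) (?t (Suc (Suc j)) q w x)) = \<zero>\<^bsub>?M j\<^esub>"
      if "q \<in> Ob Q" "w \<in> El (P (Suc (Suc j))) q" "x \<in> El X q" for q w x
      using De[OF that] De[OF that(1) dc[OF that(1,2)] that(3)] O.res_dd[OF res, of q w j]
        add_maps_zero[OF lm_ag[OF coend_left[OF A PQ X that(1)]] Mg tensor_element_add_left[OF A PQ X that(1,3)]] that by simp
  qed
  hence IK: "?I \<subseteq> ?K" using add_maps_closed[OF D] by blast
  have "?K \<subseteq> carrier (?M (Suc j))" by (rule Collect_restrict)
  from zero_quot_group_iff[OF Mg add_maps_image_closed[OF Mg Mg D] IK this]
  have "zero_module (Tor_module k Q A (Suc j) W X) \<longleftrightarrow> ?K \<subseteq> ?I" by (simp add: Tor_module_def R homology_def)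
  also have "\<dots> \<longleftrightarrow> hom_exact k (op_cat Q) P d ?X j"
  proof
    assume KI: "?K \<subseteq> ?I"
    show "hom_exact k (op_cat Q) P d ?X j"
      unfolding hom_exact_def
    proof (intro ballI impI)
      fix \<eta> assume \<eta>: "\<eta> \<in> nat_trans k (op_cat Q) (P (Suc j)) ?X"
        and z: "\<forall>p\<in>Ob (op_cat Q). \<forall>x\<in>El (P (Suc (Suc j))) p. \<eta> p (d (Suc j) p x) = \<zero>\<^bsub>fobj ?X p\<^esub>"
      obtain \<chi> where \<chi>: "\<chi> \<in> chars (?M (Suc j))"
        "\<And>q w x. q \<in> Ob Q \<Longrightarrow> w \<in> El (P (Suc j)) q \<Longrightarrow> x \<in> El X q \<Longrightarrow> \<chi> (?t (Suc j) q w x) = \<eta> q w x"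
        using tensor_char_exists[OF A PQ X \<eta>] by blast
      have "\<chi> (?D (Suc j) c) = 0" if "c \<in> carrier (?M (Suc (Suc j)))" for c
      proof (rule ext[OF qz_group_abelian add_maps_comp[OF \<chi>(1) D] _ _ that])
        show "(\<lambda>_. 0) \<in> chars (?M (Suc (Suc j)))" by (simp add: add_maps_def)
        show "\<chi> (?D (Suc j) (?t (Suc (Suc j)) q w x)) = 0"
          if "q \<in> Ob Q" "w \<in> El (P (Suc (Suc j))) q" "x \<in> El X q" for q w x
          using De[OF that] \<chi>(2)[OF that(1) dc[OF that(1,2)] that(3)] z that by (simp add: char_fun_simps)
      qed
      \<comment> \<open>A character that kills the boundaries kills the cycles when the homology
        vanishes. So it factors through \<open>?D j\<close>, and the factor extends to all of
        \<open>?M j\<close> since Q/Z is injective.\<close>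
      hence \<chi>K: "\<chi> c = 0" if "c \<in> ?K" for c using KI that by blast
      have "\<chi> x = 0" if "x \<in> carrier (?M (Suc j))" "?D j x = \<zero>\<^bsub>?M j\<^esub>" for x using \<chi>K that by simp
      hence "\<exists>\<psi> \<in> add_maps ((?M j)\<lparr>carrier := ?D j ` carrier (?M (Suc j))\<rparr>) qz_group. \<forall>x \<in> carrier (?M (Suc j)). \<psi> (?D j x) = \<chi> x"
        by (intro add_maps_factor[OF Mg Mg qz_group_abelian D \<chi>(1)]) simp
      then obtain \<psi> where \<psi>': "\<psi> \<in> add_maps ((?M j)\<lparr>carrier := ?D j ` carrier (?M (Suc j))\<rparr>) qz_group"
        and \<psi>: "\<And>x. x \<in> carrier (?M (Suc j)) \<Longrightarrow> \<psi> (?D j x) = \<chi> x" by blast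
      have "\<exists>\<chi>' \<in> chars (?M j). \<forall>u \<in> ?D j ` carrier (?M (Suc j)). \<chi>' u = \<psi> u"
        by (rule char_extend[OF Mg add_maps_image_closed[OF Mg Mg D]]) (use add_maps_add[OF \<psi>'] in simp)
      then obtain \<chi>' where \<chi>': "\<chi>' \<in> chars (?M j)" "\<And>u. u \<in> ?D j ` carrier (?M (Suc j)) \<Longrightarrow> \<chi>' u = \<psi> u" by blast
      let ?\<eta> = "\<lambda>q w. \<lambda>x\<in>El X q. \<chi>' (?t j q w x)"
      have "\<eta> p w = ?\<eta> p (d j p w)" if p: "p \<in> Ob Q" and w: "w \<in> El (P (Suc j)) p" for p w
      proof (rule extensionalityI[of _ "El X p"])
        show "\<eta> p w \<in> extensional (El X p)" using O.nat_closed[OF \<eta>, of p w] p w by (simp add: char_fun_simps)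
        show "\<eta> p w x = ?\<eta> p (d j p w) x" if x: "x \<in> El X p" for x
          using \<chi>(2)[OF p w x] De[OF p w x] \<psi>[OF te[OF p w x]] \<chi>'(2)[OF imageI[OF te[OF p w x]]] x by simp
      qed simp
      thus "\<exists>\<eta>'\<in>nat_trans k (op_cat Q) (P j) ?X. \<forall>p\<in>Ob (op_cat Q). \<forall>x\<in>El (P (Suc j)) p. \<eta> p x = \<eta>' p (d j p x)"
        by (intro bexI[of _ ?\<eta>] tensor_char_nat[OF A PQ X \<chi>'(1)]) simp
    qed
  next
    assume ex: "hom_exact k (op_cat Q) P d ?X j"
    show "?K \<subseteq> ?I"
    proof (rule subsetI, rule ccontr)
      fix c assume c: "c \<in> ?K" and cI: "c \<notin> ?I"
      have cc: "c \<in> carrier (?M (Suc j))" using c by simp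
      \<comment> \<open>If the cycle \<open>c\<close> were no boundary, a character would kill the
        boundaries but not \<open>c\<close>. It corresponds to a cocycle; being a coboundary means
        that the character factors through \<open>?D j\<close>, which kills
        \<open>c\<close>.\<close>
      obtain \<chi> where \<chi>: "\<chi> \<in> chars (?M (Suc j))" "\<And>u. u \<in> ?I \<Longrightarrow> \<chi> u = 0" "\<chi> c \<noteq> 0"
        using char_separate[OF Mg add_maps_image_closed[OF Mg Mg D] cc cI] by blast
      let ?\<eta> = "\<lambda>q w. \<lambda>x\<in>El X q. \<chi> (?t (Suc j) q w x)"
      have "?\<eta> p (d (Suc j) p w) = \<zero>\<^bsub>fobj ?X p\<^esub>" if p: "p \<in> Ob Q" and w: "w \<in> El (P (Suc (Suc j))) p" for p w
        using De[OF p w] \<chi>(2)[OF imageI[OF te[OF p w]]] by (auto simp: char_fun_simps intro!: restrict_ext)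
      then obtain \<eta>' where \<eta>': "\<eta>' \<in> nat_trans k (op_cat Q) (P j) ?X"
        "\<And>p w. p \<in> Ob Q \<Longrightarrow> w \<in> El (P (Suc j)) p \<Longrightarrow> ?\<eta> p w = \<eta>' p (d j p w)"
        using ex[unfolded hom_exact_def, rule_format, OF tensor_char_nat[OF A PQ X \<chi>(1)]] by auto
      obtain \<chi>' where \<chi>': "\<chi>' \<in> chars (?M j)"
        "\<And>q w x. q \<in> Ob Q \<Longrightarrow> w \<in> El (P j) q \<Longrightarrow> x \<in> El X q \<Longrightarrow> \<chi>' (?t j q w x) = \<eta>' q w x"
        using tensor_char_exists[OF A PQ X \<eta>'(1)] by blast
      have "\<chi> c = \<chi>' (?D j c)"
      proof (rule ext[OF qz_group_abelian \<chi>(1) add_maps_comp[OF \<chi>'(1) D] _ cc])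
        show "\<chi> (?t (Suc j) q w x) = \<chi>' (?D j (?t (Suc j) q w x))"
          if "q \<in> Ob Q" "w \<in> El (P (Suc j)) q" "x \<in> El X q" for q w x
          using fun_cong[OF \<eta>'(2)[OF that(1,2)], of x] De[OF that] \<chi>'(2)[OF that(1) dc[OF that(1,2)] that(3)] that by simp
      qed
      thus False using \<chi>(3) c char_zero[OF Mg \<chi>'(1)] by simp
    qed
  qed
  finally show ?thesis .
qed

end

section \<open>The pairing of a Serre functor\<close>

lemma add_maps_finsum:
  assumes M: "abelian_group M" and N: "abelian_group N" and h: "h \<in> add_maps M N" and D: "finite D" "\<And>i. i \<in> D \<Longrightarrow> u i \<in> carrier M"
  shows "h (\<Oplus>\<^bsub>M\<^esub>i\<in>D. u i) = (\<Oplus>\<^bsub>N\<^esub>i\<in>D. h (u i))"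
proof -
  interpret M: abelian_group M by fact
  interpret N: abelian_group N by fact
  show ?thesis using D
  proof (induction D rule: finite_induct)
    case (insert i D)
    hence "u \<in> D \<rightarrow> carrier M" "u i \<in> carrier M" "(\<lambda>i. h (u i)) \<in> D \<rightarrow> carrier N" "h (u i) \<in> carrier N"
      using add_maps_closed[OF h] by auto
    thus ?case using insert add_maps_add[OF h] M.finsum_closed by simp
  qed (simp add: add_maps_zero[OF M N h])
qed

text \<open>\<open>ex\<close> and \<open>inj\<close> identify \<open>N\<close> with the dual of
  \<open>M\<close>. Since \<open>M\<close> has a finite dual basis, the representing elements
  \<open>f0 e\<close> of its coordinate functionals give one of \<open>N\<close>, with coordinates
  \<open>B e f\<close>; hence functionals on \<open>N\<close> come from elements of
  \<open>M\<close>.\<close>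

lemma perfect_pairing:
  assumes k: "cring k" and M: "left_module k M" and N: "left_module k N" and D: "finite D" "D \<subseteq> carrier M"
    and \<kappa>: "\<And>e. e \<in> D \<Longrightarrow> \<kappa> e \<in> forms k M"
    and basis: "\<And>g. g \<in> carrier M \<Longrightarrow> (\<Oplus>\<^bsub>M\<^esub>e\<in>D. \<kappa> e g \<odot>\<^bsub>M\<^esub> e) = g"
    and B1: "\<And>g. g \<in> carrier M \<Longrightarrow> B g \<in> forms k N"
    and B2: "\<And>f. f \<in> carrier N \<Longrightarrow> (\<lambda>g. B g f) \<in> forms k M"
    and ex: "\<And>\<zeta>. \<zeta> \<in> forms k M \<Longrightarrow> \<exists>f \<in> carrier N. \<forall>g \<in> carrier M. B g f = \<zeta> g"
    and inj: "\<And>f f'. \<lbrakk>f \<in> carrier N; f' \<in> carrier N; \<And>g. g \<in> carrier M \<Longrightarrow> B g f = B g f'\<rbrakk> \<Longrightarrow> f = f'"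
  shows "\<omega> \<in> forms k N \<Longrightarrow> \<exists>g \<in> carrier M. \<forall>f \<in> carrier N. B g f = \<omega> f"
    and "\<lbrakk>g \<in> carrier M; \<forall>f \<in> carrier N. B g f = \<zero>\<^bsub>k\<^esub>\<rbrakk> \<Longrightarrow> g = \<zero>\<^bsub>M\<^esub>"
proof -
  interpret k: cring k by fact
  interpret M: left_module k M by fact
  interpret N: left_module k N by fact
  interpret K: abelian_group "self_module k" by (rule lm_ag[OF left_module_self[OF k.ring_axioms]])
  have "\<forall>e\<in>D. \<exists>f. f \<in> carrier N \<and> (\<forall>g \<in> carrier M. B g f = \<kappa> e g)" using ex[OF \<kappa>] by blast
  then obtain f0 where f0: "\<And>e. e \<in> D \<Longrightarrow> f0 e \<in> carrier N" "\<And>e g. e \<in> D \<Longrightarrow> g \<in> carrier M \<Longrightarrow> B g (f0 e) = \<kappa> e g"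
    using bchoice[of D "\<lambda>e f. f \<in> carrier N \<and> (\<forall>g \<in> carrier M. B g f = \<kappa> e g)"] by blast
  have Bc: "B g f \<in> carrier k" if "g \<in> carrier M" "f \<in> carrier N" for g f
    using lin_maps_closed[OF B1[OF that(1)] that(2)] by simp
  have De: "e \<in> carrier M" if "e \<in> D" for e using D(2) that by blast
  have S: "\<omega> (\<Oplus>\<^bsub>V\<^esub>e\<in>D. a e \<odot>\<^bsub>V\<^esub> u e) = (\<Oplus>\<^bsub>self_module k\<^esub>e\<in>D. a e \<otimes>\<^bsub>k\<^esub> \<omega> (u e))"
    if V: "left_module k V" and \<omega>: "\<omega> \<in> forms k V" and a: "\<And>e. e \<in> D \<Longrightarrow> a e \<in> carrier k" and u: "\<And>e. e \<in> D \<Longrightarrow> u e \<in> carrier V"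
    for V :: "('a, 'v) module" and \<omega> a u
  proof -
    have "\<omega> (\<Oplus>\<^bsub>V\<^esub>e\<in>D. a e \<odot>\<^bsub>V\<^esub> u e) = (\<Oplus>\<^bsub>self_module k\<^esub>e\<in>D. \<omega> (a e \<odot>\<^bsub>V\<^esub> u e))"
      by (rule add_maps_finsum[OF lm_ag[OF V] K.abelian_group_axioms lin_maps_add_maps[OF \<omega>] D(1)])
        (rule left_module.lsmult_closed[OF V a u])
    also have "\<dots> = (\<Oplus>\<^bsub>self_module k\<^esub>e\<in>D. a e \<otimes>\<^bsub>k\<^esub> \<omega> (u e))"
      by (rule K.finsum_cong') (use lin_maps_smult[OF \<omega> a u] lin_maps_closed[OF \<omega> u] a in auto)
    finally show ?thesis .
  qed
  have \<kappa>c: "\<kappa> e g \<in> carrier k" if "e \<in> D" "g \<in> carrier M" for e g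
    using lin_maps_closed[OF \<kappa>[OF that(1)] that(2)] by simp
  \<comment> \<open>Expansion of \<open>f\<close> in the dual basis of \<open>N\<close>; by
    \<open>inj\<close> it may be checked after pairing with every \<open>g\<close>.\<close>
  have fe: "(\<Oplus>\<^bsub>N\<^esub>e\<in>D. B e f \<odot>\<^bsub>N\<^esub> f0 e) = f" if f: "f \<in> carrier N" for f
  proof (rule inj)
    show "(\<Oplus>\<^bsub>N\<^esub>e\<in>D. B e f \<odot>\<^bsub>N\<^esub> f0 e) \<in> carrier N"
      by (rule N.finsum_closed) (use N.lsmult_closed Bc[OF De f] f0(1) in auto)
    fix g assume g: "g \<in> carrier M"
    have "B g (\<Oplus>\<^bsub>N\<^esub>e\<in>D. B e f \<odot>\<^bsub>N\<^esub> f0 e) = (\<Oplus>\<^bsub>self_module k\<^esub>e\<in>D. B e f \<otimes>\<^bsub>k\<^esub> B g (f0 e))"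
      by (rule S[OF N B1[OF g] Bc[OF De f] f0(1)])
    also have "\<dots> = (\<Oplus>\<^bsub>self_module k\<^esub>e\<in>D. \<kappa> e g \<otimes>\<^bsub>k\<^esub> B e f)"
      by (rule K.finsum_cong') (use f0(2)[OF _ g] \<kappa>c[OF _ g] Bc[OF De f] in \<open>auto simp: k.m_comm\<close>)
    also have "\<dots> = B (\<Oplus>\<^bsub>M\<^esub>e\<in>D. \<kappa> e g \<odot>\<^bsub>M\<^esub> e) f" by (rule S[OF M B2[OF f] \<kappa>c[OF _ g] De, symmetric])
    finally show "B g (\<Oplus>\<^bsub>N\<^esub>e\<in>D. B e f \<odot>\<^bsub>N\<^esub> f0 e) = B g f" by (simp add: basis[OF g])
  qed (rule f)
  show "\<exists>g \<in> carrier M. \<forall>f \<in> carrier N. B g f = \<omega> f" if \<omega>: "\<omega> \<in> forms k N"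
  proof (intro bexI ballI)
    have \<omega>c: "\<omega> (f0 e) \<in> carrier k" if "e \<in> D" for e using lin_maps_closed[OF \<omega> f0(1)[OF that]] by simp
    show "(\<Oplus>\<^bsub>M\<^esub>e\<in>D. \<omega> (f0 e) \<odot>\<^bsub>M\<^esub> e) \<in> carrier M" by (rule M.finsum_closed) (use M.lsmult_closed \<omega>c De in auto)
    fix f assume f: "f \<in> carrier N"
    have "B (\<Oplus>\<^bsub>M\<^esub>e\<in>D. \<omega> (f0 e) \<odot>\<^bsub>M\<^esub> e) f = (\<Oplus>\<^bsub>self_module k\<^esub>e\<in>D. \<omega> (f0 e) \<otimes>\<^bsub>k\<^esub> B e f)" by (rule S[OF M B2[OF f] \<omega>c De])
    also have "\<dots> = (\<Oplus>\<^bsub>self_module k\<^esub>e\<in>D. B e f \<otimes>\<^bsub>k\<^esub> \<omega> (f0 e))"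
      by (rule K.finsum_cong') (use \<omega>c Bc[OF De f] in \<open>auto simp: k.m_comm\<close>)
    also have "\<dots> = \<omega> (\<Oplus>\<^bsub>N\<^esub>e\<in>D. B e f \<odot>\<^bsub>N\<^esub> f0 e)" by (rule S[OF N \<omega> Bc[OF De f] f0(1), symmetric])
    finally show "B (\<Oplus>\<^bsub>M\<^esub>e\<in>D. \<omega> (f0 e) \<odot>\<^bsub>M\<^esub> e) f = \<omega> f" by (simp add: fe[OF f])
  qed
  show "g = \<zero>\<^bsub>M\<^esub>" if g: "g \<in> carrier M" and z: "\<forall>f \<in> carrier N. B g f = \<zero>\<^bsub>k\<^esub>"
  proof -
    have "(\<Oplus>\<^bsub>M\<^esub>e\<in>D. \<kappa> e g \<odot>\<^bsub>M\<^esub> e) = (\<Oplus>\<^bsub>M\<^esub>e\<in>D. \<zero>\<^bsub>M\<^esub>)"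
      by (rule M.finsum_cong') (use f0(2)[OF _ g] f0(1) z left_module_zero_smult[OF M De] in auto)
    thus ?thesis using basis[OF g] by simp
  qed
qed

context shape
begin

text \<open>The coordinates of finitely many generators involve only a finite set \<open>D\<close>
  of indices, and by linearity no element needs more.\<close>

lemma hom_dual_basis:
  assumes p: "p \<in> Ob Q" and q: "q \<in> Ob Q"
  obtains D \<kappa> where "finite D" "D \<subseteq> Mor Q p q" "\<And>e. e \<in> D \<Longrightarrow> \<kappa> e \<in> forms k (Hom Q p q)"
    "\<And>g. g \<in> Mor Q p q \<Longrightarrow> (\<Oplus>\<^bsub>Hom Q p q\<^esub>e\<in>D. \<kappa> e g \<odot>\<^bsub>Hom Q p q\<^esub> e) = g"
proof -
  let ?M = "Hom Q p q"
  interpret M: left_module k ?M by (rule hom_lm[OF p q])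
  interpret K: ring k by (rule k_ring)
  obtain \<xi> where \<xi>: "\<xi> \<in> lin_maps k ?M (coords k ?M)" "\<And>g. g \<in> carrier ?M \<Longrightarrow> lincomb k ?M (\<xi> g) = g" using hom_coords[OF p q] by blast
  have \<xi>c: "\<xi> g \<in> carrier (free_module k (carrier ?M))" if "g \<in> carrier ?M" for g
    using lin_maps_closed[OF \<xi>(1) that] by (simp add: coords_def)
  define D where "D = (\<Union>x\<in>gens p q. {e \<in> carrier ?M. \<xi> x e \<noteq> \<zero>\<^bsub>k\<^esub>})"
  have fin: "finite D" unfolding D_def
    using gens_finite[OF p q] gens_subset[OF p q] dsumD(2)[OF \<xi>c] by auto
  have D: "D \<subseteq> carrier ?M" by (auto simp: D_def)
  have sub: "submodule {g \<in> carrier ?M. \<forall>e\<in>carrier ?M - D. \<xi> g e = \<zero>\<^bsub>k\<^esub>} k ?M"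
    by (rule left_submoduleI[OF M.left_module_axioms])
      (use lin_maps_zero[OF M.abelian_group_axioms lm_ag[OF coords_left_module[OF k_ring]] \<xi>(1)]
        lin_maps_add[OF \<xi>(1)] lin_maps_smult[OF \<xi>(1)] M.lsmult_closed in \<open>auto simp: coords_def dsum_simps\<close>)
  have out: "\<xi> g e = \<zero>\<^bsub>k\<^esub>" if "g \<in> carrier ?M" "e \<in> carrier ?M - D" for g e
    using gens_induct[OF p q sub _ that(1)] gens_subset[OF p q] that(2) by (auto simp: D_def)
  have comp: "\<forall>i\<in>carrier ?M. (\<lambda>a. a \<odot>\<^bsub>?M\<^esub> i) \<in> add_maps (self_module k) ?M"
    using lin_maps_add_maps[OF left_module_smult_point[OF M.left_module_axioms]] by blast
  show ?thesis
  proof (rule that[OF fin D])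
    show "(\<lambda>g. \<xi> g e) \<in> forms k ?M" if "e \<in> D" for e
      by (rule lin_maps_comp[OF _ \<xi>(1)]) (use that D in \<open>auto simp: coords_def intro: dsum_proj_lin_maps\<close>)
    fix g assume g: "g \<in> carrier ?M"
    have "lincomb k ?M (\<xi> g) = (\<Oplus>\<^bsub>?M\<^esub>e\<in>D. \<xi> g e \<odot>\<^bsub>?M\<^esub> e)" unfolding lincomb_def
      by (rule dsum_lift_superset[OF family_abelian_group[OF family_self[OF k_ring]] M.abelian_group_axioms comp fin D _ \<xi>c[OF g]])
        (use out[OF g] in auto)
    thus "(\<Oplus>\<^bsub>?M\<^esub>e\<in>D. \<xi> g e \<odot>\<^bsub>?M\<^esub> e) = g" using \<xi>(2)[OF g] by simp
  qed
qed

text \<open>If \<open>q\<close> and \<open>p\<close> were distinct, the identity of \<open>p\<close>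
  would lie in \<open>r p\<close>, whereas its \<open>coef\<close> is 1. It follows that a Serre
  functor and its quasi-inverse are strictly inverse on objects.\<close>

lemma isomorphic_objects_equal:
  assumes p: "p \<in> Ob Q" and q: "q \<in> Ob Q" and f: "f \<in> Mor Q p q" and g: "g \<in> Mor Q q p" and "Comp Q p q p g f = Ide Q p"
  shows "q = p"
proof (rule ccontr)
  assume "q \<noteq> p"
  hence "Ide Q p \<in> r p" using retraction p q f g assms(5) unfolding strong_retraction_def by metis
  thus False using coef_rad[OF p] coef_ide[OF p] nontrivial by simp
qed

lemma serre_frob:
  assumes "has_serre_functor k Q"
  obtains \<sigma> \<sigma>' t where "frob k Q r \<sigma> \<sigma>' t"
proof -
  obtain S T \<phi> where aut: "linear_autoequivalence k Q S T"
    and \<phi>lb: "\<forall>p \<in> Ob Q. \<forall>q \<in> Ob Q. \<phi> p q \<in> lin_maps k (Hom Q p q) (dual_module k (Hom Q q (S p))) \<and>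
        bij_betw (\<phi> p q) (Mor Q p q) (carrier (dual_module k (Hom Q q (S p))))"
    and \<phi>nat: "\<forall>p \<in> Ob Q. \<forall>q \<in> Ob Q. \<forall>q' \<in> Ob Q. \<forall>f \<in> Mor Q p q. \<forall>h \<in> Mor Q q q'.
        \<forall>g \<in> Mor Q q' (S p). \<phi> p q' (Comp Q p q q' h f) g = \<phi> p q f (Comp Q q q' (S p) g h)"
    using assms unfolding has_serre_functor_def by (elim exE conjE) (rule that; assumption)
  note \<phi>l = \<phi>lb[rule_format, THEN conjunct1] and \<phi>b = \<phi>lb[rule_format, THEN conjunct2] and \<phi>n = \<phi>nat[rule_format]
  obtain S' T' where lin: "linear_endofunctor k Q S T" "linear_endofunctor k Q S' T'"
    and iso: "comp_iso_identity Q S T S' T'" "comp_iso_identity Q S' T' S T"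
    using aut unfolding linear_autoequivalence_def by blast
  have SO: "S p \<in> Ob Q" "S' p \<in> Ob Q" if "p \<in> Ob Q" for p using lin that by (simp_all add: linear_endofunctor_def)
  have S'S: "S' (S p) = p" if p: "p \<in> Ob Q" for p
  proof -
    obtain a b where "a \<in> Mor Q p (S' (S p))" "b \<in> Mor Q (S' (S p)) p" "Comp Q p (S' (S p)) p b a = Ide Q p"
      using iso(1) p unfolding comp_iso_identity_def by blast
    thus ?thesis by (rule isomorphic_objects_equal[OF p SO(2)[OF SO(1)[OF p]]])
  qed
  have SS': "S (S' p) = p" if p: "p \<in> Ob Q" for p
  proof -
    obtain a b where "a \<in> Mor Q p (S (S' p))" "b \<in> Mor Q (S (S' p)) p" "Comp Q p (S (S' p)) p b a = Ide Q p"
      using iso(2) p unfolding comp_iso_identity_def by blast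
    thus ?thesis by (rule isomorphic_objects_equal[OF p SO(1)[OF SO(2)[OF p]]])
  qed
  \<comment> \<open>As in the Yoneda lemma, naturality in \<open>q\<close> recovers the whole
    isomorphism from the images of the identities: \<open>\<phi> p q f g\<close> is
    \<open>t p\<close> of the composite of \<open>f\<close> and \<open>g\<close>.\<close>
  define t where "t p = \<phi> p p (Ide Q p)" for p
  have \<phi>c: "\<phi> p q f \<in> forms k (Hom Q q (S p))" "\<phi> p q f \<in> extensional (Mor Q q (S p))"
    if "p \<in> Ob Q" "q \<in> Ob Q" "f \<in> Mor Q p q" for p q f
    using lin_maps_closed[OF \<phi>l[OF that(1,2)] that(3)] by (simp_all add: dual_module_def)
  have \<phi>t: "t p (Comp Q p q (S p) g f) = \<phi> p q f g" if "p \<in> Ob Q" "q \<in> Ob Q" "f \<in> Mor Q p q" "g \<in> Mor Q q (S p)" for p q f g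
    using \<phi>n[OF that(1,1,2) ide_closed[OF that(1)] that(3,4)] comp_ide[OF that(1-3)] by (simp add: t_def)
  have tl: "t p \<in> forms k (Hom Q p (S p))" if "p \<in> Ob Q" for p
    unfolding t_def by (rule \<phi>c[OF that that ide_closed[OF that]])
  have lex: "\<exists>f \<in> Mor Q q s. \<forall>g \<in> Mor Q s (S q). t q (Comp Q q s (S q) g f) = \<zeta> g"
    if q: "q \<in> Ob Q" and s: "s \<in> Ob Q" and \<zeta>: "\<zeta> \<in> forms k (Hom Q s (S q))" for q s \<zeta>
  proof -
    interpret H: left_module k "Hom Q s (S q)" by (rule hom_lm[OF s SO(1)[OF q]])
    have "restrict \<zeta> (Mor Q s (S q)) \<in> carrier (dual_module k (Hom Q s (S q)))"
      using \<zeta> H.lsmult_closed by (simp add: dual_module_def lin_maps_def Pi_iff)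
    hence "restrict \<zeta> (Mor Q s (S q)) \<in> \<phi> q s ` Mor Q q s" using \<phi>b[OF q s] by (simp add: bij_betw_def)
    then obtain f where f: "f \<in> Mor Q q s" "restrict \<zeta> (Mor Q s (S q)) = \<phi> q s f" by (rule imageE)
    have "t q (Comp Q q s (S q) g f) = \<zeta> g" if g: "g \<in> Mor Q s (S q)" for g
      using \<phi>t[OF q s f(1) g] fun_cong[OF f(2), of g] g by simp
    thus ?thesis using f(1) by blast
  qed
  have linj: "f = f'" if q: "q \<in> Ob Q" and s: "s \<in> Ob Q" and f: "f \<in> Mor Q q s" and f': "f' \<in> Mor Q q s"
    and eq: "\<And>g. g \<in> Mor Q s (S q) \<Longrightarrow> t q (Comp Q q s (S q) g f) = t q (Comp Q q s (S q) g f')" for q s f f'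
  proof -
    have "\<phi> q s f = \<phi> q s f'"
      by (rule extensionalityI[OF \<phi>c(2)[OF q s f] \<phi>c(2)[OF q s f']]) (use eq \<phi>t[OF q s f] \<phi>t[OF q s f'] in simp)
    thus ?thesis by (rule inj_onD[OF bij_betw_imp_inj_on[OF \<phi>b[OF q s]] _ f f'])
  qed
  have B1: "(\<lambda>f. t q (Comp Q q s (S q) g f)) \<in> forms k (Hom Q q s)"
    if "q \<in> Ob Q" "s \<in> Ob Q" "g \<in> Mor Q s (S q)" for q s g
    by (rule lin_maps_comp[OF tl[OF that(1)] comp_linear_right[OF that(1,2) SO(1)[OF that(1)] that(3)]])
  have B2: "(\<lambda>g. t q (Comp Q q s (S q) g f)) \<in> forms k (Hom Q s (S q))"
    if "q \<in> Ob Q" "s \<in> Ob Q" "f \<in> Mor Q q s" for q s f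
    by (rule lin_maps_comp[OF tl[OF that(1)] comp_linear_left[OF that(1,2) SO(1)[OF that(1)] that(3)]])
  \<comment> \<open>The Serre isomorphism represents functionals on \<open>Q(s, S q)\<close>.
    Functionals on \<open>Q(q, s)\<close> are represented by \<open>perfect_pairing\<close>, from a
    finite dual basis of \<open>Q(s, S q)\<close>.\<close>
  have right: "(\<zeta> \<in> forms k (Hom Q q s) \<longrightarrow>
      (\<exists>g \<in> Mor Q s (S q). \<forall>f \<in> Mor Q q s. t q (Comp Q q s (S q) g f) = \<zeta> f)) \<and>
    (g \<in> Mor Q s (S q) \<longrightarrow> (\<forall>f \<in> Mor Q q s. t q (Comp Q q s (S q) g f) = \<zero>\<^bsub>k\<^esub>) \<longrightarrow> g = \<zero>\<^bsub>Hom Q s (S q)\<^esub>)"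
    if q: "q \<in> Ob Q" and s: "s \<in> Ob Q" for q s \<zeta> g
  proof -
    obtain D \<kappa> where D: "finite D" "D \<subseteq> Mor Q s (S q)" "\<And>e. e \<in> D \<Longrightarrow> \<kappa> e \<in> forms k (Hom Q s (S q))"
      "\<And>g. g \<in> Mor Q s (S q) \<Longrightarrow> (\<Oplus>\<^bsub>Hom Q s (S q)\<^esub>e\<in>D. \<kappa> e g \<odot>\<^bsub>Hom Q s (S q)\<^esub> e) = g"
      using hom_dual_basis[OF s SO(1)[OF q]] by blast
    note pp = perfect_pairing[OF base_cring hom_lm[OF s SO(1)[OF q]] hom_lm[OF q s] D B1[OF q s] B2[OF q s] lex[OF q s] linj[OF q s]]
    show ?thesis using pp by blast
  qed
  show ?thesis
  proof (rule that[of S S' t], unfold_locales)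
    show "f = \<zero>\<^bsub>Hom Q q s\<^esub>" if q: "q \<in> Ob Q" and s: "s \<in> Ob Q" and f: "f \<in> Mor Q q s"
      and z: "\<forall>g \<in> Mor Q s (S q). t q (Comp Q q s (S q) g f) = \<zero>\<^bsub>k\<^esub>" for q s f
      by (rule linj[OF q s f ag_zero_closed[OF hom_ag[OF q s]]])
        (use lin_maps_zero[OF hom_ag[OF q s] k_ag B1[OF q s]] z in simp)
  qed (use SO S'S SS' tl lex right in auto)
qed

end

section \<open>The criteria for stalk cohomology and stalk homology\<close>

context frob
begin

lemma stalk_resolution:
  assumes q: "q \<in> Ob Q"
  obtains P d e where "some_resolution k Q (stalk Q r q) = (P, d, e)" "projective_resolution k Q (stalk Q r q) (P, d, e)"
proof -
  obtain P d e where R: "some_resolution k Q (stalk Q r q) = (P, d, e)" by (cases "some_resolution k Q (stalk Q r q)")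
  have "projective_resolution k Q (stalk Q r q) (some_resolution k Q (stalk Q r q))"
    unfolding some_resolution_def by (rule someI_ex[OF projective_resolution_exists[OF stalk_QMod[OF q]]])
  thus ?thesis using that[OF R] R by simp
qed

lemma stalk_cohomology_criterion:
  assumes A: "assoc_algebra k A" and X: "X \<in> QAMod k Q A"
  shows "finite_proj_dim k Q (forget A X) \<Longrightarrow> q \<in> Ob Q \<Longrightarrow> i > 0 \<Longrightarrow> zero_module (stalk_cohomology k Q r A i q X)"
    and "\<forall>q \<in> Ob Q. zero_module (stalk_cohomology k Q r A 1 q X) \<Longrightarrow> finite_proj_dim k Q (forget A X)"
proof -
  note Y = forget_QMod[OF A X] and iff = radical_injective_iff_finite_proj_dim(1)[OF forget_QMod[OF A X]]
  show "zero_module (stalk_cohomology k Q r A i q X)" if "finite_proj_dim k Q (forget A X)" and q: "q \<in> Ob Q" and i: "i > 0"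
  proof -
    obtain j where "i = Suc j" using i by (cases i) auto
    thus ?thesis
      using stalk_resolution[OF q] Ext_zero_iff[OF Y] radical_injective_hom_exact[OF Y _ q] that(1) iff unfolding stalk_cohomology_def by metis
  qed
  assume z: "\<forall>q \<in> Ob Q. zero_module (stalk_cohomology k Q r A 1 q X)"
  show "finite_proj_dim k Q (forget A X)" unfolding iff[symmetric]
  proof (rule hom_exact_radical_injective[OF Y])
    fix q assume q: "q \<in> Ob Q"
    obtain P d e where R: "some_resolution k Q (stalk Q r q) = (P, d, e)" and res: "projective_resolution k Q (stalk Q r q) (P, d, e)"
      using stalk_resolution[OF q] .
    have "hom_exact k Q P d (forget A X) 0" using z q Ext_zero_iff[OF Y R res, of 0] by (simp add: stalk_cohomology_def)
    thus "\<exists>P d e. projective_resolution k Q (stalk Q r q) (P, d, e) \<and> hom_exact k Q P d (forget A X) 0" using res by blast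
  qed
qed

text \<open>Costalks are the stalks of the opposite category, so by \<open>Tor_zero_iff\<close> this
  is the Ext criterion for the dual of \<open>X\<close> over \<open>op_cat Q\<close>.\<close>

lemma stalk_homology_criterion:
  assumes A: "assoc_algebra k A" and X: "X \<in> QAMod k Q A"
  shows "finite_proj_dim k Q (forget A X) \<Longrightarrow> q \<in> Ob Q \<Longrightarrow> i > 0 \<Longrightarrow> zero_module (stalk_homology k Q r A i q X)"
    and "\<forall>q \<in> Ob Q. zero_module (stalk_homology k Q r A 1 q X) \<Longrightarrow> finite_proj_dim k Q (forget A X)"
proof -
  interpret op: frob k "op_cat Q" r \<sigma>' \<sigma> "\<lambda>q. t (\<sigma>' q)" by (rule op_frob)
  note Y = char_fun_QMod[OF forget_QMod[OF A X]] and iff = radical_injective_iff_finite_proj_dim(2)[OF forget_QMod[OF A X]]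
  note res = op.stalk_resolution[simplified]
  show "zero_module (stalk_homology k Q r A i q X)" if "finite_proj_dim k Q (forget A X)" and q: "q \<in> Ob Q" and i: "i > 0"
  proof -
    obtain j where j: "i = Suc j" using i by (cases i) auto
    obtain P d e where R: "some_resolution k (op_cat Q) (stalk (op_cat Q) r q) = (P, d, e)"
      and res: "projective_resolution k (op_cat Q) (stalk (op_cat Q) r q) (P, d, e)" using res[OF q] .
    show ?thesis unfolding stalk_homology_def costalk_def j Tor_zero_iff[OF A X R res]
      by (rule op.radical_injective_hom_exact[OF Y _ _ res]) (use that(1) iff q in simp_all)
  qed
  assume z: "\<forall>q \<in> Ob Q. zero_module (stalk_homology k Q r A 1 q X)"
  show "finite_proj_dim k Q (forget A X)" unfolding iff[symmetric]
  proof (rule op.hom_exact_radical_injective[OF Y])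
    fix q assume "q \<in> Ob (op_cat Q)"
    hence q: "q \<in> Ob Q" by simp
    obtain P d e where R: "some_resolution k (op_cat Q) (stalk (op_cat Q) r q) = (P, d, e)"
      and res: "projective_resolution k (op_cat Q) (stalk (op_cat Q) r q) (P, d, e)" using res[OF q] .
    have "hom_exact k (op_cat Q) P d (char_fun (forget A X)) 0"
      using z q Tor_zero_iff[OF A X R res, of 0] by (simp add: stalk_homology_def costalk_def)
    thus "\<exists>P d e. projective_resolution k (op_cat Q) (stalk (op_cat Q) r q) (P, d, e) \<and> hom_exact k (op_cat Q) P d (char_fun (forget A X)) 0"
      using res by blast
  qed
qed

end

theorem theorem7p1:
  fixes k :: "'k ring" and Q :: "('k, 'o, 'm) lincat" and r :: "'o \<Rightarrow> 'm set"
    and A :: "('k, 'a) module" and X :: "('o, 'm, 'a, 'x) modfun"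
  assumes "cring k" and "\<one>\<^bsub>k\<^esub> \<noteq> \<zero>\<^bsub>k\<^esub>" and "noetherian_ring k" and "hereditary_ring k"
    and "preadditive k Q" and "hom_finite k Q" and "locally_bounded Q"
    and "has_serre_functor k Q" and "strong_retraction k Q r"
    and "nilpotent_ideal k Q (pseudo_radical Q r)"
    and "assoc_algebra k A" and "X \<in> QAMod k Q A"
  shows "(X \<in> exact_class k Q A
            \<longleftrightarrow> (\<forall>q \<in> Ob Q. \<forall>i > 0. zero_module (stalk_cohomology k Q r A i q X)))
       \<and> (X \<in> exact_class k Q A
            \<longleftrightarrow> (\<forall>q \<in> Ob Q. zero_module (stalk_cohomology k Q r A 1 q X)))
       \<and> (X \<in> exact_class k Q A
            \<longleftrightarrow> (\<forall>q \<in> Ob Q. \<forall>i > 0. zero_module (stalk_homology k Q r A i q X)))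
       \<and> (X \<in> exact_class k Q A
            \<longleftrightarrow> (\<forall>q \<in> Ob Q. zero_module (stalk_homology k Q r A 1 q X)))"
proof -
  interpret shape k Q r
    using assms by (simp add: shape_def shape_axioms_def)
  obtain \<sigma> \<sigma>' t where "frob k Q r \<sigma> \<sigma>' t" using serre_frob[OF assms(8)] .
  then interpret frob k Q r \<sigma> \<sigma>' t .
  note c = stalk_cohomology_criterion[OF assms(11,12)] and h = stalk_homology_criterion[OF assms(11,12)]
  have X: "X \<in> exact_class k Q A \<longleftrightarrow> finite_proj_dim k Q (forget A X)" using assms(12) by (simp add: exact_class_def)
  have c1: "\<forall>q \<in> Ob Q. \<forall>i > 0. zero_module (stalk_cohomology k Q r A i q X)" if "finite_proj_dim k Q (forget A X)"
    using c(1)[OF that] by blast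
  have h1: "\<forall>q \<in> Ob Q. \<forall>i > 0. zero_module (stalk_homology k Q r A i q X)" if "finite_proj_dim k Q (forget A X)"
    using h(1)[OF that] by blast
  have c2: "finite_proj_dim k Q (forget A X)" if "\<forall>q \<in> Ob Q. \<forall>i > 0. zero_module (stalk_cohomology k Q r A i q X)"
    by (rule c(2)) (use that in simp)
  have h2: "finite_proj_dim k Q (forget A X)" if "\<forall>q \<in> Ob Q. \<forall>i > 0. zero_module (stalk_homology k Q r A i q X)"
    by (rule h(2)) (use that in simp)
  have c3: "\<forall>q \<in> Ob Q. zero_module (stalk_cohomology k Q r A 1 q X)" if "finite_proj_dim k Q (forget A X)"
    using c1[OF that] by simp
  have h3: "\<forall>q \<in> Ob Q. zero_module (stalk_homology k Q r A 1 q X)" if "finite_proj_dim k Q (forget A X)"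
    using h1[OF that] by simp
  show ?thesis unfolding X
    by (rule conjI[OF iffI[OF c1 c2] conjI[OF iffI[OF c3 c(2)] conjI[OF iffI[OF h1 h2] iffI[OF h3 h(2)]]]])
qed

end
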